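(* Let $(\mathcal X,f):\mathcal A\rightsquigarrow\mathcal B$ be left adjoint to $(\mathcal Y,g):\mathcal B\rightsquigarrow\mathcal A$ in the bicategory $\mathbf{2TDX}$. The unit 2-cell $(H,\eta)$ from the identity 2-transducer of $\mathcal A$ to the composite $g\circ f$ consists of a functor $H$ from the terminal category into the product $\mathcal X\times\mathcal Y$ of the state categories, picking an object $(x_0,y_0)$, and of maps, natural in $\underline a,\underline a'\in\mathcal A^*$, $$\eta:\mathcal A^*(\underline a',\underline a)\to G\big(f(\underline a;x_0,x_0),y_0,y_0\big)[\underline a'].$$ This unit, together with the counit, provides an adjunction $F(-,x_0,x_0)\dashv G(-,y_0,y_0)$ between the functors $F(-,x_0,x_0):\mathcal K\langle\mathcal A\rangle\to\mathcal K\langle\mathcal B\rangle$ and $G(-,y_0,y_0):\mathcal K\langle\mathcal B\rangle\to\mathcal K\langle\mathcal A\rangle$ induced by $f(-;x_0,x_0)$ and $g(-;y_0,y_0)$.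
   Context: All categories are small. $\mathcal B^*$ is the free monoidal category on $\mathcal B$: objects are finite lists, morphisms between lists of the same length are tuples of morphisms of $\mathcal B$ (none between different lengths), tensor is concatenation, unit the empty list $[\,]$; $[b]$ is the one-letter list. $\mathcal K\langle\mathcal B\rangle=[(\mathcal B^* )^{op},\mathrm{Set}]$ with Day convolution $\otimes$. A 2-transducer $(\mathcal Q,t):\mathcal A\rightsquigarrow\mathcal B$ is a category $\mathcal Q$ with a functor $t:\mathcal A\times\mathcal Q^{op}\times\mathcal Q\to\mathcal K\langle\mathcal B\rangle$, with values $t(a;q,q')[\underline b]$; it extends to lists by $t([\,];q,q')=\mathcal Q(q,q')\cdot\mathcal B^*(-,[\,])$ and $t((a_1,\dots,a_n);q,q')=\int^{x_1,\dots,x_{n-1}}t(a_1;q,x_1)\otimes\cdots\otimes t(a_n;x_{n-1},q')$, and then to $T:\mathcal K\langle\mathcal A\rangle\times\mathcal Q^{op}\times\mathcal Q\to\mathcal K\langle\mathcal B\rangle$ by $T(U,q,q')[\underline b]=\int^{\underline a\in\mathcal A^*}U(\underline a)\times t(\underline a;q,q')[\underline b]$. $F$ and $G$ in the claim are the functors so obtained from $f$ and $g$. $\mathbf{2TDX}$ is the bicategory with small categories as objects, 2-transducers as 1-cells, and as 2-cells $(\mathcal P,s)\Rightarrow(\mathcal Q,t)$ the pairs $(K,\theta)$ with $K:\mathcal P\to\mathcal Q$ a functor and $\theta:s(a;p,p')[\underline b]\to t(a;Kp,Kp')[\underline b]$ natural (extended letterwise to lists). The composite of $(\mathcal Q,s):\mathcal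 A\rightsquigarrow\mathcal B$ and $(\mathcal P,t):\mathcal B\rightsquigarrow\mathcal C$ has state category $\mathcal Q\times\mathcal P$ and $(t\circ s)(\underline a;(q,p),(q',p'))=T(s(\underline a;q,q'),p,p')$. The identity of $\mathcal A$ has terminal state category and $\iota(\underline a;\bullet,\bullet)=\mathcal A^*(-,\underline a)$. Horizontal composition of 2-cells is given by the product of state functors and the induced maps on coends. *)

theory Defs
  imports "HOL-Library.FuncSet"
begin

section \<open>Universes of sets\<close>

text \<open>
  A type of class \<open>universe\<close> supplies the elements of all sets, and the objects and arrows of all
  small categories. The predicate \<open>small\<close> selects the subsets that count as sets. The axioms are the
  closure properties needed to form coends over small categories. Examples: any infinite type with
  every subset small; the type of all sets of a model of ZFC with the usual notion of smallness.
\<close>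

class universe =
  fixes small :: "'a set \<Rightarrow> bool"
  assumes small_subset: "small S \<Longrightarrow> T \<subseteq> S \<Longrightarrow> small T"
    and small_image: "small S \<Longrightarrow> small (f ` S)"
    and small_UN: "small S \<Longrightarrow> (\<And>x. x \<in> S \<Longrightarrow> small (D x)) \<Longrightarrow> small (\<Union>x\<in>S. D x)"
    and infinite_small: "\<exists>S. infinite S \<and> small S"

instantiation nat :: universe
begin
definition small_nat :: "nat set \<Rightarrow> bool" where "small_nat S = True"
instance
proof
  show "\<exists>S :: nat set. infinite S \<and> small S"
    using infinite_UNIV_nat unfolding small_nat_def by iprover
qed (simp_all add: small_nat_def)
end

text \<open>
  Pairs and lists over a universe type are stored in the universe itself through an arbitrary
  injection. The injection exists because the universe is infinite; see the lemmas below for the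
  types at which \<open>enc\<close> is used.
\<close>

definition enc :: "'a \<Rightarrow> 'b" where
  "enc = (SOME e. inj e)"

definition dec :: "'b \<Rightarrow> 'a" where
  "dec = inv enc"

lemma inj_encI: "\<exists>e :: 'a \<Rightarrow> 'b. inj e \<Longrightarrow> inj (enc :: 'a \<Rightarrow> 'b)"
  unfolding enc_def by (erule someI_ex)

lemma dec_enc: "inj (enc :: 'a \<Rightarrow> 'b) \<Longrightarrow> dec (enc x :: 'b) = (x :: 'a)"
  unfolding dec_def by (rule inv_f_f)

lemma infinite_universe: "infinite (UNIV :: 'u::universe set)"
proof -
  obtain S :: "'u set" where "infinite S"
    using infinite_small by auto
  then show ?thesis
    using infinite_super subset_UNIV by metis
qed

lemma ex_inj_prod: "\<exists>e :: 'u \<times> 'u \<Rightarrow> 'u::universe. inj e"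
proof -
  include cardinal_syntax
  have "|(UNIV :: 'u set) \<times> (UNIV :: 'u set)| =o |UNIV :: 'u set|"
    by (rule card_of_Times_same_infinite[OF infinite_universe])
  then have "|UNIV :: ('u \<times> 'u) set| \<le>o |UNIV :: 'u set|"
    by (simp add: ordIso_iff_ordLeq)
  then show ?thesis
    by (simp add: card_of_ordLeq[symmetric])
qed

lemma ex_inj_list: "\<exists>e :: 'u list \<Rightarrow> 'u::universe. inj e"
proof -
  obtain p :: "'u \<times> 'u \<Rightarrow> 'u" where p: "inj p"
    using ex_inj_prod by blast
  obtain i :: "nat \<Rightarrow> 'u" where i: "inj i"
    using infinite_countable_subset[OF infinite_universe] by auto
  define r where "r = foldr (\<lambda>x y. p (x, y))"
  have r: "length xs = length ys \<Longrightarrow> r xs z = r ys z \<Longrightarrow> xs = ys" for xs ys z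
    by (induction xs ys rule: list_induct2) (simp_all add: r_def inj_eq[OF p])
  have "inj (\<lambda>xs. p (i (length xs), r xs (i 0)))"
    by (rule injI) (use r in \<open>force simp: inj_eq[OF p] inj_eq[OF i]\<close>)
  then show ?thesis
    by blast
qed

lemma ex_inj_Pair:
  assumes "\<exists>e :: 'a \<Rightarrow> 'u::universe. inj e" "\<exists>e :: 'b \<Rightarrow> 'u. inj e"
  shows "\<exists>e :: 'a \<times> 'b \<Rightarrow> 'u. inj e"
proof -
  obtain f :: "'a \<Rightarrow> 'u" and g :: "'b \<Rightarrow> 'u" and p :: "'u \<times> 'u \<Rightarrow> 'u"
    where *: "inj f" "inj g" "inj p"
    using assms ex_inj_prod by blast
  have "inj (p \<circ> map_prod f g)"
    using * by (intro inj_compose prod.inj_map) auto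
  then show ?thesis by blast
qed

lemma ex_inj_self: "\<exists>e :: 'u \<Rightarrow> 'u. inj e"
  by (rule exI[of _ id]) simp

lemma inj_enc:
  "inj (enc :: unit \<Rightarrow> 'u::universe)"
  "inj (enc :: 'u \<times> 'u \<Rightarrow> 'u)"
  "inj (enc :: 'u list \<Rightarrow> 'u)"
  "inj (enc :: 'u \<times> 'u list \<Rightarrow> 'u)"
  "inj (enc :: 'u list \<times> 'u \<times> 'u \<Rightarrow> 'u)"
  "inj (enc :: ('u list \<times> 'u list) \<times> 'u \<times> 'u \<times> 'u list \<Rightarrow> 'u)"
proof -
  have *: "\<exists>e :: unit \<Rightarrow> 'u. inj e"
    by (rule exI[of _ "\<lambda>_. undefined"]) (simp add: inj_def)
  show
    "inj (enc :: unit \<Rightarrow> 'u::universe)"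
    "inj (enc :: 'u \<times> 'u \<Rightarrow> 'u)"
    "inj (enc :: 'u list \<Rightarrow> 'u)"
    "inj (enc :: 'u \<times> 'u list \<Rightarrow> 'u)"
    "inj (enc :: 'u list \<times> 'u \<times> 'u \<Rightarrow> 'u)"
    "inj (enc :: ('u list \<times> 'u list) \<times> 'u \<times> 'u \<times> 'u list \<Rightarrow> 'u)"
    by (intro inj_encI * ex_inj_Pair ex_inj_list ex_inj_self)+
qed


section \<open>Categories, functors, natural transformations, adjunctions\<close>

record ('o, 'm) cat =
  Obj :: "'o set"
  Mor :: "'m set"
  Src :: "'m \<Rightarrow> 'o"
  Tgt :: "'m \<Rightarrow> 'o"
  Idn :: "'o \<Rightarrow> 'm"
  Cmp :: "'m \<Rightarrow> 'm \<Rightarrow> 'm"  \<comment> \<open>\<open>Cmp C g f\<close> is \<open>g\<close> after \<open>f\<close>\<close>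

definition hom :: "('o, 'm) cat \<Rightarrow> 'o \<Rightarrow> 'o \<Rightarrow> 'm set" where
  "hom C x y = {f \<in> Mor C. Src C f = x \<and> Tgt C f = y}"

definition category :: "('o, 'm) cat \<Rightarrow> bool" where
  "category C \<longleftrightarrow>
     (\<forall>f\<in>Mor C. Src C f \<in> Obj C \<and> Tgt C f \<in> Obj C) \<and>
     (\<forall>x\<in>Obj C. Idn C x \<in> hom C x x) \<and>
     (\<forall>f\<in>Mor C. \<forall>g\<in>Mor C. Tgt C f = Src C g \<longrightarrow> Cmp C g f \<in> hom C (Src C f) (Tgt C g)) \<and>
     (\<forall>f\<in>Mor C. Cmp C f (Idn C (Src C f)) = f \<and> Cmp C (Idn C (Tgt C f)) f = f) \<and>
     (\<forall>f\<in>Mor C. \<forall>g\<in>Mor C. \<forall>h\<in>Mor C. Tgt C f = Src C g \<and> Tgt C g = Src C h \<longrightarrow>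
        Cmp C h (Cmp C g f) = Cmp C (Cmp C h g) f)"

definition small_category :: "('u::universe, 'u) cat \<Rightarrow> bool" where
  "small_category C \<longleftrightarrow> category C \<and> small (Obj C) \<and> small (Mor C)"

definition op_cat :: "('o, 'm) cat \<Rightarrow> ('o, 'm) cat" where
  "op_cat C = \<lparr>Obj = Obj C, Mor = Mor C, Src = Tgt C, Tgt = Src C, Idn = Idn C,
     Cmp = (\<lambda>g f. Cmp C f g)\<rparr>"

definition prod_cat :: "('o, 'm) cat \<Rightarrow> ('p, 'n) cat \<Rightarrow> ('o \<times> 'p, 'm \<times> 'n) cat" (infixr \<open>\<times>\<^sub>c\<close> 75) where
  "C \<times>\<^sub>c D = \<lparr>Obj = Obj C \<times> Obj D, Mor = Mor C \<times> Mor D,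
     Src = map_prod (Src C) (Src D), Tgt = map_prod (Tgt C) (Tgt D),
     Idn = map_prod (Idn C) (Idn D),
     Cmp = (\<lambda>(g, g') (f, f'). (Cmp C g f, Cmp D g' f'))\<rparr>"

definition inverse_mor :: "('o, 'm) cat \<Rightarrow> 'm \<Rightarrow> 'm" where
  "inverse_mor C f = (THE g. g \<in> hom C (Tgt C f) (Src C f) \<and>
     Cmp C g f = Idn C (Src C f) \<and> Cmp C f g = Idn C (Tgt C f))"

record ('o, 'm, 'p, 'n) func =
  FO :: "'o \<Rightarrow> 'p"
  FM :: "'m \<Rightarrow> 'n"

text \<open>
  Functors and natural transformations are extensional (\<open>undefined\<close> off their carriers), so that
  equality of records is equality of functors and of natural transformations.
\<close>

definition mk_func :: "('o, 'm) cat \<Rightarrow> ('o \<Rightarrow> 'p) \<Rightarrow> ('m \<Rightarrow> 'n) \<Rightarrow> ('o, 'm, 'p, 'n) func" where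
  "mk_func C o\<^sub>F m\<^sub>F = \<lparr>FO = restrict o\<^sub>F (Obj C), FM = restrict m\<^sub>F (Mor C)\<rparr>"

definition is_functor :: "('o, 'm) cat \<Rightarrow> ('p, 'n) cat \<Rightarrow> ('o, 'm, 'p, 'n) func \<Rightarrow> bool" where
  "is_functor C D F \<longleftrightarrow>
     FO F \<in> Obj C \<rightarrow>\<^sub>E Obj D \<and> FM F \<in> Mor C \<rightarrow>\<^sub>E Mor D \<and>
     (\<forall>f\<in>Mor C. Src D (FM F f) = FO F (Src C f) \<and> Tgt D (FM F f) = FO F (Tgt C f)) \<and>
     (\<forall>x\<in>Obj C. FM F (Idn C x) = Idn D (FO F x)) \<and>
     (\<forall>f\<in>Mor C. \<forall>g\<in>Mor C. Tgt C f = Src C g \<longrightarrow> FM F (Cmp C g f) = Cmp D (FM F g) (FM F f))"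

definition id_func :: "('o, 'm) cat \<Rightarrow> ('o, 'm, 'o, 'm) func" where
  "id_func C = mk_func C (\<lambda>x. x) (\<lambda>f. f)"

definition comp_func :: "('o, 'm) cat \<Rightarrow> ('p, 'n, 'q, 'k) func \<Rightarrow> ('o, 'm, 'p, 'n) func
    \<Rightarrow> ('o, 'm, 'q, 'k) func" where
  "comp_func C G F = mk_func C (\<lambda>x. FO G (FO F x)) (\<lambda>f. FM G (FM F f))"

record ('o, 'm, 'p, 'n) ntrans =
  NSrc :: "('o, 'm, 'p, 'n) func"
  NTgt :: "('o, 'm, 'p, 'n) func"
  Nc :: "'o \<Rightarrow> 'n"

definition is_ntrans :: "('o, 'm) cat \<Rightarrow> ('p, 'n) cat \<Rightarrow> ('o, 'm, 'p, 'n) ntrans \<Rightarrow> bool" where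
  "is_ntrans C D N \<longleftrightarrow>
     is_functor C D (NSrc N) \<and> is_functor C D (NTgt N) \<and>
     Nc N \<in> extensional (Obj C) \<and>
     (\<forall>x\<in>Obj C. Nc N x \<in> hom D (FO (NSrc N) x) (FO (NTgt N) x)) \<and>
     (\<forall>f\<in>Mor C. Cmp D (FM (NTgt N) f) (Nc N (Src C f)) = Cmp D (Nc N (Tgt C f)) (FM (NSrc N) f))"

definition functor_cat :: "('o, 'm) cat \<Rightarrow> ('p, 'n) cat
    \<Rightarrow> (('o, 'm, 'p, 'n) func, ('o, 'm, 'p, 'n) ntrans) cat" where
  "functor_cat C D = \<lparr>Obj = {F. is_functor C D F}, Mor = {N. is_ntrans C D N},
     Src = NSrc, Tgt = NTgt,
     Idn = (\<lambda>F. \<lparr>NSrc = F, NTgt = F, Nc = (\<lambda>x\<in>Obj C. Idn D (FO F x))\<rparr>),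
     Cmp = (\<lambda>N M. \<lparr>NSrc = NSrc M, NTgt = NTgt N, Nc = (\<lambda>x\<in>Obj C. Cmp D (Nc N x) (Nc M x))\<rparr>)\<rparr>"

definition adjunction :: "('o, 'm) cat \<Rightarrow> ('p, 'n) cat \<Rightarrow> ('o, 'm, 'p, 'n) func \<Rightarrow> ('p, 'n, 'o, 'm) func
    \<Rightarrow> ('o, 'm, 'o, 'm) ntrans \<Rightarrow> ('p, 'n, 'p, 'n) ntrans \<Rightarrow> bool" where
  "adjunction C D F G \<eta> \<epsilon> \<longleftrightarrow>
     category C \<and> category D \<and> is_functor C D F \<and> is_functor D C G \<and>
     is_ntrans C C \<eta> \<and> NSrc \<eta> = id_func C \<and> NTgt \<eta> = comp_func C G F \<and>
     is_ntrans D D \<epsilon> \<and> NSrc \<epsilon> = comp_func D F G \<and> NTgt \<epsilon> = id_func D \<and>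
     (\<forall>x\<in>Obj C. Cmp D (Nc \<epsilon> (FO F x)) (FM F (Nc \<eta> x)) = Idn D (FO F x)) \<and>
     (\<forall>y\<in>Obj D. Cmp C (FM G (Nc \<epsilon> y)) (Nc \<eta> (FO G y)) = Idn C (FO G y))"


section \<open>Adjunctions in a bicategory\<close>

text \<open>
  Only the data of a bicategory are recorded; they suffice to say what an adjunction is.
  \<open>HC1 g f\<close> and \<open>HC2 \<psi> \<phi>\<close> are the horizontal composites with \<open>f\<close>, \<open>\<phi>\<close> first,
  \<open>LU f : 1 \<circ> f \<Rightarrow> f\<close>, \<open>RU f : f \<circ> 1 \<Rightarrow> f\<close> and \<open>AS h g f : (h \<circ> g) \<circ> f \<Rightarrow> h \<circ> (g \<circ> f)\<close>.
\<close>

record ('o, 'f, 'c) bicat =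
  B0 :: "'o set"
  B1 :: "'o \<Rightarrow> 'o \<Rightarrow> 'f set"
  B2 :: "'f \<Rightarrow> 'f \<Rightarrow> 'c set"
  VI :: "'f \<Rightarrow> 'c"
  VC :: "'c \<Rightarrow> 'c \<Rightarrow> 'c"
  HI :: "'o \<Rightarrow> 'f"
  HC1 :: "'f \<Rightarrow> 'f \<Rightarrow> 'f"
  HC2 :: "'c \<Rightarrow> 'c \<Rightarrow> 'c"
  LU :: "'f \<Rightarrow> 'c"
  RU :: "'f \<Rightarrow> 'c"
  AS :: "'f \<Rightarrow> 'f \<Rightarrow> 'f \<Rightarrow> 'c"

definition inverse_2cell :: "('o, 'f, 'c) bicat \<Rightarrow> 'f \<Rightarrow> 'f \<Rightarrow> 'c \<Rightarrow> 'c" where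
  "inverse_2cell \<B> s t \<phi> =
     (THE \<psi>. \<psi> \<in> B2 \<B> t s \<and> VC \<B> \<psi> \<phi> = VI \<B> s \<and> VC \<B> \<phi> \<psi> = VI \<B> t)"

definition bicat_adjunction :: "('o, 'f, 'c) bicat \<Rightarrow> 'o \<Rightarrow> 'o \<Rightarrow> 'f \<Rightarrow> 'f \<Rightarrow> 'c \<Rightarrow> 'c \<Rightarrow> bool" where
  "bicat_adjunction \<B> a b f g \<eta> \<epsilon> \<longleftrightarrow>
     a \<in> B0 \<B> \<and> b \<in> B0 \<B> \<and> f \<in> B1 \<B> a b \<and> g \<in> B1 \<B> b a \<and>
     \<eta> \<in> B2 \<B> (HI \<B> a) (HC1 \<B> g f) \<and> \<epsilon> \<in> B2 \<B> (HC1 \<B> f g) (HI \<B> b) \<and>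
     VC \<B> (LU \<B> f) (VC \<B> (HC2 \<B> \<epsilon> (VI \<B> f))
       (VC \<B> (inverse_2cell \<B> (HC1 \<B> (HC1 \<B> f g) f) (HC1 \<B> f (HC1 \<B> g f)) (AS \<B> f g f))
         (HC2 \<B> (VI \<B> f) \<eta>))) = RU \<B> f \<and>
     VC \<B> (RU \<B> g) (VC \<B> (HC2 \<B> (VI \<B> g) \<epsilon>)
       (VC \<B> (AS \<B> g f g) (HC2 \<B> \<eta> (VI \<B> g)))) = LU \<B> g"


section \<open>Sets and coends\<close>

record 'x setmap =
  SDom :: "'x set"
  SFun :: "'x \<Rightarrow> 'x"
  SCod :: "'x set"

definition smap :: "'x set \<Rightarrow> ('x \<Rightarrow> 'x) \<Rightarrow> 'x set \<Rightarrow> 'x setmap" where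
  "smap S f T = \<lparr>SDom = S, SFun = restrict f S, SCod = T\<rparr>"

definition sets_cat :: "('u::universe set, 'u setmap) cat" where
  "sets_cat = \<lparr>Obj = {S. small S},
     Mor = {m. small (SDom m) \<and> small (SCod m) \<and> SFun m \<in> SDom m \<rightarrow>\<^sub>E SCod m},
     Src = SDom, Tgt = SCod, Idn = (\<lambda>S. smap S (\<lambda>x. x) S),
     Cmp = (\<lambda>g f. smap (SDom f) (\<lambda>x. SFun g (SFun f x)) (SCod g))\<rparr>"

text \<open>
  The coend of a functor \<open>P\<close> from \<open>op_cat C \<times>\<^sub>c C\<close> to sets is the quotient of the disjoint union of
  the \<open>P (c, c)\<close>; a class is represented in the universe by the code of a chosen member.
  \<open>coend_in C P c x\<close> is the class of \<open>x \<in> P (c, c)\<close>, and \<open>coend_desc C P h\<close> is the map out of the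
  coend induced by a cowedge \<open>h\<close>.
\<close>

type_synonym ('o, 'm, 'x) bifun = "('o \<times> 'o, 'm \<times> 'm, 'x set, 'x setmap) func"

definition mk_bifun :: "('o, 'm) cat \<Rightarrow> ('o \<Rightarrow> 'o \<Rightarrow> 'x set) \<Rightarrow> ('m \<Rightarrow> 'm \<Rightarrow> 'x \<Rightarrow> 'x)
    \<Rightarrow> ('o, 'm, 'x) bifun" where
  "mk_bifun C S act = mk_func (op_cat C \<times>\<^sub>c C) (\<lambda>(c', c). S c' c)
     (\<lambda>(k, l). smap (S (Tgt C k) (Src C l)) (act k l) (S (Src C k) (Tgt C l)))"

definition coend_rel :: "('o, 'm) cat \<Rightarrow> ('o, 'm, 'x) bifun \<Rightarrow> (('o \<times> 'x) \<times> ('o \<times> 'x)) set" where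
  "coend_rel C P = {((Src C k, SFun (FM P (k, Idn C (Src C k))) z),
                     (Tgt C k, SFun (FM P (Idn C (Tgt C k), k)) z)) | k z.
                     k \<in> Mor C \<and> z \<in> FO P (Tgt C k, Src C k)}"

definition coend_in :: "('o, 'm) cat \<Rightarrow> ('o, 'm, 'x) bifun \<Rightarrow> 'o \<Rightarrow> 'x \<Rightarrow> 'u::universe" where
  "coend_in C P c x = enc (SOME y. ((c, x), y) \<in> (coend_rel C P \<union> (coend_rel C P)\<inverse>)\<^sup>*)"

definition coend :: "('o, 'm) cat \<Rightarrow> ('o, 'm, 'x) bifun \<Rightarrow> 'u::universe set" where
  "coend C P = {coend_in C P c x | c x. c \<in> Obj C \<and> x \<in> FO P (c, c)}"

definition coend_desc :: "('o, 'm) cat \<Rightarrow> ('o, 'm, 'x) bifun \<Rightarrow> ('o \<Rightarrow> 'x \<Rightarrow> 'z) \<Rightarrow> 'u::universe \<Rightarrow> 'z" where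
  "coend_desc C P h y = (THE z. \<exists>c x. c \<in> Obj C \<and> x \<in> FO P (c, c) \<and> y = coend_in C P c x \<and> z = h c x)"


section \<open>Free monoidal categories and presheaves\<close>

definition free_cat :: "('o, 'm) cat \<Rightarrow> ('o list, 'm list) cat" where
  "free_cat B = \<lparr>Obj = lists (Obj B), Mor = lists (Mor B), Src = map (Src B), Tgt = map (Tgt B),
     Idn = map (Idn B), Cmp = map2 (Cmp B)\<rparr>"

type_synonym 'u psh = "('u list, 'u list, 'u set, 'u setmap) func"
type_synonym 'u pmap = "('u list, 'u list, 'u set, 'u setmap) ntrans"

definition psh_cat :: "('u::universe, 'u) cat \<Rightarrow> ('u psh, 'u pmap) cat" where
  "psh_cat B = functor_cat (op_cat (free_cat B)) sets_cat"

definition mk_psh :: "('u, 'u) cat \<Rightarrow> ('u list \<Rightarrow> 'u set) \<Rightarrow> ('u list \<Rightarrow> 'u \<Rightarrow> 'u) \<Rightarrow> 'u psh" where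
  "mk_psh B S act = mk_func (free_cat B) S
     (\<lambda>\<beta>. smap (S (Tgt (free_cat B) \<beta>)) (act \<beta>) (S (Src (free_cat B) \<beta>)))"

definition mk_pmap :: "('u, 'u) cat \<Rightarrow> 'u psh \<Rightarrow> 'u psh \<Rightarrow> ('u list \<Rightarrow> 'u \<Rightarrow> 'u) \<Rightarrow> 'u pmap" where
  "mk_pmap B U V \<phi> = \<lparr>NSrc = U, NTgt = V,
     Nc = (\<lambda>b\<in>Obj (free_cat B). smap (FO U b) (\<phi> b) (FO V b))\<rparr>"

definition act :: "'u psh \<Rightarrow> 'u list \<Rightarrow> 'u \<Rightarrow> 'u" where
  "act U \<beta> = SFun (FM U \<beta>)"

definition app :: "'u pmap \<Rightarrow> 'u list \<Rightarrow> 'u \<Rightarrow> 'u" where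
  "app N b = SFun (Nc N b)"

text \<open>Representables: the lists of arrows in a hom-set of \<open>free_cat B\<close> are stored as their codes.\<close>

definition yon :: "('u::universe, 'u) cat \<Rightarrow> 'u list \<Rightarrow> 'u psh" where
  "yon B b = mk_psh B (\<lambda>b'. enc ` hom (free_cat B) b' b) (\<lambda>\<beta> x. enc (Cmp (free_cat B) (dec x) \<beta>))"

definition yon_map :: "('u::universe, 'u) cat \<Rightarrow> 'u list \<Rightarrow> 'u pmap" where
  "yon_map B \<gamma> = mk_pmap B (yon B (Src (free_cat B) \<gamma>)) (yon B (Tgt (free_cat B) \<gamma>))
     (\<lambda>_ x. enc (Cmp (free_cat B) \<gamma> (dec x)))"

definition yon_func :: "('u::universe, 'u) cat \<Rightarrow> ('u list, 'u list, 'u psh, 'u pmap) func" where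
  "yon_func B = mk_func (free_cat B) (yon B) (yon_map B)"

text \<open>Day convolution: the integrand of \<open>(U \<otimes> V)[b]\<close> is \<open>U[c1] \<times> V[c2] \<times> B\<^sup>*(b, d1 @ d2)\<close>.\<close>

definition dayP :: "('u, 'u) cat \<Rightarrow> 'u psh \<Rightarrow> 'u psh \<Rightarrow> 'u list
    \<Rightarrow> ('u list \<times> 'u list, 'u list \<times> 'u list, 'u \<times> 'u \<times> 'u list) bifun" where
  "dayP B U V b = mk_bifun (free_cat B \<times>\<^sub>c free_cat B)
     (\<lambda>(c1, c2) (d1, d2). FO U c1 \<times> FO V c2 \<times> hom (free_cat B) b (d1 @ d2))
     (\<lambda>(k1, k2) (l1, l2) (u, v, h). (act U k1 u, act V k2 v, Cmp (free_cat B) (l1 @ l2) h))"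

definition day_in :: "('u::universe, 'u) cat \<Rightarrow> 'u psh \<Rightarrow> 'u psh \<Rightarrow> 'u list
    \<Rightarrow> 'u list \<Rightarrow> 'u list \<Rightarrow> 'u \<Rightarrow> 'u \<Rightarrow> 'u list \<Rightarrow> 'u" where
  "day_in B U V b c1 c2 u v h = coend_in (free_cat B \<times>\<^sub>c free_cat B) (dayP B U V b) (c1, c2) (u, v, h)"

definition day_desc :: "('u::universe, 'u) cat \<Rightarrow> 'u psh \<Rightarrow> 'u psh \<Rightarrow> 'u list
    \<Rightarrow> ('u list \<Rightarrow> 'u list \<Rightarrow> 'u \<Rightarrow> 'u \<Rightarrow> 'u list \<Rightarrow> 'z) \<Rightarrow> 'u \<Rightarrow> 'z" where
  "day_desc B U V b F = coend_desc (free_cat B \<times>\<^sub>c free_cat B) (dayP B U V b)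
     (\<lambda>(c1, c2) (u, v, h). F c1 c2 u v h)"

definition day :: "('u::universe, 'u) cat \<Rightarrow> 'u psh \<Rightarrow> 'u psh \<Rightarrow> 'u psh" where
  "day B U V = mk_psh B
     (\<lambda>b. coend (free_cat B \<times>\<^sub>c free_cat B) (dayP B U V b))
     (\<lambda>\<beta>. day_desc B U V (Tgt (free_cat B) \<beta>) (\<lambda>c1 c2 u v h.
        day_in B U V (Src (free_cat B) \<beta>) c1 c2 u v (Cmp (free_cat B) h \<beta>)))"

definition day_map :: "('u::universe, 'u) cat \<Rightarrow> 'u pmap \<Rightarrow> 'u pmap \<Rightarrow> 'u pmap" where
  "day_map B M N = mk_pmap B (day B (NSrc M) (NSrc N)) (day B (NTgt M) (NTgt N))
     (\<lambda>b. day_desc B (NSrc M) (NSrc N) b (\<lambda>c1 c2 u v h.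
        day_in B (NTgt M) (NTgt N) b c1 c2 (app M c1 u) (app N c2 v) h))"

text \<open>Coends in presheaf categories are computed pointwise.\<close>

definition ev_at :: "('o, 'm, 'u psh, 'u pmap) func \<Rightarrow> 'u list \<Rightarrow> ('o, 'm, 'u set, 'u setmap) func" where
  "ev_at D b = \<lparr>FO = (\<lambda>x. FO (FO D x) b), FM = (\<lambda>f. Nc (FM D f) b)\<rparr>"

definition psh_coend :: "('o, 'm) cat \<Rightarrow> ('u::universe, 'u) cat
    \<Rightarrow> ('o \<times> 'o, 'm \<times> 'm, 'u psh, 'u pmap) func \<Rightarrow> 'u psh" where
  "psh_coend C B D = mk_psh B (\<lambda>b. coend C (ev_at D b))
     (\<lambda>\<beta>. coend_desc C (ev_at D (Tgt (free_cat B) \<beta>))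
        (\<lambda>x e. coend_in C (ev_at D (Src (free_cat B) \<beta>)) x (act (FO D (x, x)) \<beta> e)))"


section \<open>Two-sided state functors and their tensor product\<close>

text \<open>
  For \<open>S\<close>, \<open>R\<close> from \<open>op_cat Q \<times>\<^sub>c Q\<close> to presheaves, \<open>tens Q B S R\<close> sends \<open>(q, q')\<close> to the coend over
  \<open>x\<close> of \<open>S(q, x) \<otimes> R(x, q')\<close>, and \<open>tens_unit Q B\<close> sends it to \<open>Q(q, q') \<cdot> B\<^sup>*(-, [])\<close>.
\<close>

type_synonym 'u prof = "('u \<times> 'u, 'u \<times> 'u, 'u psh, 'u pmap) func"

definition tensD :: "('u::universe, 'u) cat \<Rightarrow> ('u, 'u) cat \<Rightarrow> 'u prof \<Rightarrow> 'u prof \<Rightarrow> 'u \<Rightarrow> 'u \<Rightarrow> 'u prof" where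
  "tensD Q B S R q q' = mk_func (op_cat Q \<times>\<^sub>c Q)
     (\<lambda>(x', x). day B (FO S (q, x)) (FO R (x', q')))
     (\<lambda>(k, l). day_map B (FM S (Idn Q q, l)) (FM R (k, Idn Q q')))"

definition tens_in :: "('u::universe, 'u) cat \<Rightarrow> ('u, 'u) cat \<Rightarrow> 'u prof \<Rightarrow> 'u prof \<Rightarrow> 'u \<Rightarrow> 'u \<Rightarrow> 'u list
    \<Rightarrow> 'u \<Rightarrow> 'u list \<Rightarrow> 'u list \<Rightarrow> 'u \<Rightarrow> 'u \<Rightarrow> 'u list \<Rightarrow> 'u" where
  "tens_in Q B S R q q' b x c1 c2 u v h =
     coend_in Q (ev_at (tensD Q B S R q q') b) x (day_in B (FO S (q, x)) (FO R (x, q')) b c1 c2 u v h)"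

definition tens_desc :: "('u::universe, 'u) cat \<Rightarrow> ('u, 'u) cat \<Rightarrow> 'u prof \<Rightarrow> 'u prof \<Rightarrow> 'u \<Rightarrow> 'u \<Rightarrow> 'u list
    \<Rightarrow> ('u \<Rightarrow> 'u list \<Rightarrow> 'u list \<Rightarrow> 'u \<Rightarrow> 'u \<Rightarrow> 'u list \<Rightarrow> 'z) \<Rightarrow> 'u \<Rightarrow> 'z" where
  "tens_desc Q B S R q q' b F =
     coend_desc Q (ev_at (tensD Q B S R q q') b) (\<lambda>x. day_desc B (FO S (q, x)) (FO R (x, q')) b (F x))"

text \<open>
  The map induced by a map \<open>\<kappa>\<close> of states and by \<open>\<sigma> x : S(q, x) \<rightarrow> S'(r, \<kappa> x)\<close> and
  \<open>\<rho> x : R(x, q') \<rightarrow> R'(\<kappa> x, r')\<close>.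
\<close>

definition tens_map :: "('u::universe, 'u) cat
    \<Rightarrow> ('u, 'u) cat \<Rightarrow> 'u prof \<Rightarrow> 'u prof \<Rightarrow> 'u \<Rightarrow> 'u
    \<Rightarrow> ('u, 'u) cat \<Rightarrow> 'u prof \<Rightarrow> 'u prof \<Rightarrow> 'u \<Rightarrow> 'u
    \<Rightarrow> ('u \<Rightarrow> 'u) \<Rightarrow> ('u \<Rightarrow> 'u pmap) \<Rightarrow> ('u \<Rightarrow> 'u pmap) \<Rightarrow> 'u pmap" where
  "tens_map B Q S R q q' Q' S' R' r r' \<kappa> \<sigma> \<rho> =
     mk_pmap B (psh_coend Q B (tensD Q B S R q q')) (psh_coend Q' B (tensD Q' B S' R' r r'))
       (\<lambda>b. tens_desc Q B S R q q' b (\<lambda>x c1 c2 u v h.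
          tens_in Q' B S' R' r r' b (\<kappa> x) c1 c2 (app (\<sigma> x) c1 u) (app (\<rho> x) c2 v) h))"

definition tens :: "('u::universe, 'u) cat \<Rightarrow> ('u, 'u) cat \<Rightarrow> 'u prof \<Rightarrow> 'u prof \<Rightarrow> 'u prof" where
  "tens Q B S R = mk_func (op_cat Q \<times>\<^sub>c Q)
     (\<lambda>(q, q'). psh_coend Q B (tensD Q B S R q q'))
     (\<lambda>(k, l). tens_map B Q S R (Tgt Q k) (Src Q l) Q S R (Src Q k) (Tgt Q l)
        (\<lambda>x. x) (\<lambda>x. FM S (k, Idn Q x)) (\<lambda>x. FM R (Idn Q x, l)))"

definition tens_unit_ob :: "('u::universe, 'u) cat \<Rightarrow> ('u, 'u) cat \<Rightarrow> 'u \<Rightarrow> 'u \<Rightarrow> 'u psh" where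
  "tens_unit_ob Q B q q' = mk_psh B (\<lambda>b. enc ` (hom Q q q' \<times> hom (free_cat B) b []))
     (\<lambda>\<beta> x. let (m :: 'u, h :: 'u list) = dec x in enc (m, Cmp (free_cat B) h \<beta>))"

definition tens_unit :: "('u::universe, 'u) cat \<Rightarrow> ('u, 'u) cat \<Rightarrow> 'u prof" where
  "tens_unit Q B = mk_func (op_cat Q \<times>\<^sub>c Q) (\<lambda>(q, q'). tens_unit_ob Q B q q')
     (\<lambda>(k, l). mk_pmap B (tens_unit_ob Q B (Tgt Q k) (Src Q l)) (tens_unit_ob Q B (Src Q k) (Tgt Q l))
        (\<lambda>_ x. let (m :: 'u, h :: 'u list) = dec x in enc (Cmp Q l (Cmp Q m k), h)))"


section \<open>2-transducers\<close>

record 'u tdx =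
  TSrc :: "('u, 'u) cat"
  TTgt :: "('u, 'u) cat"
  St :: "('u, 'u) cat"
  Tf :: "('u \<times> 'u \<times> 'u, 'u \<times> 'u \<times> 'u, 'u psh, 'u pmap) func"

definition is_tdx :: "'u::universe tdx \<Rightarrow> bool" where
  "is_tdx t \<longleftrightarrow> small_category (TSrc t) \<and> small_category (TTgt t) \<and> small_category (St t) \<and>
     is_functor (TSrc t \<times>\<^sub>c op_cat (St t) \<times>\<^sub>c St t) (psh_cat (TTgt t)) (Tf t)"

definition tlet :: "'u tdx \<Rightarrow> 'u \<Rightarrow> 'u prof" where
  "tlet t a = mk_func (op_cat (St t) \<times>\<^sub>c St t) (\<lambda>(q, q'). FO (Tf t) (a, q, q'))
     (\<lambda>(k, l). FM (Tf t) (Idn (TSrc t) a, k, l))"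

fun tlist :: "'u::universe tdx \<Rightarrow> 'u list \<Rightarrow> 'u prof" where
  "tlist t [] = tens_unit (St t) (TTgt t)"
| "tlist t [a] = tlet t a"
| "tlist t (a # a' # as) = tens (St t) (TTgt t) (tlet t a) (tlist t (a' # as))"

fun tlist_map :: "'u::universe tdx \<Rightarrow> 'u list \<Rightarrow> 'u \<Rightarrow> 'u \<Rightarrow> 'u pmap" where
  "tlist_map t [] q q' = Idn (psh_cat (TTgt t)) (FO (tlist t []) (q, q'))"
| "tlist_map t [\<alpha>] q q' = FM (Tf t) (\<alpha>, Idn (St t) q, Idn (St t) q')"
| "tlist_map t (\<alpha> # \<alpha>' # \<alpha>s) q q' = tens_map (TTgt t)
     (St t) (tlet t (Src (TSrc t) \<alpha>)) (tlist t (map (Src (TSrc t)) (\<alpha>' # \<alpha>s))) q q'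
     (St t) (tlet t (Tgt (TSrc t) \<alpha>)) (tlist t (map (Tgt (TSrc t)) (\<alpha>' # \<alpha>s))) q q'
     (\<lambda>x. x) (\<lambda>x. FM (Tf t) (\<alpha>, Idn (St t) q, Idn (St t) x)) (\<lambda>x. tlist_map t (\<alpha>' # \<alpha>s) x q')"

definition lext :: "'u::universe tdx \<Rightarrow> ('u list \<times> 'u \<times> 'u, 'u list \<times> 'u \<times> 'u, 'u psh, 'u pmap) func" where
  "lext t = mk_func (free_cat (TSrc t) \<times>\<^sub>c op_cat (St t) \<times>\<^sub>c St t)
     (\<lambda>(as, q, q'). FO (tlist t as) (q, q'))
     (\<lambda>(\<alpha>s, k, l). Cmp (psh_cat (TTgt t))
        (FM (tlist t (Tgt (free_cat (TSrc t)) \<alpha>s)) (k, l))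
        (tlist_map t \<alpha>s (Tgt (St t) k) (Src (St t) l)))"

text \<open>The extension \<open>T\<close> to presheaves, with integrand \<open>U[a'] \<times> t(a; q, q')[b]\<close>.\<close>

definition liftP :: "'u::universe tdx \<Rightarrow> 'u psh \<Rightarrow> 'u \<Rightarrow> 'u \<Rightarrow> 'u list \<Rightarrow> ('u list, 'u list, 'u \<times> 'u) bifun" where
  "liftP t U q q' b = mk_bifun (free_cat (TSrc t))
     (\<lambda>a' a. FO U a' \<times> FO (FO (lext t) (a, q, q')) b)
     (\<lambda>k l (u, e). (act U k u, app (FM (lext t) (l, Idn (St t) q, Idn (St t) q')) b e))"

definition lift_in :: "'u::universe tdx \<Rightarrow> 'u psh \<Rightarrow> 'u \<Rightarrow> 'u \<Rightarrow> 'u list \<Rightarrow> 'u list \<Rightarrow> 'u \<Rightarrow> 'u \<Rightarrow> 'u" where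
  "lift_in t U q q' b a u e = coend_in (free_cat (TSrc t)) (liftP t U q q' b) a (u, e)"

definition lift_desc :: "'u::universe tdx \<Rightarrow> 'u psh \<Rightarrow> 'u \<Rightarrow> 'u \<Rightarrow> 'u list
    \<Rightarrow> ('u list \<Rightarrow> 'u \<Rightarrow> 'u \<Rightarrow> 'z) \<Rightarrow> 'u \<Rightarrow> 'z" where
  "lift_desc t U q q' b F = coend_desc (free_cat (TSrc t)) (liftP t U q q' b) (\<lambda>a (u, e). F a u e)"

definition lift_ob :: "'u::universe tdx \<Rightarrow> 'u psh \<Rightarrow> 'u \<Rightarrow> 'u \<Rightarrow> 'u psh" where
  "lift_ob t U q q' = mk_psh (TTgt t) (\<lambda>b. coend (free_cat (TSrc t)) (liftP t U q q' b))
     (\<lambda>\<beta>. lift_desc t U q q' (Tgt (free_cat (TTgt t)) \<beta>) (\<lambda>a u e.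
        lift_in t U q q' (Src (free_cat (TTgt t)) \<beta>) a u (act (FO (lext t) (a, q, q')) \<beta> e)))"

text \<open>The map \<open>T(U, q, q') \<rightarrow> T'(U', r, r')\<close> induced by \<open>\<mu> : U \<rightarrow> U'\<close> and \<open>\<phi> a : t(a; q, q') \<rightarrow> t'(a; r, r')\<close>.\<close>

definition lift_map :: "'u::universe tdx \<Rightarrow> 'u psh \<Rightarrow> 'u \<Rightarrow> 'u \<Rightarrow> 'u tdx \<Rightarrow> 'u psh \<Rightarrow> 'u \<Rightarrow> 'u
    \<Rightarrow> 'u pmap \<Rightarrow> ('u list \<Rightarrow> 'u pmap) \<Rightarrow> 'u pmap" where
  "lift_map t U q q' t' U' r r' \<mu> \<phi> = mk_pmap (TTgt t) (lift_ob t U q q') (lift_ob t' U' r r')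
     (\<lambda>b. lift_desc t U q q' b (\<lambda>a u e. lift_in t' U' r r' b a (app \<mu> a u) (app (\<phi> a) b e)))"

definition lift :: "'u::universe tdx
    \<Rightarrow> ('u psh \<times> 'u \<times> 'u, 'u pmap \<times> 'u \<times> 'u, 'u psh, 'u pmap) func" where
  "lift t = mk_func (psh_cat (TSrc t) \<times>\<^sub>c op_cat (St t) \<times>\<^sub>c St t)
     (\<lambda>(U, q, q'). lift_ob t U q q')
     (\<lambda>(\<mu>, k, l). lift_map t (NSrc \<mu>) (Tgt (St t) k) (Src (St t) l) t (NTgt \<mu>) (Src (St t) k) (Tgt (St t) l)
        \<mu> (\<lambda>a. FM (lext t) (Idn (free_cat (TSrc t)) a, k, l)))"

definition lift_at :: "'u::universe tdx \<Rightarrow> 'u \<Rightarrow> ('u psh, 'u pmap, 'u psh, 'u pmap) func" where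
  "lift_at t q = mk_func (psh_cat (TSrc t)) (\<lambda>U. FO (lift t) (U, q, q))
     (\<lambda>\<mu>. FM (lift t) (\<mu>, Idn (St t) q, Idn (St t) q))"

definition lext_at :: "'u::universe tdx \<Rightarrow> 'u \<Rightarrow> ('u list, 'u list, 'u psh, 'u pmap) func" where
  "lext_at t q = mk_func (free_cat (TSrc t)) (\<lambda>a. FO (lext t) (a, q, q))
     (\<lambda>\<alpha>. FM (lext t) (\<alpha>, Idn (St t) q, Idn (St t) q))"


section \<open>Identity and composite 2-transducers\<close>

definition code_cat :: "('o, 'm) cat \<Rightarrow> ('u::universe, 'u) cat" where
  "code_cat C = \<lparr>Obj = enc ` Obj C, Mor = enc ` Mor C,
     Src = (\<lambda>f. enc (Src C (dec f))), Tgt = (\<lambda>f. enc (Tgt C (dec f))),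
     Idn = (\<lambda>x. enc (Idn C (dec x))), Cmp = (\<lambda>g f. enc (Cmp C (dec g) (dec f)))\<rparr>"

definition pt :: "'u::universe" where
  "pt = enc ()"

definition terminal_cat :: "('u::universe, 'u) cat" where
  "terminal_cat = code_cat \<lparr>Obj = {()}, Mor = {()}, Src = (\<lambda>_. ()), Tgt = (\<lambda>_. ()),
     Idn = (\<lambda>_. ()), Cmp = (\<lambda>_ _. ())\<rparr>"

definition states_prod :: "('u::universe, 'u) cat \<Rightarrow> ('u, 'u) cat \<Rightarrow> ('u, 'u) cat" where
  "states_prod Q P = code_cat (Q \<times>\<^sub>c P)"

definition tdx_id :: "('u::universe, 'u) cat \<Rightarrow> 'u tdx" where
  "tdx_id A = \<lparr>TSrc = A, TTgt = A, St = terminal_cat,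
     Tf = mk_func (A \<times>\<^sub>c op_cat terminal_cat \<times>\<^sub>c terminal_cat)
       (\<lambda>(a, _, _). yon A [a]) (\<lambda>(\<alpha>, _, _). yon_map A [\<alpha>])\<rparr>"

definition tdx_comp :: "'u::universe tdx \<Rightarrow> 'u tdx \<Rightarrow> 'u tdx" where
  "tdx_comp t s = \<lparr>TSrc = TSrc s, TTgt = TTgt t, St = states_prod (St s) (St t),
     Tf = mk_func (TSrc s \<times>\<^sub>c op_cat (states_prod (St s) (St t)) \<times>\<^sub>c states_prod (St s) (St t))
       (\<lambda>(a, z, z'). let (q, p) = dec z; (q', p') = dec z' in
          FO (lift t) (FO (Tf s) (a, q, q'), p, p'))
       (\<lambda>(\<alpha>, m, m'). let (k, l) = dec m; (k', l') = dec m' in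
          FM (lift t) (FM (Tf s) (\<alpha>, k, k'), l, l'))\<rparr>"


section \<open>2-cells\<close>

record 'u cell =
  CSrc :: "'u tdx"
  CTgt :: "'u tdx"
  CK :: "('u, 'u, 'u, 'u) func"
  CTh :: "('u \<times> 'u \<times> 'u, 'u \<times> 'u \<times> 'u, 'u psh, 'u pmap) ntrans"

text \<open>\<open>pull s t K\<close> is the functor \<open>(a, p, p') \<mapsto> t(a; K p, K p')\<close>, for \<open>K\<close> from the states of \<open>s\<close> to those of \<open>t\<close>.\<close>

definition pull :: "'u tdx \<Rightarrow> 'u tdx \<Rightarrow> ('u, 'u, 'u, 'u) func
    \<Rightarrow> ('u \<times> 'u \<times> 'u, 'u \<times> 'u \<times> 'u, 'u psh, 'u pmap) func" where
  "pull s t K = mk_func (TSrc s \<times>\<^sub>c op_cat (St s) \<times>\<^sub>c St s)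
     (\<lambda>(a, p, p'). FO (Tf t) (a, FO K p, FO K p'))
     (\<lambda>(\<alpha>, k, k'). FM (Tf t) (\<alpha>, FM K k, FM K k'))"

definition mk_cell :: "'u tdx \<Rightarrow> 'u tdx \<Rightarrow> ('u \<Rightarrow> 'u) \<Rightarrow> ('u \<Rightarrow> 'u) \<Rightarrow> ('u \<Rightarrow> 'u \<Rightarrow> 'u \<Rightarrow> 'u pmap) \<Rightarrow> 'u cell" where
  "mk_cell s t o\<^sub>K m\<^sub>K \<theta> = (let K = mk_func (St s) o\<^sub>K m\<^sub>K in
     \<lparr>CSrc = s, CTgt = t, CK = K,
      CTh = \<lparr>NSrc = Tf s, NTgt = pull s t K,
        Nc = (\<lambda>(a, p, p')\<in>Obj (TSrc s \<times>\<^sub>c op_cat (St s) \<times>\<^sub>c St s). \<theta> a p p')\<rparr>\<rparr>)"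

definition is_cell :: "'u::universe tdx \<Rightarrow> 'u tdx \<Rightarrow> 'u cell \<Rightarrow> bool" where
  "is_cell s t \<phi> \<longleftrightarrow> CSrc \<phi> = s \<and> CTgt \<phi> = t \<and> TSrc s = TSrc t \<and> TTgt s = TTgt t \<and>
     is_functor (St s) (St t) (CK \<phi>) \<and>
     is_ntrans (TSrc s \<times>\<^sub>c op_cat (St s) \<times>\<^sub>c St s) (psh_cat (TTgt s)) (CTh \<phi>) \<and>
     NSrc (CTh \<phi>) = Tf s \<and> NTgt (CTh \<phi>) = pull s t (CK \<phi>)"

text \<open>The letterwise extension \<open>s(as; p, p') \<rightarrow> t(as; K p, K p')\<close> of a 2-cell \<open>s \<Rightarrow> t\<close> to lists.\<close>

fun cext :: "'u::universe cell \<Rightarrow> 'u list \<Rightarrow> 'u \<Rightarrow> 'u \<Rightarrow> 'u pmap" where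
  "cext \<phi> [] p p' = mk_pmap (TTgt (CSrc \<phi>))
     (FO (tlist (CSrc \<phi>) []) (p, p')) (FO (tlist (CTgt \<phi>) []) (FO (CK \<phi>) p, FO (CK \<phi>) p'))
     (\<lambda>_ x. let (m :: 'u, h :: 'u list) = dec x in enc (FM (CK \<phi>) m, h))"
| "cext \<phi> [a] p p' = Nc (CTh \<phi>) (a, p, p')"
| "cext \<phi> (a # a' # as) p p' = tens_map (TTgt (CSrc \<phi>))
     (St (CSrc \<phi>)) (tlet (CSrc \<phi>) a) (tlist (CSrc \<phi>) (a' # as)) p p'
     (St (CTgt \<phi>)) (tlet (CTgt \<phi>) a) (tlist (CTgt \<phi>) (a' # as)) (FO (CK \<phi>) p) (FO (CK \<phi>) p')
     (FO (CK \<phi>)) (\<lambda>x. Nc (CTh \<phi>) (a, p, x)) (\<lambda>x. cext \<phi> (a' # as) x p')"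

definition cell_id :: "'u::universe tdx \<Rightarrow> 'u cell" where
  "cell_id t = mk_cell t t (\<lambda>q. q) (\<lambda>k. k) (\<lambda>a q q'. Idn (psh_cat (TTgt t)) (FO (Tf t) (a, q, q')))"

definition cell_vcomp :: "'u::universe cell \<Rightarrow> 'u cell \<Rightarrow> 'u cell" where
  "cell_vcomp \<psi> \<phi> = mk_cell (CSrc \<phi>) (CTgt \<psi>)
     (\<lambda>p. FO (CK \<psi>) (FO (CK \<phi>) p)) (\<lambda>k. FM (CK \<psi>) (FM (CK \<phi>) k))
     (\<lambda>a p p'. Cmp (psh_cat (TTgt (CSrc \<phi>)))
        (Nc (CTh \<psi>) (a, FO (CK \<phi>) p, FO (CK \<phi>) p')) (Nc (CTh \<phi>) (a, p, p')))"

definition cell_hcomp :: "'u::universe cell \<Rightarrow> 'u cell \<Rightarrow> 'u cell" where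
  "cell_hcomp \<psi> \<phi> = mk_cell (tdx_comp (CSrc \<psi>) (CSrc \<phi>)) (tdx_comp (CTgt \<psi>) (CTgt \<phi>))
     (\<lambda>z. let (q :: 'u, p :: 'u) = dec z in enc (FO (CK \<phi>) q, FO (CK \<psi>) p))
     (\<lambda>m. let (k :: 'u, l :: 'u) = dec m in enc (FM (CK \<phi>) k, FM (CK \<psi>) l))
     (\<lambda>a z z'. let (q, p) = dec z; (q', p') = dec z' in
        lift_map (CSrc \<psi>) (FO (Tf (CSrc \<phi>)) (a, q, q')) p p'
          (CTgt \<psi>) (FO (Tf (CTgt \<phi>)) (a, FO (CK \<phi>) q, FO (CK \<phi>) q')) (FO (CK \<psi>) p) (FO (CK \<psi>) p')
          (Nc (CTh \<phi>) (a, q, q')) (\<lambda>b. cext \<psi> b p p'))"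


section \<open>Unitors\<close>

text \<open>
  The canonical map from \<open>\<iota>(b; pt, pt)[b']\<close>, the list extension of the identity 2-transducer, to
  \<open>B\<^sup>*(b', b)\<close>.
\<close>

fun id_collapse :: "('u::universe, 'u) cat \<Rightarrow> 'u list \<Rightarrow> 'u list \<Rightarrow> 'u \<Rightarrow> 'u list" where
  "id_collapse B [] b' e = snd (dec e :: 'u \<times> 'u list)"
| "id_collapse B [x] b' e = dec e"
| "id_collapse B (x # y # bs) b' e =
     tens_desc terminal_cat B (tlet (tdx_id B) x) (tlist (tdx_id B) (y # bs)) pt pt b'
       (\<lambda>_ c1 c2 e1 e2 h. Cmp (free_cat B) (dec e1 @ id_collapse B (y # bs) c2 e2) h) e"

definition id_collapse_map :: "('u::universe, 'u) cat \<Rightarrow> 'u list \<Rightarrow> 'u pmap" where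
  "id_collapse_map B b = mk_pmap B (FO (lext (tdx_id B)) (b, pt, pt)) (yon B b)
     (\<lambda>b' e. enc (id_collapse B b b' e))"

text \<open>The canonical map \<open>T(V, pt, pt) \<rightarrow> V\<close> for the identity 2-transducer.\<close>

definition lift_id_map :: "('u::universe, 'u) cat \<Rightarrow> 'u psh \<Rightarrow> 'u pmap" where
  "lift_id_map B V = mk_pmap B (lift_ob (tdx_id B) V pt pt) V
     (\<lambda>b'. lift_desc (tdx_id B) V pt pt b' (\<lambda>b v e. act V (id_collapse B b b' e) v))"

definition left_unitor :: "'u::universe tdx \<Rightarrow> 'u cell" where
  "left_unitor f = mk_cell (tdx_comp (tdx_id (TTgt f)) f) f
     (\<lambda>z. fst (dec z :: 'u \<times> 'u)) (\<lambda>m. fst (dec m :: 'u \<times> 'u))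
     (\<lambda>a z z'. lift_id_map (TTgt f)
        (FO (Tf f) (a, fst (dec z :: 'u \<times> 'u), fst (dec z' :: 'u \<times> 'u))))"

definition right_unitor :: "'u::universe tdx \<Rightarrow> 'u cell" where
  "right_unitor f = mk_cell (tdx_comp f (tdx_id (TSrc f))) f
     (\<lambda>z. snd (dec z :: 'u \<times> 'u)) (\<lambda>m. snd (dec m :: 'u \<times> 'u))
     (\<lambda>a z z'. let x = snd (dec z :: 'u \<times> 'u); x' = snd (dec z' :: 'u \<times> 'u) in
        mk_pmap (TTgt f) (lift_ob f (yon (TSrc f) [a]) x x') (FO (Tf f) (a, x, x'))
          (\<lambda>b. lift_desc f (yon (TSrc f) [a]) x x' b (\<lambda>a' \<phi> e.
             app (FM (lext f) (dec \<phi>, Idn (St f) x, Idn (St f) x')) b e)))"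


section \<open>Associator\<close>

text \<open>
  Concatenation \<open>u(c1; r, w)[d1] \<times> u(c2; w, r')[d2] \<rightarrow> u(c1 @ c2; r, r')[d1 @ d2]\<close> for the list
  extension of a 2-transducer.
\<close>

fun tcat :: "'u::universe tdx \<Rightarrow> 'u list \<Rightarrow> 'u list \<Rightarrow> 'u \<Rightarrow> 'u \<Rightarrow> 'u \<Rightarrow> 'u list \<Rightarrow> 'u list \<Rightarrow> 'u \<Rightarrow> 'u \<Rightarrow> 'u" where
  "tcat u [] c2 r w r' d1 d2 e1 e2 =
     (let (m :: 'u, h :: 'u list) = dec e1 in
        act (FO (lext u) (c2, r, r')) (h @ Idn (free_cat (TTgt u)) d2)
          (app (FM (lext u) (Idn (free_cat (TSrc u)) c2, m, Idn (St u) r')) d2 e2))"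
| "tcat u [c] [] r w r' d1 d2 e1 e2 =
     (let (m :: 'u, h :: 'u list) = dec e2 in
        act (FO (lext u) ([c], r, r')) (Idn (free_cat (TTgt u)) d1 @ h)
          (app (FM (lext u) ([Idn (TSrc u) c], Idn (St u) r, m)) d1 e1))"
| "tcat u [c] (c' # cs) r w r' d1 d2 e1 e2 =
     tens_in (St u) (TTgt u) (tlet u c) (tlist u (c' # cs)) r r' (d1 @ d2)
       w d1 d2 e1 e2 (Idn (free_cat (TTgt u)) (d1 @ d2))"
| "tcat u (c # c' # cs) c2 r w r' d1 d2 e1 e2 =
     tens_desc (St u) (TTgt u) (tlet u c) (tlist u (c' # cs)) r w d1
       (\<lambda>y b1 b2 p p' h.
          tens_in (St u) (TTgt u) (tlet u c) (tlist u (c' # cs @ c2)) r r' (d1 @ d2)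
            y b1 (b2 @ d2) p (tcat u (c' # cs) c2 y w r' b2 d2 p' e2)
            (h @ Idn (free_cat (TTgt u)) d2)) e1"

text \<open>
  For \<open>t : B \<rightarrow> C\<close> and \<open>u : C \<rightarrow> D\<close>, the canonical map
  \<open>(u \<circ> t)(bs; (p, r), (p', r'))[d] \<rightarrow> U(t(bs; p, p'), r, r')[d]\<close> from the list extension of the
  composite. It is the identity on one-letter lists, and it regroups the letters of longer lists
  using \<open>tcat\<close>.
\<close>

fun comp_regroup :: "'u::universe tdx \<Rightarrow> 'u tdx \<Rightarrow> 'u list \<Rightarrow> 'u \<Rightarrow> 'u \<Rightarrow> 'u \<Rightarrow> 'u \<Rightarrow> 'u list \<Rightarrow> 'u \<Rightarrow> 'u" where
  "comp_regroup u t [] p r p' r' d e =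
     (let (m :: 'u, h :: 'u list) = dec e; (k :: 'u, l :: 'u) = dec m in
        lift_in u (FO (tlist t []) (p, p')) r r' d [] (enc (k, [] :: 'u list)) (enc (l, h)))"
| "comp_regroup u t [b] p r p' r' d e = e"
| "comp_regroup u t (b # b' # bs) p r p' r' d e =
     tens_desc (states_prod (St t) (St u)) (TTgt u) (tlet (tdx_comp u t) b) (tlist (tdx_comp u t) (b' # bs))
       (enc (p, r)) (enc (p', r')) d
       (\<lambda>z d1 d2 e1 e2 h. let (x, w) = dec z in
          lift_desc u (FO (Tf t) (b, p, x)) r w d1
            (\<lambda>c1 v1 w1.
               lift_desc u (FO (tlist t (b' # bs)) (x, p')) w r' d2
                 (\<lambda>c2 v2 w2.
                    lift_in u (FO (tlist t (b # b' # bs)) (p, p')) r r' d (c1 @ c2)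
                      (tens_in (St t) (TTgt t) (tlet t b) (tlist t (b' # bs)) p p' (c1 @ c2)
                         x c1 c2 v1 v2 (Idn (free_cat (TTgt t)) (c1 @ c2)))
                      (act (FO (lext u) (c1 @ c2, r, r')) h (tcat u c1 c2 r w r' d1 d2 w1 w2)))
                 (comp_regroup u t (b' # bs) x w p' r' d2 e2))
            e1) e"

definition comp_regroup_map :: "'u::universe tdx \<Rightarrow> 'u tdx \<Rightarrow> 'u list \<Rightarrow> 'u \<Rightarrow> 'u \<Rightarrow> 'u \<Rightarrow> 'u \<Rightarrow> 'u pmap" where
  "comp_regroup_map u t bs p r p' r' =
     mk_pmap (TTgt u) (FO (lext (tdx_comp u t)) (bs, enc (p, r), enc (p', r')))
       (lift_ob u (FO (lext t) (bs, p, p')) r r') (comp_regroup u t bs p r p' r')"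

text \<open>
  The canonical map \<open>(U \<circ> T)(V, (p, r), (p', r')) \<rightarrow> U(T(V, p, p'), r, r')\<close> between the extensions
  to presheaves, where \<open>U \<circ> T\<close> is the extension of the composite \<open>u \<circ> t\<close>.
\<close>

definition lift_comp_map :: "'u::universe tdx \<Rightarrow> 'u tdx \<Rightarrow> 'u psh \<Rightarrow> 'u \<Rightarrow> 'u \<Rightarrow> 'u \<Rightarrow> 'u \<Rightarrow> 'u pmap" where
  "lift_comp_map u t V p r p' r' =
     mk_pmap (TTgt u) (lift_ob (tdx_comp u t) V (enc (p, r)) (enc (p', r')))
       (lift_ob u (lift_ob t V p p') r r')
       (\<lambda>d. lift_desc (tdx_comp u t) V (enc (p, r)) (enc (p', r')) d (\<lambda>b v e.
          lift_desc u (FO (lext t) (b, p, p')) r r' d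
            (\<lambda>c w e'. lift_in u (lift_ob t V p p') r r' d c (lift_in t V p p' c b v w) e')
            (comp_regroup u t b p r p' r' d e)))"

definition associator :: "'u::universe tdx \<Rightarrow> 'u tdx \<Rightarrow> 'u tdx \<Rightarrow> 'u cell" where
  "associator u t s = mk_cell (tdx_comp (tdx_comp u t) s) (tdx_comp u (tdx_comp t s))
     (\<lambda>z. let (q :: 'u, y :: 'u) = dec z; (p :: 'u, r :: 'u) = dec y in enc (enc (q, p) :: 'u, r))
     (\<lambda>m. let (k :: 'u, n :: 'u) = dec m; (l :: 'u, j :: 'u) = dec n in enc (enc (k, l) :: 'u, j))
     (\<lambda>a z z'. let (q :: 'u, y :: 'u) = dec z; (p, r) = dec y; (q' :: 'u, y' :: 'u) = dec z'; (p', r') = dec y' in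
        lift_comp_map u t (FO (Tf s) (a, q, q')) p r p' r')"


section \<open>The bicategory of 2-transducers\<close>

definition TDX :: "(('u::universe, 'u) cat, 'u tdx, 'u cell) bicat" where
  "TDX = \<lparr>B0 = {A. small_category A},
     B1 = (\<lambda>A B. {t. is_tdx t \<and> TSrc t = A \<and> TTgt t = B}),
     B2 = (\<lambda>s t. {\<phi>. is_cell s t \<phi>}),
     VI = cell_id, VC = cell_vcomp, HI = tdx_id, HC1 = tdx_comp, HC2 = cell_hcomp,
     LU = left_unitor, RU = right_unitor, AS = associator\<rparr>"


section \<open>The transformations induced by the unit and counit\<close>

text \<open>
  The extension to lists \<open>a\<close> of a unit 2-cell \<open>\<eta> : 1 \<Rightarrow> g \<circ> f\<close> with states \<open>(x0, y0)\<close>, as a map of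
  presheaves \<open>A\<^sup>*(-, a) \<rightarrow> G(f(a; x0, x0), y0, y0)\<close>, using \<open>A\<^sup>*(-, a) \<cong> \<iota>(a; pt, pt)\<close>.
\<close>

definition unit_on_lists :: "'u::universe tdx \<Rightarrow> 'u tdx \<Rightarrow> 'u cell \<Rightarrow> 'u \<Rightarrow> 'u
    \<Rightarrow> ('u list, 'u list, 'u psh, 'u pmap) ntrans" where
  "unit_on_lists f g \<eta> x0 y0 = (let A = TSrc f; K = psh_cat A in
     \<lparr>NSrc = yon_func A,
      NTgt = comp_func (free_cat A) (lift_at g y0) (lext_at f x0),
      Nc = (\<lambda>a\<in>Obj (free_cat A).
        Cmp K (comp_regroup_map g f a x0 y0 x0 y0)
          (Cmp K (cext \<eta> a pt pt) (inverse_mor K (id_collapse_map A a))))\<rparr>)"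

text \<open>
  A 2-cell \<open>\<phi> : s \<Rightarrow> t\<close> induces \<open>S(U, p, p') \<rightarrow> T(U, K p, K p')\<close>. The unit \<open>U \<rightarrow> G(F U)\<close> and the
  counit \<open>F(G V) \<rightarrow> V\<close> are these maps for \<open>\<eta>\<close> and \<open>\<epsilon>\<close>, composed with the canonical isomorphisms.
\<close>

definition lift_cell :: "'u::universe cell \<Rightarrow> 'u psh \<Rightarrow> 'u \<Rightarrow> 'u \<Rightarrow> 'u pmap" where
  "lift_cell \<phi> U p p' = lift_map (CSrc \<phi>) U p p' (CTgt \<phi>) U (FO (CK \<phi>) p) (FO (CK \<phi>) p')
     (Idn (psh_cat (TSrc (CSrc \<phi>))) U) (\<lambda>a. cext \<phi> a p p')"

definition induced_unit :: "'u::universe tdx \<Rightarrow> 'u tdx \<Rightarrow> 'u cell \<Rightarrow> 'u \<Rightarrow> 'u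
    \<Rightarrow> ('u psh, 'u pmap, 'u psh, 'u pmap) ntrans" where
  "induced_unit f g \<eta> x0 y0 = (let A = TSrc f; K = psh_cat A in
     \<lparr>NSrc = id_func K, NTgt = comp_func K (lift_at g y0) (lift_at f x0),
      Nc = (\<lambda>U\<in>Obj K.
        Cmp K (lift_comp_map g f U x0 y0 x0 y0)
          (Cmp K (lift_cell \<eta> U pt pt) (inverse_mor K (lift_id_map A U))))\<rparr>)"

definition induced_counit :: "'u::universe tdx \<Rightarrow> 'u tdx \<Rightarrow> 'u cell \<Rightarrow> 'u \<Rightarrow> 'u
    \<Rightarrow> ('u psh, 'u pmap, 'u psh, 'u pmap) ntrans" where
  "induced_counit f g \<epsilon> x0 y0 = (let B = TTgt f; K = psh_cat B in
     \<lparr>NSrc = comp_func K (lift_at f x0) (lift_at g y0), NTgt = id_func K,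
      Nc = (\<lambda>V\<in>Obj K.
        Cmp K (lift_id_map B V)
          (Cmp K (lift_cell \<epsilon> V (enc (y0, x0)) (enc (y0, x0)))
            (inverse_mor K (lift_comp_map f g V y0 x0 y0 x0))))\<rparr>)"

end

theory Submission
 imports Defs
begin

text \<open>
 Evaluated on states, the two triangle identities of the bicategory force every object and arrow of
 the state categories of \<open>f\<close> and \<open>g\<close> to be \<open>x0\<close>, \<open>y0\<close> or their identities. Evaluated at a letter
 on elements, they become \<open>act f (EE e' e) w = e\<close> and \<open>act g (EE e' w) e = e'\<close>, where \<open>(w, e)\<close>
 represents the value of the unit at that letter and \<open>EE\<close> is the counit. The list extensions of the unit and
 the counit are compatible with concatenation, so both equations propagate from letters to lists, and on
 lists they are the triangle identities of the functors \<open>F(-, x0, x0)\<close> and \<open>G(-, y0, y0)\<close>. Most of the work is to show that the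
 regrouping map of a composite is bijective: the associator must be inverted before the first triangle can be read.
\<close>

section \<open>Categories and functors\<close>

text \<open>An equation between 2-cells contains an equation between their functors on states. Along
  a triangle the counit sends its states to the terminal category and the unit inserts
  \<open>(x0, y0)\<close>, so one side is constant while the other is a projection. This is why
  elements over lists may be studied at \<open>x0\<close> and \<open>y0\<close> alone, although
  splitting a list introduces an arbitrary intermediate state. The obstacle is that the list
  extension of a composite is an iterated coend over pairs of states, with a further coend inside
  each letter, while the regrouped form is one coend over a single middle list. Choosing
  representatives gives surjectivity of regrouping; injectivity needs a map back, which is obtained
  from the universal property of concatenation. All maps out of coends are evaluated on generators.
  Each recursive map carries an invariant (\<open>TM\<close>, \<open>TP\<close>, \<open>RP\<close>,
  \<open>CP\<close>, \<open>IP\<close>) that joins typing and naturality, because well-definedness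
  at the next letter rests on naturality at the tail. The counit yields arrows \<open>EE\<close>
  that can act on elements because the identity 2-transducer is representable at every list.\<close>

lemma hom_Mor: "f:hom C x y ==> f:Mor C"
 and hom_Src: "f:hom C x y ==> Src C f = x"
 and hom_Tgt: "f:hom C x y ==> Tgt C f = y"
 and Mor_hom: "f:Mor C ==> f:hom C (Src C f) (Tgt C f)"
 by (auto simp: hom_def)

lemma categoryI:
 assumes "!!f. f:Mor C ==> Src C f:Obj C & Tgt C f:Obj C"
  and "!!x. x:Obj C ==> Idn C x:hom C x x"
  and "!!x y z f g. f:hom C x y ==> g:hom C y z ==> Cmp C g f:hom C x z"
  and "!!x y f. f:hom C x y ==> Cmp C f (Idn C x) = f"
  and "!!x y f. f:hom C x y ==> Cmp C (Idn C y) f = f"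
  and "!!x y z w f g h. f:hom C x y ==> g:hom C y z ==> h:hom C z w ==>
  Cmp C h (Cmp C g f) = Cmp C (Cmp C h g) f"
 shows "category C"
 unfolding category_def
proof (intro conjI ballI impI allI)
 fix f g assume fg: "f:Mor C" "g:Mor C" "Tgt C f = Src C g"
 then show "Cmp C g f:hom C (Src C f) (Tgt C g)"
  using assms(3)[of f "Src C f" "Src C g" g] by (simp add: hom_def)
next
 fix f g h assume fg: "f:Mor C" "g:Mor C" "h:Mor C" "Tgt C f = Src C g & Tgt C g = Src C h"
 then show "Cmp C h (Cmp C g f) = Cmp C (Cmp C h g) f"
  using fg assms(6)[of f "Src C f" "Src C g" g "Src C h" h] by (simp add: hom_def)
qed (use assms(1,2) assms(4)[OF Mor_hom] assms(5)[OF Mor_hom] in \<open>simp_all add: hom_def\<close>)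

context
 fixes C :: "('o, 'm) cat"
 assumes C: "category C"
begin

lemma hom_obj1: "f:hom C x y ==> x:Obj C"
 and hom_obj2: "f:hom C x y ==> y:Obj C"
 using C by (auto simp: category_def hom_def)

lemmas hom_objs = hom_obj1 hom_obj2

lemma Idn_hom: "x:Obj C ==> Idn C x:hom C x x"
 using C by (auto simp: category_def)

lemma Idn_Mor: "x:Obj C ==> Idn C x:Mor C"
 using Idn_hom by (auto simp: hom_def)

lemma Cmp_hom: "f:hom C x y ==> g:hom C y z ==> Cmp C g f:hom C x z"
 using C by (auto simp: category_def hom_def)

lemma Cmp_idr: "f:hom C x y ==> Cmp C f (Idn C x) = f"
 and Cmp_idl: "f:hom C x y ==> Cmp C (Idn C y) f = f"
 using C by (auto simp: category_def hom_def)

lemma Cmp_assoc: "f:hom C x y ==> g:hom C y z ==> h:hom C z w ==>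
  Cmp C h (Cmp C g f) = Cmp C (Cmp C h g) f"
 using C by (simp add: category_def hom_def)

end

section \<open>Opposite and product categories\<close>

lemma op_simps [simp]:
 "Obj (op_cat C) = Obj C" "Mor (op_cat C) = Mor C" "Src (op_cat C) = Tgt C" "Tgt (op_cat C) = Src C"
 "Idn (op_cat C) = Idn C" "Cmp (op_cat C) g f = Cmp C f g" "hom (op_cat C) x y = hom C y x"
 by (auto simp: op_cat_def hom_def)

lemma prod_simps [simp]:
 "Obj (C \<times>\<^sub>c D) = Obj C \<times> Obj D" "Mor (C \<times>\<^sub>c D) = Mor C \<times> Mor D"
 "Src (C \<times>\<^sub>c D) (f, g) = (Src C f, Src D g)" "Tgt (C \<times>\<^sub>c D) (f, g) = (Tgt C f, Tgt D g)"
 "Idn (C \<times>\<^sub>c D) (x, y) = (Idn C x, Idn D y)"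
 "Cmp (C \<times>\<^sub>c D) (f', g') (f, g) = (Cmp C f' f, Cmp D g' g)"
 "(f, g):hom (C \<times>\<^sub>c D) (x, y) (x', y') \<longleftrightarrow> f:hom C x x' & g:hom D y y'"
 by (auto simp: prod_cat_def hom_def)

lemma category_op: "category C ==> category (op_cat C)"
 by (rule categoryI)
  (auto intro: Idn_hom Cmp_hom hom_obj1 hom_obj2 Mor_hom simp: Cmp_idl Cmp_idr,
  simp add: Cmp_assoc)

lemma category_prod: "category C ==> category D ==> category (C \<times>\<^sub>c D)"
 by (rule categoryI; clarsimp simp: Cmp_idl Cmp_idr Cmp_assoc)
  (auto intro: Idn_hom Cmp_hom hom_obj1 hom_obj2 Mor_hom simp: Cmp_idl Cmp_idr Cmp_assoc)

section \<open>Functors, natural transformations and functor categories\<close>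

lemma functorI:
 assumes "category C"
  and "!!x. x:Obj C ==> oF x:Obj D"
  and "!!x y f. f:hom C x y ==> mF f:hom D (oF x) (oF y)"
  and "!!x. x:Obj C ==> mF (Idn C x) = Idn D (oF x)"
  and "!!x y z f g. f:hom C x y ==> g:hom C y z ==> mF (Cmp C g f) = Cmp D (mF g) (mF f)"
 shows "is_functor C D (mk_func C oF mF)"
proof -
 have 1: "Src C f:Obj C" "Tgt C f:Obj C" if "f:Mor C" for f
  using that assms(1) by (auto simp: category_def)
 have 2: "Idn C x:Mor C" if "x:Obj C" for x
  using that assms(1) by (auto simp: Idn_Mor)
 have 3: "Cmp C g f:Mor C" if "f:Mor C" "g:Mor C" "Tgt C f = Src C g" for f g
  using Cmp_hom[OF assms(1) Mor_hom[OF that(1)], of g] that(2,3) by (auto simp: hom_def)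
 have 4: "mF f:Mor D" "Src D (mF f) = oF (Src C f)" "Tgt D (mF f) = oF (Tgt C f)" if "f:Mor C" for f
  using assms(3)[OF Mor_hom[OF that]] by (auto simp: hom_def)
 have 5: "mF (Cmp C g f) = Cmp D (mF g) (mF f)" if "f:Mor C" "g:Mor C" "Tgt C f = Src C g" for f g
  using assms(5)[of f "Src C f" "Src C g" g] that by (simp add: hom_def)
 show ?thesis
  using assms(2,4) 1 2 3 4 5
  by (auto simp: is_functor_def mk_func_def)
qed

lemma functor_obj: "is_functor C D F ==> x:Obj C ==> FO F x:Obj D"
 by (auto simp: is_functor_def)

lemma functor_hom: "is_functor C D F ==> f:hom C x y ==> FM F f:hom D (FO F x) (FO F y)"
 by (auto simp: is_functor_def hom_def)

lemma functor_Idn: "is_functor C D F ==> x:Obj C ==> FM F (Idn C x) = Idn D (FO F x)"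
 by (auto simp: is_functor_def)

lemma functor_Cmp: "is_functor C D F ==> f:hom C x y ==> g:hom C y z ==>
  FM F (Cmp C g f) = Cmp D (FM F g) (FM F f)"
 by (auto simp: is_functor_def hom_def)

lemma mk_func_simps [simp]:
 "x:Obj C ==> FO (mk_func C oF mF) x = oF x"
 "f:Mor C ==> FM (mk_func C oF mF) f = mF f"
 by (auto simp: mk_func_def)

lemma functor_eqI:
 assumes "is_functor C D F" "is_functor C D G"
  and "!!x. x:Obj C ==> FO F x = FO G x" and "!!f. f:Mor C ==> FM F f = FM G f"
 shows "F = G"
proof -
 have "FO F = FO G" "FM F = FM G"
  using assms by (auto simp: is_functor_def intro: PiE_ext)
 then show ?thesis by simp
qed

lemma functor_comp:
 assumes "category C" "is_functor C D F" "is_functor D E G"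
 shows "is_functor C E (comp_func C G F)"
 unfolding comp_func_def
proof (rule functorI)
 fix x y z f g assume "f:hom C x y" "g:hom C y z"
 then show "FM G (FM F (Cmp C g f)) = Cmp E (FM G (FM F g)) (FM G (FM F f))"
  using assms by (simp add: functor_Cmp functor_Cmp[OF assms(3) functor_hom functor_hom])
qed (use assms in \<open>auto intro: functor_obj functor_hom simp: functor_Idn[OF assms(2)]
 functor_Idn[OF assms(3) functor_obj]\<close>)

lemma functor_id: "category C ==> is_functor C C (id_func C)"
 unfolding id_func_def by (rule functorI) auto

lemma ntransD:
 assumes "is_ntrans C D N" 
 shows "is_functor C D (NSrc N)" "is_functor C D (NTgt N)"
  "x:Obj C ==> Nc N x:hom D (FO (NSrc N) x) (FO (NTgt N) x)"
  "f:hom C x y ==> Cmp D (FM (NTgt N) f) (Nc N x) = Cmp D (Nc N y) (FM (NSrc N) f)"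
 using assms by (auto simp: is_ntrans_def hom_def)

lemma ntransI:
 assumes "is_functor C D (NSrc N)" "is_functor C D (NTgt N)" "Nc N:extensional (Obj C)"
  "!!x. x:Obj C ==> Nc N x:hom D (FO (NSrc N) x) (FO (NTgt N) x)"
  "!!f x y. f:hom C x y ==> Cmp D (FM (NTgt N) f) (Nc N x) = Cmp D (Nc N y) (FM (NSrc N) f)"
 shows "is_ntrans C D N"
 using assms(1-4) assms(5)[OF Mor_hom] by (auto simp: is_ntrans_def)

lemma ntrans_eqI:
 assumes "is_ntrans C D N" "is_ntrans C D M" "NSrc N = NSrc M" "NTgt N = NTgt M"
  and "!!x. x:Obj C ==> Nc N x = Nc M x"
 shows "N = M"
proof -
 have "Nc N = Nc M"
  using assms by (auto simp: is_ntrans_def intro: extensionalityI)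
 then show ?thesis using assms by simp
qed

lemma functor_cat_simps [simp]:
 "F:Obj (functor_cat C D) \<longleftrightarrow> is_functor C D F"
 "N:Mor (functor_cat C D) \<longleftrightarrow> is_ntrans C D N"
 "Src (functor_cat C D) = NSrc" "Tgt (functor_cat C D) = NTgt"
 "NSrc (Idn (functor_cat C D) F) = F" "NTgt (Idn (functor_cat C D) F) = F"
 "x:Obj C ==> Nc (Idn (functor_cat C D) F) x = Idn D (FO F x)"
 "NSrc (Cmp (functor_cat C D) N M) = NSrc M" "NTgt (Cmp (functor_cat C D) N M) = NTgt N"
 "x:Obj C ==> Nc (Cmp (functor_cat C D) N M) x = Cmp D (Nc N x) (Nc M x)"
 by (auto simp: functor_cat_def)

lemma hom_functor_cat: "N:hom (functor_cat C D) F G \<longleftrightarrow> is_ntrans C D N & NSrc N = F & NTgt N = G"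
 by (auto simp: hom_def)

lemma category_functor_cat:
 assumes C: "category C" and D: "category D"
 shows "category (functor_cat C D)"
proof (rule categoryI)
 fix F assume "F:Obj (functor_cat C D)"
 then have F: "is_functor C D F" by simp
 have "is_ntrans C D (Idn (functor_cat C D) F)"
 proof (rule ntransI)
  show "Nc (Idn (functor_cat C D) F):extensional (Obj C)" by (simp add: functor_cat_def)
  fix f x y assume f: "f:hom C x y"
  then have "x:Obj C" "y:Obj C" using C by (auto intro: hom_obj1 hom_obj2)
  then show "Cmp D (FM (NTgt (Idn (functor_cat C D) F)) f) (Nc (Idn (functor_cat C D) F) x) =
  Cmp D (Nc (Idn (functor_cat C D) F) y) (FM (NSrc (Idn (functor_cat C D) F)) f)"
  using functor_hom[OF F f] D by (simp add: Cmp_idl Cmp_idr)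
 qed (use F D in \<open>auto intro: Idn_hom functor_obj\<close>)
 then show "Idn (functor_cat C D) F:hom (functor_cat C D) F F"
  by (simp add: hom_functor_cat)
next
 fix F G H M N assume MN: "M:hom (functor_cat C D) F G" "N:hom (functor_cat C D) G H"
 then have M: "is_ntrans C D M" and N: "is_ntrans C D N" and [simp]: "NSrc M = F" "NTgt M = G" "NSrc N = G" "NTgt N = H"
  by (auto simp: hom_functor_cat)
 have *: "is_functor C D F" "is_functor C D G" "is_functor C D H"
  using ntransD(1,2)[OF M] ntransD(1,2)[OF N] by auto
 have "is_ntrans C D (Cmp (functor_cat C D) N M)"
 proof (rule ntransI)
  show "Nc (Cmp (functor_cat C D) N M):extensional (Obj C)" by (simp add: functor_cat_def)
  fix f x y assume f: "f:hom C x y"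
  then have xy: "x:Obj C" "y:Obj C" using C by (auto intro: hom_obj1 hom_obj2)
  note [simp] = *[THEN functor_hom, OF f]
  note Ms = ntransD(3)[OF M] ntransD(4)[OF M f] and Ns = ntransD(3)[OF N] ntransD(4)[OF N f]
  show "Cmp D (FM (NTgt (Cmp (functor_cat C D) N M)) f) (Nc (Cmp (functor_cat C D) N M) x) =
  Cmp D (Nc (Cmp (functor_cat C D) N M) y) (FM (NSrc (Cmp (functor_cat C D) N M)) f)"
  using xy Ms(2) Ns(2) 
  Cmp_assoc[OF D, of "Nc M x" "FO F x" "FO G x" "Nc N x" "FO H x" "FM H f" "FO H y"]
  Cmp_assoc[OF D, of "Nc M x" "FO F x" "FO G x" "FM G f" "FO G y" "Nc N y" "FO H y"]
  Ms(1)[OF xy(1)] Ns(1)[OF xy(1)]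
  Cmp_assoc[OF D, of "FM F f" "FO F x" "FO F y" "Nc M y" "FO G y" "Nc N y" "FO H y"]
  Ms(1)[OF xy(2)] Ns(1)[OF xy(2)]
  by simp
 qed (use * ntransD(3)[OF M] ntransD(3)[OF N] in \<open>auto intro!: Cmp_hom[OF D]\<close>)
 then show "Cmp (functor_cat C D) N M:hom (functor_cat C D) F H"
  by (simp add: hom_functor_cat)
next
 fix F G N assume "N:hom (functor_cat C D) F G"
 then have N: "is_ntrans C D N" and [simp]: "NSrc N = F" "NTgt N = G"
  by (auto simp: hom_functor_cat)
 have e: "Nc N:extensional (Obj C)" using N by (auto simp: is_ntrans_def)
 show "Cmp (functor_cat C D) N (Idn (functor_cat C D) F) = N" 
  using ntransD(3)[OF N] e
  by (auto intro!: ntrans.equality extensionalityI[where A="Obj C"] Cmp_idr[OF D] simp: functor_cat_def)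
 show "Cmp (functor_cat C D) (Idn (functor_cat C D) G) N = N" 
  using ntransD(3)[OF N] e
  by (auto intro!: ntrans.equality extensionalityI[where A="Obj C"] Cmp_idl[OF D] simp: functor_cat_def)
next
 fix F G H K L M N assume "L:hom (functor_cat C D) F G" "M:hom (functor_cat C D) G H"
  "N:hom (functor_cat C D) H K"
 then have *: "is_ntrans C D L" "is_ntrans C D M" "is_ntrans C D N" "NSrc L = F" "NTgt L = G"
  "NSrc M = G" "NTgt M = H" "NSrc N = H" "NTgt N = K"
  by (auto simp: hom_functor_cat)
 show "Cmp (functor_cat C D) N (Cmp (functor_cat C D) M L) = Cmp (functor_cat C D) (Cmp (functor_cat C D) N M) L"
 proof (rule ntrans.equality)
  show "Nc (Cmp (functor_cat C D) N (Cmp (functor_cat C D) M L)) = Nc (Cmp (functor_cat C D) (Cmp (functor_cat C D) N M) L)"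
  proof (rule extensionalityI[where A = "Obj C"])
  fix x assume "x:Obj C"
  then show "Nc (Cmp (functor_cat C D) N (Cmp (functor_cat C D) M L)) x = Nc (Cmp (functor_cat C D) (Cmp (functor_cat C D) N M) L) x"
  using Cmp_assoc[OF D *(1-3)[THEN ntransD(3), of x, unfolded *(4-)]] by simp
  qed (simp_all add: functor_cat_def)
 qed simp_all
qed (simp_all add: ntransD(1,2))

section \<open>The category of small sets\<close>

lemma sets_simps [simp]:
 "Obj sets_cat = {S. small S}"
 "Src sets_cat = SDom" "Tgt sets_cat = SCod" "Idn sets_cat S = smap S (%x. x) S"
 "Cmp sets_cat g f = smap (SDom f) (%x. SFun g (SFun f x)) (SCod g)"
 "m:hom sets_cat S T \<longleftrightarrow> small S & small T & SDom m = S & SCod m = T & SFun m:S \<rightarrow>\<^sub>E T"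
 by (auto simp: sets_cat_def hom_def)

lemma smap_simps [simp]: "SDom (smap S f T) = S" "SCod (smap S f T) = T" "x:S ==> SFun (smap S f T) x = f x"
 by (auto simp: smap_def)

lemma smap_eqI:
 fixes m n :: "'x setmap"
 shows "SDom m = SDom n ==> SCod m = SCod n ==> SFun m:extensional (SDom m) ==> SFun n:extensional (SDom n) ==>
  (!!x. x:SDom m ==> SFun m x = SFun n x) ==> m = n"
 by (cases m; cases n) (auto intro: extensionalityI)

lemma smap_ext [simp]: "SFun (smap S f T):extensional S"
 by (simp add: smap_def)

lemma smap_hom: "small S ==> small T ==> (!!x. x:S ==> f x:T) ==> smap S f T:hom sets_cat S T"
 by (simp add: smap_def)

lemma hom_sets_eqI:
 "m:hom sets_cat S T ==> n:hom sets_cat S T ==> (!!x. x:S ==> SFun m x = SFun n x) ==> m = n"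
 by (rule smap_eqI) (simp_all add: PiE_def)

lemma hom_setsD: "m:hom sets_cat S T ==> small S & small T & SDom m = S & SCod m = T & (ALL x:S. SFun m x:T)"
 by (auto simp: PiE_mem)

lemma category_sets: "category (sets_cat :: ('u::universe set, 'u setmap) cat)"
proof (rule categoryI)
 fix f assume "f:Mor (sets_cat :: ('u set, 'u setmap) cat)"
 then show "Src sets_cat f:Obj sets_cat & Tgt sets_cat f:Obj sets_cat"
  by (simp add: sets_cat_def)
next
 fix x assume "x:Obj (sets_cat :: ('u set, 'u setmap) cat)"
 then show "Idn sets_cat x:hom sets_cat x x"
  by (simp add: smap_hom del: sets_simps(6))
next
 fix x y z :: "'u set" and f g
 assume fg: "f:hom sets_cat x y" "g:hom sets_cat y z"
 show "Cmp sets_cat g f:hom sets_cat x z"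
  using hom_setsD[OF fg(1)] hom_setsD[OF fg(2)] by (auto simp: smap_hom simp del: sets_simps(6))
next
 fix x y :: "'u set" and f
 assume f: "f:hom sets_cat x y"
 show "Cmp sets_cat f (Idn sets_cat x) = f" "Cmp sets_cat (Idn sets_cat y) f = f"
  using hom_setsD[OF f]
  by (auto intro!: hom_sets_eqI[OF _ f] smap_hom simp del: sets_simps(6))
next
 fix x y z w :: "'u set" and f g h
 assume fgh: "f:hom sets_cat x y" "g:hom sets_cat y z" "h:hom sets_cat z w"
 show "Cmp sets_cat h (Cmp sets_cat g f) = Cmp sets_cat (Cmp sets_cat h g) f"
  using fgh[THEN hom_setsD]
  by (auto intro!: hom_sets_eqI[of _ x w] smap_hom simp del: sets_simps(6))
qed


section \<open>Small sets\<close>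

text \<open>A set in any type is small if a small set of codes covers it.\<close>

definition covered :: "'u::universe itself => 'x set => bool" where
 "covered _ X \<longleftrightarrow> (EX S (f :: 'u => 'x). small S & X \<subseteq> f ` S)"

lemma covered_small [simp]: "covered TYPE('u::universe) (X :: 'u set) \<longleftrightarrow> small X"
proof
 assume "small X"
 then show "covered TYPE('u) X"
  unfolding covered_def by (intro exI[of _ X] exI[of _ id]) simp
qed (auto simp: covered_def intro: small_subset small_image)

lemma covered_subset: "covered T X ==> Y \<subseteq> X ==> covered T Y"
 unfolding covered_def by (meson subset_trans)

lemma covered_image:
 fixes g :: "'x => 'y"
 assumes "covered TYPE('u::universe) X"
 shows "covered TYPE('u) (g ` X)"
proof -
 obtain S and f :: "'u => 'x" where "small S" "X \<subseteq> f ` S" using assms by (auto simp: covered_def)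
 then show ?thesis
  unfolding covered_def by (intro exI[of _ S] exI[of _ "g \<circ> f"]) auto
qed

text \<open>Small unions of small sets are small, and this is applied to codes: a code of
  \<open>(x, y)\<close> is the pair of a code of \<open>x\<close> and a code of \<open>y\<close> in
  a cover chosen for the fibre over \<open>x\<close>.\<close>

lemma covered_Sigma:
 assumes "covered TYPE('u::universe) X" "!!x. x:X ==> covered TYPE('u) (Y x)"
 shows "covered TYPE('u) (Sigma X Y)"
proof -
 obtain S and f :: "'u => 'a" where S: "small S" "X \<subseteq> f ` S"
  using assms(1) by (auto simp: covered_def)
 have "ALL x:X. EX T (g :: 'u => 'b). small T & Y x \<subseteq> g ` T"
  using assms(2) by (auto simp: covered_def)
 then obtain T :: "'a => 'u set" and g :: "'a => 'u => 'b" where T: "x:X ==> small (T x)" "x:X ==> Y x \<subseteq> g x ` T x" for x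
  by metis
 \<comment> \<open>Covers of fibres are chosen only for members of \<open>X\<close>, so codes
   \<open>s\<close> with \<open>f s\<close> outside \<open>X\<close> are dropped before the union is
   formed.\<close>
 let ?S = "{s:S. f s:X}"
 let ?U = "\<Union>s\<in>?S. (%t. enc (s, t) :: 'u) ` T (f s)"
 have "small ?U"
  by (rule small_UN) (auto intro: small_subset[OF S(1)] small_image T)
 moreover have "Sigma X Y \<subseteq> (%z. let (s, t) = dec z in (f s, g (f s) t)) ` ?U"
 proof
  fix z assume "z:Sigma X Y"
  then obtain x y where z: "z = (x, y)" "x:X" "y:Y x" by auto
  moreover obtain s where "s:S" "x = f s" using z S(2) by auto
  moreover obtain t where "t:T x" "y = g x t" using z T(2)[of x] by auto
  ultimately have "s:?S" "x = f s" "t:T (f s)" "y = g (f s) t"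
  by auto
  then show "z:(%z. let (s, t) = dec z in (f s, g (f s) t)) ` ?U"
  using z by (intro image_eqI[of _ _ "enc (s, t)"]) (auto simp: dec_enc[OF inj_enc(2)])
 qed
 ultimately show ?thesis
  unfolding covered_def by blast
qed

lemma covered_UN:
 assumes "covered TYPE('u::universe) X" "!!x. x:X ==> covered TYPE('u) (Y x)"
 shows "covered TYPE('u) (\<Union>x\<in>X. Y x)"
 using covered_image[OF covered_Sigma[OF assms], where g = snd] by (simp add: snd_image_Sigma)

text \<open>An infinite small set contains an injective copy of the natural numbers, and the inverse
  of that injection is a covering. Here the smallness of some infinite set enters.\<close>

lemma covered_nat: "covered TYPE('u::universe) (UNIV :: nat set)"
proof -
 obtain S :: "'u set" where S: "infinite S" "small S" using infinite_small by blast
 then obtain i :: "nat => 'u" where i: "inj i" "range i \<subseteq> S"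
  using infinite_countable_subset by blast
 then show ?thesis
  unfolding covered_def using S(2)
  by (intro exI[of _ S] exI[of _ "inv i"]) (auto, metis image_eqI inv_f_f rangeI subsetD)
qed

text \<open>Lists of a fixed length are covered by induction through products; the union over all
  lengths is covered because the set of lengths is.\<close>

lemma covered_lists:
 assumes "covered TYPE('u::universe) X"
 shows "covered TYPE('u) (lists X)"
proof -
 have "covered TYPE('u) {xs:lists X. length xs = n}" for n
 proof (induction n)
  case 0
  have "covered TYPE('u) {0::nat}" by (rule covered_subset[OF covered_nat]) auto
  from covered_image[OF this, where g = "%_. []"] show ?case by (rule covered_subset) auto
 next
  case (Suc n)
  from covered_image[OF covered_Sigma[OF assms this], where g = "%(x, xs). x # xs"] show ?case
  by (rule covered_subset) (force simp: length_Suc_conv)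
 qed
 then have "covered TYPE('u) (\<Union>n. {xs:lists X. length xs = n})"
  by (intro covered_UN covered_nat)
 then show ?thesis by (rule covered_subset) auto
qed


section \<open>Coends of sets\<close>

text \<open>A class is named by an element chosen among those related to the given one. Related
  elements have the same set of relatives, so the choice falls on the same element.\<close>

lemma coend_in_slide:
 assumes "k:hom C x y" "z:FO P (y, x)"
 shows "coend_in C P x (SFun (FM P (k, Idn C x)) z) = coend_in C P y (SFun (FM P (Idn C y, k)) z)"
proof -
 let ?E = "(coend_rel C P \<union> (coend_rel C P)\<inverse>)\<^sup>*"
 have "sym ?E" by (intro sym_rtrancl) (auto simp: sym_def)
 moreover have "((x, SFun (FM P (k, Idn C x)) z), (y, SFun (FM P (Idn C y, k)) z)):coend_rel C P"
  using assms by (auto simp: coend_rel_def hom_def)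
 ultimately have *: "((x, SFun (FM P (k, Idn C x)) z), (y, SFun (FM P (Idn C y, k)) z)):?E"
  "((y, SFun (FM P (Idn C y, k)) z), (x, SFun (FM P (k, Idn C x)) z)):?E"
  by (auto dest: symD)
 have "((x, SFun (FM P (k, Idn C x)) z), w):?E \<longleftrightarrow> ((y, SFun (FM P (Idn C y, k)) z), w):?E" for w
  using rtrancl_trans[OF *(1)] rtrancl_trans[OF *(2)] by blast
 then show ?thesis
  by (simp only: coend_in_def)
qed

text \<open>The hypothesis on \<open>h\<close> is compatibility with the generating relation, hence
  with the equivalence it generates. As \<open>enc\<close> is injective, equal classes have the same
  chosen member and are therefore related; this makes the description in \<open>coend_desc\<close>
  unique.\<close>

lemma coend_desc_in:
 assumes inj: "inj (enc :: 'o \<times> 'x => 'u::universe)"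
  and h: "!!x y k z. k:hom C x y ==> z:FO P (y, x) ==>
  h x (SFun (FM P (k, Idn C x)) z) = h y (SFun (FM P (Idn C y, k)) z)"
  and c: "c:Obj C" "x:FO P (c, c)"
 shows "coend_desc C P h (coend_in C P (c :: 'o) (x :: 'x) :: 'u) = h c x"
proof -
 let ?E = "(coend_rel C P \<union> (coend_rel C P)\<inverse>)\<^sup>*"
 have sym: "sym ?E" by (intro sym_rtrancl) (auto simp: sym_def)
 have rel: "case_prod h p = case_prod h q" if "(p, q):?E" for p q
  using that
 proof (induction rule: rtrancl_induct)
  case (step q r)
  then have "(q, r):coend_rel C P \<or> (r, q):coend_rel C P" by auto
  then have "case_prod h q = case_prod h r"
  by (auto simp: coend_rel_def dest!: h[OF Mor_hom])
  with step show ?case by simp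
 qed simp
 show ?thesis
  unfolding coend_desc_def
 proof (rule the_equality)
  fix z assume "EX c' x'. c':Obj C & x':FO P (c', c') & (coend_in C P c x :: 'u) = coend_in C P c' x' & z = h c' x'"
  then obtain c' x' where *: "(coend_in C P c x :: 'u) = coend_in C P c' x'" "z = h c' x'" by auto
  have 1: "(SOME w. ((c, x), w):?E) = (SOME w. ((c', x'), w):?E)"
  using *(1) injD[OF inj] unfolding coend_in_def by blast
  \<comment> \<open>Reflexivity shows that there is something to choose from, so every element is
    related to its own representative.\<close>
  have 2: "((d, y), SOME w. ((d, y), w):?E):?E" for d y
  by (rule someI[where P = "%w. ((d, y), w):?E" and x = "(d, y)"]) simp
  have "case_prod h (c, x) = case_prod h (c', x')"
  using rel[OF 2, of c x] rel[OF 2, of c' x'] 1 by simp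
  then have "h c x = h c' x'" by simp
  then show "z = h c x" using * by simp
 qed (use c in auto)
qed

lemma coend_in_mem: "c:Obj C ==> x:FO P (c, c) ==> coend_in C P c x:coend C P"
 by (auto simp: coend_def)

lemma coend_small:
 assumes "covered TYPE('u::universe) (Obj C)" "!!c. c:Obj C ==> covered TYPE('u) (FO P (c, c))"
 shows "small (coend C P :: 'u set)"
proof -
 let ?S = "(%(c, x). coend_in C P c x :: 'u) ` (SIGMA c : Obj C. FO P (c, c))"
 have "small ?S"
  unfolding covered_small[symmetric]
  by (intro covered_image covered_Sigma assms)
 moreover have "coend C P \<subseteq> ?S"
  unfolding coend_def by blast
 ultimately show ?thesis by (rule small_subset)
qed

lemma bifun_simps [simp]:
 "c:Obj C ==> c':Obj C ==> FO (mk_bifun C S a) (c', c) = S c' c"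
 "k:hom C x y ==> l:hom C z w ==> v:S y z ==> SFun (FM (mk_bifun C S a) (k, l)) v = a k l v"
 by (auto simp: mk_bifun_def hom_def)

lemma coend_bifun_slide:
 assumes "category C" "k:hom C x y" "z:S y x"
 shows "coend_in C (mk_bifun C S a) x (a k (Idn C x) z) = coend_in C (mk_bifun C S a) y (a (Idn C y) k z)"
 using coend_in_slide[OF assms(2), of z "mk_bifun C S a"] assms
  Idn_hom[OF assms(1) hom_obj1[OF assms(1,2)]] Idn_hom[OF assms(1) hom_obj2[OF assms(1,2)]]
 by (simp add: hom_objs[OF assms(1,2)])

lemma coend_bifun_desc:
 assumes "inj (enc :: 'o \<times> 'x => 'u::universe)" and C: "category C"
  and "!!x y k z. k:hom C x y ==> z:S y x ==> h x (a k (Idn C x) z) = h y (a (Idn C y) k z)"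
  and "c:Obj C" "x:S c c"
 shows "coend_desc C (mk_bifun C S a) h (coend_in C (mk_bifun C S a) (c :: 'o) (x :: 'x) :: 'u) = h c x"
proof (rule coend_desc_in[OF assms(1)])
 fix x y k z assume k: "k:hom C x y" and z: "z:FO (mk_bifun C S a) (y, x)"
 have o: "x:Obj C" "y:Obj C" using k C by (auto intro: hom_obj1 hom_obj2)
 have "z:S y x" using z o by simp
 then show "h x (SFun (FM (mk_bifun C S a) (k, Idn C x)) z) = h y (SFun (FM (mk_bifun C S a) (Idn C y, k)) z)"
  using assms(3)[OF k] k Idn_hom[OF C o(1)] Idn_hom[OF C o(2)] by simp
qed (use assms in auto)

section \<open>Free monoidal categories\<close>

abbreviation "QQ Q == op_cat Q \<times>\<^sub>c Q"
abbreviation "fob B == Obj (free_cat B)"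
abbreviation "fhom B == hom (free_cat B)"
abbreviation "fid B == Idn (free_cat B)"
abbreviation "fcmp B == Cmp (free_cat B)"

lemma free_simps [simp]:
 "[]:fob B" "x # b:fob B \<longleftrightarrow> x:Obj B & b:fob B" "a @ b:fob B \<longleftrightarrow> a:fob B & b:fob B"
 "fid B [] = []" "fid B (x # b) = Idn B x # fid B b" "fid B (a @ b) = fid B a @ fid B b"
 "fcmp B [] g = []" "fcmp B (k # f) (l # g) = Cmp B k l # fcmp B f g"
 "f:fhom B [] b \<longleftrightarrow> f = [] & b = []" "f:fhom B b [] \<longleftrightarrow> f = [] & b = []"
 "[]:fhom B a b \<longleftrightarrow> a = [] & b = []"
 "k # f:fhom B (x # a) (y # b) \<longleftrightarrow> k:hom B x y & f:fhom B a b"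
 "Src (free_cat B) f = map (Src B) f" "Tgt (free_cat B) f = map (Tgt B) f"
 by (auto simp: free_cat_def hom_def)

lemma fhom_Cons_left: "f:fhom B (x # a) b ==> EX k f' y b'. f = k # f' & b = y # b' & k:hom B x y & f':fhom B a b'"
 by (auto simp: free_cat_def hom_def)

lemma fhom_Cons_arr: "k # f:fhom B a b ==> EX x a' y b'. a = x # a' & b = y # b' & k:hom B x y & f:fhom B a' b'"
 by (auto simp: free_cat_def hom_def)

lemma fhom_length: "f:fhom B a b ==> length a = length f & length b = length f"
 by (auto simp: free_cat_def hom_def)

lemma fhom_append: "f:fhom B a b ==> g:fhom B a' b' ==> f @ g:fhom B (a @ a') (b @ b')"
 by (auto simp: free_cat_def hom_def)

text \<open>The interchange law. Since \<open>fcmp\<close> is a \<open>map2\<close>, both lists are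
  cut at the same place once the left factors have equal lengths.\<close>

lemma fcmp_append:
 assumes "f:fhom B a b" "g:fhom B b c"
 shows "fcmp B (g @ g') (f @ f') = fcmp B g f @ fcmp B g' f'"
 using fhom_length[OF assms(1)] fhom_length[OF assms(2)] by (auto simp: free_cat_def)

lemma category_free:
 assumes "category B"
 shows "category (free_cat B)"
proof (rule categoryI)
 show "Src (free_cat B) f:fob B & Tgt (free_cat B) f:fob B" if "f:Mor (free_cat B)" for f
  using that assms by (auto simp: free_cat_def category_def)
 show "fid B x:fhom B x x" if "x:fob B" for x
  using that by (induction x) (auto simp: Idn_hom[OF assms])
 show "fcmp B g f:fhom B x z" if "f:fhom B x y" "g:fhom B y z" for x y z f g
  using that
 proof (induction f arbitrary: x y z g)
  case (Cons k f)
  then obtain x1 x' y1 y' where 1: "x = x1 # x'" "y = y1 # y'" "k:hom B x1 y1" "f:fhom B x' y'"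
  using fhom_Cons_arr by meson
  moreover from this Cons obtain l g' z1 z' where 2: "g = l # g'" "z = z1 # z'" "l:hom B y1 z1" "g':fhom B y' z'"
  by (meson fhom_Cons_left)
  ultimately show ?case
  using Cons.IH[OF 1(4) 2(4)] assms by (auto intro: Cmp_hom)
 qed auto
 show "fcmp B f (fid B x) = f" if "f:fhom B x y" for x y f
  using that
 proof (induction f arbitrary: x y)
  case (Cons k f)
  then show ?case using assms by (auto dest!: fhom_Cons_arr simp: Cmp_idr)
 qed auto
 show "fcmp B (fid B y) f = f" if "f:fhom B x y" for x y f
  using that
 proof (induction f arbitrary: x y)
  case (Cons k f)
  then show ?case using assms by (auto dest!: fhom_Cons_arr simp: Cmp_idl)
 qed auto
 show "fcmp B h (fcmp B g f) = fcmp B (fcmp B h g) f" 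
  if "f:fhom B x y" "g:fhom B y z" "h:fhom B z w" for x y z w f g h
  using that
 proof (induction f arbitrary: x y z w g h)
  case (Cons k f)
  then obtain x1 x' y1 y' where 1: "x = x1 # x'" "y = y1 # y'" "k:hom B x1 y1" "f:fhom B x' y'"
  using fhom_Cons_arr by meson
  from this Cons.prems obtain l g' z1 z' where 2: "g = l # g'" "z = z1 # z'" "l:hom B y1 z1" "g':fhom B y' z'"
  by (meson fhom_Cons_left)
  from this Cons.prems obtain m h' w1 w' where 3: "h = m # h'" "w = w1 # w'" "m:hom B z1 w1" "h':fhom B z' w'"
  by (meson fhom_Cons_left)
  show ?case
  using Cons.IH[OF 1(4) 2(4) 3(4)] Cmp_assoc[OF assms 1(3) 2(3) 3(3)] by (simp add: 1 2 3)
 qed auto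
qed

lemma small_categoryD: "small_category C ==> category C"
 by (simp add: small_category_def)

lemma category_fop: "category B ==> category (op_cat (free_cat B))"
 by (intro category_op category_free)

lemma covered_free:
 assumes "small_category (B :: ('u::universe, 'u) cat)"
 shows "covered TYPE('u) (fob B)" "covered TYPE('u) (fhom B a b)"
proof -
 show "covered TYPE('u) (fob B)"
  using assms by (simp add: free_cat_def covered_lists small_category_def)
 have "covered TYPE('u) (lists (Mor B))"
  using assms by (simp add: covered_lists small_category_def)
 then show "covered TYPE('u) (fhom B a b)"
  by (rule covered_subset) (auto simp: hom_def free_cat_def)
qed


section \<open>Presheaves\<close>

abbreviation "psh B U == U:Obj (psh_cat B)"
abbreviation "phom B == hom (psh_cat B)"

text \<open>Membership in \<open>sel B U b\<close> and \<open>pel C B P x b\<close> carries the membership of the indices.\<close>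

definition sel :: "('u, 'u) cat => 'u psh => 'u list => 'u set" where
 "sel B U b = {e. b:fob B & e:FO U b}"

lemma selD: "e:sel B U b ==> b:fob B" "e:sel B U b ==> e:FO U b"
 by (auto simp: sel_def)

lemma psh_iff: "psh B U \<longleftrightarrow> is_functor (op_cat (free_cat B)) sets_cat U"
 by (simp add: psh_cat_def)

lemma psh_small: "psh B U ==> b:fob B ==> small (FO U b)"
 using functor_obj[of "op_cat (free_cat B)" sets_cat U b] by (simp add: psh_iff)

lemma category_psh: "category B ==> category (psh_cat B)"
 unfolding psh_cat_def by (intro category_functor_cat category_fop category_sets)

lemma mk_psh_simps:
 "b:fob B ==> FO (mk_psh B S a) b = S b"
 "be:fhom B b' b ==> e:S b ==> act (mk_psh B S a) be e = a be e"
 using hom_Mor[of be "free_cat B"] hom_Src[of be "free_cat B"] hom_Tgt[of be "free_cat B"]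
 by (simp_all add: mk_psh_def act_def del: free_simps)

lemma phom_Src: "N:phom B U V ==> NSrc N = U" and phom_Tgt: "N:phom B U V ==> NTgt N = V"
 by (auto simp: psh_cat_def hom_functor_cat)

lemma app_mk_pmap: "e:sel B U b ==> app (mk_pmap B U V ph) b e = ph b e"
 by (simp add: app_def mk_pmap_def sel_def)

lemma app_id: "e:sel B U b ==> app (Idn (psh_cat B) U) b e = e"
 by (simp add: app_def psh_cat_def sel_def)

context
 fixes B :: "('u::universe, 'u) cat"
 assumes B: "category B"
begin

lemma act_mem:
 assumes "psh B U" "e:sel B U b" "be:fhom B b' b"
 shows "act U be e:sel B U b'"
proof -
 have "FM U be:hom sets_cat (FO U b) (FO U b')"
  using functor_hom[of "op_cat (free_cat B)" sets_cat U be b b'] assms by (simp add: psh_iff)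
 from hom_setsD[OF this] show ?thesis
  using assms hom_obj1[OF category_free[OF B] assms(3)] by (auto simp: act_def sel_def)
qed

lemma act_id:
 assumes "psh B U" "e:sel B U b"
 shows "act U (fid B b) e = e"
 using functor_Idn[of "op_cat (free_cat B)" sets_cat U b] assms by (simp add: psh_iff act_def sel_def)

lemma act_cmp:
 assumes "psh B U" "e:sel B U b" "be:fhom B b' b" "be':fhom B b'' b'"
 shows "act U be' (act U be e) = act U (fcmp B be be') e"
proof -
 have *: "FM U be:hom sets_cat (FO U b) (FO U b')"
  using functor_hom[of "op_cat (free_cat B)" sets_cat U be b b'] assms by (simp add: psh_iff)
 show ?thesis
  using functor_Cmp[of "op_cat (free_cat B)" sets_cat U be b b' be' b''] assms hom_setsD[OF *]
  by (simp add: psh_iff act_def sel_def)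
qed

text \<open>Later presheaves are given by elements and an action. The passage to a functor into
  \<open>sets_cat\<close>, with its extensional functions, is made here once.\<close>

lemma mk_pshI:
 assumes "!!b. b:fob B ==> small (S b)"
  and m: "!!b b' be e. be:fhom B b' b ==> e:S b ==> a be e:S b'"
  and "!!b e. b:fob B ==> e:S b ==> a (fid B b) e = e"
  and "!!b b' b'' be be' e. be:fhom B b' b ==> be':fhom B b'' b' ==> e:S b ==> a be' (a be e) = a (fcmp B be be') e"
 shows "psh B (mk_psh B S a)"
proof -
 let ?C = "op_cat (free_cat B)"
 let ?m = "%be. smap (S (Tgt (free_cat B) be)) (a be) (S (Src (free_cat B) be))"
 have 1: "mk_psh B S a = mk_func ?C S ?m"
  by (simp add: mk_psh_def mk_func_def)
 have m': "?m be = smap (S b) (a be) (S b')" if "be:fhom B b' b" for be b b'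
  using that by (auto simp del: free_simps dest: hom_Src hom_Tgt)
 have mh: "?m be:hom sets_cat (S b) (S b')" if "be:fhom B b' b" for be b b'
  unfolding m'[OF that] using that
  by (intro smap_hom assms(1) m) (auto intro: hom_obj1 hom_obj2 category_free[OF B])
 have "is_functor ?C sets_cat (mk_func ?C S ?m)"
 proof (rule functorI[OF category_fop[OF B]])
  fix b assume b: "b:Obj ?C"
  then have i: "fid B b:fhom B b b" by (simp add: Idn_hom category_free B)
  show "?m (Idn ?C b) = Idn sets_cat (S b)"
  using mh[OF i] assms(1,3) b smap_hom[of "S b" "S b"]
  by (intro hom_sets_eqI[of _ "S b" "S b"]) (simp_all add: m'[OF i] del: free_simps sets_simps(6))
 next
  fix x y z f g assume fg: "f:hom ?C x y" "g:hom ?C y z"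
  then have fg': "f:fhom B y x" "g:fhom B z y" by simp_all
  then have c: "fcmp B f g:fhom B z x" by (intro Cmp_hom category_free B)
  show "?m (Cmp ?C g f) = Cmp sets_cat (?m g) (?m f)"
  proof (rule hom_sets_eqI)
  show "?m (Cmp ?C g f):hom sets_cat (S x) (S z)"
  using mh[OF c] by (simp del: free_simps sets_simps(6))
  show "Cmp sets_cat (?m g) (?m f):hom sets_cat (S x) (S z)"
  by (rule Cmp_hom[OF category_sets mh[OF fg'(1)] mh[OF fg'(2)]])
  fix e assume e: "e:S x"
  show "SFun (?m (Cmp ?C g f)) e = SFun (Cmp sets_cat (?m g) (?m f)) e"
  using assms(4)[OF fg' e] m[OF fg'(1) e] e
  by (simp add: m'[OF c] m'[OF fg'(1)] m'[OF fg'(2)] del: free_simps)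
  qed
 qed (use assms(1) mh in \<open>simp_all del: free_simps sets_simps(6)\<close>)
 then show ?thesis by (simp add: psh_iff 1)
qed

lemma app_mem:
 assumes "N:phom B U V" "e:sel B U b"
 shows "app N b e:sel B V b"
proof -
 have "is_ntrans (op_cat (free_cat B)) sets_cat N" "NSrc N = U" "NTgt N = V"
  using assms(1) by (auto simp: psh_cat_def hom_functor_cat)
 from ntransD(3)[OF this(1), of b] this have "Nc N b:hom sets_cat (FO U b) (FO V b)"
  using assms(2) by (simp add: sel_def)
 from hom_setsD[OF this] assms(2) show ?thesis
  by (auto simp: app_def sel_def)
qed

lemma phom_psh: "N:phom B U V ==> psh B U" "N:phom B U V ==> psh B V"
 by (auto intro: hom_obj1 hom_obj2 category_psh[OF B])

lemma app_act:
 assumes "N:phom B U V" "e:sel B U b" "be:fhom B b' b"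
 shows "app N b' (act U be e) = act V be (app N b e)"
proof -
 have N: "is_ntrans (op_cat (free_cat B)) sets_cat N" "NSrc N = U" "NTgt N = V"
  using assms(1) by (auto simp: psh_cat_def hom_functor_cat)
 have b': "b':fob B" using assms(3) by (rule hom_obj1[OF category_free[OF B]])
 have "Nc N b:hom sets_cat (FO U b) (FO V b)" "Nc N b':hom sets_cat (FO U b') (FO V b')"
  using ntransD(3)[OF N(1), of b] ntransD(3)[OF N(1), of b'] assms(2) N b' by (simp_all add: sel_def)
 note 1 = this[THEN hom_setsD]
 have "FM U be:hom sets_cat (FO U b) (FO U b')" "FM V be:hom sets_cat (FO V b) (FO V b')"
  using ntransD(1,2)[OF N(1)] functor_hom[of "op_cat (free_cat B)" sets_cat _ be b b'] assms N by simp_all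
 note 2 = this[THEN hom_setsD]
 have e: "e:FO U b" using assms(2) by (simp add: sel_def)
 have "Cmp sets_cat (FM V be) (Nc N b) = Cmp sets_cat (Nc N b') (FM U be)"
  using ntransD(4)[OF N(1), of be b b'] N assms(3) by simp
 then have "SFun (Cmp sets_cat (FM V be) (Nc N b)) e = SFun (Cmp sets_cat (Nc N b') (FM U be)) e" by simp
 then show ?thesis
  using e 1 2 by (simp add: app_def act_def)
qed

lemma mk_pmap_hom:
 assumes U: "psh B U" and V: "psh B V"
  and m: "!!b e. e:sel B U b ==> ph b e:sel B V b"
  and n: "!!b b' be e. e:sel B U b ==> be:fhom B b' b ==> ph b' (act U be e) = act V be (ph b e)"
 shows "mk_pmap B U V ph:phom B U V"
proof -
 let ?C = "op_cat (free_cat B)"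
 have h: "smap (FO U b) (ph b) (FO V b):hom sets_cat (FO U b) (FO V b)" if "b:fob B" for b
  using that m by (intro smap_hom psh_small[OF U] psh_small[OF V]) (auto simp: sel_def)
 have "is_ntrans ?C sets_cat (mk_pmap B U V ph)"
 proof (rule ntransI)
  fix f x y assume f: "f:hom ?C x y"
  then have f': "f:fhom B y x" by simp
  have o: "x:fob B" "y:fob B"
  using f' by (auto intro: hom_obj1 hom_obj2 category_free[OF B])
  have FM: "FM U f:hom sets_cat (FO U x) (FO U y)" "FM V f:hom sets_cat (FO V x) (FO V y)"
  using U V by (auto simp only: psh_iff intro!: functor_hom[OF _ f])
  have "Cmp sets_cat (FM V f) (smap (FO U x) (ph x) (FO V x)) = Cmp sets_cat (smap (FO U y) (ph y) (FO V y)) (FM U f)"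
  proof (rule hom_sets_eqI)
  show "Cmp sets_cat (FM V f) (smap (FO U x) (ph x) (FO V x)):hom sets_cat (FO U x) (FO V y)"
  by (rule Cmp_hom[OF category_sets h FM(2)]) (rule o)
  show "Cmp sets_cat (smap (FO U y) (ph y) (FO V y)) (FM U f):hom sets_cat (FO U x) (FO V y)"
  by (rule Cmp_hom[OF category_sets FM(1) h]) (rule o)
  fix e assume e: "e:FO U x"
  then have e': "e:sel B U x" using o by (simp add: sel_def)
  show "SFun (Cmp sets_cat (FM V f) (smap (FO U x) (ph x) (FO V x))) e = SFun (Cmp sets_cat (smap (FO U y) (ph y) (FO V y)) (FM U f)) e"
  using n[OF e' f'] act_mem[OF U e' f'] e hom_setsD[OF FM(1)] by (simp add: act_def sel_def)
  qed
  then show "Cmp sets_cat (FM (NTgt (mk_pmap B U V ph)) f) (Nc (mk_pmap B U V ph) x) =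
  Cmp sets_cat (Nc (mk_pmap B U V ph) y) (FM (NSrc (mk_pmap B U V ph)) f)"
  using o by (simp add: mk_pmap_def)
 qed (use U V h in \<open>simp_all add: psh_iff mk_pmap_def del: sets_simps(6)\<close>)
 then show ?thesis
  by (simp add: psh_cat_def hom_functor_cat mk_pmap_def)
qed

lemma phom_eqI:
 assumes N: "N:phom B U V" and M: "M:phom B U V"
  and eq: "!!b e. e:sel B U b ==> app N b e = app M b e"
 shows "N = M"
proof -
 have *: "is_ntrans (op_cat (free_cat B)) sets_cat N" "is_ntrans (op_cat (free_cat B)) sets_cat M"
  "NSrc N = U" "NSrc M = U" "NTgt N = V" "NTgt M = V"
  using N M by (auto simp: psh_cat_def hom_functor_cat)
 show ?thesis
 proof (rule ntrans_eqI[OF *(1,2)])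
  fix b assume b: "b:Obj (op_cat (free_cat B))"
  show "Nc N b = Nc M b"
  proof (rule hom_sets_eqI)
  show "Nc N b:hom sets_cat (FO U b) (FO V b)" "Nc M b:hom sets_cat (FO U b) (FO V b)"
  using ntransD(3)[OF *(1) b] ntransD(3)[OF *(2) b] * by (simp_all del: sets_simps)
  show "SFun (Nc N b) e = SFun (Nc M b) e" if "e:FO U b" for e
  using eq[of e b] that b by (simp add: app_def sel_def)
  qed
 qed (use * in simp_all)
qed

lemma phom_cmp: "M:phom B U V ==> N:phom B V W ==> Cmp (psh_cat B) N M:phom B U W"
 by (rule Cmp_hom[OF category_psh[OF B]])

lemma phom_id: "psh B U ==> Idn (psh_cat B) U:phom B U U"
 by (rule Idn_hom[OF category_psh[OF B]])

lemma app_cmp: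
 assumes "M:phom B U V" "N:phom B V W" "e:sel B U b"
 shows "app (Cmp (psh_cat B) N M) b e = app N b (app M b e)"
proof -
 have N: "is_ntrans (op_cat (free_cat B)) sets_cat M" "NSrc M = U" "NTgt M = V"
  using assms(1) by (auto simp: psh_cat_def hom_functor_cat)
 from ntransD(3)[OF this(1), of b] this have "Nc M b:hom sets_cat (FO U b) (FO V b)"
  using assms(3) by (simp add: sel_def)
 from hom_setsD[OF this] assms(3) show ?thesis
  by (simp add: app_def psh_cat_def sel_def)
qed

text \<open>Two-sided inverses in a category are unique, which is what the definite description in
  \<open>inverse_mor\<close> asks for.\<close>

lemma inverse_mor_eqI:
 assumes N: "N:phom B U V" and M: "M:phom B V U"
  and "!!b e. e:sel B U b ==> app M b (app N b e) = e"
  and "!!b e. e:sel B V b ==> app N b (app M b e) = e"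
 shows "inverse_mor (psh_cat B) N = M"
proof -
 note C = category_psh[OF B]
 note P = phom_psh[OF N]
 have 1: "Cmp (psh_cat B) M N = Idn (psh_cat B) U" "Cmp (psh_cat B) N M = Idn (psh_cat B) V"
  using assms P by (auto intro!: phom_eqI phom_cmp phom_id simp: app_cmp[OF N M] app_cmp[OF M N] app_id)
 have s: "Src (psh_cat B) N = U" "Tgt (psh_cat B) N = V"
  using N by (auto dest: hom_Src hom_Tgt)
 show ?thesis
  unfolding inverse_mor_def s
 proof (rule the_equality)
  fix G assume G: "G:phom B V U & Cmp (psh_cat B) G N = Idn (psh_cat B) U & Cmp (psh_cat B) N G = Idn (psh_cat B) V"
  then have "G = Cmp (psh_cat B) G (Cmp (psh_cat B) N M)"
  using 1 Cmp_idr[OF C, of G V U] by simp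
  also have "... = Cmp (psh_cat B) (Cmp (psh_cat B) G N) M"
  using G M N by (intro Cmp_assoc[OF C]) auto
  also have "... = M"
  using G Cmp_idl[OF C M] by simp
  finally show "G = M" .
 qed (intro conjI M 1)
qed

text \<open>The inverse chooses preimages. Injectivity makes the chosen preimage the only one, and
  naturality of the choice then follows from that of \<open>N\<close>.\<close>

lemma inverse_mor_bij:
 assumes N: "N:phom B U V"
  and inj: "!!b e e'. e:sel B U b ==> e':sel B U b ==> app N b e = app N b e' ==> e = e'"
  and surj: "!!b e. e:sel B V b ==> EX e':sel B U b. app N b e' = e"
 shows "inverse_mor (psh_cat B) N:phom B V U" (is "PROP ?Ga")
  and "e:sel B U b ==> app (inverse_mor (psh_cat B) N) b (app N b e) = e"
  and "e:sel B V b ==> app N b (app (inverse_mor (psh_cat B) N) b e) = e"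
proof -
 note P = phom_psh[OF N]
 define ph where "ph b e = (SOME e'. e':sel B U b & app N b e' = e)" for b e
 have ph: "ph b e:sel B U b & app N b (ph b e) = e" if "e:sel B V b" for b e
  unfolding ph_def by (rule someI_ex) (use surj[OF that] in blast)
 have ph2: "ph b (app N b e) = e" if "e:sel B U b" for b e
  using ph[OF app_mem[OF N that]] that inj by blast
 let ?M = "mk_pmap B V U ph"
 have M: "?M:phom B V U"
 proof (rule mk_pmap_hom[OF P(2,1)])
  fix b b' be e assume *: "e:sel B V b" "be:fhom B b' b"
  show "ph b' (act V be e) = act U be (ph b e)"
  using ph2[OF act_mem[OF P(1) _ *(2)], of "ph b e"] ph[OF *(1)] app_act[OF N _ *(2), of "ph b e"] by simp
 qed (use ph in blast)
 have 1: "app ?M b (app N b e) = e" if "e:sel B U b" for b e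
  using ph2[OF that] app_mem[OF N that] by (simp add: app_mk_pmap)
 have 2: "app N b (app ?M b e) = e" if "e:sel B V b" for b e
  using ph[OF that] that by (simp add: app_mk_pmap)
 have 3: "inverse_mor (psh_cat B) N = ?M"
  by (rule inverse_mor_eqI[OF N M 1 2])
 show "PROP ?Ga"
  "e:sel B U b ==> app (inverse_mor (psh_cat B) N) b (app N b e) = e"
  "e:sel B V b ==> app N b (app (inverse_mor (psh_cat B) N) b e) = e"
  unfolding 3 using M 1 2 by auto
qed

lemma functor_pshI:
 assumes C: "category C"
  and o: "!!x. x:Obj C ==> psh B (oF x)"
  and m: "!!x y f. f:hom C x y ==> mF f:phom B (oF x) (oF y)"
  and i: "!!x b e. x:Obj C ==> e:sel B (oF x) b ==> app (mF (Idn C x)) b e = e"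
  and c: "!!x y z f g b e. f:hom C x y ==> g:hom C y z ==> e:sel B (oF x) b ==>
  app (mF (Cmp C g f)) b e = app (mF g) b (app (mF f) b e)"
 shows "is_functor C (psh_cat B) (mk_func C oF mF)"
proof (rule functorI[OF C o m])
 fix x assume x: "x:Obj C"
 show "mF (Idn C x) = Idn (psh_cat B) (oF x)"
  by (rule phom_eqI[OF m[OF Idn_hom[OF C x]] phom_id[OF o[OF x]]]) (simp add: i[OF x] app_id)
next
 fix x y z f g assume fg: "f:hom C x y" "g:hom C y z"
 show "mF (Cmp C g f) = Cmp (psh_cat B) (mF g) (mF f)"
  by (rule phom_eqI[OF m[OF Cmp_hom[OF C fg]] phom_cmp[OF m[OF fg(1)] m[OF fg(2)]]])
  (simp add: c[OF fg] app_cmp[OF m[OF fg(1)] m[OF fg(2)]])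
qed

end

definition pel :: "('o, 'm) cat => ('u, 'u) cat => ('o, 'm, 'u psh, 'u pmap) func => 'o => 'u list => 'u set" where
 "pel C B P x b = {e. x:Obj C & e:sel B (FO P x) b}"

context
 fixes B :: "('u::universe, 'u) cat" and C :: "('o, 'm) cat" and P
 assumes B: "category B" and C: "category C" and P: "is_functor C (psh_cat B) P"
begin

lemma FM_phom: "f:hom C x y ==> FM P f:phom B (FO P x) (FO P y)"
 by (rule functor_hom[OF P])

lemma FO_psh: "x:Obj C ==> psh B (FO P x)"
 by (rule functor_obj[OF P])

lemma FM_mem: "e:pel C B P x b ==> f:hom C x y ==> app (FM P f) b e:pel C B P y b"
 using app_mem[OF B FM_phom] hom_obj2[OF C] by (auto simp: pel_def)

lemma FM_id: "e:pel C B P x b ==> app (FM P (Idn C x)) b e = e"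
 by (simp add: pel_def functor_Idn[OF P] app_id)

lemma FM_cmp: "e:pel C B P x b ==> f:hom C x y ==> g:hom C y z ==>
  app (FM P g) b (app (FM P f) b e) = app (FM P (Cmp C g f)) b e"
 by (simp add: pel_def functor_Cmp[OF P] app_cmp[OF B FM_phom FM_phom])

lemma FM_act: "e:pel C B P x b ==> f:hom C x y ==> be:fhom B b' b ==>
  app (FM P f) b' (act (FO P x) be e) = act (FO P y) be (app (FM P f) b e)"
 by (simp add: pel_def app_act[OF B FM_phom])

lemma pel_act: "e:pel C B P x b ==> be:fhom B b' b ==> act (FO P x) be e:pel C B P x b'"
 using act_mem[OF B FO_psh] by (auto simp: pel_def)

lemma pel_act_id: "e:pel C B P x b ==> act (FO P x) (fid B b) e = e"
 using act_id[OF B FO_psh] by (auto simp: pel_def)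

lemma pel_act_cmp: "e:pel C B P x b ==> be:fhom B b' b ==> be':fhom B b'' b' ==>
 act (FO P x) be' (act (FO P x) be e) = act (FO P x) (fcmp B be be') e"
 using act_cmp[OF B FO_psh] by (auto simp: pel_def)

end

lemmas dec_enc_simps [simp] = inj_enc(1-6)[THEN dec_enc]
lemmas enc_eq_simps [simp] = inj_enc(1-6)[THEN inj_eq]

text \<open>The code of the arrow \<open>m\<close> as an element of the unit
  \<open>tens_unit\<close>; the second component is the only arrow of lists that ends in the empty
  list.\<close>

abbreviation en :: "'u::universe => 'u" where "en m == enc (m, [] :: 'u list)"

section \<open>Day convolution\<close>

context
 fixes B :: "('u::universe, 'u) cat" and U V :: "'u psh"
 assumes B: "small_category B" and U: "psh B U" and V: "psh B V"
begin

private lemma cB: "category B" using B by (rule small_categoryD)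
private lemma cF: "category (free_cat B)" by (rule category_free[OF cB])
private lemma cP: "category (free_cat B \<times>\<^sub>c free_cat B)" by (intro category_prod cF)

text \<open>The coend relation at the arrow \<open>(k1, k2)\<close>: on one side it acts on the two
  elements, on the other on the arrow \<open>h\<close>; the identities that accompany it act
  trivially.\<close>

lemma day_slide:
 assumes k: "k1:fhom B c1' c1" "k2:fhom B c2' c2" and uv: "u:sel B U c1" "v:sel B V c2"
  and h: "h:fhom B b (c1' @ c2')"
 shows "day_in B U V b c1' c2' (act U k1 u) (act V k2 v) h = day_in B U V b c1 c2 u v (fcmp B (k1 @ k2) h)"
proof -
 have k': "(k1, k2):hom (free_cat B \<times>\<^sub>c free_cat B) (c1', c2') (c1, c2)" using k by simp
 have o: "c1':fob B" "c2':fob B" using k by (auto intro: hom_obj1[OF cF])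
 have "fcmp B (fid B c1' @ fid B c2') h = h"
  using Cmp_idl[OF cF h] by simp
 then show ?thesis
  using coend_bifun_slide[OF cP k', of "(u, v, h)" "(%(c1, c2) (d1, d2). FO U c1 \<times> FO V c2 \<times> hom (free_cat B) b (d1 @ d2))"
  "(%(k1, k2) (l1, l2) (u, v, h). (act U k1 u, act V k2 v, Cmp (free_cat B) (l1 @ l2) h))"]
  uv h act_id[OF cB U uv(1)] act_id[OF cB V uv(2)]
  by (simp add: day_in_def dayP_def sel_def)
qed

lemma day_desc_in:
 assumes F: "!!c1 c1' c2 c2' k1 k2 u v h. k1:fhom B c1' c1 ==> k2:fhom B c2' c2 ==>
  u:sel B U c1 ==> v:sel B V c2 ==> h:fhom B b (c1' @ c2') ==>
  F c1' c2' (act U k1 u) (act V k2 v) h = F c1 c2 u v (fcmp B (k1 @ k2) h)"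
  and uv: "u:sel B U c1" "v:sel B V c2" and h: "h:fhom B b (c1 @ c2)"
 shows "day_desc B U V b F (day_in B U V b c1 c2 u v h) = F c1 c2 u v h"
proof -
 have "coend_desc (free_cat B \<times>\<^sub>c free_cat B) (dayP B U V b) (%(c1, c2) (u, v, h). F c1 c2 u v h)
  (coend_in (free_cat B \<times>\<^sub>c free_cat B) (dayP B U V b) (c1, c2) (u, v, h) :: 'u) = (%(c1, c2) (u, v, h). F c1 c2 u v h) (c1, c2) (u, v, h)"
  unfolding dayP_def
 proof (rule coend_bifun_desc[OF inj_enc(6) cP], clarsimp)
  fix c1' c2' c1 c2 k1 k2 u v h
  assume *: "k1:fhom B c1' c1" "k2:fhom B c2' c2" "u:FO U c1" "v:FO V c2" "h:fhom B b (c1' @ c2')"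
  have o: "c1:fob B" "c2:fob B" "c1':fob B" "c2':fob B" using * by (auto intro: hom_objs[OF cF])
  have uv: "u:sel B U c1" "v:sel B V c2" using * o by (auto simp: sel_def)
  show "F c1' c2' (act U k1 u) (act V k2 v) (fcmp B (fid B c1' @ fid B c2') h) =
  F c1 c2 (act U (fid B c1) u) (act V (fid B c2) v) (fcmp B (k1 @ k2) h)"
  using F[OF *(1,2) uv *(5)] act_id[OF cB U uv(1)] act_id[OF cB V uv(2)] Cmp_idl[OF cF *(5)] by simp
 qed (use uv h hom_obj2[OF cF h] in \<open>auto simp: sel_def\<close>)
 then show ?thesis
  by (simp add: day_desc_def day_in_def)
qed

private lemma dayS: "coend (free_cat B \<times>\<^sub>c free_cat B) (dayP B U V b) =
 {day_in B U V b c1 c2 u v h | c1 c2 u v h. u:sel B U c1 & v:sel B V c2 & h:fhom B b (c1 @ c2)}" (is "?L = ?R")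
proof
 show "?L \<subseteq> ?R"
 proof
  fix z assume "z:?L"
  then obtain c1 c2 x where *: "z = coend_in (free_cat B \<times>\<^sub>c free_cat B) (dayP B U V b) (c1, c2) x"
  "c1:fob B" "c2:fob B" "x:FO (dayP B U V b) ((c1, c2), (c1, c2))"
  unfolding coend_def by auto
  then obtain u v h where "x = (u, v, h)" "u:sel B U c1" "v:sel B V c2" "h:fhom B b (c1 @ c2)"
  by (auto simp: dayP_def sel_def)
  with * show "z:?R"
  unfolding day_in_def by blast
 qed
 show "?R \<subseteq> ?L"
 proof
  fix z assume "z:?R"
  then obtain c1 c2 u v h where *: "u:sel B U c1" "v:sel B V c2" "h:fhom B b (c1 @ c2)" "z = day_in B U V b c1 c2 u v h"
  by auto
  then show "z:?L"
  unfolding *(4) day_in_def by (intro coend_in_mem) (auto simp: dayP_def sel_def)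
 qed
qed

private lemma day_in_coend: "u:sel B U c1 ==> v:sel B V c2 ==> h:fhom B b (c1 @ c2) ==>
  day_in B U V b c1 c2 u v h:coend (free_cat B \<times>\<^sub>c free_cat B) (dayP B U V b)"
 unfolding dayS by blast

private lemma day_act0:
 assumes uv: "u:sel B U c1" "v:sel B V c2" and h: "h:fhom B b (c1 @ c2)" and be: "be:fhom B b' b"
 shows "day_desc B U V (Tgt (free_cat B) be) (%c1 c2 u v h.
  day_in B U V (Src (free_cat B) be) c1 c2 u v (Cmp (free_cat B) h be)) (day_in B U V b c1 c2 u v h) =
  day_in B U V b' c1 c2 u v (fcmp B h be)"
 unfolding hom_Src[OF be] hom_Tgt[OF be]
proof (rule day_desc_in[OF _ uv h])
 fix c1 c1' c2 c2' k1 k2 u v h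
 assume *: "k1:fhom B c1' c1" "k2:fhom B c2' c2" "u:sel B U c1" "v:sel B V c2" "h:fhom B b (c1' @ c2')"
 show "day_in B U V b' c1' c2' (act U k1 u) (act V k2 v) (fcmp B h be) = day_in B U V b' c1 c2 u v (fcmp B (fcmp B (k1 @ k2) h) be)"
  using day_slide[OF *(1-4) Cmp_hom[OF cF be *(5)]] Cmp_assoc[OF cF be *(5) fhom_append[OF *(1,2)]] by simp
qed

lemma psh_day: "psh B (day B U V)"
 unfolding day_def
proof (rule mk_pshI[OF cB])
 show "small (coend (free_cat B \<times>\<^sub>c free_cat B) (dayP B U V b) :: 'u set)" for b
 proof (rule coend_small)
  show "covered TYPE('u) (Obj (free_cat B \<times>\<^sub>c free_cat B))"
  by (auto intro: covered_Sigma covered_free[OF B])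
  fix c assume "c:Obj (free_cat B \<times>\<^sub>c free_cat B)"
  then obtain c1 c2 where "c = (c1, c2)" "c1:fob B" "c2:fob B" by auto
  then show "covered TYPE('u) (FO (dayP B U V b) (c, c))"
  by (auto simp: dayP_def intro!: covered_Sigma covered_free[OF B] psh_small[OF U] psh_small[OF V])
 qed
next
 fix b b' be and e :: 'u assume be: "be:fhom B b' b" and "e:coend (free_cat B \<times>\<^sub>c free_cat B) (dayP B U V b)"
 then obtain c1 c2 u v h where *: "u:sel B U c1" "v:sel B V c2" "h:fhom B b (c1 @ c2)" and [simp]: "e = day_in B U V b c1 c2 u v h"
  unfolding dayS by auto
 show "day_desc B U V (Tgt (free_cat B) be) (%c1 c2 u v h.
  day_in B U V (Src (free_cat B) be) c1 c2 u v (Cmp (free_cat B) h be)) e:coend (free_cat B \<times>\<^sub>c free_cat B) (dayP B U V b')"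
  using day_act0[OF * be] day_in_coend[OF *(1,2) Cmp_hom[OF cF be *(3)]] by (simp del: free_simps)
next
 fix b and e :: 'u assume b: "b:fob B" and "e:coend (free_cat B \<times>\<^sub>c free_cat B) (dayP B U V b)"
 then obtain c1 c2 u v h where "u:sel B U c1" "v:sel B V c2" "h:fhom B b (c1 @ c2)" and [simp]: "e = day_in B U V b c1 c2 u v h"
  unfolding dayS by auto
 then show "day_desc B U V (Tgt (free_cat B) (fid B b)) (%c1 c2 u v h.
  day_in B U V (Src (free_cat B) (fid B b)) c1 c2 u v (Cmp (free_cat B) h (fid B b))) e = e"
  using day_act0[OF _ _ _ Idn_hom[OF cF b]] Cmp_idr[OF cF] by (simp del: free_simps)
next
 fix b b' b'' be be' and e :: 'u assume be: "be:fhom B b' b" "be':fhom B b'' b'" and "e:coend (free_cat B \<times>\<^sub>c free_cat B) (dayP B U V b)"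
 then obtain c1 c2 u v h where *: "u:sel B U c1" "v:sel B V c2" "h:fhom B b (c1 @ c2)" and [simp]: "e = day_in B U V b c1 c2 u v h"
  unfolding dayS by auto
 show "day_desc B U V (Tgt (free_cat B) be') (%c1 c2 u v h.
  day_in B U V (Src (free_cat B) be') c1 c2 u v (Cmp (free_cat B) h be')) 
  (day_desc B U V (Tgt (free_cat B) be) (%c1 c2 u v h.
  day_in B U V (Src (free_cat B) be) c1 c2 u v (Cmp (free_cat B) h be)) e) = 
  day_desc B U V (Tgt (free_cat B) (fcmp B be be')) (%c1 c2 u v h.
  day_in B U V (Src (free_cat B) (fcmp B be be')) c1 c2 u v (Cmp (free_cat B) h (fcmp B be be'))) e"
  using day_act0[OF * be(1)] day_act0[OF *(1,2) Cmp_hom[OF cF be(1) *(3)] be(2)]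
  day_act0[OF * Cmp_hom[OF cF be(2,1)]] Cmp_assoc[OF cF be(2,1) *(3)] by (simp del: free_simps)
qed

lemma day_in_mem: "u:sel B U c1 ==> v:sel B V c2 ==> h:fhom B b (c1 @ c2) ==>
  day_in B U V b c1 c2 u v h:sel B (day B U V) b"
 using hom_obj1[OF cF, of h b "c1 @ c2"] day_in_coend
 by (simp add: sel_def[of B "day B U V"]) (simp add: day_def mk_psh_simps)

lemma day_E:
 assumes "e:sel B (day B U V) b"
 obtains c1 c2 u v h where "u:sel B U c1" "v:sel B V c2" "h:fhom B b (c1 @ c2)" "e = day_in B U V b c1 c2 u v h"
proof -
 have "e:coend (free_cat B \<times>\<^sub>c free_cat B) (dayP B U V b)"
  using assms by (auto simp: sel_def day_def mk_psh_simps)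
 then show ?thesis using that unfolding dayS by auto
qed

lemma day_act: "u:sel B U c1 ==> v:sel B V c2 ==> h:fhom B b (c1 @ c2) ==> be:fhom B b' b ==>
  act (day B U V) be (day_in B U V b c1 c2 u v h) = day_in B U V b' c1 c2 u v (fcmp B h be)"
 unfolding day_def
 by (subst mk_psh_simps(2), assumption, force simp: dayS) (rule day_act0)

end

lemma day_map:
 assumes B: "small_category (B :: ('u::universe, 'u) cat)" and M: "M:phom B U U'" and N: "N:phom B V V'"
 shows "day_map B M N:phom B (day B U V) (day B U' V')"
  and "u:sel B U c1 ==> v:sel B V c2 ==> h:fhom B b (c1 @ c2) ==>
  app (day_map B M N) b (day_in B U V b c1 c2 u v h) = day_in B U' V' b c1 c2 (app M c1 u) (app N c2 v) h"
proof -
 have cB: "category B" using B by (rule small_categoryD)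
 note cF = category_free[OF cB]
 note p = phom_psh[OF cB M] phom_psh[OF cB N]
 note s = phom_Src[OF M] phom_Tgt[OF M] phom_Src[OF N] phom_Tgt[OF N]
 let ?ph = "%b. day_desc B U V b (%c1 c2 u v h. day_in B U' V' b c1 c2 (app M c1 u) (app N c2 v) h)"
 have ph: "?ph b (day_in B U V b c1 c2 u v h) = day_in B U' V' b c1 c2 (app M c1 u) (app N c2 v) h"
  if "u:sel B U c1" "v:sel B V c2" "h:fhom B b (c1 @ c2)" for b u v h c1 c2
  by (rule day_desc_in[OF B p(1,3) _ that])
  (simp add: app_act[OF cB M] app_act[OF cB N] day_slide[OF B p(2,4)] app_mem[OF cB M] app_mem[OF cB N])
 show 1: "day_map B M N:phom B (day B U V) (day B U' V')"
  unfolding day_map_def s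
 proof (rule mk_pmap_hom[OF cB psh_day[OF B p(1,3)] psh_day[OF B p(2,4)]])
  fix b and e :: 'u assume "e:sel B (day B U V) b"
  then show "?ph b e:sel B (day B U' V') b"
  by (elim day_E[OF B p(1,3)]) (simp add: ph day_in_mem[OF B p(2,4)] app_mem[OF cB M] app_mem[OF cB N])
 next
  fix b b' be and e :: 'u assume "e:sel B (day B U V) b" and be: "be:fhom B b' b"
  then show "?ph b' (act (day B U V) be e) = act (day B U' V') be (?ph b e)"
  by (elim day_E[OF B p(1,3)])
  (simp add: ph day_act[OF B p(2,4)] day_act[OF B p(1,3)] app_mem[OF cB M] app_mem[OF cB N] Cmp_hom[OF cF be])
 qed
 show "app (day_map B M N) b (day_in B U V b c1 c2 u v h) = day_in B U' V' b c1 c2 (app M c1 u) (app N c2 v) h"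
  if "u:sel B U c1" "v:sel B V c2" "h:fhom B b (c1 @ c2)"
  using ph[OF that] day_in_mem[OF B p(1,3) that] by (simp add: day_map_def s app_mk_pmap)
qed


section \<open>Coends of presheaves\<close>

abbreviation "prof Q B == is_functor (QQ Q) (psh_cat B)"
abbreviation "pe Q B S q q' b == pel (QQ Q) B S (q, q') b"

context
 fixes Q B :: "('u::universe, 'u) cat" and D :: "'u prof"
 assumes Q: "small_category Q" and B: "small_category B" and D: "prof Q B D"
begin

private lemma qB: "category B" using B by (rule small_categoryD)
private lemma qQ: "category Q" using Q by (rule small_categoryD)
private lemma qF: "category (free_cat B)" by (rule category_free[OF qB])
private lemma qP: "category (QQ Q)" by (intro category_prod category_op qQ)

private lemma ev [simp]: "FO (ev_at D b) x = FO (FO D x) b" "SFun (FM (ev_at D b) f) = app (FM D f) b"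
 by (auto simp: ev_at_def app_def)

lemma pcoend_slide:
 assumes "k:hom Q x y" "z:pe Q B D y x b"
 shows "coend_in Q (ev_at D b) x (app (FM D (k, Idn Q x)) b z) = coend_in Q (ev_at D b) y (app (FM D (Idn Q y, k)) b z)"
 using coend_in_slide[OF assms(1), of z "ev_at D b"] assms(2) by (simp add: pel_def sel_def)

lemma pcoend_desc:
 assumes h: "!!x y k z. k:hom Q x y ==> z:pe Q B D y x b ==>
  h x (app (FM D (k, Idn Q x)) b z) = h y (app (FM D (Idn Q y, k)) b z)"
  and e: "e:pe Q B D x x b"
 shows "coend_desc Q (ev_at D b) h (coend_in Q (ev_at D b) x e :: 'u) = h x e"
proof (rule coend_desc_in[OF inj_enc(2)])
 fix x y k z assume *: "k:hom Q x y" "z:FO (ev_at D b) (y, x)"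
 show "h x (SFun (FM (ev_at D b) (k, Idn Q x)) z) = h y (SFun (FM (ev_at D b) (Idn Q y, k)) z)"
  using h[OF *(1)] * e hom_objs[OF qQ *(1)] by (simp add: pel_def sel_def)
qed (use e in \<open>auto simp: pel_def sel_def\<close>)

private lemma pact:
 assumes e: "e:pe Q B D x x b" and be: "be:fhom B b' b"
 shows "coend_desc Q (ev_at D (Tgt (free_cat B) be))
  (%x e. coend_in Q (ev_at D (Src (free_cat B) be)) x (act (FO D (x, x)) be e)) (coend_in Q (ev_at D b) x e :: 'u) =
 (coend_in Q (ev_at D b') x (act (FO D (x, x)) be e) :: 'u)"
 unfolding hom_Src[OF be] hom_Tgt[OF be]
proof (rule pcoend_desc[where h = "%x e. coend_in Q (ev_at D b') x (act (FO D (x, x)) be e)", OF _ e])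
 fix x y k z assume *: "k:hom Q x y" "z:pe Q B D y x b"
 have 1: "(k, Idn Q x):hom (QQ Q) (y, x) (x, x)" "(Idn Q y, k):hom (QQ Q) (y, x) (y, y)"
  using *(1) by (auto intro: Idn_hom[OF qQ] hom_objs[OF qQ])
 show "coend_in Q (ev_at D b') x (act (FO D (x, x)) be (app (FM D (k, Idn Q x)) b z)) =
  coend_in Q (ev_at D b') y (act (FO D (y, y)) be (app (FM D (Idn Q y, k)) b z))"
  using FM_act[OF qB qP D *(2) 1(1) be] FM_act[OF qB qP D *(2) 1(2) be]
  pcoend_slide[OF *(1) pel_act[OF qB qP D *(2) be]] by simp
qed

private lemma pS: "b:fob B ==> coend Q (ev_at D b) = {coend_in Q (ev_at D b) x e | x e. e:pe Q B D x x b}"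
 unfolding coend_def by (simp add: pel_def sel_def)

private lemma pcoend_in_coend: "e:pe Q B D x x b ==> coend_in Q (ev_at D b) x e:coend Q (ev_at D b)"
 by (rule coend_in_mem) (auto simp: pel_def sel_def)

lemma psh_pcoend: "psh B (psh_coend Q B D)"
 unfolding psh_coend_def
proof (rule mk_pshI[OF qB])
 show "small (coend Q (ev_at D b) :: 'u set)" if "b:fob B" for b
 proof (rule coend_small)
  show "covered TYPE('u) (FO (ev_at D b) (c, c))" if "c:Obj Q" for c
  using psh_small[OF functor_obj[OF D], of "(c, c)" b] \<open>b \<in> fob B\<close> that by simp
 qed (use Q in \<open>simp add: small_category_def\<close>)
next
 fix b b' be and e :: 'u assume be: "be:fhom B b' b" and e: "e:coend Q (ev_at D b)"
 have b: "b:fob B" "b':fob B" using be by (auto intro: hom_objs[OF qF])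
 obtain x z where z: "z:pe Q B D x x b" and [simp]: "e = coend_in Q (ev_at D b) x z"
  using e unfolding pS[OF b(1)] by auto
 show "coend_desc Q (ev_at D (Tgt (free_cat B) be))
  (%x e. coend_in Q (ev_at D (Src (free_cat B) be)) x (act (FO D (x, x)) be e)) e:(coend Q (ev_at D b') :: 'u set)"
  using pact[OF z be] pcoend_in_coend[OF pel_act[OF qB qP D z be]] by (simp del: free_simps)
next
 fix b and e :: 'u assume b: "b:fob B" and e: "e:coend Q (ev_at D b)"
 obtain x z where z: "z:pe Q B D x x b" and [simp]: "e = coend_in Q (ev_at D b) x z"
  using e unfolding pS[OF b(1)] by auto
 show "coend_desc Q (ev_at D (Tgt (free_cat B) (fid B b)))
  (%x e. coend_in Q (ev_at D (Src (free_cat B) (fid B b))) x (act (FO D (x, x)) (fid B b) e)) e = e"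
  using pact[OF z Idn_hom[OF qF b]] pel_act_id[OF qB qP D z] by (simp del: free_simps)
next
 fix b b' b'' be be' and e :: 'u assume be: "be:fhom B b' b" "be':fhom B b'' b'" and e: "e:coend Q (ev_at D b)"
 have b: "b:fob B" "b':fob B" using be by (auto intro: hom_objs[OF qF])
 obtain x z where z: "z:pe Q B D x x b" and [simp]: "e = coend_in Q (ev_at D b) x z"
  using e unfolding pS[OF b(1)] by auto
 show "coend_desc Q (ev_at D (Tgt (free_cat B) be'))
  (%x e. coend_in Q (ev_at D (Src (free_cat B) be')) x (act (FO D (x, x)) be' e))
  (coend_desc Q (ev_at D (Tgt (free_cat B) be))
  (%x e. coend_in Q (ev_at D (Src (free_cat B) be)) x (act (FO D (x, x)) be e)) e :: 'u) =
  (coend_desc Q (ev_at D (Tgt (free_cat B) (fcmp B be be')))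
  (%x e. coend_in Q (ev_at D (Src (free_cat B) (fcmp B be be'))) x (act (FO D (x, x)) (fcmp B be be') e)) e :: 'u)"
  using pact[OF z be(1)] pact[OF pel_act[OF qB qP D z be(1)] be(2)]
  pact[OF z Cmp_hom[OF qF be(2,1)]] pel_act_cmp[OF qB qP D z be] by (simp del: free_simps)
qed

lemma pcoend_mem: "e:pe Q B D x x b ==> coend_in Q (ev_at D b) x e:sel B (psh_coend Q B D) b"
 by (auto simp: psh_coend_def mk_psh_simps pS sel_def pel_def)

lemma pcoend_E:
 assumes "e:sel B (psh_coend Q B D) b"
 obtains x z where "z:pe Q B D x x b" "e = coend_in Q (ev_at D b) x z"
 using assms by (auto simp: psh_coend_def mk_psh_simps pS sel_def)

lemma pcoend_act:
 assumes "e:pe Q B D x x b" "be:fhom B b' b"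
 shows "act (psh_coend Q B D) be (coend_in Q (ev_at D b) x e) = coend_in Q (ev_at D b') x (act (FO D (x, x)) be e)"
proof -
 have b: "b:fob B" using assms(1) by (simp add: pel_def sel_def)
 have "coend_in Q (ev_at D b) x e:coend Q (ev_at D b)" using assms(1) by (auto simp: pS[OF b])
 then show ?thesis
  unfolding psh_coend_def using assms(2) by (subst mk_psh_simps(2)) (auto intro: pact[OF assms] simp del: free_simps)
qed

end

section \<open>Two-sided state functors\<close>

lemma peD: "e:pe Q B S x y b ==> x:Obj Q" "e:pe Q B S x y b ==> y:Obj Q" "e:pe Q B S x y b ==> b:fob B"
 "e:pe Q B S x y b ==> e:sel B (FO S (x, y)) b"
 by (auto simp: pel_def sel_def)

lemma peI: "e:sel B (FO S (x, y)) b ==> x:Obj Q ==> y:Obj Q ==> e:pe Q B S x y b"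
 by (auto simp: pel_def)

lemma prof_psh: "prof Q B S ==> x:Obj Q ==> y:Obj Q ==> psh B (FO S (x, y))"
 using functor_obj[of _ _ S "(x, y)"] by simp

lemma prof_phom: "prof Q B S ==> k:hom Q x' x ==> l:hom Q y y' ==> FM S (k, l):phom B (FO S (x, y)) (FO S (x', y'))"
 using functor_hom[of _ _ S "(k, l)" "(x, y)" "(x', y')"] by simp

context
 fixes Q B :: "('u::universe, 'u) cat"
 assumes Q: "category Q" and B: "category B"
begin

lemma category_opQ: "category (QQ Q)"
 by (intro category_prod category_op Q)

lemma profI:
 assumes o: "!!x y. x:Obj Q ==> y:Obj Q ==> psh B (oF x y)"
  and m: "!!k l x x' y y'. k:hom Q x' x ==> l:hom Q y y' ==> mF k l:phom B (oF x y) (oF x' y')"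
  and i: "!!x y b e. x:Obj Q ==> y:Obj Q ==> e:sel B (oF x y) b ==> app (mF (Idn Q x) (Idn Q y)) b e = e"
  and c: "!!k l k' l' x x' x'' y y' y'' b e. k:hom Q x' x ==> l:hom Q y y' ==> k':hom Q x'' x' ==> l':hom Q y' y'' ==>
  e:sel B (oF x y) b ==> app (mF (Cmp Q k k') (Cmp Q l' l)) b e = app (mF k' l') b (app (mF k l) b e)"
 shows "prof Q B (mk_func (QQ Q) (%(x, y). oF x y) (%(k, l). mF k l))"
proof (rule functor_pshI[OF B category_opQ])
 fix x assume "x:Obj (QQ Q)"
 then show "psh B (case x of (x, y) => oF x y)" by (cases x) (simp add: o)
next
 fix x y f assume "f:hom (QQ Q) x y"
 then show "(case f of (k, l) => mF k l):phom B (case x of (x, y) => oF x y) (case y of (x, y) => oF x y)"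
  by (cases x; cases y; cases f) (simp add: m)
next
 fix x b e assume "x:Obj (QQ Q)" "e:sel B (case x of (x, y) => oF x y) b"
 then show "app (case Idn (QQ Q) x of (k, l) => mF k l) b e = e"
  by (cases x) (simp add: i)
next
 fix x y z f g b e assume "f:hom (QQ Q) x y" "g:hom (QQ Q) y z" "e:sel B (case x of (x, y) => oF x y) b"
 then show "app (case Cmp (QQ Q) g f of (k, l) => mF k l) b e = app (case g of (k, l) => mF k l) b (app (case f of (k, l) => mF k l) b e)"
  by (cases x; cases y; cases z; cases f; cases g) (simp, rule c, auto)
qed

context
 fixes S
 assumes S: "prof Q B S"
begin

lemma prof_mem: "e:pe Q B S x y b ==> k:hom Q x' x ==> l:hom Q y y' ==> app (FM S (k, l)) b e:pe Q B S x' y' b"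
 using FM_mem[OF B category_opQ S, of e "(x, y)" b "(k, l)" "(x', y')"] by simp

lemma prof_id: "e:pe Q B S x y b ==> app (FM S (Idn Q x, Idn Q y)) b e = e"
 using FM_id[OF B category_opQ S, of e "(x, y)" b] by simp

lemma prof_cmp: "e:pe Q B S x y b ==> k:hom Q x' x ==> l:hom Q y y' ==> k':hom Q x'' x' ==> l':hom Q y' y'' ==>
  app (FM S (k', l')) b (app (FM S (k, l)) b e) = app (FM S (Cmp Q k k', Cmp Q l' l)) b e"
 using FM_cmp[OF B category_opQ S, of e "(x, y)" b "(k, l)" "(x', y')" "(k', l')" "(x'', y'')"] by simp

end

end

lemmas sl = small_categoryD

context
 fixes Q B :: "('u::universe, 'u) cat" and S R :: "'u prof"
 assumes Q: "small_category Q" and B: "small_category B" and S: "prof Q B S" and R: "prof Q B R"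
begin

private lemma tB: "category B" using B by (rule sl)
private lemma tQ: "category Q" using Q by (rule sl)

lemma tensD_prof:
 assumes q: "q:Obj Q" "q':Obj Q"
 shows "prof Q B (tensD Q B S R q q')"
 unfolding tensD_def
proof (rule profI[OF tQ tB])
 fix x y assume "x:Obj Q" "y:Obj Q"
 then show "psh B (day B (FO S (q, y)) (FO R (x, q')))"
  using q by (intro psh_day B prof_psh[OF S] prof_psh[OF R])
next
 fix k l x x' y y' assume "k:hom Q x' x" "l:hom Q y y'"
 then show "day_map B (FM S (Idn Q q, l)) (FM R (k, Idn Q q')):phom B (day B (FO S (q, y)) (FO R (x, q'))) (day B (FO S (q, y')) (FO R (x', q')))"
  using q by (intro day_map B prof_phom[OF S] prof_phom[OF R] Idn_hom[OF tQ])
next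
 fix x y b e assume xy: "x:Obj Q" "y:Obj Q" and "e:sel B (day B (FO S (q, y)) (FO R (x, q'))) b"
 then obtain c1 c2 u v h where *: "u:sel B (FO S (q, y)) c1" "v:sel B (FO R (x, q')) c2" "h:fhom B b (c1 @ c2)"
  and e: "e = day_in B (FO S (q, y)) (FO R (x, q')) b c1 c2 u v h"
  using day_E[OF B prof_psh[OF S q(1) xy(2)] prof_psh[OF R xy(1) q(2)]] by metis
 have "FM S (Idn Q q, Idn Q y):phom B (FO S (q, y)) (FO S (q, y))" "FM R (Idn Q x, Idn Q q'):phom B (FO R (x, q')) (FO R (x, q'))"
  by (rule prof_phom[OF S Idn_hom[OF tQ q(1)] Idn_hom[OF tQ xy(2)]] prof_phom[OF R Idn_hom[OF tQ xy(1)] Idn_hom[OF tQ q(2)]])+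
 from day_map(2)[OF B this *]
 show "app (day_map B (FM S (Idn Q q, Idn Q y)) (FM R (Idn Q x, Idn Q q'))) b e = e"
  using prof_id[OF tQ tB S peI[OF *(1) q(1) xy(2)]] prof_id[OF tQ tB R peI[OF *(2) xy(1) q(2)]] by (simp add: e)
next
 fix k l k' l' x x' x'' y y' y'' b e
 assume kl: "k:hom Q x' x" "l:hom Q y y'" "k':hom Q x'' x'" "l':hom Q y' y''"
  and "e:sel B (day B (FO S (q, y)) (FO R (x, q'))) b"
 note xy = hom_obj2[OF tQ kl(1)] hom_obj1[OF tQ kl(2)]
 note i = Idn_hom[OF tQ q(1)] Idn_hom[OF tQ q(2)]
 obtain c1 c2 u v h where *: "u:sel B (FO S (q, y)) c1" "v:sel B (FO R (x, q')) c2" "h:fhom B b (c1 @ c2)"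
  and e: "e = day_in B (FO S (q, y)) (FO R (x, q')) b c1 c2 u v h"
  using day_E[OF B prof_psh[OF S q(1) xy(2)] prof_psh[OF R xy(1) q(2)] \<open>e \<in> _\<close>] by metis
 note u = peI[OF *(1) q(1) xy(2)] and v = peI[OF *(2) xy(1) q(2)]
 note uv' = prof_mem[OF tQ tB S u i(1) kl(2), THEN peD(4)] prof_mem[OF tQ tB R v kl(1) i(2), THEN peD(4)]
 have ii: "Cmp Q (Idn Q q) (Idn Q q) = Idn Q q" "Cmp Q (Idn Q q') (Idn Q q') = Idn Q q'"
  using i by (simp_all add: Cmp_idl[OF tQ])
 note p1 = prof_phom[OF S i(1) kl(2)] prof_phom[OF R kl(1) i(2)]
 note p2 = prof_phom[OF S i(1) kl(4)] prof_phom[OF R kl(3) i(2)]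
 note p3 = prof_phom[OF S i(1) Cmp_hom[OF tQ kl(2,4)]] prof_phom[OF R Cmp_hom[OF tQ kl(3,1)] i(2)]
 show "app (day_map B (FM S (Idn Q q, Cmp Q l' l)) (FM R (Cmp Q k k', Idn Q q'))) b e =
  app (day_map B (FM S (Idn Q q, l')) (FM R (k', Idn Q q'))) b (app (day_map B (FM S (Idn Q q, l)) (FM R (k, Idn Q q'))) b e)"
  unfolding e day_map(2)[OF B p1 *] day_map(2)[OF B p3 *] day_map(2)[OF B p2 uv' *(3)]
  using prof_cmp[OF tQ tB S u i(1) kl(2) i(1) kl(4)] prof_cmp[OF tQ tB R v kl(1) i(2) kl(3) i(2)] by (simp add: ii)
qed

lemma tensD_simps:
 assumes "x:Obj Q" "y:Obj Q"
 shows "FO (tensD Q B S R q q') (y, x) = day B (FO S (q, x)) (FO R (y, q'))"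
 using assms by (simp add: tensD_def)

lemma tensD_in:
 assumes "u:pe Q B S q x c1" "v:pe Q B R y q' c2" "h:fhom B b (c1 @ c2)"
 shows "day_in B (FO S (q, x)) (FO R (y, q')) b c1 c2 u v h:pe Q B (tensD Q B S R q q') y x b"
proof -
 note o = peD(1,2)[OF assms(1)] peD(1,2)[OF assms(2)]
 show ?thesis
  using day_in_mem[OF B prof_psh[OF S o(1,2)] prof_psh[OF R o(3,4)] peD(4)[OF assms(1)] peD(4)[OF assms(2)] assms(3)] o
  by (intro peI) (simp_all add: tensD_simps)
qed

lemma tensD_E:
 assumes "q:Obj Q" "q':Obj Q" "z:pe Q B (tensD Q B S R q q') y x b"
 obtains c1 c2 u v h where "u:pe Q B S q x c1" "v:pe Q B R y q' c2" "h:fhom B b (c1 @ c2)"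
  "z = day_in B (FO S (q, x)) (FO R (y, q')) b c1 c2 u v h"
proof -
 note o = peD(1,2)[OF assms(3)]
 have "z:sel B (day B (FO S (q, x)) (FO R (y, q'))) b"
  using peD(4)[OF assms(3)] o by (simp add: tensD_simps)
 then show ?thesis
  by (rule day_E[OF B prof_psh[OF S assms(1) o(2)] prof_psh[OF R o(1) assms(2)]])
  (rule that, (rule peI; simp add: assms o)+)
qed

lemma tensD_FM:
 assumes u: "u:pe Q B S q x c1" and v: "v:pe Q B R y q' c2" and h: "h:fhom B b (c1 @ c2)"
  and kl: "k:hom Q y' y" "l:hom Q x x'"
 shows "app (FM (tensD Q B S R q q') (k, l)) b (day_in B (FO S (q, x)) (FO R (y, q')) b c1 c2 u v h) =
  day_in B (FO S (q, x')) (FO R (y', q')) b c1 c2 (app (FM S (Idn Q q, l)) c1 u) (app (FM R (k, Idn Q q')) c2 v) h"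
proof -
 note o = peD(1,2)[OF u] peD(1,2)[OF v]
 note i = Idn_hom[OF tQ o(1)] Idn_hom[OF tQ o(4)]
 show ?thesis
  using day_map(2)[OF B prof_phom[OF S i(1) kl(2)] prof_phom[OF R kl(1) i(2)] peD(4)[OF u] peD(4)[OF v] h]
  hom_Mor[OF kl(1)] hom_Mor[OF kl(2)] by (simp add: tensD_def)
qed

text \<open>This is the relation of the outer coend, over states, whereas \<open>tens_slide\<close>
  is that of the inner Day convolution, over lists. Together they present the tensor
  product.\<close>

lemma tens_slide_state:
 assumes l: "l:hom Q x y" and u: "u:pe Q B S q x c1" and v: "v:pe Q B R y q' c2" and h: "h:fhom B b (c1 @ c2)"
 shows "tens_in Q B S R q q' b y c1 c2 (app (FM S (Idn Q q, l)) c1 u) v h =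
  tens_in Q B S R q q' b x c1 c2 u (app (FM R (l, Idn Q q')) c2 v) h"
proof -
 note o = peD(1,2)[OF u] peD(1,2)[OF v]
 let ?z = "day_in B (FO S (q, x)) (FO R (y, q')) b c1 c2 u v h"
 have "(coend_in Q (ev_at (tensD Q B S R q q') b) y (app (FM (tensD Q B S R q q') (Idn Q y, l)) b ?z) :: 'u) =
  coend_in Q (ev_at (tensD Q B S R q q') b) x (app (FM (tensD Q B S R q q') (l, Idn Q x)) b ?z)"
  by (rule pcoend_slide[OF Q B tensD_prof[OF o(1,4)] l tensD_in[OF u v h], symmetric])
 then show ?thesis
  using tensD_FM[OF u v h l Idn_hom[OF tQ o(2)]] tensD_FM[OF u v h Idn_hom[OF tQ o(3)] l]
  prof_id[OF tQ tB S u] prof_id[OF tQ tB R v]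
  by (simp add: tens_in_def)
qed

lemma tens_slide:
 assumes k: "k1:fhom B c1' c1" "k2:fhom B c2' c2" and u: "u:pe Q B S q x c1" and v: "v:pe Q B R x q' c2"
  and h: "h:fhom B b (c1' @ c2')"
 shows "tens_in Q B S R q q' b x c1' c2' (act (FO S (q, x)) k1 u) (act (FO R (x, q')) k2 v) h =
  tens_in Q B S R q q' b x c1 c2 u v (fcmp B (k1 @ k2) h)"
 using day_slide[OF B prof_psh[OF S] prof_psh[OF R] k peD(4)[OF u] peD(4)[OF v] h] peD(1,2)[OF u] peD(1,2)[OF v]
 by (simp add: tens_in_def)

text \<open>A map out of an iterated coend respects one relation per coend: by \<open>Fd\<close> it
  descends to the Day convolution at each state, and by \<open>Fx\<close> the resulting maps agree
  across states.\<close>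

lemma tens_desc_in:
 assumes Fd: "!!x c1 c1' c2 c2' k1 k2 u v h. k1:fhom B c1' c1 ==> k2:fhom B c2' c2 ==>
  u:pe Q B S q x c1 ==> v:pe Q B R x q' c2 ==> h:fhom B b (c1' @ c2') ==>
  F x c1' c2' (act (FO S (q, x)) k1 u) (act (FO R (x, q')) k2 v) h = F x c1 c2 u v (fcmp B (k1 @ k2) h)"
  and Fx: "!!x y l c1 c2 u v h. l:hom Q x y ==> u:pe Q B S q x c1 ==> v:pe Q B R y q' c2 ==> h:fhom B b (c1 @ c2) ==>
  F y c1 c2 (app (FM S (Idn Q q, l)) c1 u) v h = F x c1 c2 u (app (FM R (l, Idn Q q')) c2 v) h"
  and u: "u:pe Q B S q x c1" and v: "v:pe Q B R x q' c2" and h: "h:fhom B b (c1 @ c2)"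
 shows "tens_desc Q B S R q q' b F (tens_in Q B S R q q' b x c1 c2 u v h) = F x c1 c2 u v h"
proof -
 have q: "q:Obj Q" "q':Obj Q" using peD(1)[OF u] peD(2)[OF v] .
 have d: "day_desc B (FO S (q, x)) (FO R (x, q')) b (F x) (day_in B (FO S (q, x)) (FO R (x, q')) b c1 c2 u v h) = F x c1 c2 u v h"
  if u: "u:pe Q B S q x c1" and v: "v:pe Q B R x q' c2" and h: "h:fhom B b (c1 @ c2)" for x c1 c2 u v h
  by (rule day_desc_in[OF B prof_psh[OF S peD(1,2)[OF u]] prof_psh[OF R peD(1,2)[OF v]] _ peD(4)[OF u] peD(4)[OF v] h])
  (rule Fd; (assumption | rule peI peD[OF u] peD[OF v])+)
 show ?thesis
  unfolding tens_desc_def tens_in_def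
 proof (subst pcoend_desc[OF Q B tensD_prof[OF q] _ tensD_in[OF u v h]])
  fix x y k z assume k: "k:hom Q x y" and z: "z:pe Q B (tensD Q B S R q q') y x b"
  obtain c1 c2 u v h where *: "u:pe Q B S q x c1" "v:pe Q B R y q' c2" "h:fhom B b (c1 @ c2)"
  and e: "z = day_in B (FO S (q, x)) (FO R (y, q')) b c1 c2 u v h"
  using tensD_E[OF q z] by metis
  note o = peD(1,2)[OF *(1)] peD(1,2)[OF *(2)]
  note i = Idn_hom[OF tQ o(1)] Idn_hom[OF tQ o(2)] Idn_hom[OF tQ o(3)] Idn_hom[OF tQ o(4)]
  show "day_desc B (FO S (q, x)) (FO R (x, q')) b (F x) (app (FM (tensD Q B S R q q') (k, Idn Q x)) b z) =
  day_desc B (FO S (q, y)) (FO R (y, q')) b (F y) (app (FM (tensD Q B S R q q') (Idn Q y, k)) b z)"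
  unfolding e tensD_FM[OF * k i(2)] tensD_FM[OF * i(3) k] prof_id[OF tQ tB S *(1)] prof_id[OF tQ tB R *(2)]
  d[OF *(1) prof_mem[OF tQ tB R *(2) k i(4)] *(3)] d[OF prof_mem[OF tQ tB S *(1) i(1) k] *(2,3)]
  by (rule Fx[OF k *, symmetric])
 qed (rule d[OF u v h])
qed

abbreviation (input) "tensO q q' == psh_coend Q B (tensD Q B S R q q')"

lemma psh_tensO: "q:Obj Q ==> q':Obj Q ==> psh B (tensO q q')"
 by (intro psh_pcoend Q B tensD_prof)

lemma tensO_in:
 assumes u: "u:pe Q B S q x c1" and v: "v:pe Q B R x q' c2" and h: "h:fhom B b (c1 @ c2)"
 shows "tens_in Q B S R q q' b x c1 c2 u v h:sel B (tensO q q') b"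
 unfolding tens_in_def
 by (rule pcoend_mem[OF Q B tensD_prof tensD_in]) (rule peD(1)[OF u] peD(2)[OF v] u v h)+

lemma tensO_E:
 assumes q: "q:Obj Q" "q':Obj Q" and e: "e:sel B (tensO q q') b"
 obtains x c1 c2 u v h where "u:pe Q B S q x c1" "v:pe Q B R x q' c2" "h:fhom B b (c1 @ c2)"
  "e = tens_in Q B S R q q' b x c1 c2 u v h"
 by (rule pcoend_E[OF Q B tensD_prof[OF q] e], erule tensD_E[OF q]) (rule that, auto simp: tens_in_def)

lemma tensO_act:
 assumes u: "u:pe Q B S q x c1" and v: "v:pe Q B R x q' c2" and h: "h:fhom B b (c1 @ c2)" and be: "be:fhom B b' b"
 shows "act (tensO q q') be (tens_in Q B S R q q' b x c1 c2 u v h) = tens_in Q B S R q q' b' x c1 c2 u v (fcmp B h be)"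
 using pcoend_act[OF Q B tensD_prof tensD_in[OF u v h] be] peD(1,2)[OF u] peD(1,2)[OF v]
  day_act[OF B prof_psh[OF S peD(1,2)[OF u]] prof_psh[OF R peD(1,2)[OF v]] peD(4)[OF u] peD(4)[OF v] h be]
 by (simp add: tens_in_def tensD_simps)

end

text \<open>Compatibility with the Day relation follows from naturality of \<open>si\<close> and
  \<open>rh\<close> in the lists. Compatibility with state arrows does not, as \<open>ka\<close> is
  a map of objects only; it is the hypothesis \<open>dinat\<close>.\<close>

lemma tens_map:
 fixes B Q Q' :: "('u::universe, 'u) cat"
 assumes B: "small_category B" and Q: "small_category Q" "small_category Q'"
  and SR: "prof Q B S" "prof Q B R" "prof Q' B S'" "prof Q' B R'"
  and q: "q:Obj Q" "q':Obj Q" "r:Obj Q'" "r':Obj Q'"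
  and ka: "!!x. x:Obj Q ==> ka x:Obj Q'"
  and si: "!!x. x:Obj Q ==> si x:phom B (FO S (q, x)) (FO S' (r, ka x))"
  and rh: "!!x. x:Obj Q ==> rh x:phom B (FO R (x, q')) (FO R' (ka x, r'))"
  and dinat: "!!x y l c1 c2 u v h b. l:hom Q x y ==> u:pe Q B S q x c1 ==> v:pe Q B R y q' c2 ==> h:fhom B b (c1 @ c2) ==>
  tens_in Q' B S' R' r r' b (ka y) c1 c2 (app (si y) c1 (app (FM S (Idn Q q, l)) c1 u)) (app (rh y) c2 v) h =
  tens_in Q' B S' R' r r' b (ka x) c1 c2 (app (si x) c1 u) (app (rh x) c2 (app (FM R (l, Idn Q q')) c2 v)) h"
 shows "tens_map B Q S R q q' Q' S' R' r r' ka si rh:phom B (psh_coend Q B (tensD Q B S R q q')) (psh_coend Q' B (tensD Q' B S' R' r r'))"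
  and "u:pe Q B S q x c1 ==> v:pe Q B R x q' c2 ==> h:fhom B b (c1 @ c2) ==>
  app (tens_map B Q S R q q' Q' S' R' r r' ka si rh) b (tens_in Q B S R q q' b x c1 c2 u v h) =
  tens_in Q' B S' R' r r' b (ka x) c1 c2 (app (si x) c1 u) (app (rh x) c2 v) h"
proof -
 note cB = sl[OF B]
 let ?F = "%b x c1 c2 u v h. tens_in Q' B S' R' r r' b (ka x) c1 c2 (app (si x) c1 u) (app (rh x) c2 v) h"
 have sim: "app (si x) c u:pe Q' B S' r (ka x) c" if "u:pe Q B S q x c" for x c u
  using app_mem[OF cB si peD(4)[OF that]] peD(1,2)[OF that] q ka by (intro peI)
 have rhm: "app (rh x) c u:pe Q' B R' (ka x) r' c" if "u:pe Q B R x q' c" for x c u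
  using app_mem[OF cB rh peD(4)[OF that]] peD(1,2)[OF that] q ka by (intro peI)
 have d: "tens_desc Q B S R q q' b (?F b) (tens_in Q B S R q q' b x c1 c2 u v h) = ?F b x c1 c2 u v h"
  if u: "u:pe Q B S q x c1" and v: "v:pe Q B R x q' c2" and h: "h:fhom B b (c1 @ c2)" for x c1 c2 u v h b
 proof (rule tens_desc_in[OF Q(1) B SR(1,2) _ dinat u v h])
  fix x c1 c1' c2 c2' k1 k2 u v h
  assume *: "k1:fhom B c1' c1" "k2:fhom B c2' c2" "u:pe Q B S q x c1" "v:pe Q B R x q' c2" "h:fhom B b (c1' @ c2')"
  show "?F b x c1' c2' (act (FO S (q, x)) k1 u) (act (FO R (x, q')) k2 v) h = ?F b x c1 c2 u v (fcmp B (k1 @ k2) h)"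
  using tens_slide[OF Q(2) B SR(3,4) *(1,2) sim[OF *(3)] rhm[OF *(4)] *(5)] *
  app_act[OF cB si peD(4)[OF *(3)] *(1)] app_act[OF cB rh peD(4)[OF *(4)] *(2)] peD(1,2)[OF *(3)]
  by simp
 qed
 have "tens_desc Q B S R q q' b (?F b) e:sel B (psh_coend Q' B (tensD Q' B S' R' r r')) b"
  if "e:sel B (psh_coend Q B (tensD Q B S R q q')) b" for b e
  using that by (elim tensO_E[OF Q(1) B SR(1,2) q(1,2)]) (simp add: d tensO_in[OF Q(2) B SR(3,4)] sim rhm)
 moreover have "tens_desc Q B S R q q' b' (?F b') (act (psh_coend Q B (tensD Q B S R q q')) be e) =
  act (psh_coend Q' B (tensD Q' B S' R' r r')) be (tens_desc Q B S R q q' b (?F b) e)"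
  if "e:sel B (psh_coend Q B (tensD Q B S R q q')) b" and be: "be:fhom B b' b" for b b' be e
  using that(1) by (elim tensO_E[OF Q(1) B SR(1,2) q(1,2)]) 
  (simp add: d tensO_act[OF Q(2) B SR(3,4) _ _ _ be] tensO_act[OF Q(1) B SR(1,2) _ _ _ be] sim rhm Cmp_hom[OF category_free[OF cB] be])
 ultimately show "tens_map B Q S R q q' Q' S' R' r r' ka si rh:phom B (psh_coend Q B (tensD Q B S R q q')) (psh_coend Q' B (tensD Q' B S' R' r r'))"
  unfolding tens_map_def
  by (intro mk_pmap_hom[OF cB] psh_tensO Q B SR q)
 show "app (tens_map B Q S R q q' Q' S' R' r r' ka si rh) b (tens_in Q B S R q q' b x c1 c2 u v h) = ?F b x c1 c2 u v h"
  if u: "u:pe Q B S q x c1" and v: "v:pe Q B R x q' c2" and h: "h:fhom B b (c1 @ c2)"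
  unfolding tens_map_def using d[OF that] tensO_in[OF Q(1) B SR(1,2) that] by (simp add: app_mk_pmap)
qed

context
 fixes Q B :: "('u::universe, 'u) cat" and S R :: "'u prof"
 assumes Q: "small_category Q" and B: "small_category B" and S: "prof Q B S" and R: "prof Q B R"
begin

private lemma xB: "category B" using B by (rule sl)
private lemma xQ: "category Q" using Q by (rule sl)

text \<open>An outer state arrow and an arrow \<open>n\<close> of the middle state act on different
  arguments of \<open>S\<close> and \<open>R\<close>, so they commute by functoriality. This
  supplies the dinaturality required by \<open>tens_map\<close>.\<close>

private lemma tens_FM0:
 assumes k: "k:hom Q q0 q" and l: "l:hom Q q' q1"
 shows "tens_map B Q S R q q' Q S R q0 q1 (%x. x) (%x. FM S (k, Idn Q x)) (%x. FM R (Idn Q x, l)):phom B (psh_coend Q B (tensD Q B S R q q')) (psh_coend Q B (tensD Q B S R q0 q1))" (is "PROP ?Ga")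
  and "u:pe Q B S q x c1 ==> v:pe Q B R x q' c2 ==> h:fhom B b (c1 @ c2) ==>
  app (tens_map B Q S R q q' Q S R q0 q1 (%x. x) (%x. FM S (k, Idn Q x)) (%x. FM R (Idn Q x, l))) b
  (tens_in Q B S R q q' b x c1 c2 u v h) =
  tens_in Q B S R q0 q1 b x c1 c2 (app (FM S (k, Idn Q x)) c1 u) (app (FM R (Idn Q x, l)) c2 v) h"
proof -
 note o = hom_objs[OF xQ k] hom_objs[OF xQ l]
 have *: "tens_in Q B S R q0 q1 b y c1 c2 (app (FM S (k, Idn Q y)) c1 (app (FM S (Idn Q q, n)) c1 u)) (app (FM R (Idn Q y, l)) c2 v) h =
  tens_in Q B S R q0 q1 b x c1 c2 (app (FM S (k, Idn Q x)) c1 u) (app (FM R (Idn Q x, l)) c2 (app (FM R (n, Idn Q q')) c2 v)) h"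
  if n: "n:hom Q x y" and u: "u:pe Q B S q x c1" and v: "v:pe Q B R y q' c2" and h: "h:fhom B b (c1 @ c2)" for x y n c1 c2 u v h b
 proof -
  note o' = hom_objs[OF xQ n]
  note i = Idn_hom[OF xQ o(1)] Idn_hom[OF xQ o(2)] Idn_hom[OF xQ o(3)] Idn_hom[OF xQ o(4)] Idn_hom[OF xQ o'(1)] Idn_hom[OF xQ o'(2)]
  note ii = Cmp_idl[OF xQ] Cmp_idr[OF xQ]
  have "app (FM S (k, Idn Q y)) c1 (app (FM S (Idn Q q, n)) c1 u) = app (FM S (Idn Q q0, n)) c1 (app (FM S (k, Idn Q x)) c1 u)"
  unfolding prof_cmp[OF xQ xB S u i(2) n k i(6)] prof_cmp[OF xQ xB S u k i(5) i(1) n]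
  by (simp add: ii[OF k] ii[OF n])
  moreover have "app (FM R (Idn Q x, l)) c2 (app (FM R (n, Idn Q q')) c2 v) = app (FM R (n, Idn Q q1)) c2 (app (FM R (Idn Q y, l)) c2 v)"
  unfolding prof_cmp[OF xQ xB R v n i(3) i(5) l] prof_cmp[OF xQ xB R v i(6) l n i(4)]
  by (simp add: ii[OF l] ii[OF n])
  ultimately show ?thesis
  using tens_slide_state[OF Q B S R n prof_mem[OF xQ xB S u k i(5)] prof_mem[OF xQ xB R v i(6) l] h] by simp
 qed
 note T = tens_map[where ka = "%x. x" and si = "%x. FM S (k, Idn Q x)" and rh = "%x. FM R (Idn Q x, l)",
  OF B Q Q S R S R o(2,3,1,4) _ prof_phom[OF S k Idn_hom[OF xQ]] prof_phom[OF R Idn_hom[OF xQ] l] *]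
 show "PROP ?Ga"
  by (rule T(1))
 show "app (tens_map B Q S R q q' Q S R q0 q1 (%x. x) (%x. FM S (k, Idn Q x)) (%x. FM R (Idn Q x, l))) b
  (tens_in Q B S R q q' b x c1 c2 u v h) =
  tens_in Q B S R q0 q1 b x c1 c2 (app (FM S (k, Idn Q x)) c1 u) (app (FM R (Idn Q x, l)) c2 v) h"
  if "u:pe Q B S q x c1" "v:pe Q B R x q' c2" "h:fhom B b (c1 @ c2)"
  by (rule T(2)) (assumption | rule that)+
qed

lemma tens_FO: "q:Obj Q ==> q':Obj Q ==> FO (tens Q B S R) (q, q') = psh_coend Q B (tensD Q B S R q q')"
 by (simp add: tens_def)

lemma tens_FM:
 assumes k: "k:hom Q q0 q" and l: "l:hom Q q' q1"
  and "u:pe Q B S q x c1" "v:pe Q B R x q' c2" "h:fhom B b (c1 @ c2)"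
 shows "app (FM (tens Q B S R) (k, l)) b (tens_in Q B S R q q' b x c1 c2 u v h) =
  tens_in Q B S R q0 q1 b x c1 c2 (app (FM S (k, Idn Q x)) c1 u) (app (FM R (Idn Q x, l)) c2 v) h"
 using tens_FM0(2)[OF assms] hom_Src[OF k] hom_Tgt[OF k] hom_Src[OF l] hom_Tgt[OF l] hom_Mor[OF k] hom_Mor[OF l]
 by (simp add: tens_def)

lemma tens_prof: "prof Q B (tens Q B S R)"
 unfolding tens_def
proof (rule profI[OF xQ xB])
 fix x y assume "x:Obj Q" "y:Obj Q"
 then show "psh B (psh_coend Q B (tensD Q B S R x y))" by (rule psh_tensO[OF Q B S R])
next
 fix k l x x' y y' assume kl: "k:hom Q x' x" "l:hom Q y y'"
 show "tens_map B Q S R (Tgt Q k) (Src Q l) Q S R (Src Q k) (Tgt Q l)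
  (%x. x) (%x. FM S (k, Idn Q x)) (%x. FM R (Idn Q x, l)):phom B (psh_coend Q B (tensD Q B S R x y)) (psh_coend Q B (tensD Q B S R x' y'))"
  using tens_FM0(1)[OF kl] by (simp add: hom_Src[OF kl(1)] hom_Tgt[OF kl(1)] hom_Src[OF kl(2)] hom_Tgt[OF kl(2)])
next
 fix q q' b e assume q: "q:Obj Q" "q':Obj Q" and "e:sel B (psh_coend Q B (tensD Q B S R q q')) b"
 then obtain x c1 c2 u v h where *: "u:pe Q B S q x c1" "v:pe Q B R x q' c2" "h:fhom B b (c1 @ c2)"
  and e: "e = tens_in Q B S R q q' b x c1 c2 u v h"
  using tensO_E[OF Q B S R] by metis
 note i = Idn_hom[OF xQ q(1)] Idn_hom[OF xQ q(2)]
 show "app (tens_map B Q S R (Tgt Q (Idn Q q)) (Src Q (Idn Q q')) Q S R (Src Q (Idn Q q)) (Tgt Q (Idn Q q'))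
  (%x. x) (%x. FM S (Idn Q q, Idn Q x)) (%x. FM R (Idn Q x, Idn Q q'))) b e = e"
  unfolding hom_Src[OF i(1)] hom_Tgt[OF i(1)] hom_Src[OF i(2)] hom_Tgt[OF i(2)] e tens_FM0(2)[OF i *]
  prof_id[OF xQ xB S *(1)] prof_id[OF xQ xB R *(2)] ..
next
 fix k l k' l' q q' q0 q1 q00 q11 b e
 assume kl: "k:hom Q q0 q" "l:hom Q q' q1" "k':hom Q q00 q0" "l':hom Q q1 q11"
  and "e:sel B (psh_coend Q B (tensD Q B S R q q')) b"
 then obtain x c1 c2 u v h where *: "u:pe Q B S q x c1" "v:pe Q B R x q' c2" "h:fhom B b (c1 @ c2)"
  and e: "e = tens_in Q B S R q q' b x c1 c2 u v h"
  using tensO_E[OF Q B S R hom_obj2[OF xQ kl(1)] hom_obj1[OF xQ kl(2)]] by metis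
 note i = Idn_hom[OF xQ peD(2)[OF *(1)]]
 note c = Cmp_hom[OF xQ kl(3,1)] Cmp_hom[OF xQ kl(2,4)]
 note s = hom_Src[OF kl(1)] hom_Tgt[OF kl(1)] hom_Src[OF kl(2)] hom_Tgt[OF kl(2)]
  hom_Src[OF kl(3)] hom_Tgt[OF kl(3)] hom_Src[OF kl(4)] hom_Tgt[OF kl(4)]
  hom_Src[OF c(1)] hom_Tgt[OF c(1)] hom_Src[OF c(2)] hom_Tgt[OF c(2)]
 have uv: "app (FM S (k, Idn Q x)) c1 u:pe Q B S q0 x c1" "app (FM R (Idn Q x, l)) c2 v:pe Q B R x q1 c2"
  by (rule prof_mem[OF xQ xB S *(1) kl(1) i] prof_mem[OF xQ xB R *(2) i kl(2)])+
 show "app (tens_map B Q S R (Tgt Q (Cmp Q k k')) (Src Q (Cmp Q l' l)) Q S R (Src Q (Cmp Q k k')) (Tgt Q (Cmp Q l' l))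
  (%x. x) (%x. FM S (Cmp Q k k', Idn Q x)) (%x. FM R (Idn Q x, Cmp Q l' l))) b e = 
  app (tens_map B Q S R (Tgt Q k') (Src Q l') Q S R (Src Q k') (Tgt Q l')
  (%x. x) (%x. FM S (k', Idn Q x)) (%x. FM R (Idn Q x, l'))) b 
  (app (tens_map B Q S R (Tgt Q k) (Src Q l) Q S R (Src Q k) (Tgt Q l)
  (%x. x) (%x. FM S (k, Idn Q x)) (%x. FM R (Idn Q x, l))) b e)"
  unfolding s e tens_FM0(2)[OF kl(1,2) *] tens_FM0(2)[OF c *] tens_FM0(2)[OF kl(3,4) uv *(3)]
  prof_cmp[OF xQ xB S *(1) kl(1) i kl(3) i] prof_cmp[OF xQ xB R *(2) i kl(2) i kl(4)] Cmp_idl[OF xQ i] ..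
qed

lemma tens_mem:
 assumes "u:pe Q B S q x c1" "v:pe Q B R x q' c2" "h:fhom B b (c1 @ c2)"
 shows "tens_in Q B S R q q' b x c1 c2 u v h:pe Q B (tens Q B S R) q q' b"
 using tensO_in[OF Q B S R assms] peD(1)[OF assms(1)] peD(2)[OF assms(2)] by (intro peI) (simp_all add: tens_FO)

lemma tens_E:
 assumes e: "e:pe Q B (tens Q B S R) q q' b"
 obtains x c1 c2 u v h where "u:pe Q B S q x c1" "v:pe Q B R x q' c2" "h:fhom B b (c1 @ c2)"
  "e = tens_in Q B S R q q' b x c1 c2 u v h"
proof -
 have "e:sel B (psh_coend Q B (tensD Q B S R q q')) b"
  using peD[OF e] by (simp add: tens_FO)
 then show ?thesis
  by (rule tensO_E[OF Q B S R peD(1,2)[OF e]]) (rule that)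
qed

lemma tens_act:
 assumes "u:pe Q B S q x c1" "v:pe Q B R x q' c2" "h:fhom B b (c1 @ c2)" "be:fhom B b' b"
 shows "act (FO (tens Q B S R) (q, q')) be (tens_in Q B S R q q' b x c1 c2 u v h) = tens_in Q B S R q q' b' x c1 c2 u v (fcmp B h be)"
 using tensO_act[OF Q B S R assms] peD(1)[OF assms(1)] peD(2)[OF assms(2)] by (simp add: tens_FO)

end

section \<open>The unit\<close>

context
 fixes Q B :: "('u::universe, 'u) cat"
 assumes Q: "small_category Q" and B: "small_category B"
begin

private lemma uB: "category B" using B by (rule sl)
private lemma uQ: "category Q" using Q by (rule sl)

private lemma unit_ob: "psh B (tens_unit_ob Q B q q')"
 unfolding tens_unit_ob_def
proof (rule mk_pshI[OF uB])
 fix b assume "b:fob B"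
 have "covered TYPE('u) (hom Q q q')"
  by (rule covered_subset[of _ "Mor Q"]) (use Q in \<open>auto simp: small_category_def hom_def\<close>)
 then show "small (enc ` (hom Q q q' \<times> fhom B b []) :: 'u set)"
  unfolding covered_small[symmetric] by (intro covered_image covered_Sigma covered_free[OF B])
qed (auto simp: Let_def intro!: imageI)

text \<open>No arrow of a free monoidal category joins lists of different lengths. The copower of
  the representable at \<open>[]\<close> is therefore concentrated at \<open>[]\<close>, where it is
  a hom-set of states.\<close>

lemma unit_ob_simps:
 "x:sel B (tens_unit_ob Q B q q') b \<longleftrightarrow> b = [] & (EX m. x = en m & m:hom Q q q')"
 "m:hom Q q q' ==> act (tens_unit_ob Q B q q') [] (en m) = en m"
proof -
 show "x:sel B (tens_unit_ob Q B q q') b \<longleftrightarrow> b = [] & (EX m. x = en m & m:hom Q q q')"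
 proof (cases "b:fob B")
  case True
  then show ?thesis
  by (auto simp: sel_def tens_unit_ob_def mk_psh_simps)
 qed (auto simp: sel_def)
 show "m:hom Q q q' ==> act (tens_unit_ob Q B q q') [] (en m) = en m"
  unfolding tens_unit_ob_def by (subst mk_psh_simps(2)[of _ _ "[]" "[]"]) (auto simp: Let_def)
qed

private lemma unit_map:
 assumes kl: "k:hom Q x' x" "l:hom Q y y'"
 shows "mk_pmap B (tens_unit_ob Q B x y) (tens_unit_ob Q B x' y')
  (%_ x. let (m :: 'u, h :: 'u list) = dec x in enc (Cmp Q l (Cmp Q m k), h)):phom B (tens_unit_ob Q B x y) (tens_unit_ob Q B x' y')"
proof (rule mk_pmap_hom[OF uB unit_ob unit_ob])
 have 1: "Cmp Q l (Cmp Q m k):hom Q x' y'" if "m:hom Q x y" for m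
  using that kl by (intro Cmp_hom[OF uQ])
 show "(let (m :: 'u, h :: 'u list) = dec e in enc (Cmp Q l (Cmp Q m k), h)):sel B (tens_unit_ob Q B x' y') b"
  if "e:sel B (tens_unit_ob Q B x y) b" for b e
  using that 1 by (auto simp: unit_ob_simps)
 show "(let (m :: 'u, h :: 'u list) = dec (act (tens_unit_ob Q B x y) be e) in enc (Cmp Q l (Cmp Q m k), h)) =
  act (tens_unit_ob Q B x' y') be (let (m :: 'u, h :: 'u list) = dec e in enc (Cmp Q l (Cmp Q m k), h))"
  if "e:sel B (tens_unit_ob Q B x y) b" "be:fhom B b' b" for b b' be e
  using that 1 by (auto simp: unit_ob_simps)
qed

lemma unit_FM:
 assumes kl: "k:hom Q x' x" "l:hom Q y y'" and m: "m:hom Q x y"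
 shows "app (FM (tens_unit Q B) (k, l)) [] (en m) = en (Cmp Q l (Cmp Q m k))"
 using assms hom_Mor[OF kl(1)] hom_Mor[OF kl(2)]
 by (simp add: tens_unit_def app_mk_pmap unit_ob_simps hom_Src[OF kl(1)] hom_Tgt[OF kl(1)] hom_Src[OF kl(2)] hom_Tgt[OF kl(2)])

lemma unit_prof: "prof Q B (tens_unit Q B)"
 unfolding tens_unit_def
proof (rule profI[OF uQ uB])
 fix k l x x' y y' assume kl: "k:hom Q x' x" "l:hom Q y y'"
 show "mk_pmap B (tens_unit_ob Q B (Tgt Q k) (Src Q l)) (tens_unit_ob Q B (Src Q k) (Tgt Q l))
  (%_ x. let (m :: 'u, h :: 'u list) = dec x in enc (Cmp Q l (Cmp Q m k), h)):phom B (tens_unit_ob Q B x y) (tens_unit_ob Q B x' y')"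
  using unit_map[OF kl] by (simp only: hom_Src[OF kl(1)] hom_Tgt[OF kl(1)] hom_Src[OF kl(2)] hom_Tgt[OF kl(2)])
next
 fix x y b e assume xy: "x:Obj Q" "y:Obj Q" and e: "e:sel B (tens_unit_ob Q B x y) b"
 note i = Idn_hom[OF uQ xy(1)] Idn_hom[OF uQ xy(2)]
 obtain m where "b = []" "e = en m" "m:hom Q x y" using e by (auto simp: unit_ob_simps)
 then show "app (mk_pmap B (tens_unit_ob Q B (Tgt Q (Idn Q x)) (Src Q (Idn Q y))) (tens_unit_ob Q B (Src Q (Idn Q x)) (Tgt Q (Idn Q y)))
  (%_ z. let (m :: 'u, h :: 'u list) = dec z in enc (Cmp Q (Idn Q y) (Cmp Q m (Idn Q x)), h))) b e = e"
  using e by (simp add: hom_Src[OF i(1)] hom_Tgt[OF i(1)] hom_Src[OF i(2)] hom_Tgt[OF i(2)] app_mk_pmap Cmp_idl[OF uQ] Cmp_idr[OF uQ])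
next
 fix k l k' l' x x' x'' y y' y'' b e
 assume kl: "k:hom Q x' x" "l:hom Q y y'" "k':hom Q x'' x'" "l':hom Q y' y''"
  and e: "e:sel B (tens_unit_ob Q B x y) b"
 obtain m where m: "b = []" "e = en m" "m:hom Q x y" using e by (auto simp: unit_ob_simps)
 note c = Cmp_hom[OF uQ kl(3,1)] Cmp_hom[OF uQ kl(2,4)]
 have m': "Cmp Q l (Cmp Q m k):hom Q x' y'" using m kl by (intro Cmp_hom[OF uQ])
 have "Cmp Q (Cmp Q l' l) (Cmp Q m (Cmp Q k k')) = Cmp Q l' (Cmp Q (Cmp Q l (Cmp Q m k)) k')"
 proof -
  have "Cmp Q m (Cmp Q k k') = Cmp Q (Cmp Q m k) k'" by (rule Cmp_assoc[OF uQ kl(3,1) m(3)])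
  moreover have "Cmp Q l (Cmp Q (Cmp Q m k) k') = Cmp Q (Cmp Q l (Cmp Q m k)) k'"
  by (rule Cmp_assoc[OF uQ kl(3) Cmp_hom[OF uQ kl(1) m(3)] kl(2)])
  moreover have "Cmp Q l' (Cmp Q l (Cmp Q (Cmp Q m k) k')) = Cmp Q (Cmp Q l' l) (Cmp Q (Cmp Q m k) k')"
  by (rule Cmp_assoc[OF uQ Cmp_hom[OF uQ kl(3) Cmp_hom[OF uQ kl(1) m(3)]] kl(2,4)])
  ultimately show ?thesis by simp
 qed
 then show "app (mk_pmap B (tens_unit_ob Q B (Tgt Q (Cmp Q k k')) (Src Q (Cmp Q l' l))) (tens_unit_ob Q B (Src Q (Cmp Q k k')) (Tgt Q (Cmp Q l' l)))
  (%_ z. let (m :: 'u, h :: 'u list) = dec z in enc (Cmp Q (Cmp Q l' l) (Cmp Q m (Cmp Q k k')), h))) b e =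
  app (mk_pmap B (tens_unit_ob Q B (Tgt Q k') (Src Q l')) (tens_unit_ob Q B (Src Q k') (Tgt Q l'))
  (%_ z. let (m :: 'u, h :: 'u list) = dec z in enc (Cmp Q l' (Cmp Q m k'), h))) b
  (app (mk_pmap B (tens_unit_ob Q B (Tgt Q k) (Src Q l)) (tens_unit_ob Q B (Src Q k) (Tgt Q l))
  (%_ z. let (m :: 'u, h :: 'u list) = dec z in enc (Cmp Q l (Cmp Q m k), h))) b e)"
  using m m' by (simp add: hom_Src[OF kl(1)] hom_Tgt[OF kl(1)] hom_Src[OF kl(2)] hom_Tgt[OF kl(2)]
  hom_Src[OF kl(3)] hom_Tgt[OF kl(3)] hom_Src[OF kl(4)] hom_Tgt[OF kl(4)]
  hom_Src[OF c(1)] hom_Tgt[OF c(1)] hom_Src[OF c(2)] hom_Tgt[OF c(2)] app_mk_pmap unit_ob_simps)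
qed (rule unit_ob)

lemma unit_pe: "x:pe Q B (tens_unit Q B) q q' b \<longleftrightarrow> b = [] & (EX m. x = en m & m:hom Q q q')"
proof (cases "q:Obj Q & q':Obj Q")
 case True
 then show ?thesis by (simp add: pel_def tens_unit_def unit_ob_simps)
qed (auto simp: pel_def dest: hom_objs[OF uQ])

end

section \<open>Extension of a 2-transducer to lists\<close>

text \<open>
 \<open>E t as q q' b\<close> is the set \<open>t(as; q, q')[b]\<close> (empty for invalid indices), and \<open>X\<close>, \<open>Act\<close> are the actions
 on it of arrows in \<open>(as, q, q')\<close> and in \<open>b\<close>.
\<close>

text \<open>\<open>E t as q q' b\<close> is the paper's \<open>t(as; q, q')[b]\<close>; \<open>X\<close> and \<open>Act\<close> are its covariant and contravariant actions.\<close>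

definition E :: "'u::universe tdx => 'u list => 'u => 'u => 'u list => 'u set" where
 "E t as q q' b = pel (free_cat (TSrc t) \<times>\<^sub>c op_cat (St t) \<times>\<^sub>c St t) (TTgt t) (lext t) (as, q, q') b"

definition X :: "'u::universe tdx => 'u list => 'u => 'u => 'u list => 'u => 'u" where
 "X t al k l b e = app (FM (lext t) (al, k, l)) b e"

abbreviation "Act t as q q' == act (FO (lext t) (as, q, q'))"

abbreviation "D3 t == TSrc t \<times>\<^sub>c op_cat (St t) \<times>\<^sub>c St t"
abbreviation "DL t == free_cat (TSrc t) \<times>\<^sub>c op_cat (St t) \<times>\<^sub>c St t"
abbreviation "DP t == psh_cat (TSrc t) \<times>\<^sub>c op_cat (St t) \<times>\<^sub>c St t"

locale tdx =
 fixes t :: "'u::universe tdx"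
 assumes tdx: "is_tdx t"
begin

abbreviation "A == TSrc t"
abbreviation "B == TTgt t"
abbreviation "Q == St t"

lemma smallA: "small_category A" and smallB: "small_category B" and smallQ: "small_category Q"
 and Tf: "is_functor (D3 t) (psh_cat B) (Tf t)"
 using tdx by (auto simp: is_tdx_def)

lemmas catA = sl[OF smallA] and catB = sl[OF smallB] and catQ = sl[OF smallQ]
lemmas catFA = category_free[OF catA] and catFB = category_free[OF catB]

lemma catT: "category (D3 t)"
 by (intro category_prod category_op catA catQ)

lemma tlet_simps:
 "a:Obj A ==> q:Obj Q ==> q':Obj Q ==> FO (tlet t a) (q, q') = FO (Tf t) (a, q, q')"
 "k:Mor Q ==> l:Mor Q ==> FM (tlet t a) (k, l) = FM (Tf t) (Idn A a, k, l)"
 by (auto simp: tlet_def)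

lemma tlet_prof:
 assumes a: "a:Obj A"
 shows "prof Q B (tlet t a)"
 unfolding tlet_def
proof (rule profI[OF catQ catB])
 note i = Idn_hom[OF catA a]
 show "psh B (FO (Tf t) (a, x, y))" if "x:Obj Q" "y:Obj Q" for x y
  using functor_obj[OF Tf, of "(a, x, y)"] that a by simp
 show "FM (Tf t) (Idn A a, k, l):phom B (FO (Tf t) (a, x, y)) (FO (Tf t) (a, x', y'))"
  if "k:hom Q x' x" "l:hom Q y y'" for k l x x' y y'
  using functor_hom[OF Tf, of "(Idn A a, k, l)" "(a, x, y)" "(a, x', y')"] that i by simp
 show "app (FM (Tf t) (Idn A a, Idn Q x, Idn Q y)) b e = e"
  if "x:Obj Q" "y:Obj Q" "e:sel B (FO (Tf t) (a, x, y)) b" for x y b e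
  using FM_id[OF catB catT Tf, of e "(a, x, y)" b] that a by (simp add: pel_def)
 show "app (FM (Tf t) (Idn A a, Cmp Q k k', Cmp Q l' l)) b e = app (FM (Tf t) (Idn A a, k', l')) b (app (FM (Tf t) (Idn A a, k, l)) b e)"
  if kl: "k:hom Q x' x" "l:hom Q y y'" "k':hom Q x'' x'" "l':hom Q y' y''" and "e:sel B (FO (Tf t) (a, x, y)) b"
  for k l k' l' x x' x'' y y' y'' b e
  using FM_cmp[OF catB catT Tf, of e "(a, x, y)" b "(Idn A a, k, l)" "(a, x', y')" "(Idn A a, k', l')" "(a, x'', y'')"]
  that a i hom_obj2[OF catQ kl(1)] hom_obj1[OF catQ kl(2)] by (simp add: pel_def Cmp_idl[OF catA i])
qed

lemma tlist_prof: "as:fob A ==> prof Q B (tlist t as)"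
 by (induction as rule: induct_list012) (simp_all add: tlet_prof tens_prof smallQ smallB unit_prof)

text \<open>Typing of \<open>tlist_map\<close> together with its naturality in the states. The two
  go through one induction: naturality at the tail is what makes the map at the next letter well
  defined on the coend over the middle state.\<close>

definition TM where
 "TM als as as' \<longleftrightarrow>
  (ALL q:Obj Q. ALL q':Obj Q. tlist_map t als q q':phom B (FO (tlist t as) (q, q')) (FO (tlist t as') (q, q'))) &
  (ALL q q' q0 q1 k l e b. k:hom Q q0 q --> l:hom Q q' q1 --> e:pe Q B (tlist t as) q q' b -->
  app (tlist_map t als q0 q1) b (app (FM (tlist t as) (k, l)) b e) =
  app (FM (tlist t as') (k, l)) b (app (tlist_map t als q q') b e))"

lemma TM_phom: "TM als as as' ==> q:Obj Q ==> q':Obj Q ==>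
  tlist_map t als q q':phom B (FO (tlist t as) (q, q')) (FO (tlist t as') (q, q'))"
 and TM_nat: "TM als as as' ==> k:hom Q q0 q ==> l:hom Q q' q1 ==> e:pe Q B (tlist t as) q q' b ==>
  app (tlist_map t als q0 q1) b (app (FM (tlist t as) (k, l)) b e) =
  app (FM (tlist t as') (k, l)) b (app (tlist_map t als q q') b e)"
 by (simp_all add: TM_def)

lemma TM_mem: "TM als as as' ==> e:pe Q B (tlist t as) q q' b ==> app (tlist_map t als q q') b e:pe Q B (tlist t as') q q' b"
proof -
 assume TM: "TM als as as'" and e: "e:pe Q B (tlist t as) q q' b"
 note o = peD(1,2)[OF e]
 show ?thesis
  by (rule peI[OF app_mem[OF catB TM_phom[OF TM o] peD(4)[OF e]] o])
qed

text \<open>Letters and states are independent arguments of \<open>Tf t\<close>, so both sides are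
  its value at one and the same triple of arrows.\<close>

lemma TM_letter:
 assumes al: "al:hom A a a'"
 shows "TM [al] [a] [a']"
 unfolding TM_def
proof (intro conjI ballI allI impI)
 note o = hom_objs[OF catA al]
 note i = Idn_hom[OF catA o(1)] Idn_hom[OF catA o(2)]
 show "tlist_map t [al] q q':phom B (FO (tlist t [a]) (q, q')) (FO (tlist t [a']) (q, q'))" if "q:Obj Q" "q':Obj Q" for q q'
  using functor_hom[OF Tf, of "(al, Idn Q q, Idn Q q')" "(a, q, q')" "(a', q, q')"] that al o
  by (simp add: tlet_simps Idn_hom[OF catQ])
 fix q q' q0 q1 k l e b
 assume kl: "k:hom Q q0 q" "l:hom Q q' q1" and e: "e:pe Q B (tlist t [a]) q q' b"
 note oq = hom_objs[OF catQ kl(1)] hom_objs[OF catQ kl(2)]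
 have e': "e:pel (D3 t) B (Tf t) (a, q, q') b"
  using peD[OF e] o by (simp add: pel_def tlet_simps)
 note C = FM_cmp[OF catB catT Tf e', of "(Idn A a, k, l)" "(a, q0, q1)" "(al, Idn Q q0, Idn Q q1)" "(a', q0, q1)"]
  FM_cmp[OF catB catT Tf e', of "(al, Idn Q q, Idn Q q')" "(a', q, q')" "(Idn A a', k, l)" "(a', q0, q1)"]
 show "app (tlist_map t [al] q0 q1) b (app (FM (tlist t [a]) (k, l)) b e) =
  app (FM (tlist t [a']) (k, l)) b (app (tlist_map t [al] q q') b e)"
  using C kl al i oq hom_Mor[OF kl(1)] hom_Mor[OF kl(2)]
  by (simp add: tlet_simps Idn_hom[OF catQ] Cmp_idl[OF catA al] Cmp_idr[OF catA al]
  Cmp_idl[OF catQ kl(1)] Cmp_idr[OF catQ kl(1)] Cmp_idl[OF catQ kl(2)] Cmp_idr[OF catQ kl(2)])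
qed

text \<open>Arrow lists of length at least two are handled through their first letter and tail.\<close>

lemma tlist_map_gen:
 assumes al: "al:hom A a a'" and als: "als:fhom A as as'" "als ~= []" and TM: "TM als as as'"
 shows "q:Obj Q ==> q':Obj Q ==> tlist_map t (al # als) q q':phom B (FO (tlist t (a # as)) (q, q')) (FO (tlist t (a' # as')) (q, q'))"
  and "u:pe Q B (tlet t a) q x c1 ==> v:pe Q B (tlist t as) x q' c2 ==> h:fhom B b (c1 @ c2) ==>
  app (tlist_map t (al # als) q q') b (tens_in Q B (tlet t a) (tlist t as) q q' b x c1 c2 u v h) =
  tens_in Q B (tlet t a') (tlist t as') q q' b x c1 c2 (app (tlist_map t [al] q x) c1 u) (app (tlist_map t als x q') c2 v) h"
proof -
 obtain al' alr where r: "als = al' # alr" using als by (cases als) auto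
 obtain b0 br b1 br' where r': "as = b0 # br" "as' = b1 # br'" using als(1) fhom_Cons_arr unfolding r by metis
 note L = TM_letter[OF al]
 note s = hom_Src[OF al] hom_Tgt[OF al] hom_Src[OF als(1), unfolded r] hom_Tgt[OF als(1), unfolded r]
 note o = hom_objs[OF catA al] hom_objs[OF catFA als(1)]
 note P = tlet_prof[OF o(1)] tlist_prof[OF o(3)] tlet_prof[OF o(2)] tlist_prof[OF o(4)]
 have eq: "tlist_map t (al # als) q q' = tens_map B Q (tlet t a) (tlist t as) q q' Q (tlet t a') (tlist t as') q q'
  (%x. x) (%x. tlist_map t [al] q x) (%x. tlist_map t als x q')" for q q'
  using s by (simp add: r)
 have *: "tens_in Q B (tlet t a') (tlist t as') q q' b y c1 c2 (app (tlist_map t [al] q y) c1 (app (FM (tlet t a) (Idn Q q, l)) c1 u)) (app (tlist_map t als y q') c2 v) h =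
  tens_in Q B (tlet t a') (tlist t as') q q' b x c1 c2 (app (tlist_map t [al] q x) c1 u) (app (tlist_map t als x q') c2 (app (FM (tlist t as) (l, Idn Q q')) c2 v)) h"
  if l: "l:hom Q x y" and u: "u:pe Q B (tlet t a) q x c1" and v: "v:pe Q B (tlist t as) y q' c2" and h: "h:fhom B b (c1 @ c2)"
  for x y l c1 c2 u v h b q q'
 proof -
  note i = Idn_hom[OF catQ peD(1)[OF u]] Idn_hom[OF catQ peD(2)[OF v]]
  have u': "u:pe Q B (tlist t [a]) q x c1" using u by simp
  show ?thesis
  using tens_slide_state[OF smallQ smallB P(3,4) l TM_mem[OF L u', simplified] TM_mem[OF TM v] h]
  TM_nat[OF L i(1) l u'] TM_nat[OF TM l i(2) v] by simp
 qed
 note T = tens_map[where ka = "%x. x" and si = "%x. tlist_map t [al] q x" and rh = "%x. tlist_map t als x q'",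
  OF smallB smallQ smallQ P _ _ _ _ _ TM_phom[OF L, unfolded tlist.simps] TM_phom[OF TM] *, folded eq]
 show "tlist_map t (al # als) q q':phom B (FO (tlist t (a # as)) (q, q')) (FO (tlist t (a' # as')) (q, q'))" if q: "q:Obj Q" "q':Obj Q"
 proof -
  have "tlist_map t (al # als) q q':phom B (psh_coend Q B (tensD Q B (tlet t a) (tlist t as) q q'))
  (psh_coend Q B (tensD Q B (tlet t a') (tlist t as') q q'))"
  by (rule T(1)) (assumption | rule q)+
  then show ?thesis
  using q P by (simp add: tens_FO[OF smallQ smallB] r')
 qed
 show "app (tlist_map t (al # als) q q') b (tens_in Q B (tlet t a) (tlist t as) q q' b x c1 c2 u v h) =
  tens_in Q B (tlet t a') (tlist t as') q q' b x c1 c2 (app (tlist_map t [al] q x) c1 u) (app (tlist_map t als x q') c2 v) h"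
  if u: "u:pe Q B (tlet t a) q x c1" and v: "v:pe Q B (tlist t as) x q' c2" and h: "h:fhom B b (c1 @ c2)"
  by (rule T(2)) (assumption | rule u v h peD(1)[OF u] peD(2)[OF v])+
qed

lemma tens_E_list:
 assumes "a:Obj A" "as:fob A" "as ~= []" "e:pe Q B (tlist t (a # as)) q q' b"
 obtains x c1 c2 u v h where "u:pe Q B (tlet t a) q x c1" "v:pe Q B (tlist t as) x q' c2" "h:fhom B b (c1 @ c2)"
  "e = tens_in Q B (tlet t a) (tlist t as) q q' b x c1 c2 u v h"
proof -
 have "e:pe Q B (tens Q B (tlet t a) (tlist t as)) q q' b"
  using assms(3,4) by (cases as) auto
 then show ?thesis
  by (rule tens_E[OF smallQ smallB tlet_prof[OF assms(1)] tlist_prof[OF assms(2)]]) (rule that)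
qed

lemma tlist_FM_gen:
 assumes "a:Obj A" "as:fob A" "as ~= []" "k:hom Q q0 q" "l:hom Q q' q1"
  "u:pe Q B (tlet t a) q x c1" "v:pe Q B (tlist t as) x q' c2" "h:fhom B b (c1 @ c2)"
 shows "app (FM (tlist t (a # as)) (k, l)) b (tens_in Q B (tlet t a) (tlist t as) q q' b x c1 c2 u v h) =
  tens_in Q B (tlet t a) (tlist t as) q0 q1 b x c1 c2 (app (FM (tlet t a) (k, Idn Q x)) c1 u) (app (FM (tlist t as) (Idn Q x, l)) c2 v) h"
 using tens_FM[OF smallQ smallB tlet_prof[OF assms(1)] tlist_prof[OF assms(2)] assms(4-)] assms(3)
 by (cases as) auto

text \<open>The induction splits off the first letter. A one-letter list is no tensor product, so it
  is settled by \<open>TM_letter\<close> and not by the recursion.\<close>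

lemma TM: "als:fhom A as as' ==> TM als as as'"
proof (induction als arbitrary: as as')
 case Nil
 then have [simp]: "as = []" "as' = []" by auto
 show ?case
  unfolding TM_def
 proof (intro conjI ballI allI impI)
  show "tlist_map t [] q q':phom B (FO (tlist t as) (q, q')) (FO (tlist t as') (q, q'))" if "q:Obj Q" "q':Obj Q" for q q'
  using that prof_psh[OF unit_prof[OF smallQ smallB]] by (simp add: phom_id[OF catB])
  fix q q' q0 q1 k l e b assume kl: "k:hom Q q0 q" "l:hom Q q' q1" and e: "e:pe Q B (tlist t as) q q' b"
  have e': "e:pe Q B (tens_unit Q B) q q' b" using e by simp
  show "app (tlist_map t [] q0 q1) b (app (FM (tlist t as) (k, l)) b e) = app (FM (tlist t as') (k, l)) b (app (tlist_map t [] q q') b e)"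
  using peD(4)[OF e'] peD(4)[OF prof_mem[OF catQ catB unit_prof[OF smallQ smallB] e' kl]] by (simp add: app_id)
 qed
next
 case (Cons al als)
 then obtain a ar a' ar' where r: "as = a # ar" "as' = a' # ar'" "al:hom A a a'" "als:fhom A ar ar'"
  using fhom_Cons_arr by metis
 show ?case
 proof (cases "als = []")
  case True
  then show ?thesis using r TM_letter by auto
 next
  case False
  note IH = Cons.IH[OF r(4)]
  note L = TM_letter[OF r(3)]
  note G = tlist_map_gen[OF r(3,4) False IH]
  have ne: "ar ~= []" "ar' ~= []" using r(4) False by auto
  note o = hom_objs[OF catA r(3)] hom_objs[OF catFA r(4)]
  show ?thesis
  unfolding TM_def r
  proof (intro conjI ballI allI impI)
  fix q q' q0 q1 k l e b assume kl: "k:hom Q q0 q" "l:hom Q q' q1" and e: "e:pe Q B (tlist t (a # ar)) q q' b"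
  obtain x c1 c2 u v h where u: "u:pe Q B (tlet t a) q x c1" and v: "v:pe Q B (tlist t ar) x q' c2" and h: "h:fhom B b (c1 @ c2)"
  and e: "e = tens_in Q B (tlet t a) (tlist t ar) q q' b x c1 c2 u v h"
  using tens_E_list[OF o(1,3) ne(1) e] by metis
  have u': "u:pe Q B (tlist t [a]) q x c1" using u by simp
  note i = Idn_hom[OF catQ peD(2)[OF u]]
  note uv = TM_mem[OF L u', unfolded tlist.simps] TM_mem[OF IH v]
  note uv' = prof_mem[OF catQ catB tlet_prof[OF o(1)] u kl(1) i] prof_mem[OF catQ catB tlist_prof[OF o(3)] v i kl(2)]
  show "app (tlist_map t (al # als) q0 q1) b (app (FM (tlist t (a # ar)) (k, l)) b e) =
  app (FM (tlist t (a' # ar')) (k, l)) b (app (tlist_map t (al # als) q q') b e)"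
  unfolding e G(2)[OF u v h] tlist_FM_gen[OF o(1,3) ne(1) kl u v h] tlist_FM_gen[OF o(2,4) ne(2) kl uv h]
  G(2)[OF uv' h]
  using TM_nat[OF L kl(1) i u'] TM_nat[OF IH i kl(2) v] by simp
  qed (rule G(1))
 qed
qed

lemma TM_id: "as:fob A ==> e:pe Q B (tlist t as) q q' b ==> app (tlist_map t (fid A as) q q') b e = e"
proof (induction as arbitrary: e q q' b)
 case Nil
 then show ?case using peD(4) by (fastforce simp: app_id)
next
 case (Cons a as)
 then have o: "a:Obj A" "as:fob A" by auto
 have L: "app (tlist_map t [Idn A a] q q') b e = e" if "e:pe Q B (tlet t a) q q' b" for e q q' b
  using FM_id[OF catB catT Tf, of e "(a, q, q')" b] peD[OF that] o by (simp add: tlet_simps pel_def)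
 show ?case
 proof (cases "as = []")
  case True
  then show ?thesis using L Cons.prems by simp
 next
  case False
  obtain x c1 c2 u v h where u: "u:pe Q B (tlet t a) q x c1" and v: "v:pe Q B (tlist t as) x q' c2" and h: "h:fhom B b (c1 @ c2)"
  and e: "e = tens_in Q B (tlet t a) (tlist t as) q q' b x c1 c2 u v h"
  using tens_E_list[OF o False Cons.prems(2)] by metis
  have ne: "fid A as ~= []" using False by (cases as) auto
  note i = Idn_hom[OF catA o(1)] Idn_hom[OF catFA o(2)]
  show ?thesis
  using tlist_map_gen(2)[OF i(1) i(2) ne TM[OF i(2)] u v h] L[OF u] Cons.IH[OF o(2) v] by (simp add: e)
 qed
qed

lemma TM_cmp:
 "als:fhom A as as' ==> bes:fhom A as' as'' ==> e:pe Q B (tlist t as) q q' b ==>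
  app (tlist_map t (fcmp A bes als) q q') b e = app (tlist_map t bes q q') b (app (tlist_map t als q q') b e)"
proof (induction als arbitrary: as as' as'' bes e q q' b)
 case Nil
 then have [simp]: "as = []" "as' = []" "bes = []" by auto
 show ?case using Nil.prems(3) peD(4) by (fastforce simp: app_id)
next
 case (Cons al als)
 then obtain a ar a' ar' where r: "as = a # ar" "as' = a' # ar'" "al:hom A a a'" "als:fhom A ar ar'"
  using fhom_Cons_arr by metis
 then obtain be ber a'' ar'' where r': "as'' = a'' # ar''" "bes = be # ber" "be:hom A a' a''" "ber:fhom A ar' ar''"
  using Cons.prems(2) fhom_Cons_left by metis
 note o = hom_objs[OF catA r(3)] hom_objs[OF catFA r(4)]
 have L: "app (tlist_map t [Cmp A be al] q q') b e = app (tlist_map t [be] q q') b (app (tlist_map t [al] q q') b e)" if e: "e:pe Q B (tlet t a) q q' b" for e q q' b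
 proof -
  note oq = peD(1,2)[OF e]
  show ?thesis
  using FM_cmp[OF catB catT Tf, of e "(a, q, q')" b "(al, Idn Q q, Idn Q q')" "(a', q, q')" "(be, Idn Q q, Idn Q q')" "(a'', q, q')"] e o r r'
  by (simp add: tlet_simps pel_def Idn_hom[OF catQ] Cmp_idl[OF catQ Idn_hom[OF catQ]] oq)
 qed
 show ?case
 proof (cases "als = []")
  case True
  then show ?thesis using L Cons.prems r r' by auto
 next
  case False
  have ne: "ar ~= []" "ber ~= []" "fcmp A ber als ~= []"
  using r(4) r'(4) False by (auto; cases als; cases ber; auto)+
  obtain x c1 c2 u v h where u: "u:pe Q B (tlet t a) q x c1" and v: "v:pe Q B (tlist t ar) x q' c2" and h: "h:fhom B b (c1 @ c2)"
  and e: "e = tens_in Q B (tlet t a) (tlist t ar) q q' b x c1 c2 u v h"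
  using tens_E_list[OF o(1,3) ne(1)] Cons.prems(3) r(1) by metis
  have u': "u:pe Q B (tlist t [a]) q x c1" using u by simp
  note c = Cmp_hom[OF catA r(3) r'(3)] Cmp_hom[OF catFA r(4) r'(4)]
  note uv = TM_mem[OF TM_letter[OF r(3)] u', unfolded tlist.simps] TM_mem[OF TM[OF r(4)] v]
  show ?thesis
  unfolding e r' free_simps tlist_map_gen(2)[OF c ne(3) TM[OF c(2)] u v h] tlist_map_gen(2)[OF r(3,4) False TM[OF r(4)] u v h]
  tlist_map_gen(2)[OF r'(3,4) ne(2) TM[OF r'(4)] uv h] L[OF u] Cons.IH[OF r(4) r'(4) v] ..
 qed
qed

section \<open>Functoriality of the extension to lists\<close>

lemma catL: "category (DL t)"
 by (intro category_prod category_op catFA catQ)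

lemma lext_mor:
 assumes "al:fhom A as as'" "k:hom Q q0 q" "l:hom Q q' q1"
 shows "Cmp (psh_cat B) (FM (tlist t as') (k, l)) (tlist_map t al q q'):phom B (FO (tlist t as) (q, q')) (FO (tlist t as') (q0, q1))" (is "PROP ?Ga")
  and "e:sel B (FO (tlist t as) (q, q')) b ==>
  app (Cmp (psh_cat B) (FM (tlist t as') (k, l)) (tlist_map t al q q')) b e = app (FM (tlist t as') (k, l)) b (app (tlist_map t al q q') b e)"
proof -
 have 1: "tlist_map t al q q':phom B (FO (tlist t as) (q, q')) (FO (tlist t as') (q, q'))"
  by (rule TM_phom[OF TM[OF assms(1)] hom_obj2[OF catQ assms(2)] hom_obj1[OF catQ assms(3)]])
 have 2: "FM (tlist t as') (k, l):phom B (FO (tlist t as') (q, q')) (FO (tlist t as') (q0, q1))"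
  by (rule prof_phom[OF tlist_prof[OF hom_obj2[OF catFA assms(1)]] assms(2,3)])
 show "PROP ?Ga"
  by (rule phom_cmp[OF catB 1 2])
 show "app (Cmp (psh_cat B) (FM (tlist t as') (k, l)) (tlist_map t al q q')) b e = app (FM (tlist t as') (k, l)) b (app (tlist_map t al q q') b e)"
  if "e:sel B (FO (tlist t as) (q, q')) b"
  by (rule app_cmp[OF catB 1 2 that])
qed

lemma lext_FM0:
 assumes "al:fhom A as as'" "k:hom Q q0 q" "l:hom Q q' q1"
 shows "(case (al, k, l) of (als, k, l) => Cmp (psh_cat B) (FM (tlist t (Tgt (free_cat A) als)) (k, l))
  (tlist_map t als (Tgt Q k) (Src Q l))) = Cmp (psh_cat B) (FM (tlist t as') (k, l)) (tlist_map t al q q')"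
 unfolding prod.case hom_Tgt[OF assms(1)] hom_Tgt[OF assms(2)] hom_Src[OF assms(3)] ..

text \<open>Arrows of letters and arrows of states are each functorial on their own;
  \<open>TM_nat\<close> lets them pass each other, so that a composite of two mixed arrows can be
  sorted.\<close>

lemma lext_functor: "is_functor (DL t) (psh_cat B) (lext t)"
 unfolding lext_def
proof (rule functor_pshI[OF catB catL])
 fix x assume "x:Obj (DL t)"
 then show "psh B (case x of (as, q, q') => FO (tlist t as) (q, q'))"
  by (cases x) (auto intro!: prof_psh tlist_prof)
next
 fix x y f assume "f:hom (DL t) x y"
 then obtain as as' q q' q0 q1 al k l where *: "x = (as, q, q')" "y = (as', q0, q1)" "f = (al, k, l)" 
  "al:fhom A as as'" "k:hom Q q0 q" "l:hom Q q' q1"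
  by (cases x; cases y; cases f) simp
 show "(case f of (als, k, l) => Cmp (psh_cat B) (FM (tlist t (Tgt (free_cat A) als)) (k, l))
  (tlist_map t als (Tgt Q k) (Src Q l))):phom B (case x of (as, q, q') => FO (tlist t as) (q, q')) (case y of (as, q, q') => FO (tlist t as) (q, q'))"
  unfolding *(1-3) lext_FM0[OF *(4-6)] unfolding prod.case by (rule lext_mor(1)[OF *(4-6)])
next
 fix x b e assume x: "x:Obj (DL t)" and e: "e:sel B (case x of (as, q, q') => FO (tlist t as) (q, q')) b"
 obtain as q q' where *: "x = (as, q, q')" "as:fob A" "q:Obj Q" "q':Obj Q" using x by (cases x) auto
 note i = Idn_hom[OF catFA *(2)] Idn_hom[OF catQ *(3)] Idn_hom[OF catQ *(4)]
 have e': "e:sel B (FO (tlist t as) (q, q')) b" using e * by simp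
 note e'' = peI[OF e' *(3,4)]
 show "app (case Idn (DL t) x of (als, k, l) => Cmp (psh_cat B) (FM (tlist t (Tgt (free_cat A) als)) (k, l))
  (tlist_map t als (Tgt Q k) (Src Q l))) b e = e"
  unfolding * prod_simps op_simps lext_FM0[OF i] lext_mor(2)[OF i e'] TM_id[OF *(2) e'']
  by (rule prof_id[OF catQ catB tlist_prof[OF *(2)] e''])
next
 fix x y z f g b e assume f: "f:hom (DL t) x y" and g: "g:hom (DL t) y z"
  and e: "e:sel B (case x of (as, q, q') => FO (tlist t as) (q, q')) b"
 obtain as as' q q' q0 q1 al k l where *: "x = (as, q, q')" "y = (as', q0, q1)" "f = (al, k, l)" 
  "al:fhom A as as'" "k:hom Q q0 q" "l:hom Q q' q1"
  using f by (cases x; cases y; cases f) simp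
 obtain as'' q00 q11 al' k' l' where **: "z = (as'', q00, q11)" "g = (al', k', l')" 
  "al':fhom A as' as''" "k':hom Q q00 q0" "l':hom Q q1 q11"
  using g *(2) by (cases z; cases g) simp
 note c = Cmp_hom[OF catFA *(4) **(3)] Cmp_hom[OF catQ **(4) *(5)] Cmp_hom[OF catQ *(6) **(5)]
 have e': "e:sel B (FO (tlist t as) (q, q')) b" using e * by simp
 note e'' = peI[OF e' hom_obj2[OF catQ *(5)] hom_obj1[OF catQ *(6)]]
 note m = TM_mem[OF TM[OF *(4)] e'']
 note m' = prof_mem[OF catQ catB tlist_prof[OF hom_obj2[OF catFA *(4)]] m *(5,6)]
 note m2 = TM_mem[OF TM[OF **(3)] m]
 show "app (case Cmp (DL t) g f of (als, k, l) => Cmp (psh_cat B) (FM (tlist t (Tgt (free_cat A) als)) (k, l))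
  (tlist_map t als (Tgt Q k) (Src Q l))) b e =
  app (case g of (als, k, l) => Cmp (psh_cat B) (FM (tlist t (Tgt (free_cat A) als)) (k, l))
  (tlist_map t als (Tgt Q k) (Src Q l))) b
  (app (case f of (als, k, l) => Cmp (psh_cat B) (FM (tlist t (Tgt (free_cat A) als)) (k, l))
  (tlist_map t als (Tgt Q k) (Src Q l))) b e)"
  unfolding *(1-3) **(1,2) prod_simps op_simps lext_FM0[OF c] lext_FM0[OF *(4-6)] lext_FM0[OF **(3-5)]
  lext_mor(2)[OF c e'] lext_mor(2)[OF *(4-6) e'] lext_mor(2)[OF **(3-5) peD(4)[OF m']]
  TM_nat[OF TM[OF **(3)] *(5,6) m] TM_cmp[OF *(4) **(3) e'']
  by (rule prof_cmp[OF catQ catB tlist_prof[OF hom_obj2[OF catFA **(3)]] m2 *(5,6) **(4,5), symmetric])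
qed

end

text \<open>The conditions for a family \<open>F\<close>, indexed by splittings of an element along
  \<open>c1 @ c2\<close>, to descend to the extension at the concatenated list: the first clause is
  the relation over the middle state, the second the relation over the target lists. When
  \<open>c1\<close> is a single letter and \<open>c2\<close> is nonempty, these are the hypotheses
  of \<open>tens_desc_in\<close>.\<close>

definition cowedge :: "'u::universe tdx => 'u list => 'u list => 'u => 'u => 'u list =>
  ('u => 'u list => 'u list => 'u => 'u => 'u list => 'z) => bool" where
 "cowedge t c1 c2 r r' d F \<longleftrightarrow>
  (ALL w w' l d1 d2 e1 e2 h. l:hom (St t) w w' --> e1:E t c1 r w d1 --> e2:E t c2 w' r' d2 -->
  h:fhom (TTgt t) d (d1 @ d2) -->
  F w' d1 d2 (X t (fid (TSrc t) c1) (Idn (St t) r) l d1 e1) e2 h =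
  F w d1 d2 e1 (X t (fid (TSrc t) c2) l (Idn (St t) r') d2 e2) h) &
  (ALL w d1 d1' d2 d2' k1 k2 e1 e2 h. k1:fhom (TTgt t) d1' d1 --> k2:fhom (TTgt t) d2' d2 -->
  e1:E t c1 r w d1 --> e2:E t c2 w r' d2 --> h:fhom (TTgt t) d (d1' @ d2') -->
  F w d1' d2' (Act t c1 r w k1 e1) (Act t c2 w r' k2 e2) h = F w d1 d2 e1 e2 (fcmp (TTgt t) (k1 @ k2) h))"

lemma cowedgeD:
 assumes "cowedge t c1 c2 r r' d F"
 shows "l:hom (St t) w w' ==> e1:E t c1 r w d1 ==> e2:E t c2 w' r' d2 ==> h:fhom (TTgt t) d (d1 @ d2) ==>
  F w' d1 d2 (X t (fid (TSrc t) c1) (Idn (St t) r) l d1 e1) e2 h = F w d1 d2 e1 (X t (fid (TSrc t) c2) l (Idn (St t) r') d2 e2) h"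
  and "k1:fhom (TTgt t) d1' d1 ==> k2:fhom (TTgt t) d2' d2 ==>
  e1:E t c1 r w d1 ==> e2:E t c2 w r' d2 ==> h:fhom (TTgt t) d (d1' @ d2') ==>
  F w d1' d2' (Act t c1 r w k1 e1) (Act t c2 w r' k2 e2) h = F w d1 d2 e1 e2 (fcmp (TTgt t) (k1 @ k2) h)"
 using assms unfolding cowedge_def by blast+

lemma cowedgeI:
 assumes "!!w w' l d1 d2 e1 e2 h. l:hom (St t) w w' ==> e1:E t c1 r w d1 ==> e2:E t c2 w' r' d2 ==> h:fhom (TTgt t) d (d1 @ d2) ==>
  F w' d1 d2 (X t (fid (TSrc t) c1) (Idn (St t) r) l d1 e1) e2 h = F w d1 d2 e1 (X t (fid (TSrc t) c2) l (Idn (St t) r') d2 e2) h"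
  and "!!w d1 d1' d2 d2' k1 k2 e1 e2 h. k1:fhom (TTgt t) d1' d1 ==> k2:fhom (TTgt t) d2' d2 ==>
  e1:E t c1 r w d1 ==> e2:E t c2 w r' d2 ==> h:fhom (TTgt t) d (d1' @ d2') ==>
  F w d1' d2' (Act t c1 r w k1 e1) (Act t c2 w r' k2 e2) h = F w d1 d2 e1 e2 (fcmp (TTgt t) (k1 @ k2) h)"
 shows "cowedge t c1 c2 r r' d F"
 unfolding cowedge_def using assms by blast

context tdx
begin

lemma lext_FO: "as:fob A ==> q:Obj Q ==> q':Obj Q ==> FO (lext t) (as, q, q') = FO (tlist t as) (q, q')"
 by (simp add: lext_def)

lemma E_iff: "e:E t as q q' b \<longleftrightarrow> as:fob A & e:pe Q B (tlist t as) q q' b"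
 by (auto simp: E_def pel_def lext_FO)

lemma E_D:
 assumes "e:E t as q q' b"
 shows "as:fob A" "q:Obj Q" "q':Obj Q" "b:fob B" "e:pe Q B (tlist t as) q q' b"
 using assms by (auto simp: E_def pel_def sel_def lext_FO)

lemma X_eq:
 assumes e: "e:E t as q q' b" and al: "al:fhom A as as'" "k:hom Q q0 q" "l:hom Q q' q1"
 shows "X t al k l b e = app (FM (tlist t as') (k, l)) b (app (tlist_map t al q q') b e)"
proof -
 have m: "al:Mor (free_cat A)" "k:Mor Q" "l:Mor Q" using al by (auto dest: hom_Mor)
 show ?thesis
  unfolding X_def lext_def using m lext_FM0[OF al] lext_mor(2)[OF al peD(4)[OF E_D(5)[OF e]]] by (simp del: prod.case free_simps)
qed

lemma X_mem:
 assumes "e:E t as q q' b" "al:fhom A as as'" "k:hom Q q0 q" "l:hom Q q' q1"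
 shows "X t al k l b e:E t as' q0 q1 b"
 using FM_mem[OF catB catL lext_functor, of e "(as, q, q')" b "(al, k, l)" "(as', q0, q1)"] assms
 by (simp add: E_def X_def)

lemma X_id: "e:E t as q q' b ==> X t (fid A as) (Idn Q q) (Idn Q q') b e = e"
 using FM_id[OF catB catL lext_functor, of e "(as, q, q')" b] by (simp add: E_def X_def)

lemma X_cmp:
 assumes "e:E t as q q' b" "al:fhom A as as'" "k:hom Q q0 q" "l:hom Q q' q1"
  "al':fhom A as' as''" "k':hom Q q00 q0" "l':hom Q q1 q11"
 shows "X t al' k' l' b (X t al k l b e) = X t (fcmp A al' al) (Cmp Q k k') (Cmp Q l' l) b e"
 using FM_cmp[OF catB catL lext_functor, of e "(as, q, q')" b "(al, k, l)" "(as', q0, q1)" "(al', k', l')" "(as'', q00, q11)"] assms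
 by (simp add: E_def X_def)

lemma X_Act:
 assumes "e:E t as q q' b" "al:fhom A as as'" "k:hom Q q0 q" "l:hom Q q' q1" "be:fhom B b' b"
 shows "X t al k l b' (Act t as q q' be e) = Act t as' q0 q1 be (X t al k l b e)"
 using FM_act[OF catB catL lext_functor, of e "(as, q, q')" b "(al, k, l)" "(as', q0, q1)" be b'] assms
 by (simp add: E_def X_def)

lemma Act_mem: "e:E t as q q' b ==> be:fhom B b' b ==> Act t as q q' be e:E t as q q' b'"
 unfolding E_def by (rule pel_act[OF catB catL lext_functor])

lemma Act_id: "e:E t as q q' b ==> Act t as q q' (fid B b) e = e"
 unfolding E_def by (rule pel_act_id[OF catB catL lext_functor])

lemma Act_cmp: "e:E t as q q' b ==> be:fhom B b' b ==> be':fhom B b'' b' ==>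
  Act t as q q' be' (Act t as q q' be e) = Act t as q q' (fcmp B be be') e"
 unfolding E_def by (rule pel_act_cmp[OF catB catL lext_functor])

lemmas QI = Idn_hom[OF catQ]
lemmas FBI = Idn_hom[OF catFB]
lemmas FAI = Idn_hom[OF catFA]
lemmas cmps = Cmp_idl[OF catQ] Cmp_idr[OF catQ] Cmp_idl[OF catFA] Cmp_idr[OF catFA]
 Cmp_idl[OF catFB] Cmp_idr[OF catFB]

lemma X_state:
 assumes e: "e:E t as q q' b" and kl: "k:hom Q q0 q" "l:hom Q q' q1"
 shows "X t (fid A as) k l b e = app (FM (tlist t as) (k, l)) b e"
 using X_eq[OF e FAI[OF E_D(1)[OF e]] kl] TM_id[OF E_D(1,5)[OF e]] by simp

lemma E_Nil: "e:E t [] q q' b \<longleftrightarrow> b = [] & (EX m. e = en m & m:hom Q q q')"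
 by (simp add: E_iff unit_pe[OF smallQ smallB])

lemma E_NilI: "m:hom Q q q' ==> en m:E t [] q q' []"
 by (simp add: E_Nil)

lemma X_Nil:
 assumes "m:hom Q q q'" "k:hom Q q0 q" "l:hom Q q' q1"
 shows "X t [] k l [] (en m) = en (Cmp Q l (Cmp Q m k))"
 using X_state[OF E_NilI[OF assms(1)] assms(2,3)] unit_FM[OF smallQ smallB assms(2,3,1)] by simp

lemma Act_Nil: "m:hom Q q q' ==> Act t [] q q' [] (en m) = en m"
 using Act_id[OF E_NilI] by simp

section \<open>Concatenation of elements of the extension to lists\<close>

lemma tcat_Nil:
 assumes m: "m:hom Q r w" and e2: "e2:E t c2 w r' d2"
 shows "tcat t [] c2 r w r' [] d2 (en m) e2 = X t (fid A c2) m (Idn Q r') d2 e2"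
 using Act_id[OF X_mem[OF e2 FAI[OF E_D(1)[OF e2]] m QI[OF E_D(3)[OF e2]]]] by (simp add: X_def)

lemma tcat_letter_Nil:
 assumes e1: "e1:E t [c] r w d1" and m: "m:hom Q w r'"
 shows "tcat t [c] [] r w r' d1 [] e1 (en m) = X t [Idn A c] (Idn Q r) m d1 e1"
 using Act_id[OF X_mem[OF e1 _ QI[OF E_D(2)[OF e1]] m, of "[Idn A c]" "[c]"]] FAI[OF E_D(1)[OF e1]] by (simp add: X_def)

lemma tcat_letter:
 "cs ~= [] ==> tcat t [c] cs r w r' d1 d2 e1 e2 =
  tens_in Q B (tlet t c) (tlist t cs) r r' (d1 @ d2) w d1 d2 e1 e2 (fid B (d1 @ d2))"
 by (cases cs) (simp_all del: free_simps)

lemma E_tens: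
 assumes "cs ~= []" "u:E t [c] q x c1" "v:E t cs x q' c2" "h:fhom B b (c1 @ c2)"
 shows "tens_in Q B (tlet t c) (tlist t cs) q q' b x c1 c2 u v h:E t (c # cs) q q' b"
proof -
 have "tens_in Q B (tlet t c) (tlist t cs) q q' b x c1 c2 u v h:pe Q B (tens Q B (tlet t c) (tlist t cs)) q q' b"
  using assms by (intro tens_mem smallQ smallB tlet_prof tlist_prof) (auto simp: E_iff)
 then show ?thesis using assms by (cases cs) (auto simp: E_iff)
qed

lemma X_tens:
 assumes cs: "cs ~= []" and u: "u:E t [c] q x c1" and v: "v:E t cs x q' c2" and h: "h:fhom B b (c1 @ c2)"
  and al: "al:hom A c c'" "als:fhom A cs cs'" and kl: "k:hom Q q0 q" "l:hom Q q' q1"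
 shows "X t (al # als) k l b (tens_in Q B (tlet t c) (tlist t cs) q q' b x c1 c2 u v h) =
  tens_in Q B (tlet t c') (tlist t cs') q0 q1 b x c1 c2 (X t [al] k (Idn Q x) c1 u) (X t als (Idn Q x) l c2 v) h"
proof -
 have ne: "als ~= []" "cs' ~= []" using al(2) cs by auto
 have u': "u:pe Q B (tlet t c) q x c1" using u by (simp add: E_iff)
 note v' = E_D(5)[OF v]
 have al': "al # als:fhom A (c # cs) (c' # cs')" "[al]:fhom A [c] [c']" using al by auto
 note o = hom_obj2[OF catA al(1)] hom_obj2[OF catFA al(2)]
 note i = QI[OF E_D(3)[OF u]]
 have m: "app (tlist_map t [al] q x) c1 u:pe Q B (tlet t c') q x c1"
  using TM_mem[OF TM_letter[OF al(1)]] u' by simp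
 show ?thesis
  unfolding X_eq[OF E_tens[OF cs u v h] al'(1) kl] tlist_map_gen(2)[OF al ne(1) TM[OF al(2)] u' v' h]
  tlist_FM_gen[OF o ne(2) kl m TM_mem[OF TM[OF al(2)] v'] h] X_eq[OF u al'(2) kl(1) i] X_eq[OF v al(2) i kl(2)]
  by simp
qed

lemma Act_tens:
 assumes cs: "cs ~= []" and u: "u:E t [c] q x c1" and v: "v:E t cs x q' c2" and h: "h:fhom B b (c1 @ c2)" and be: "be:fhom B b' b"
 shows "Act t (c # cs) q q' be (tens_in Q B (tlet t c) (tlist t cs) q q' b x c1 c2 u v h) =
  tens_in Q B (tlet t c) (tlist t cs) q q' b' x c1 c2 u v (fcmp B h be)"
proof -
 have u': "u:pe Q B (tlet t c) q x c1" "c:Obj A" using u by (auto simp: E_iff)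
 note v' = E_D(5)[OF v]
 have "FO (lext t) (c # cs, q, q') = FO (tens Q B (tlet t c) (tlist t cs)) (q, q')"
  using cs E_D[OF u] E_D[OF v] by (cases cs) (simp_all add: lext_FO)
 then show ?thesis
  using tens_act[OF smallQ smallB tlet_prof[OF u'(2)] tlist_prof[OF E_D(1)[OF v]] u'(1) v' h be] by simp
qed

text \<open>At \<open>c # cs\<close> with nonempty \<open>cs\<close>, \<open>tcat\<close> is a map
  out of a coend whose well-definedness uses that concatenation at \<open>cs\<close> is natural in
  the target lists and in the states. Typing, naturality and sliding of the middle state are
  therefore proved together.\<close>

definition TP where
 "TP c1 \<longleftrightarrow> (ALL c2 r w r' d1 d2 e1 e2. e1:E t c1 r w d1 --> e2:E t c2 w r' d2 -->
  tcat t c1 c2 r w r' d1 d2 e1 e2:E t (c1 @ c2) r r' (d1 @ d2) &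
  (ALL k1 k2 d1' d2'. k1:fhom B d1' d1 --> k2:fhom B d2' d2 -->
  Act t (c1 @ c2) r r' (k1 @ k2) (tcat t c1 c2 r w r' d1 d2 e1 e2) =
  tcat t c1 c2 r w r' d1' d2' (Act t c1 r w k1 e1) (Act t c2 w r' k2 e2)) &
  (ALL al1 al2 c1' c2' k l r0 r1. al1:fhom A c1 c1' --> al2:fhom A c2 c2' --> k:hom Q r0 r --> l:hom Q r' r1 -->
  X t (al1 @ al2) k l (d1 @ d2) (tcat t c1 c2 r w r' d1 d2 e1 e2) =
  tcat t c1' c2' r0 w r1 d1 d2 (X t al1 k (Idn Q w) d1 e1) (X t al2 (Idn Q w) l d2 e2))) &
  (ALL c2 r w w' r' d1 d2 e1 e2 l. e1:E t c1 r w d1 --> e2:E t c2 w' r' d2 --> l:hom Q w w' -->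
  tcat t c1 c2 r w' r' d1 d2 (X t (fid A c1) (Idn Q r) l d1 e1) e2 =
  tcat t c1 c2 r w r' d1 d2 e1 (X t (fid A c2) l (Idn Q r') d2 e2))"

lemma TP_D:
 assumes "TP c1" 
 shows "e1:E t c1 r w d1 ==> e2:E t c2 w r' d2 ==>
  tcat t c1 c2 r w r' d1 d2 e1 e2:E t (c1 @ c2) r r' (d1 @ d2)"
  and "e1:E t c1 r w d1 ==> e2:E t c2 w r' d2 ==>
  k1:fhom B d1' d1 ==> k2:fhom B d2' d2 ==>
  Act t (c1 @ c2) r r' (k1 @ k2) (tcat t c1 c2 r w r' d1 d2 e1 e2) =
  tcat t c1 c2 r w r' d1' d2' (Act t c1 r w k1 e1) (Act t c2 w r' k2 e2)"
  and "e1:E t c1 r w d1 ==> e2:E t c2 w r' d2 ==>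
  al1:fhom A c1 c1' ==> al2:fhom A c2 c2' ==> k:hom Q r0 r ==> l:hom Q r' r1 ==>
  X t (al1 @ al2) k l (d1 @ d2) (tcat t c1 c2 r w r' d1 d2 e1 e2) =
  tcat t c1' c2' r0 w r1 d1 d2 (X t al1 k (Idn Q w) d1 e1) (X t al2 (Idn Q w) l d2 e2)"
 using assms[unfolded TP_def, THEN conjunct1] by blast+

lemma TP_slide: "TP c1 ==> e1:E t c1 r w d1 ==> e2:E t c2 w' r' d2 ==> l:hom Q w w' ==>
  tcat t c1 c2 r w' r' d1 d2 (X t (fid A c1) (Idn Q r) l d1 e1) e2 =
  tcat t c1 c2 r w r' d1 d2 e1 (X t (fid A c2) l (Idn Q r') d2 e2)"
 unfolding TP_def by simp

text \<open>An element over the empty list is a state arrow, and concatenation with it is the action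
  of that arrow; every clause becomes functoriality of \<open>X\<close>.\<close>

lemma TP_Nil: "TP []"
 unfolding TP_def
proof (intro conjI allI impI)
 fix c2 r w r' d1 d2 e1 e2 assume e1: "e1:E t [] r w d1" and e2: "e2:E t c2 w r' d2"
 obtain m where m: "d1 = []" "e1 = en m" "m:hom Q r w" using e1 by (auto simp: E_Nil)
 note i = FAI[OF E_D(1)[OF e2]] QI[OF E_D(3)[OF e2]] QI[OF E_D(2)[OF e2]] QI[OF E_D(2)[OF e1]]
 show "tcat t [] c2 r w r' d1 d2 e1 e2:E t ([] @ c2) r r' (d1 @ d2)"
  using X_mem[OF e2 i(1) m(3) i(2)] by (simp add: m tcat_Nil[OF m(3) e2] del: tcat.simps)
 show "Act t ([] @ c2) r r' (k1 @ k2) (tcat t [] c2 r w r' d1 d2 e1 e2) =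
  tcat t [] c2 r w r' d1' d2' (Act t [] r w k1 e1) (Act t c2 w r' k2 e2)"
  if k: "k1:fhom B d1' d1" "k2:fhom B d2' d2" for k1 k2 d1' d2'
  using X_Act[OF e2 i(1) m(3) i(2) k(2)] k(1)
  by (auto simp: m tcat_Nil[OF m(3) e2] tcat_Nil[OF m(3) Act_mem[OF e2 k(2)]] Act_Nil[OF m(3)] simp del: tcat.simps)
 show "X t (al1 @ al2) k l (d1 @ d2) (tcat t [] c2 r w r' d1 d2 e1 e2) =
  tcat t c1' c2' r0 w r1 d1 d2 (X t al1 k (Idn Q w) d1 e1) (X t al2 (Idn Q w) l d2 e2)"
  if a: "al1:fhom A [] c1'" "al2:fhom A c2 c2'" and kl: "k:hom Q r0 r" "l:hom Q r' r1" for al1 al2 c1' c2' k l r0 r1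
 proof -
  have [simp]: "al1 = []" "c1' = []" using a by auto
  note i' = FAI[OF hom_obj2[OF catFA a(2)]] QI[OF hom_obj2[OF catQ kl(2)]]
  note mk = Cmp_hom[OF catQ kl(1) m(3)]
  have "X t al2 k l d2 (X t (fid A c2) m (Idn Q r') d2 e2) = X t al2 (Cmp Q m k) l d2 e2"
  using X_cmp[OF e2 i(1) m(3) i(2) a(2) kl] a kl by (simp add: cmps)
  moreover have "X t (fid A c2') (Cmp Q m k) (Idn Q r1) d2 (X t al2 (Idn Q w) l d2 e2) = X t al2 (Cmp Q m k) l d2 e2"
  using X_cmp[OF e2 a(2) i(3) kl(2) i'(1) mk i'(2)] a kl mk by (simp add: cmps)
  ultimately show ?thesis
  using mk by (simp add: m tcat_Nil[OF m(3) e2] tcat_Nil[OF mk X_mem[OF e2 a(2) i(3) kl(2)]] X_Nil[OF m(3) kl(1) i(3)] cmps del: tcat.simps)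
 qed
next
 fix c2 r w w' r' d1 d2 e1 e2 l assume e1: "e1:E t [] r w d1" and e2: "e2:E t c2 w' r' d2" and l: "l:hom Q w w'"
 obtain m where m: "d1 = []" "e1 = en m" "m:hom Q r w" using e1 by (auto simp: E_Nil)
 note i = FAI[OF E_D(1)[OF e2]] QI[OF E_D(3)[OF e2]] QI[OF E_D(2)[OF e1]]
 note lm = Cmp_hom[OF catQ m(3) l]
 show "tcat t [] c2 r w' r' d1 d2 (X t (fid A []) (Idn Q r) l d1 e1) e2 =
  tcat t [] c2 r w r' d1 d2 e1 (X t (fid A c2) l (Idn Q r') d2 e2)"
  using X_cmp[OF e2 i(1) l i(2) i(1) m(3) i(2)] m i lm
  by (simp add: tcat_Nil[OF lm e2] tcat_Nil[OF m(3) X_mem[OF e2 i(1) l i(2)]] X_Nil[OF m(3) i(3) l] cmps del: tcat.simps)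
qed

text \<open>Two shapes occur. For \<open>cs = []\<close> the second element is a state arrow acting
  from the right; otherwise the concatenation is a generator of the tensor product whose arrow of
  lists is an identity.\<close>

lemma TP_letter: "TP [c]"
 unfolding TP_def
proof (intro conjI allI impI)
 fix cs r w r' d1 d2 e1 e2 assume e1: "e1:E t [c] r w d1" and e2: "e2:E t cs w r' d2"
 note o1 = E_D(1-4)[OF e1] and o2 = E_D(1-4)[OF e2]
 have c: "c:Obj A" using o1 by simp
 have ic: "[Idn A c]:fhom A [c] [c]" using Idn_hom[OF catA c] by simp
 have id: "fid B (d1 @ d2):fhom B (d1 @ d2) (d1 @ d2)" using o1 o2 by (intro FBI) simp
 note i = QI[OF o1(2)] QI[OF o1(3)] QI[OF o2(3)] FBI[OF o1(4)] FBI[OF o2(4)]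
 have e1': "e1:pe Q B (tlet t c) r w d1" using e1 by (simp add: E_iff)
 note e2' = E_D(5)[OF e2]
 show "tcat t [c] cs r w r' d1 d2 e1 e2:E t ([c] @ cs) r r' (d1 @ d2)"
 proof (cases "cs = []")
  case True
  then obtain m where m: "d2 = []" "e2 = en m" "m:hom Q w r'" using e2 by (auto simp: E_Nil)
  show ?thesis using X_mem[OF e1 ic i(1) m(3)] by (simp add: True m tcat_letter_Nil[OF e1 m(3)] del: tcat.simps)
 next
  case False
  show ?thesis using E_tens[OF False e1 e2 id] by (simp add: tcat_letter[OF False] del: free_simps)
 qed
 show "Act t ([c] @ cs) r r' (k1 @ k2) (tcat t [c] cs r w r' d1 d2 e1 e2) =
  tcat t [c] cs r w r' d1' d2' (Act t [c] r w k1 e1) (Act t cs w r' k2 e2)"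
  if k: "k1:fhom B d1' d1" "k2:fhom B d2' d2" for k1 k2 d1' d2'
 proof (cases "cs = []")
  case True
  then obtain m where m: "d2 = []" "e2 = en m" "m:hom Q w r'" using e2 by (auto simp: E_Nil)
  have "k2 = []" "d2' = []" using k(2) m by auto
  then show ?thesis
  using X_Act[OF e1 ic i(1) m(3) k(1)]
  by (simp add: True m tcat_letter_Nil[OF e1 m(3)] tcat_letter_Nil[OF Act_mem[OF e1 k(1)] m(3)] Act_Nil[OF m(3)] del: tcat.simps)
 next
  case False
  have kk: "k1 @ k2:fhom B (d1' @ d2') (d1 @ d2)" by (rule fhom_append[OF k])
  have id': "fid B (d1' @ d2'):fhom B (d1' @ d2') (d1' @ d2')" by (rule FBI[OF hom_obj1[OF catFB kk]])
  have "Act t [c] r w k1 e1 = act (FO (tlet t c) (r, w)) k1 e1" "Act t cs w r' k2 e2 = act (FO (tlist t cs) (w, r')) k2 e2"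
  using o1 o2 by (simp_all add: lext_FO)
  then show ?thesis
  using Act_tens[OF False e1 e2 id kk] tens_slide[OF smallQ smallB tlet_prof[OF c] tlist_prof[OF o2(1)] k e1' e2' id'] kk
  by (simp add: tcat_letter[OF False] cmps del: free_simps)
 qed
 show "X t (al1 @ al2) k l (d1 @ d2) (tcat t [c] cs r w r' d1 d2 e1 e2) =
  tcat t c1' c2' r0 w r1 d1 d2 (X t al1 k (Idn Q w) d1 e1) (X t al2 (Idn Q w) l d2 e2)"
  if a: "al1:fhom A [c] c1'" "al2:fhom A cs c2'" and kl: "k:hom Q r0 r" "l:hom Q r' r1" for al1 al2 c1' c2' k l r0 r1
 proof -
  obtain al c' where a1: "al1 = [al]" "c1' = [c']" "al:hom A c c'" using fhom_Cons_left[OF a(1)] by auto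
  note ir0 = QI[OF hom_obj1[OF catQ kl(1)]]
  show ?thesis
  proof (cases "cs = []")
  case True
  then obtain m where m: "d2 = []" "e2 = en m" "m:hom Q w r'" using e2 by (auto simp: E_Nil)
  have [simp]: "al2 = []" "c2' = []" using a(2) True by auto
  note lm = Cmp_hom[OF catQ m(3) kl(2)]
  have ic': "[Idn A c']:fhom A [c'] [c']" using Idn_hom[OF catA hom_obj2[OF catA a1(3)]] by simp
  have "X t [al] k l d1 (X t [Idn A c] (Idn Q r) m d1 e1) = X t [al] k (Cmp Q l m) d1 e1"
  using X_cmp[OF e1 ic i(1) m(3) a(1) kl] kl Cmp_idr[OF catA a1(3)] by (simp add: cmps a1)
  moreover have "X t [Idn A c'] (Idn Q r0) (Cmp Q l m) d1 (X t [al] k (Idn Q w) d1 e1) = X t [al] k (Cmp Q l m) d1 e1"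
  using X_cmp[OF e1 a(1) kl(1) i(2) _ ir0 lm, of "[Idn A c']" "[c']"] a1 ic' kl lm Cmp_idl[OF catA a1(3)] by (simp add: cmps)
  ultimately show ?thesis
  using m lm tcat_letter_Nil[OF X_mem[OF e1 a(1) kl(1) i(2), unfolded a1] lm] True
  by (simp add: a1 tcat_letter_Nil[OF e1 m(3)] X_Nil[OF m(3) i(2) kl(2)] cmps del: tcat.simps)
  next
  case False
  then have "c2' ~= []" using a(2) by auto
  then show ?thesis
  using X_tens[OF False e1 e2 id a1(3) a(2) kl] by (simp add: a1 tcat_letter False del: free_simps tcat.simps)
  qed
 qed
next
 fix cs r w w' r' d1 d2 e1 e2 l assume e1: "e1:E t [c] r w d1" and e2: "e2:E t cs w' r' d2" and l: "l:hom Q w w'"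
 note o1 = E_D(1-4)[OF e1] and o2 = E_D(1-4)[OF e2]
 have c: "c:Obj A" using o1 by simp
 have ic: "[Idn A c]:fhom A [c] [c]" using Idn_hom[OF catA c] by simp
 have id: "fid B (d1 @ d2):fhom B (d1 @ d2) (d1 @ d2)" using o1 o2 by (intro FBI) simp
 note i = QI[OF o1(2)] QI[OF o2(3)] QI[OF o2(2)]
 have e1': "e1:pe Q B (tlet t c) r w d1" using e1 by (simp add: E_iff)
 note e2' = E_D(5)[OF e2]
 show "tcat t [c] cs r w' r' d1 d2 (X t (fid A [c]) (Idn Q r) l d1 e1) e2 =
  tcat t [c] cs r w r' d1 d2 e1 (X t (fid A cs) l (Idn Q r') d2 e2)"
 proof (cases "cs = []")
  case True
  then obtain m where m: "d2 = []" "e2 = en m" "m:hom Q w' r'" using e2 by (auto simp: E_Nil)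
  note ml = Cmp_hom[OF catQ l m(3)]
  show ?thesis
  using X_cmp[OF e1 ic i(1) l ic i(1) m(3)] i Idn_hom[OF catA c] ml
  by (simp add: True m tcat_letter_Nil[OF X_mem[OF e1 ic i(1) l] m(3)] tcat_letter_Nil[OF e1 ml] X_Nil[OF m(3) l i(2)] cmps Cmp_idl[OF catA] del: tcat.simps)
 next
  case False
  then show ?thesis
  using tens_slide_state[OF smallQ smallB tlet_prof[OF c] tlist_prof[OF o2(1)] l e1' e2' id]
  X_state[OF e1 i(1) l] X_state[OF e2 l i(2)] by (simp add: tcat_letter del: free_simps tcat.simps)
 qed
qed

text \<open>For a nonempty tail these are the generators of the tensor product, with their arrow of
  lists written as an action. For an empty tail \<open>e\<close> is concatenated with an identity
  state arrow, so that later inductions can treat both cases alike.\<close>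

lemma cons_surj:
 assumes e: "e:E t (c # cs) r r' d"
 obtains w d1 d2 p p' h where "p:E t [c] r w d1" "p':E t cs w r' d2" "h:fhom B d (d1 @ d2)"
  "e = Act t (c # cs) r r' h (tcat t [c] cs r w r' d1 d2 p p')"
proof (cases "cs = []")
 case True
 note o = E_D(1-4)[OF e]
 note i = QI[OF o(2)] QI[OF o(3)] FBI[OF o(4)]
 have e': "e:E t [c] r r' d" using e True by simp
 have "tcat t [c] [] r r' r' d [] e (en (Idn Q r')) = e"
  using tcat_letter_Nil[OF e' i(2)] X_id[OF e'] by simp
 then show ?thesis
  using that[of e r' d "en (Idn Q r')" "[]" "fid B d"] e' E_NilI[OF i(2)] i(3) True Act_id[OF e] by (simp del: tcat.simps)
next
 case False
 have o: "c:Obj A" "cs:fob A" using E_D(1)[OF e] by auto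
 obtain x c1 c2 u v h where u: "u:pe Q B (tlet t c) r x c1" and v: "v:pe Q B (tlist t cs) x r' c2" and h: "h:fhom B d (c1 @ c2)"
  and eq: "e = tens_in Q B (tlet t c) (tlist t cs) r r' d x c1 c2 u v h"
  by (rule tens_E_list[OF o False E_D(5)[OF e]])
 have u': "u:E t [c] r x c1" and v': "v:E t cs x r' c2" using u v o by (auto simp: E_iff)
 have id: "fid B (c1 @ c2):fhom B (c1 @ c2) (c1 @ c2)" by (rule FBI[OF hom_obj2[OF catFB h]])
 show ?thesis
  using that[OF u' v' h] Act_tens[OF False u' v' id h] h
  by (simp add: eq tcat_letter[OF False] cmps del: free_simps)
qed

text \<open>The recursive clause can be evaluated at a generator once its integrand is known to be a
  cowedge, and that check consumes \<open>TP cs\<close>. For \<open>cs = []\<close> the clause does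
  not recurse, and the equation is the passage of a state arrow from the left factor to the right
  one.\<close>

lemma tcat_rec0:
 assumes cs: "TP cs" and p: "p:E t [c] r y b1" and p': "p':E t cs y w b2" and h: "h:fhom B d1 (b1 @ b2)"
  and e2: "e2:E t c2 w r' d2"
 shows "tcat t (c # cs) c2 r w r' d1 d2 (Act t (c # cs) r w h (tcat t [c] cs r y w b1 b2 p p')) e2 =
  Act t (c # cs @ c2) r r' (h @ fid B d2) (tcat t [c] (cs @ c2) r y r' b1 (b2 @ d2) p (tcat t cs c2 y w r' b2 d2 p' e2))"
proof -
 note L = TP_D[OF TP_letter]
 have i2: "fid B d2:fhom B d2 d2" by (rule FBI[OF E_D(4)[OF e2]])
 show ?thesis
 proof (cases "cs = []")
  case True
  then obtain m where m: "b2 = []" "p' = en m" "m:hom Q y w" using p' by (auto simp: E_Nil)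
  have h': "h:fhom B d1 b1" using h m by simp
  have ic: "[Idn A c]:fhom A [c] [c]" using FAI[OF E_D(1)[OF p]] by simp
  note Xp = X_mem[OF p ic QI[OF E_D(2)[OF p]] m(3)]
  have "tcat t [c] c2 r w r' d1 d2 (Act t [c] r w h (X t [Idn A c] (Idn Q r) m b1 p)) e2 =
  Act t (c # c2) r r' (h @ fid B d2) (tcat t [c] c2 r w r' b1 d2 (X t [Idn A c] (Idn Q r) m b1 p) e2)"
  using L(2)[OF Xp e2 h' i2] Act_id[OF e2] by simp
  also have "tcat t [c] c2 r w r' b1 d2 (X t [Idn A c] (Idn Q r) m b1 p) e2 = tcat t [c] c2 r y r' b1 d2 p (X t (fid A c2) m (Idn Q r') d2 e2)"
  using TP_slide[OF TP_letter p e2 m(3)] by simp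
  finally show ?thesis
  using tcat_letter_Nil[OF p m(3)] tcat_Nil[OF m(3) e2] by (simp add: True m del: tcat.simps)
 next
  case False
  then obtain c' cr where r: "cs = c' # cr" by (cases cs) auto
  have pp: "p:pe Q B (tlet t c) r y b1" "c:Obj A" using p by (auto simp: E_iff)
  note oc = E_D(1)[OF p']
  have id: "fid B (b1 @ b2):fhom B (b1 @ b2) (b1 @ b2)" by (rule FBI[OF hom_obj2[OF catFB h]])
  \<comment> \<open>The integrand of the recursive clause; \<open>fid B d2\<close> extends the arrow
    \<open>h\<close> over the target list of the second factor.\<close>
  let ?F = "%y b1 b2 p p' h. tens_in Q B (tlet t c) (tlist t (c' # cr @ c2)) r r' (d1 @ d2)
  y b1 (b2 @ d2) p (tcat t (c' # cr) c2 y w r' b2 d2 p' e2)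
  (h @ fid B d2)"
  note o2 = E_D[OF e2]
  have oc2: "c' # cr @ c2:fob A" using oc o2 r by auto
  have "tcat t (c # cs) c2 r w r' d1 d2 (tens_in Q B (tlet t c) (tlist t cs) r w d1 y b1 b2 p p' h) e2 = ?F y b1 b2 p p' h"
  unfolding r tcat.simps
  proof (rule tens_desc_in[OF smallQ smallB tlet_prof[OF pp(2)] tlist_prof[OF oc[unfolded r]] _ _ pp(1) E_D(5)[OF p', unfolded r] h])
  fix x c1 c1' c2' c2'' k1 k2 u v h
  assume *: "k1:fhom B c1' c1" "k2:fhom B c2'' c2'" "u:pe Q B (tlet t c) r x c1"
  "v:pe Q B (tlist t (c' # cr)) x w c2'" "h:fhom B d1 (c1' @ c2'')"
  have u: "u:E t [c] r x c1" and v: "v:E t cs x w c2'" using * pp oc r by (auto simp: E_iff)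
  have a: "act (FO (tlet t c) (r, x)) k1 u = Act t [c] r x k1 u" "act (FO (tlist t (c' # cr)) (x, w)) k2 v = Act t cs x w k2 v"
  using E_D[OF u] E_D[OF v] by (simp_all add: lext_FO r)
  note T = TP_D(1)[OF cs v e2]
  have T': "tcat t (c' # cr) c2 x w r' c2' d2 v e2:pe Q B (tlist t (c' # cr @ c2)) x r' (c2' @ d2)"
  using E_D(5)[OF T] by (simp add: r)
  have hh: "h @ fid B d2:fhom B (d1 @ d2) (c1' @ c2'' @ d2)" using fhom_append[OF *(5) i2] by simp
  note k2' = fhom_append[OF *(2) i2]
  have "?F x c1' c2'' (act (FO (tlet t c) (r, x)) k1 u) (act (FO (tlist t (c' # cr)) (x, w)) k2 v) h =
  tens_in Q B (tlet t c) (tlist t (c' # cr @ c2)) r r' (d1 @ d2) x c1' (c2'' @ d2)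
  (act (FO (tlet t c) (r, x)) k1 u) (act (FO (tlist t (c' # cr @ c2)) (x, r')) (k2 @ fid B d2) (tcat t (c' # cr) c2 x w r' c2' d2 v e2)) (h @ fid B d2)"
  using TP_D(2)[OF cs v e2 *(2) i2] Act_id[OF e2] a(2) oc2 E_D[OF T] by (simp add: r lext_FO)
  also have "... = tens_in Q B (tlet t c) (tlist t (c' # cr @ c2)) r r' (d1 @ d2) x c1 (c2' @ d2) u (tcat t (c' # cr) c2 x w r' c2' d2 v e2) 
  (fcmp B (k1 @ k2 @ fid B d2) (h @ fid B d2))"
  by (rule tens_slide[OF smallQ smallB tlet_prof[OF pp(2)] tlist_prof[OF oc2] *(1) k2' *(3) T' hh])
  also have "fcmp B (k1 @ k2 @ fid B d2) (h @ fid B d2) = fcmp B (k1 @ k2) h @ fid B d2"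
  using fcmp_append[OF *(5) fhom_append[OF *(1,2)], of "fid B d2" "fid B d2"] i2 by (simp add: cmps)
  finally show "?F x c1' c2'' (act (FO (tlet t c) (r, x)) k1 u) (act (FO (tlist t (c' # cr)) (x, w)) k2 v) h =
  ?F x c1 c2' u v (fcmp B (k1 @ k2) h)" .
  next
  fix x z l c1 c2' u v h
  assume *: "l:hom Q x z" "u:pe Q B (tlet t c) r x c1"
  "v:pe Q B (tlist t (c' # cr)) z w c2'" "h:fhom B d1 (c1 @ c2')"
  have u: "u:E t [c] r x c1" and v: "v:E t cs z w c2'" using * pp oc r by (auto simp: E_iff)
  note T = TP_D(1)[OF cs v e2]
  have T': "tcat t (c' # cr) c2 z w r' c2' d2 v e2:pe Q B (tlist t (c' # cr @ c2)) z r' (c2' @ d2)"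
  using E_D(5)[OF T] by (simp add: r)
  have hh: "h @ fid B d2:fhom B (d1 @ d2) (c1 @ c2' @ d2)" using fhom_append[OF *(4) i2] by simp
  note i = QI[OF E_D(3)[OF e2]] QI[OF E_D(2)[OF e2]]
  have "app (FM (tlist t (c' # cr @ c2)) (l, Idn Q r')) (c2' @ d2) (tcat t (c' # cr) c2 z w r' c2' d2 v e2) =
  X t (fid A cs @ fid A c2) l (Idn Q r') (c2' @ d2) (tcat t cs c2 z w r' c2' d2 v e2)"
  using X_state[OF T *(1) i(1)] by (simp add: r)
  also have "... = tcat t cs c2 x w r' c2' d2 (X t (fid A cs) l (Idn Q w) c2' v) e2"
  using TP_D(3)[OF cs v e2 FAI[OF oc] FAI[OF o2(1)] *(1) i(1)] X_id[OF e2] by simp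
  also have "X t (fid A cs) l (Idn Q w) c2' v = app (FM (tlist t (c' # cr)) (l, Idn Q w)) c2' v"
  using X_state[OF v *(1) i(2)] by (simp add: r)
  finally show "?F z c1 c2' (app (FM (tlet t c) (Idn Q r, l)) c1 u) v h = ?F x c1 c2' u (app (FM (tlist t (c' # cr)) (l, Idn Q w)) c2' v) h"
  using tens_slide_state[OF smallQ smallB tlet_prof[OF pp(2)] tlist_prof[OF oc2] *(1,2) T' hh] by (simp add: r)
  qed
  moreover have "Act t (c # cs) r w h (tcat t [c] cs r y w b1 b2 p p') = tens_in Q B (tlet t c) (tlist t cs) r w d1 y b1 b2 p p' h"
  using Act_tens[OF False p p' id h] h by (simp add: tcat_letter[OF False] cmps del: free_simps)
  moreover have "Act t (c # cs @ c2) r r' (h @ fid B d2) (tcat t [c] (cs @ c2) r y r' b1 (b2 @ d2) p (tcat t cs c2 y w r' b2 d2 p' e2)) = ?F y b1 b2 p p' h"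
  proof -
  have ne: "cs @ c2 ~= []" using False by simp
  have hh: "h @ fid B d2:fhom B (d1 @ d2) (b1 @ b2 @ d2)" using fhom_append[OF h i2] by simp
  have id: "fid B (b1 @ b2 @ d2):fhom B (b1 @ b2 @ d2) (b1 @ b2 @ d2)" by (rule FBI[OF hom_obj2[OF catFB hh]])
  show ?thesis
  using Act_tens[OF ne p TP_D(1)[OF cs p' e2] id hh] hh unfolding tcat_letter[OF ne] by (simp add: r cmps del: free_simps tcat.simps)
  qed
  ultimately show ?thesis by simp
 qed
qed

text \<open>An arrow of letters turns the tail into another list of the same length, so naturality
  at \<open>c # cs\<close> refers to \<open>TP\<close> at that list too. This is why the hypothesis
  ranges over a length.\<close>

lemma TP_Cons:
 assumes TPs: "!!cs'. length cs' = length cs ==> TP cs'"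
 shows "TP (c # cs)"
 unfolding TP_def
proof (intro conjI allI impI)
 note cs = TPs[OF refl]
 note L = TP_D[OF TP_letter] and T = TP_D[OF cs]
 fix c2 r w r' d1 d2 e1 e2 assume e1: "e1:E t (c # cs) r w d1" and e2: "e2:E t c2 w r' d2"
 obtain y b1 b2 p p' h where p: "p:E t [c] r y b1" and p': "p':E t cs y w b2" and h: "h:fhom B d1 (b1 @ b2)"
  and eq: "e1 = Act t (c # cs) r w h (tcat t [c] cs r y w b1 b2 p p')"
  by (rule cons_surj[OF e1])
 have i2: "fid B d2:fhom B d2 d2" by (rule FBI[OF E_D(4)[OF e2]])
 have hh: "h @ fid B d2:fhom B (d1 @ d2) (b1 @ b2 @ d2)" using fhom_append[OF h i2] by simp
 note K = L(1)[OF p T(1)[OF p' e2], simplified]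
 note K0 = L(1)[OF p p', simplified]
 show "tcat t (c # cs) c2 r w r' d1 d2 e1 e2:E t ((c # cs) @ c2) r r' (d1 @ d2)"
  using Act_mem[OF K hh] by (simp add: eq tcat_rec0[OF cs p p' h e2] del: tcat.simps)
 show "Act t ((c # cs) @ c2) r r' (k1 @ k2) (tcat t (c # cs) c2 r w r' d1 d2 e1 e2) =
  tcat t (c # cs) c2 r w r' d1' d2' (Act t (c # cs) r w k1 e1) (Act t c2 w r' k2 e2)"
  if k: "k1:fhom B d1' d1" "k2:fhom B d2' d2" for k1 k2 d1' d2'
 proof -
  note hk = Cmp_hom[OF catFB k(1) h]
  have i2': "fid B d2':fhom B d2' d2'" by (rule FBI[OF hom_obj1[OF catFB k(2)]])
  have ib: "fid B b1:fhom B b1 b1" "fid B b2:fhom B b2 b2" using E_D(4)[OF p] E_D(4)[OF p'] by (auto intro: FBI)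
  have kk: "k1 @ k2:fhom B (d1' @ d2') (d1 @ d2)" by (rule fhom_append[OF k])
  have bk: "fid B b2 @ k2:fhom B (b2 @ d2') (b2 @ d2)" by (rule fhom_append[OF ib(2) k(2)])
  have bbk: "fid B b1 @ fid B b2 @ k2:fhom B (b1 @ b2 @ d2') (b1 @ b2 @ d2)" by (rule fhom_append[OF ib(1) bk])
  have hkk: "fcmp B h k1 @ fid B d2':fhom B (d1' @ d2') (b1 @ b2 @ d2')" using fhom_append[OF hk i2'] by simp
  have "Act t (c # cs @ c2) r r' (k1 @ k2) (tcat t (c # cs) c2 r w r' d1 d2 e1 e2) =
  Act t (c # cs @ c2) r r' (fcmp B h k1 @ k2) (tcat t [c] (cs @ c2) r y r' b1 (b2 @ d2) p (tcat t cs c2 y w r' b2 d2 p' e2))"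
  using Act_cmp[OF K hh kk] fcmp_append[OF k(1) h, of "fid B d2" k2] k(2)
  by (simp add: eq tcat_rec0[OF cs p p' h e2] cmps del: tcat.simps)
  \<comment> \<open>Interchange separates \<open>k2\<close> from \<open>h\<close> and
    \<open>k1\<close>: it can then be handed to the inner concatenation, and what remains outside
    has the shape required by \<open>tcat_rec0\<close>.\<close>
  also have "fcmp B h k1 @ k2 = fcmp B (fid B b1 @ fid B b2 @ k2) (fcmp B h k1 @ fid B d2')"
  using fcmp_append[OF hk fhom_append[OF ib], of k2 "fid B d2'"] hk k(2) by (simp add: cmps) (metis cmps(5) free_simps(6) hk)
  also have "Act t (c # cs @ c2) r r' (fcmp B (fid B b1 @ fid B b2 @ k2) (fcmp B h k1 @ fid B d2')) (tcat t [c] (cs @ c2) r y r' b1 (b2 @ d2) p (tcat t cs c2 y w r' b2 d2 p' e2)) =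
  Act t (c # cs @ c2) r r' (fcmp B h k1 @ fid B d2') (Act t (c # cs @ c2) r r' (fid B b1 @ fid B b2 @ k2) (tcat t [c] (cs @ c2) r y r' b1 (b2 @ d2) p (tcat t cs c2 y w r' b2 d2 p' e2)))"
  by (rule Act_cmp[OF K bbk hkk, symmetric])
  also have "Act t (c # cs @ c2) r r' (fid B b1 @ fid B b2 @ k2) (tcat t [c] (cs @ c2) r y r' b1 (b2 @ d2) p (tcat t cs c2 y w r' b2 d2 p' e2)) =
  tcat t [c] (cs @ c2) r y r' b1 (b2 @ d2') p (tcat t cs c2 y w r' b2 d2' p' (Act t c2 w r' k2 e2))"
  using L(2)[OF p T(1)[OF p' e2] ib(1) bk] T(2)[OF p' e2 ib(2) k(2)] Act_id[OF p] Act_id[OF p'] by simp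
  finally show ?thesis
  using tcat_rec0[OF cs p p' hk Act_mem[OF e2 k(2)]] Act_cmp[OF K0 h k(1)] by (simp add: eq del: tcat.simps)
 qed
 show "X t (al1 @ al2) k l (d1 @ d2) (tcat t (c # cs) c2 r w r' d1 d2 e1 e2) =
  tcat t c1' c2' r0 w r1 d1 d2 (X t al1 k (Idn Q w) d1 e1) (X t al2 (Idn Q w) l d2 e2)"
  if a: "al1:fhom A (c # cs) c1'" "al2:fhom A c2 c2'" and kl: "k:hom Q r0 r" "l:hom Q r' r1" for al1 al2 c1' c2' k l r0 r1
 proof -
  obtain al als c' cs' where a1: "al1 = al # als" "c1' = c' # cs'" "al:hom A c c'" "als:fhom A cs cs'" using fhom_Cons_left[OF a(1)] by auto
  have a0: "[al]:fhom A [c] [c']" using a1 by simp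
  have cs': "TP cs'" using fhom_length[OF a1(4)] by (intro TPs) simp
  note iw = QI[OF E_D(3)[OF e1]] and iy = QI[OF E_D(3)[OF p]]
  note as = fhom_append[OF a1(4) a(2)]
  have 1: "X t (al1 @ al2) k l (d1 @ d2) (tcat t (c # cs) c2 r w r' d1 d2 e1 e2) =
  Act t (c' # cs' @ c2') r0 r1 (h @ fid B d2) (X t ([al] @ als @ al2) k l (b1 @ b2 @ d2) (tcat t [c] (cs @ c2) r y r' b1 (b2 @ d2) p (tcat t cs c2 y w r' b2 d2 p' e2)))"
  using X_Act[OF K _ kl hh, of "al1 @ al2" "c1' @ c2'"] fhom_append[OF a(1,2)] by (simp add: eq tcat_rec0[OF cs p p' h e2] a1 del: tcat.simps)
  note 2 = L(3)[OF p T(1)[OF p' e2] a0 as kl] T(3)[OF p' e2 a1(4) a(2) iy kl(2)]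
  have 3: "X t al1 k (Idn Q w) d1 e1 = Act t (c' # cs') r0 w h (tcat t [c'] cs' r0 y w b1 b2 (X t [al] k (Idn Q y) b1 p) (X t als (Idn Q y) (Idn Q w) b2 p'))"
  using X_Act[OF K0 _ kl(1) iw h, of al1 c1'] L(3)[OF p p' a0 a1(4) kl(1) iw] a(1) by (simp add: eq a1 del: tcat.simps)
  show ?thesis
  using 1 2 3 tcat_rec0[OF cs' X_mem[OF p a0 kl(1) iy] X_mem[OF p' a1(4) iy iw] h X_mem[OF e2 a(2) iw kl(2)]]
  by (simp add: a1 del: tcat.simps)
 qed
next
 note cs = TPs[OF refl]
 note L = TP_D[OF TP_letter] and T = TP_D[OF cs]
 fix c2 r w w' r' d1 d2 e1 e2 l assume e1: "e1:E t (c # cs) r w d1" and e2: "e2:E t c2 w' r' d2" and l: "l:hom Q w w'"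
 obtain y b1 b2 p p' h where p: "p:E t [c] r y b1" and p': "p':E t cs y w b2" and h: "h:fhom B d1 (b1 @ b2)"
  and eq: "e1 = Act t (c # cs) r w h (tcat t [c] cs r y w b1 b2 p p')"
  by (rule cons_surj[OF e1])
 note o = E_D(1)[OF p] E_D(1)[OF p'] E_D(1)[OF e2]
 note i = FAI[OF o(1)] FAI[OF o(2)] FAI[OF o(3)] QI[OF E_D(2)[OF p]] QI[OF E_D(3)[OF p]] QI[OF E_D(3)[OF e2]]
 note K0 = L(1)[OF p p', simplified]
 have "X t (fid A (c # cs)) (Idn Q r) l d1 e1 = Act t (c # cs) r w' h (tcat t [c] cs r y w' b1 b2 p (X t (fid A cs) (Idn Q y) l b2 p'))"
  using X_Act[OF K0 _ i(4) l h, of "fid A (c # cs)" "c # cs"] L(3)[OF p p' i(1,2,4) l] X_id[OF p] fhom_append[OF i(1,2)] by (simp add: eq del: tcat.simps)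
 then show "tcat t (c # cs) c2 r w' r' d1 d2 (X t (fid A (c # cs)) (Idn Q r) l d1 e1) e2 =
  tcat t (c # cs) c2 r w r' d1 d2 e1 (X t (fid A c2) l (Idn Q r') d2 e2)"
  using tcat_rec0[OF cs p X_mem[OF p' i(2) i(5) l] h e2] TP_slide[OF cs p' e2 l] tcat_rec0[OF cs p p' h X_mem[OF e2 i(3) l i(6)]]
  by (simp add: eq del: tcat.simps)
qed

lemma TP: "TP cs"
proof (induction "length cs" arbitrary: cs)
 case 0
 then show ?case using TP_Nil by simp
next
 case (Suc n)
 then obtain c cr where "cs = c # cr" "n = length cr" by (cases cs) auto
 then show ?case using TP_Cons[of cr c] Suc.hyps(1) by auto
qed

lemmas tcat_mem = TP_D(1)[OF TP] and tcat_Act = TP_D(2)[OF TP] and tcat_X = TP_D(3)[OF TP]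
 and tcat_slide = TP_slide[OF TP] and tcat_rec = tcat_rec0[OF TP]

declare tcat.simps [simp del]

lemma tcat_Cons:
 assumes p: "p:E t [c] r y b1" and p': "p':E t cs y w b2" and e2: "e2:E t c2 w r' d2"
 shows "tcat t (c # cs) c2 r w r' (b1 @ b2) d2 (tcat t [c] cs r y w b1 b2 p p') e2 =
  tcat t [c] (cs @ c2) r y r' b1 (b2 @ d2) p (tcat t cs c2 y w r' b2 d2 p' e2)"
proof -
 note K = tcat_mem[OF p p'] and K2 = tcat_mem[OF p tcat_mem[OF p' e2]]
 have i: "fid B (b1 @ b2):fhom B (b1 @ b2) (b1 @ b2)" by (rule FBI[OF E_D(4)[OF K]])
 show ?thesis
  using tcat_rec[OF p p' i e2] Act_id[OF K] Act_id[OF K2] by simp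
qed

text \<open>\<open>tcat\<close> recurses on its left list, so the right unit law takes an induction,
  whereas the left one is its first clause.\<close>

lemma tcat_Nil_right:
 "e1:E t c1 r w d1 ==> m:hom Q w r' ==>
  tcat t c1 [] r w r' d1 [] e1 (en m) = X t (fid A c1) (Idn Q r) m d1 e1"
proof (induction c1 arbitrary: r d1 e1)
 case Nil
 then obtain m' where m': "d1 = []" "e1 = en m'" "m':hom Q r w" by (auto simp: E_Nil)
 note i = QI[OF hom_obj1[OF catQ m'(3)]] QI[OF hom_obj2[OF catQ Nil.prems(2)]]
 show ?case
  using tcat_Nil[OF m'(3) E_NilI[OF Nil.prems(2)]] X_Nil[OF Nil.prems(2) m'(3) i(2)] X_Nil[OF m'(3) i(1) Nil.prems(2)]
  Cmp_hom[OF catQ m'(3) Nil.prems(2)] m' by (simp add: m' cmps)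
next
 case (Cons c cs)
 obtain y b1 b2 p p' h where p: "p:E t [c] r y b1" and p': "p':E t cs y w b2" and h: "h:fhom B d1 (b1 @ b2)"
  and eq: "e1 = Act t (c # cs) r w h (tcat t [c] cs r y w b1 b2 p p')"
  by (rule cons_surj[OF Cons.prems(1)])
 note i = FAI[OF E_D(1)[OF p]] FAI[OF E_D(1)[OF p']] QI[OF E_D(2)[OF p]]
 note K0 = tcat_mem[OF p p', simplified]
 have "X t (fid A (c # cs)) (Idn Q r) m d1 e1 = Act t (c # cs) r r' h (tcat t [c] cs r y r' b1 b2 p (X t (fid A cs) (Idn Q y) m b2 p'))"
  using X_Act[OF K0 _ i(3) Cons.prems(2) h, of "fid A (c # cs)" "c # cs"] tcat_X[OF p p' i(1,2,3) Cons.prems(2)]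
  X_id[OF p] fhom_append[OF i(1,2)] by (simp add: eq)
 then show ?case
  using tcat_rec[OF p p' h E_NilI[OF Cons.prems(2)]] Cons.IH[OF p' Cons.prems(2)] by (simp add: eq)
qed

text \<open>By \<open>tcat_rec\<close> the same first letter is peeled off on both sides. At the
  empty list, where the first element is a state arrow, the claim is naturality of concatenation in
  the outer state.\<close>

lemma tcat_assoc:
 "e1:E t c1 r w d1 ==> e2:E t c2 w w' d2 ==> e3:E t c3 w' r' d3 ==>
  tcat t (c1 @ c2) c3 r w' r' (d1 @ d2) d3 (tcat t c1 c2 r w w' d1 d2 e1 e2) e3 =
  tcat t c1 (c2 @ c3) r w r' d1 (d2 @ d3) e1 (tcat t c2 c3 w w' r' d2 d3 e2 e3)"
proof (induction c1 arbitrary: r d1 e1)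
 case Nil
 then obtain m where m: "d1 = []" "e1 = en m" "m:hom Q r w" by (auto simp: E_Nil)
 note e2 = Nil.prems(2) and e3 = Nil.prems(3)
 note i = FAI[OF E_D(1)[OF e2]] FAI[OF E_D(1)[OF e3]] QI[OF E_D(3)[OF e3]]
 show ?case
  using tcat_X[OF e2 e3 i(1,2) m(3) i(3)] X_id[OF e3]
  by (simp add: m tcat_Nil[OF m(3) e2] tcat_Nil[OF m(3) tcat_mem[OF e2 e3]])
next
 case (Cons c cs)
 note e2 = Cons.prems(2) and e3 = Cons.prems(3)
 obtain y b1 b2 p p' h where p: "p:E t [c] r y b1" and p': "p':E t cs y w b2" and h: "h:fhom B d1 (b1 @ b2)"
  and eq: "e1 = Act t (c # cs) r w h (tcat t [c] cs r y w b1 b2 p p')"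
  by (rule cons_surj[OF Cons.prems(1)])
 have i2: "fid B d2:fhom B d2 d2" by (rule FBI[OF E_D(4)[OF e2]])
 have h2: "h @ fid B d2:fhom B (d1 @ d2) (b1 @ b2 @ d2)" using fhom_append[OF h i2] by simp
 show ?case
  using tcat_rec[OF p p' h e2] tcat_rec[OF p tcat_mem[OF p' e2] h2 e3] tcat_rec[OF p p' h tcat_mem[OF e2 e3]]
  Cons.IH[OF p' e2 e3] by (simp add: eq)
qed

text \<open>One letter is split off by \<open>cons_surj\<close>, the remainder is split by
  induction, and \<open>tcat_Cons\<close> rebrackets; the two arrows of lists compose.\<close>

lemma tcat_surj:
 assumes "e:E t (c1 @ c2) r r' d"
 obtains w d1 d2 e1 e2 h where "e1:E t c1 r w d1" "e2:E t c2 w r' d2" "h:fhom B d (d1 @ d2)"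
  "e = Act t (c1 @ c2) r r' h (tcat t c1 c2 r w r' d1 d2 e1 e2)"
 using assms
proof (induction c1 arbitrary: r d e thesis)
 case Nil
 have e: "e:E t c2 r r' d" using Nil.prems(2) by simp
 note i = QI[OF E_D(2)[OF e]] FBI[OF E_D(4)[OF e]]
 show ?case
  using Nil.prems(1)[OF E_NilI[OF i(1)] e, of "fid B d"] i(2) tcat_Nil[OF i(1) e] X_id[OF e] Act_id[OF e] by simp
next
 case (Cons c cs)
 obtain y b1 b2 p p' h where p: "p:E t [c] r y b1" and p': "p':E t (cs @ c2) y r' b2" and h: "h:fhom B d (b1 @ b2)"
  and eq: "e = Act t (c # cs @ c2) r r' h (tcat t [c] (cs @ c2) r y r' b1 b2 p p')"
  by (rule cons_surj[OF Cons.prems(2)[unfolded append_Cons]])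
 obtain w b3 b4 e3 e4 h' where e3: "e3:E t cs y w b3" and e4: "e4:E t c2 w r' b4" and h': "h':fhom B b2 (b3 @ b4)"
  and eq': "p' = Act t (cs @ c2) y r' h' (tcat t cs c2 y w r' b3 b4 e3 e4)"
  using Cons.IH[OF _ p'] by metis
 note i1 = FBI[OF E_D(4)[OF p]]
 have hh: "fid B b1 @ h':fhom B (b1 @ b2) (b1 @ b3 @ b4)" by (rule fhom_append[OF i1 h'])
 have h'': "fcmp B (fid B b1 @ h') h:fhom B d ((b1 @ b3) @ b4)" using Cmp_hom[OF catFB h hh] by simp
 note T = tcat_mem[OF e3 e4]
 have "e = Act t (c # cs @ c2) r r' (fcmp B (fid B b1 @ h') h) (tcat t [c] (cs @ c2) r y r' b1 (b3 @ b4) p (tcat t cs c2 y w r' b3 b4 e3 e4))"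
  using tcat_Act[OF p T i1 h'] Act_id[OF p] Act_cmp[OF tcat_mem[OF p T, simplified] hh h] by (simp add: eq eq')
 then show ?case
  using Cons.prems(1)[OF tcat_mem[OF p e3, simplified] e4 h''] tcat_Cons[OF p e3 e4] by simp
qed

section \<open>Universal property of concatenation\<close>

lemma letter_desc:
 assumes False: "cs ~= []" and F: "cowedge t [c] cs r r' d F"
  and e1: "e1:E t [c] r w d1" and e2: "e2:E t cs w r' d2" and h: "h:fhom B d (d1 @ d2)"
 shows "tens_desc Q B (tlet t c) (tlist t cs) r r' d F (Act t (c # cs) r r' h (tcat t [c] cs r w r' d1 d2 e1 e2)) = F w d1 d2 e1 e2 h"
proof -
 have c: "c:Obj A" "cs:fob A" using E_D(1)[OF e1] E_D(1)[OF e2] by auto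
 have id: "fid B (d1 @ d2):fhom B (d1 @ d2) (d1 @ d2)" by (rule FBI[OF hom_obj2[OF catFB h]])
 have "Act t (c # cs) r r' h (tcat t [c] cs r w r' d1 d2 e1 e2) = tens_in Q B (tlet t c) (tlist t cs) r r' d w d1 d2 e1 e2 h"
  using Act_tens[OF False e1 e2 id h] h by (simp add: tcat_letter[OF False] cmps del: free_simps)
 moreover have "tens_desc Q B (tlet t c) (tlist t cs) r r' d F (tens_in Q B (tlet t c) (tlist t cs) r r' d w d1 d2 e1 e2 h) = F w d1 d2 e1 e2 h"
 proof (rule tens_desc_in[OF smallQ smallB tlet_prof[OF c(1)] tlist_prof[OF c(2)]])
  fix x c1 c1' c2 c2' k1 k2 u v h
  assume *: "k1:fhom B c1' c1" "k2:fhom B c2' c2" "u:pe Q B (tlet t c) r x c1"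
  "v:pe Q B (tlist t cs) x r' c2" "h:fhom B d (c1' @ c2')"
  have u: "u:E t [c] r x c1" and v: "v:E t cs x r' c2" using * c by (auto simp: E_iff)
  show "F x c1' c2' (act (FO (tlet t c) (r, x)) k1 u) (act (FO (tlist t cs) (x, r')) k2 v) h = F x c1 c2 u v (fcmp B (k1 @ k2) h)"
  using cowedgeD(2)[OF F *(1,2) u v *(5)] E_D[OF u] E_D[OF v] by (simp add: lext_FO)
 next
  fix x y l c1 c2 u v h
  assume *: "l:hom Q x y" "u:pe Q B (tlet t c) r x c1"
  "v:pe Q B (tlist t cs) y r' c2" "h:fhom B d (c1 @ c2)"
  have u: "u:E t [c] r x c1" and v: "v:E t cs y r' c2" using * c by (auto simp: E_iff)
  show "F y c1 c2 (app (FM (tlet t c) (Idn Q r, l)) c1 u) v h = F x c1 c2 u (app (FM (tlist t cs) (l, Idn Q r')) c2 v) h"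
  using cowedgeD(1)[OF F *(1) u v *(4)] X_state[OF u QI[OF E_D(2)[OF u]] *(1)] X_state[OF v *(1) QI[OF E_D(3)[OF v]]] by simp
 qed (use e1 e2 h in \<open>auto simp: E_iff\<close>)
 ultimately show ?thesis by simp
qed

text \<open>For a nonempty tail \<open>G\<close> is the description map of the tensor product. For
  the empty tail there is no coend to leave, and \<open>G\<close> evaluates \<open>F\<close> at the
  splitting of \<open>e\<close> that has an identity state arrow on the right; the cowedge
  conditions reduce every other splitting to this one.\<close>

lemma letter_univ:
 assumes F: "cowedge t [c] cs r r' d F" and c: "c:Obj A" "cs:fob A"
 shows "EX G. ALL w d1 d2 e1 e2 h. e1:E t [c] r w d1 --> e2:E t cs w r' d2 --> h:fhom B d (d1 @ d2) -->
  G (Act t (c # cs) r r' h (tcat t [c] cs r w r' d1 d2 e1 e2)) = F w d1 d2 e1 e2 h"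
proof (cases "cs = []")
 case True
 show ?thesis
 proof (intro exI[of _ "%e. F r' d [] e (en (Idn Q r')) (fid B d)"] allI impI)
  fix w d1 d2 e1 e2 h
  assume e1: "e1:E t [c] r w d1" and e2: "e2:E t cs w r' d2" and h: "h:fhom B d (d1 @ d2)"
  then obtain m where m: "d2 = []" "e2 = en m" "m:hom Q w r'" using True by (auto simp: E_Nil)
  have h': "h:fhom B d d1" using h m by simp
  have ic: "[Idn A c]:fhom A [c] [c]" using Idn_hom[OF catA c(1)] by simp
  note i = QI[OF hom_obj2[OF catQ m(3)]] QI[OF E_D(2)[OF e1]]
  note Xe = X_mem[OF e1 ic i(2) m(3)]
  note I = E_NilI[OF i(1), folded True]
  have id: "fid B d:fhom B d (d @ [])" using FBI[OF hom_obj1[OF catFB h']] by simp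
  have "F r' d [] (Act t [c] r r' h (X t [Idn A c] (Idn Q r) m d1 e1)) (en (Idn Q r')) (fid B d) =
  F r' d1 [] (X t [Idn A c] (Idn Q r) m d1 e1) (en (Idn Q r')) h"
  using cowedgeD(2)[OF F h' _ Xe I id, of "[]"] Act_Nil[OF i(1)] h' by (simp add: True cmps)
  also have "... = F w d1 [] e1 e2 h"
  using cowedgeD(1)[OF F m(3) e1 I, of h] h m X_Nil[OF i(1) m(3) i(1)] by (simp add: True cmps)
  finally show "F r' d [] (Act t (c # cs) r r' h (tcat t [c] cs r w r' d1 d2 e1 e2)) (en (Idn Q r')) (fid B d) = F w d1 d2 e1 e2 h"
  using tcat_letter_Nil[OF e1 m(3)] by (simp add: True m)
 qed
next
 case False
 show ?thesis
  by (rule exI[of _ "tens_desc Q B (tlet t c) (tlist t cs) r r' d F"]) (use letter_desc[OF False F] in blast)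
qed

text \<open>With the element \<open>p\<close> of the first letter and the arrow \<open>h\<close>
  held fixed, the induction hypothesis gives a map out of the tail. These maps form a cowedge for
  the first letter, and \<open>letter_univ\<close> combines them. They are only known to exist, so
  \<open>G0\<close> selects them by choice.\<close>

lemma tcat_univ:
 "c1:fob A ==> c2:fob A ==> cowedge t c1 c2 r r' d F ==>
  EX G. ALL w d1 d2 e1 e2 h. e1:E t c1 r w d1 --> e2:E t c2 w r' d2 --> h:fhom B d (d1 @ d2) -->
  G (Act t (c1 @ c2) r r' h (tcat t c1 c2 r w r' d1 d2 e1 e2)) = F w d1 d2 e1 e2 h"
proof (induction c1 arbitrary: r d F)
 case Nil
 note F = Nil.prems(3)
 show ?case
 proof (intro exI[of _ "%e. F r [] d (en (Idn Q r)) e (fid B d)"] allI impI)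
  fix w d1 d2 e1 e2 h
  assume e1: "e1:E t [] r w d1" and e2: "e2:E t c2 w r' d2" and h: "h:fhom B d (d1 @ d2)"
  then obtain m where m: "d1 = []" "e1 = en m" "m:hom Q r w" by (auto simp: E_Nil)
  have h': "h:fhom B d d2" using h m by simp
  note i = QI[OF hom_obj1[OF catQ m(3)]] QI[OF E_D(3)[OF e2]] FAI[OF E_D(1)[OF e2]]
  note Xe = X_mem[OF e2 i(3) m(3) i(2)]
  note I = E_NilI[OF i(1)]
  have id: "fid B d:fhom B d ([] @ d)" using FBI[OF hom_obj1[OF catFB h']] by simp
  have "F r [] d (en (Idn Q r)) (Act t c2 r r' h (X t (fid A c2) m (Idn Q r') d2 e2)) (fid B d) =
  F r [] d2 (en (Idn Q r)) (X t (fid A c2) m (Idn Q r') d2 e2) h"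
  using cowedgeD(2)[OF F _ h' I Xe id, of "[]"] Act_Nil[OF i(1)] h' by (simp add: cmps)
  also have "... = F w d1 d2 e1 e2 h"
  using cowedgeD(1)[OF F m(3) I e2, of h] h m i(1) X_Nil[OF i(1) i(1) m(3)] by (simp add: cmps)
  finally show "F r [] d (en (Idn Q r)) (Act t ([] @ c2) r r' h (tcat t [] c2 r w r' d1 d2 e1 e2)) (fid B d) = F w d1 d2 e1 e2 h"
  using tcat_Nil[OF m(3) e2] by (simp add: m)
 qed
next
 case (Cons c cs)
 note F = Cons.prems(3)
 have o: "c:Obj A" "cs:fob A" "cs @ c2:fob A" using Cons.prems by auto
 \<comment> \<open>\<open>P\<close> says that \<open>G\<close> is the map out of the tail for the
   fixed data \<open>(y, b1, b2, p, h)\<close>; the arrow \<open>fid B b1 @ h'\<close> refines a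
   splitting of \<open>b2\<close> to one of the whole target.\<close>
 define P where "P y b1 b2 p h G \<longleftrightarrow> (ALL w b3 b4 e3 e4 h'. e3:E t cs y w b3 --> e4:E t c2 w r' b4 --> h':fhom B b2 (b3 @ b4) -->
  G (Act t (cs @ c2) y r' h' (tcat t cs c2 y w r' b3 b4 e3 e4)) = F w (b1 @ b3) b4 (tcat t [c] cs r y w b1 b3 p e3) e4 (fcmp B (fid B b1 @ h') h))"
  for y b1 b2 p h and G
 define G0 where "G0 y b1 b2 p h = (SOME G. P y b1 b2 p h G)" for y b1 b2 p h
 have "P y b1 b2 p h (G0 y b1 b2 p h)" if p: "p:E t [c] r y b1" and h: "h:fhom B d (b1 @ b2)" for y b1 b2 p h
 proof -
  note ip = FAI[OF E_D(1)[OF p]] QI[OF E_D(2)[OF p]] QI[OF E_D(3)[OF p]] FBI[OF E_D(4)[OF p]]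
  let ?F = "%w b3 b4 e3 e4 h'. F w (b1 @ b3) b4 (tcat t [c] cs r y w b1 b3 p e3) e4 (fcmp B (fid B b1 @ h') h)"
  have "cowedge t cs c2 y r' b2 ?F"
  proof (rule cowedgeI)
  fix w w' l d1 d2 e1 e2 h'
  assume l: "l:hom Q w w'" and e1: "e1:E t cs y w d1" and e2: "e2:E t c2 w' r' d2" and h': "h':fhom B b2 (d1 @ d2)"
  have H: "fcmp B (fid B b1 @ h') h:fhom B d ((b1 @ d1) @ d2)"
  using Cmp_hom[OF catFB h fhom_append[OF ip(4) h']] by simp
  have "X t (fid A (c # cs)) (Idn Q r) l (b1 @ d1) (tcat t [c] cs r y w b1 d1 p e1) = tcat t [c] cs r y w' b1 d1 p (X t (fid A cs) (Idn Q y) l d1 e1)"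
  using tcat_X[OF p e1 ip(1) FAI[OF o(2)] ip(2) l] X_id[OF p] by simp
  then show "?F w' d1 d2 (X t (fid A cs) (Idn Q y) l d1 e1) e2 h' = ?F w d1 d2 e1 (X t (fid A c2) l (Idn Q r') d2 e2) h'"
  using cowedgeD(1)[OF F l tcat_mem[OF p e1, simplified] e2 H] by simp
  next
  fix w d1 d1' d2 d2' k1 k2 e1 e2 h'
  assume k: "k1:fhom B d1' d1" "k2:fhom B d2' d2" and e1: "e1:E t cs y w d1" and e2: "e2:E t c2 w r' d2" and h': "h':fhom B b2 (d1' @ d2')"
  have H: "fcmp B (fid B b1 @ h') h:fhom B d ((b1 @ d1') @ d2')"
  using Cmp_hom[OF catFB h fhom_append[OF ip(4) h']] by simp
  note k12 = fhom_append[OF k]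
  have "fcmp B ((fid B b1 @ k1) @ k2) (fcmp B (fid B b1 @ h') h) = fcmp B (fid B b1 @ fcmp B (k1 @ k2) h') h"
  using Cmp_assoc[OF catFB h fhom_append[OF ip(4) h'] fhom_append[OF ip(4) k12]] fcmp_append[OF ip(4) ip(4), of "k1 @ k2" h'] ip(4)
  by (simp add: cmps)
  then show "?F w d1' d2' (Act t cs y w k1 e1) (Act t c2 w r' k2 e2) h' = ?F w d1 d2 e1 e2 (fcmp B (k1 @ k2) h')"
  using cowedgeD(2)[OF F fhom_append[OF ip(4) k(1)] k(2) tcat_mem[OF p e1, simplified] e2 H]
  tcat_Act[OF p e1 ip(4) k(1)] Act_id[OF p] by simp
  qed
  from Cons.IH[OF o(2) Cons.prems(2) this] have "EX G. P y b1 b2 p h G"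
  unfolding P_def .
  then show ?thesis
  unfolding G0_def by (rule someI_ex)
 qed
 then have G0: "G0 y b1 b2 p h (Act t (cs @ c2) y r' h' (tcat t cs c2 y w r' b3 b4 e3 e4)) = F w (b1 @ b3) b4 (tcat t [c] cs r y w b1 b3 p e3) e4 (fcmp B (fid B b1 @ h') h)"
  if "p:E t [c] r y b1" "h:fhom B d (b1 @ b2)" "e3:E t cs y w b3" "e4:E t c2 w r' b4" "h':fhom B b2 (b3 @ b4)"
  for y b1 b2 p h w b3 b4 e3 e4 h'
  using that unfolding P_def by blast
 \<comment> \<open>By \<open>tcat_surj\<close> every element of the tail is a splitting, so each
   relevant value of \<open>G0\<close> is known from \<open>F\<close>, although \<open>G0\<close>
   was chosen separately for each \<open>p\<close> and \<open>h\<close>.\<close>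
 have "cowedge t [c] (cs @ c2) r r' d (%y b1 b2 p p' h. G0 y b1 b2 p h p')"
 proof (rule cowedgeI)
  fix y y' l b1 b2 p p' h
  assume l: "l:hom Q y y'" and p: "p:E t [c] r y b1" and p': "p':E t (cs @ c2) y' r' b2" and h: "h:fhom B d (b1 @ b2)"
  obtain w b3 b4 e3 e4 h' where e3: "e3:E t cs y' w b3" and e4: "e4:E t c2 w r' b4" and h': "h':fhom B b2 (b3 @ b4)"
  and eq: "p' = Act t (cs @ c2) y' r' h' (tcat t cs c2 y' w r' b3 b4 e3 e4)"
  by (rule tcat_surj[OF p'])
  note i = FAI[OF E_D(1)[OF p]] FAI[OF o(2)] FAI[OF E_D(1)[OF e4]] QI[OF E_D(2)[OF p]] QI[OF E_D(3)[OF e3]] QI[OF E_D(3)[OF e4]]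
  have "X t (fid A (cs @ c2)) l (Idn Q r') b2 p' = Act t (cs @ c2) y r' h' (tcat t cs c2 y w r' b3 b4 (X t (fid A cs) l (Idn Q w) b3 e3) e4)"
  using X_Act[OF tcat_mem[OF e3 e4] fhom_append[OF i(2,3)] l i(6) h'] tcat_X[OF e3 e4 i(2,3) l i(6)] X_id[OF e4] by (simp add: eq)
  then show "G0 y' b1 b2 (X t (fid A [c]) (Idn Q r) l b1 p) h p' = G0 y b1 b2 p h (X t (fid A (cs @ c2)) l (Idn Q r') b2 p')"
  using G0[OF X_mem[OF p i(1,4) l] h e3 e4 h'] G0[OF p h X_mem[OF e3 i(2) l i(5)] e4 h'] tcat_slide[OF p e3 l] by (simp add: eq)
 next
  fix y b1 b1' b2 b2' k1 k2 p p' h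
  assume k: "k1:fhom B b1' b1" "k2:fhom B b2' b2" and p: "p:E t [c] r y b1" and p': "p':E t (cs @ c2) y r' b2" and h: "h:fhom B d (b1' @ b2')"
  obtain w b3 b4 e3 e4 h' where e3: "e3:E t cs y w b3" and e4: "e4:E t c2 w r' b4" and h': "h':fhom B b2 (b3 @ b4)"
  and eq: "p' = Act t (cs @ c2) y r' h' (tcat t cs c2 y w r' b3 b4 e3 e4)"
  by (rule tcat_surj[OF p'])
  note hk = Cmp_hom[OF catFB k(2) h'] and kh = Cmp_hom[OF catFB h fhom_append[OF k]]
  note i = FBI[OF E_D(4)[OF p]] FBI[OF E_D(4)[OF e3]] FBI[OF E_D(4)[OF e4]] FBI[OF hom_obj1[OF catFB k(1)]]
  have e: "Act t (cs @ c2) y r' k2 p' = Act t (cs @ c2) y r' (fcmp B h' k2) (tcat t cs c2 y w r' b3 b4 e3 e4)"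
  using Act_cmp[OF tcat_mem[OF e3 e4] h' k(2)] by (simp add: eq)
  have K: "tcat t [c] cs r y w b1' b3 (Act t [c] r y k1 p) e3 = Act t (c # cs) r w (k1 @ fid B b3) (tcat t [c] cs r y w b1 b3 p e3)"
  using tcat_Act[OF p e3 k(1) i(2)] Act_id[OF e3] by simp
  have H: "fcmp B (fid B b1' @ fcmp B h' k2) h:fhom B d ((b1' @ b3) @ b4)"
  using Cmp_hom[OF catFB h fhom_append[OF i(4) hk]] by simp
  have i34: "fid B b3 @ fid B b4:fhom B (b3 @ b4) (b3 @ b4)" by (rule fhom_append[OF i(2,3)])
  have "fcmp B ((k1 @ fid B b3) @ fid B b4) (fcmp B (fid B b1' @ fcmp B h' k2) h) = fcmp B (k1 @ fcmp B h' k2) h"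
  using Cmp_assoc[OF catFB h fhom_append[OF i(4) hk] fhom_append[OF k(1) i34]]
  fcmp_append[OF i(4) k(1), of "fid B b3 @ fid B b4" "fcmp B h' k2"] Cmp_idl[OF catFB hk] Cmp_idr[OF catFB k(1)] by simp
  also have "... = fcmp B (fid B b1 @ h') (fcmp B (k1 @ k2) h)"
  using Cmp_assoc[OF catFB h fhom_append[OF k] fhom_append[OF i(1) h']] fcmp_append[OF k(1) i(1), of h' k2] Cmp_idl[OF catFB k(1)] by simp
  finally show "G0 y b1' b2' (Act t [c] r y k1 p) h (Act t (cs @ c2) y r' k2 p') = G0 y b1 b2 p (fcmp B (k1 @ k2) h) p'"
  unfolding e G0[OF Act_mem[OF p k(1)] h e3 e4 hk] K
  using cowedgeD(2)[OF F fhom_append[OF k(1) i(2)] i(3) tcat_mem[OF p e3, simplified] e4 H] Act_id[OF e4]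
  G0[OF p kh e3 e4 h'] by (simp add: eq)
 qed
 from letter_univ[OF this o(1,3)] obtain G where "ALL y b1 b2 p p' h. p:E t [c] r y b1 --> p':E t (cs @ c2) y r' b2 --> h:fhom B d (b1 @ b2) -->
  G (Act t (c # cs @ c2) r r' h (tcat t [c] (cs @ c2) r y r' b1 b2 p p')) = G0 y b1 b2 p h p'" ..
 then have G: "p:E t [c] r y b1 ==> p':E t (cs @ c2) y r' b2 ==> h:fhom B d (b1 @ b2) ==>
  G (Act t (c # cs @ c2) r r' h (tcat t [c] (cs @ c2) r y r' b1 b2 p p')) = G0 y b1 b2 p h p'" for y b1 b2 p p' h
  by blast
 show ?case
 proof (intro exI[of _ G] allI impI)
  fix w d1 d2 e1 e2 h
  assume e1: "e1:E t (c # cs) r w d1" and e2: "e2:E t c2 w r' d2" and h: "h:fhom B d (d1 @ d2)"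
  obtain y b1 b3 p e3 h0 where p: "p:E t [c] r y b1" and e3: "e3:E t cs y w b3" and h0: "h0:fhom B d1 (b1 @ b3)"
  and eq: "e1 = Act t (c # cs) r w h0 (tcat t [c] cs r y w b1 b3 p e3)"
  by (rule cons_surj[OF e1])
  note i = FBI[OF E_D(4)[OF p]] FBI[OF E_D(4)[OF e3]] FBI[OF E_D(4)[OF e2]]
  have h0': "h0 @ fid B d2:fhom B (d1 @ d2) (b1 @ b3 @ d2)" using fhom_append[OF h0 i(3)] by simp
  note H = Cmp_hom[OF catFB h h0']
  have i32: "fid B (b3 @ d2):fhom B (b3 @ d2) (b3 @ d2)" using fhom_append[OF i(2,3)] by simp
  note T = tcat_mem[OF e3 e2]
  have 1: "Act t (c # cs @ c2) r r' h (tcat t (c # cs) c2 r w r' d1 d2 e1 e2) =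
  Act t (c # cs @ c2) r r' (fcmp B (h0 @ fid B d2) h) (tcat t [c] (cs @ c2) r y r' b1 (b3 @ d2) p (tcat t cs c2 y w r' b3 d2 e3 e2))"
  using tcat_rec[OF p e3 h0 e2] Act_cmp[OF tcat_mem[OF p T, simplified] h0' h] by (simp add: eq)
  have 2: "fcmp B (fid B b1 @ fid B (b3 @ d2)) (fcmp B (h0 @ fid B d2) h) = fcmp B (h0 @ fid B d2) h"
  using Cmp_idl[OF catFB H] by simp
  have "G (Act t (c # cs @ c2) r r' h (tcat t (c # cs) c2 r w r' d1 d2 e1 e2)) =
  F w (b1 @ b3) d2 (tcat t [c] cs r y w b1 b3 p e3) e2 (fcmp B (h0 @ fid B d2) h)"
  unfolding 1 G[OF p T H] using G0[OF p H e3 e2 i32] Act_id[OF T] 2 by simp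
  also have "... = F w d1 d2 e1 e2 h"
  using cowedgeD(2)[OF F h0 i(3) tcat_mem[OF p e3, simplified] e2 h] Act_id[OF e2] by (simp add: eq)
  finally show "G (Act t ((c # cs) @ c2) r r' h (tcat t (c # cs) c2 r w r' d1 d2 e1 e2)) = F w d1 d2 e1 e2 h" by simp
 qed
qed

text \<open>\<open>lext\<close> moves the letter first and the states afterwards; functoriality of
  \<open>Tf t\<close> fuses the two moves into one.\<close>

lemma lext_letter:
 assumes al: "al:hom A a a'" and k: "k:hom Q q0 q" and l: "l:hom Q q' q1"
 shows "FM (lext t) ([al], k, l) = FM (Tf t) (al, k, l)"
proof -
 note o = hom_objs[OF catA al] hom_obj2[OF catQ k] hom_obj1[OF catQ l]
 have "FM (lext t) ([al], k, l) = Cmp (psh_cat B) (FM (Tf t) (Idn A a', k, l)) (FM (Tf t) (al, Idn Q q, Idn Q q'))"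
  using lext_FM0[of "[al]" "[a]" "[a']" k q0 q l q' q1] al k l hom_Mor[OF k] hom_Mor[OF l] hom_Mor[of "[al]" "free_cat A" "[a]" "[a']"]
  by (simp add: lext_def tlet_simps)
 then show ?thesis
  using functor_Cmp[OF Tf, of "(al, Idn Q q, Idn Q q')" "(a, q, q')" "(a', q, q')" "(Idn A a', k, l)" "(a', q0, q1)"]
  o al k l by (simp add: Idn_hom catA catQ Cmp_idl[OF catA al] cmps)
qed

end

section \<open>Extension of a 2-transducer to presheaves\<close>

context tdx
begin

lemma sel_lext: "q:Obj Q ==> q':Obj Q ==> a:fob A ==> e:sel B (FO (lext t) (a, q, q')) b \<longleftrightarrow> e:E t a q q' b"
 by (simp add: E_def pel_def)

lemma lift_slide:
 assumes U: "psh A U" and al: "al:fhom A a' a" and u: "u:sel A U a" and e: "e:E t a' q q' b"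
 shows "lift_in t U q q' b a' (act U al u) e = lift_in t U q q' b a u (X t al (Idn Q q) (Idn Q q') b e)"
proof -
 have "(u, e):FO U a \<times> FO (FO (lext t) (a', q, q')) b"
  using u e by (simp add: sel_def E_def pel_def)
 then show ?thesis
  using act_id[OF catA U u] X_id[OF e]
  coend_bifun_slide[OF catFA al, of "(u, e)" "%a' a. FO U a' \<times> FO (FO (lext t) (a, q, q')) b"
  "%k l (u, e). (act U k u, app (FM (lext t) (l, Idn (St t) q, Idn (St t) q')) b e)"]
  by (simp add: lift_in_def liftP_def X_def)
qed

lemma lift_desc_in:
 assumes U: "psh A U"
  and F: "!!a a' al u e. al:fhom A a' a ==> u:sel A U a ==> e:E t a' q q' b ==>
  F a' (act U al u) e = F a u (X t al (Idn Q q) (Idn Q q') b e)"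
  and u: "u:sel A U a" and e: "e:E t a q q' b"
 shows "lift_desc t U q q' b F (lift_in t U q q' b a u e) = F a u e"
proof -
 note o = E_D(2,3,4)[OF e]
 have "coend_desc (free_cat A) (liftP t U q q' b) (%a (u, e). F a u e)
  (coend_in (free_cat A) (liftP t U q q' b) a (u, e) :: 'u) = (%a (u, e). F a u e) a (u, e)"
  unfolding liftP_def
 proof (rule coend_bifun_desc[OF inj_enc(5) catFA], clarsimp simp del: free_simps)
  fix a' a al u e
  assume *: "al:fhom A a' a" "u:FO U a" "e:FO (FO (lext t) (a', q, q')) b"
  have oa: "a':fob A" "a:fob A" using *(1) by (auto intro: hom_objs[OF catFA])
  have u: "u:sel A U a" and e: "e:E t a' q q' b"
  using * o oa by (auto simp: sel_def E_def pel_def)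
  show "F a' (act U al u) (app (FM (lext t) (fid A a', Idn Q q, Idn Q q')) b e) =
  F a (act U (fid A a) u) (app (FM (lext t) (al, Idn Q q, Idn Q q')) b e)"
  using F[OF *(1) u e] act_id[OF catA U u] X_id[OF e] by (simp add: X_def)
 qed (use u e in \<open>auto simp: sel_def E_def pel_def\<close>)
 then show ?thesis
  by (simp add: lift_desc_def lift_in_def)
qed

lemma lift_coend:
 assumes "q:Obj Q" "q':Obj Q" "b:fob B"
 shows "coend (free_cat A) (liftP t U q q' b) = {lift_in t U q q' b a u e | a u e. u:sel A U a & e:E t a q q' b}"
  (is "?L = ?R")
proof
 show "?L \<subseteq> ?R"
 proof
  fix z assume "z:?L"
  then obtain a x where *: "z = coend_in (free_cat A) (liftP t U q q' b) a x" "a:fob A" "x:FO (liftP t U q q' b) (a, a)"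
  unfolding coend_def by auto
  then obtain u e where "x = (u, e)" "u:sel A U a" "e:E t a q q' b"
  using assms by (auto simp: liftP_def sel_def E_def pel_def)
  with * show "z:?R" unfolding lift_in_def by blast
 qed
 show "?R \<subseteq> ?L"
 proof
  fix z assume "z:?R"
  then obtain a u e where *: "u:sel A U a" "e:E t a q q' b" "z = lift_in t U q q' b a u e" by auto
  then show "z:?L"
  unfolding *(3) lift_in_def by (intro coend_in_mem) (auto simp: liftP_def sel_def E_def pel_def)
 qed
qed

lemma lift_in_coend: "u:sel A U a ==> e:E t a q q' b ==> lift_in t U q q' b a u e:coend (free_cat A) (liftP t U q q' b)"
 using lift_coend[of q q' b U] E_D(2-4)[of e a q q' b] by blast

lemma lift_act0:
 assumes U: "psh A U" and u: "u:sel A U a" and e: "e:E t a q q' b" and be: "be:fhom B b' b"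
 shows "lift_desc t U q q' (Tgt (free_cat (TTgt t)) be) (%a u e.
  lift_in t U q q' (Src (free_cat (TTgt t)) be) a u (act (FO (lext t) (a, q, q')) be e)) (lift_in t U q q' b a u e) =
  lift_in t U q q' b' a u (Act t a q q' be e)"
 unfolding hom_Src[OF be] hom_Tgt[OF be]
proof (rule lift_desc_in[OF U _ u e])
 fix a a' al u e assume *: "al:fhom A a' a" "u:sel A U a" "e:E t a' q q' b"
 show "lift_in t U q q' b' a' (act U al u) (Act t a' q q' be e) = lift_in t U q q' b' a u (Act t a q q' be (X t al (Idn Q q) (Idn Q q') b e))"
  using lift_slide[OF U *(1,2) Act_mem[OF *(3) be]] X_Act[OF *(3,1) QI[OF E_D(2)[OF *(3)]] QI[OF E_D(3)[OF *(3)]] be] by simp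
qed

lemma psh_lift:
 assumes U: "psh A U" and q: "q:Obj Q" "q':Obj Q"
 shows "psh B (lift_ob t U q q')"
 unfolding lift_ob_def
proof (rule mk_pshI[OF catB])
 show "small (coend (free_cat A) (liftP t U q q' b) :: 'u set)" if b: "b:fob B" for b
 proof (rule coend_small)
  show "covered TYPE('u) (fob A)" by (rule covered_free[OF smallA])
  show "covered TYPE('u) (FO (liftP t U q q' b) (a, a))" if a: "a:fob A" for a
  using a b q psh_small[OF FO_psh[OF catB catL lext_functor, of "(a, q, q')"], of b]
  by (auto simp: liftP_def intro!: covered_Sigma psh_small[OF U])
 qed
next
 fix b b' be and e :: 'u assume be: "be:fhom B b' b" and "e:coend (free_cat A) (liftP t U q q' b)"
 then obtain a u e' where *: "u:sel A U a" "e':E t a q q' b" and [simp]: "e = lift_in t U q q' b a u e'"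
  unfolding lift_coend[OF q hom_obj2[OF catFB be]] by auto
 show "lift_desc t U q q' (Tgt (free_cat (TTgt t)) be) (%a u e.
  lift_in t U q q' (Src (free_cat (TTgt t)) be) a u (act (FO (lext t) (a, q, q')) be e)) e:coend (free_cat A) (liftP t U q q' b')"
  using lift_act0[OF U * be] lift_in_coend[OF *(1) Act_mem[OF *(2) be]] by (simp del: free_simps)
next
 fix b and e :: 'u assume b: "b:fob B" and "e:coend (free_cat A) (liftP t U q q' b)"
 then obtain a u e' where *: "u:sel A U a" "e':E t a q q' b" and [simp]: "e = lift_in t U q q' b a u e'"
  unfolding lift_coend[OF q b] by auto
 show "lift_desc t U q q' (Tgt (free_cat (TTgt t)) (fid B b)) (%a u e.
  lift_in t U q q' (Src (free_cat (TTgt t)) (fid B b)) a u (act (FO (lext t) (a, q, q')) (fid B b) e)) e = e"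
  using lift_act0[OF U * FBI[OF b]] Act_id[OF *(2)] by (simp del: free_simps)
next
 fix b b' b'' be be' and e :: 'u assume be: "be:fhom B b' b" "be':fhom B b'' b'" and "e:coend (free_cat A) (liftP t U q q' b)"
 then obtain a u e' where *: "u:sel A U a" "e':E t a q q' b" and [simp]: "e = lift_in t U q q' b a u e'"
  unfolding lift_coend[OF q hom_obj2[OF catFB be(1)]] by auto
 show "lift_desc t U q q' (Tgt (free_cat (TTgt t)) be') (%a u e.
  lift_in t U q q' (Src (free_cat (TTgt t)) be') a u (act (FO (lext t) (a, q, q')) be' e))
  (lift_desc t U q q' (Tgt (free_cat (TTgt t)) be) (%a u e.
  lift_in t U q q' (Src (free_cat (TTgt t)) be) a u (act (FO (lext t) (a, q, q')) be e)) e) =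
  lift_desc t U q q' (Tgt (free_cat (TTgt t)) (fcmp B be be')) (%a u e.
  lift_in t U q q' (Src (free_cat (TTgt t)) (fcmp B be be')) a u (act (FO (lext t) (a, q, q')) (fcmp B be be') e)) e"
  using lift_act0[OF U * be(1)] lift_act0[OF U *(1) Act_mem[OF *(2) be(1)] be(2)] lift_act0[OF U * Cmp_hom[OF catFB be(2,1)]]
  Act_cmp[OF *(2) be] by (simp del: free_simps)
qed

lemma lift_mem:
 assumes u: "u:sel A U a" and e: "e:E t a q q' b"
 shows "lift_in t U q q' b a u e:sel B (lift_ob t U q q') b"
 using lift_in_coend[OF u e] E_D(4)[OF e] by (simp add: sel_def lift_ob_def mk_psh_simps)

lemma lift_E:
 assumes q: "q:Obj Q" "q':Obj Q" and z: "z:sel B (lift_ob t U q q') b"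
 obtains a u e where "u:sel A U a" "e:E t a q q' b" "z = lift_in t U q q' b a u e"
proof -
 have "b:fob B" "z:coend (free_cat A) (liftP t U q q' b)"
  using z by (auto simp: sel_def lift_ob_def mk_psh_simps)
 then show ?thesis using that lift_coend[OF q] by auto
qed

lemma lift_act:
 assumes U: "psh A U" and u: "u:sel A U a" and e: "e:E t a q q' b" and be: "be:fhom B b' b"
 shows "act (lift_ob t U q q') be (lift_in t U q q' b a u e) = lift_in t U q q' b' a u (Act t a q q' be e)"
 unfolding lift_ob_def
 by (subst mk_psh_simps(2)[OF be], rule lift_in_coend[OF u e]) (rule lift_act0[OF assms])

end

text \<open>The hypothesis \<open>nat\<close> and the naturality of \<open>mu\<close> make the
  assignment well defined on the coend; \<open>Act\<close> makes the resulting map natural in the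
  target list.\<close>

lemma lift_map:
 fixes t t' :: "'u::universe tdx"
 assumes t: "is_tdx t" "is_tdx t'" and eq: "TSrc t' = TSrc t" "TTgt t' = TTgt t"
  and q: "q:Obj (St t)" "q':Obj (St t)" "r:Obj (St t')" "r':Obj (St t')"
  and mu: "mu:phom (TSrc t) U U'"
  and ph: "!!a b e. e:E t a q q' b ==> app (ph a) b e:E t' a r r' b"
  and Act: "!!a b b' be e. e:E t a q q' b ==> be:fhom (TTgt t) b' b ==>
  app (ph a) b' (Act t a q q' be e) = Act t' a r r' be (app (ph a) b e)"
  and nat: "!!al a a' b e. al:fhom (TSrc t) a a' ==> e:E t a q q' b ==>
  app (ph a') b (X t al (Idn (St t) q) (Idn (St t) q') b e) = X t' al (Idn (St t') r) (Idn (St t') r') b (app (ph a) b e)"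
 shows "lift_map t U q q' t' U' r r' mu ph:phom (TTgt t) (lift_ob t U q q') (lift_ob t' U' r r')"
  and "u:sel (TSrc t) U a ==> e:E t a q q' b ==>
  app (lift_map t U q q' t' U' r r' mu ph) b (lift_in t U q q' b a u e) = lift_in t' U' r r' b a (app mu a u) (app (ph a) b e)"
proof -
 interpret t: tdx t by unfold_locales (rule t)
 interpret t': tdx t' by unfold_locales (rule t)
 note U = phom_psh[OF t.catA mu]
 note U' = U(2)[folded eq(1)]
 let ?F = "%b a u e. lift_in t' U' r r' b a (app mu a u) (app (ph a) b e)"
 have mu': "app mu a u:sel (TSrc t') U' a" if "u:sel (TSrc t) U a" for u a
  using app_mem[OF t.catA mu that] eq by simp
 have d: "lift_desc t U q q' b (?F b) (lift_in t U q q' b a u e) = ?F b a u e"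
  if u: "u:sel (TSrc t) U a" and e: "e:E t a q q' b" for a b u e
 proof (rule t.lift_desc_in[OF U(1) _ u e])
  fix a a' al u e assume *: "al:fhom (TSrc t) a' a" "u:sel (TSrc t) U a" "e:E t a' q q' b"
  show "?F b a' (act U al u) e = ?F b a u (X t al (Idn (St t) q) (Idn (St t) q') b e)"
  using t'.lift_slide[OF U' _ mu'[OF *(2)] ph[OF *(3)], of al] * nat[OF *(1,3)] app_act[OF t.catA mu *(2,1)] eq by simp
 qed
 have "lift_desc t U q q' b (?F b) z:sel (TTgt t) (lift_ob t' U' r r') b" if z0: "z:sel (TTgt t) (lift_ob t U q q') b" for b z
 proof -
  obtain a u e where *: "u:sel (TSrc t) U a" "e:E t a q q' b" and z: "z = lift_in t U q q' b a u e"
  by (rule t.lift_E[OF q(1,2) z0])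
  show ?thesis
  unfolding z d[OF *] using t'.lift_mem[OF mu'[OF *(1)] ph[OF *(2)]] eq by simp
 qed
 moreover have "lift_desc t U q q' b' (?F b') (act (lift_ob t U q q') be z) = act (lift_ob t' U' r r') be (lift_desc t U q q' b (?F b) z)"
  if z: "z:sel (TTgt t) (lift_ob t U q q') b" and be: "be:fhom (TTgt t) b' b" for b b' be z
 proof -
  obtain a u e where *: "u:sel (TSrc t) U a" "e:E t a q q' b" and [simp]: "z = lift_in t U q q' b a u e"
  by (rule t.lift_E[OF q(1,2) z])
  show ?thesis
  using t.lift_act[OF U(1) * be] d[OF *] d[OF *(1) t.Act_mem[OF *(2) be]] Act[OF *(2) be]
  t'.lift_act[OF U' mu'[OF *(1)] ph[OF *(2)], of be b'] be eq by simp
 qed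
 ultimately show "lift_map t U q q' t' U' r r' mu ph:phom (TTgt t) (lift_ob t U q q') (lift_ob t' U' r r')"
  unfolding lift_map_def using t'.psh_lift[OF U' q(3,4)] eq
  by (intro mk_pmap_hom[OF t.catB] t.psh_lift U q) simp_all
 show "app (lift_map t U q q' t' U' r r' mu ph) b (lift_in t U q q' b a u e) = ?F b a u e"
  if "u:sel (TSrc t) U a" "e:E t a q q' b"
  unfolding lift_map_def app_mk_pmap[OF t.lift_mem[OF that]] by (rule d[OF that])
qed

context tdx
begin

lemma catPL: "category (DP t)"
 by (intro category_prod category_op category_psh catA catQ)

lemma lift_FM0:
 assumes mu: "mu:phom A U U'" and k: "k:hom Q q0 q" and l: "l:hom Q q' q1"
 shows "lift_map t U q q' t U' q0 q1 mu (%a. FM (lext t) (Idn (free_cat (TSrc t)) a, k, l)):phom B (lift_ob t U q q') (lift_ob t U' q0 q1)" (is "PROP ?Ga")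
  and "u:sel A U a ==> e:E t a q q' b ==>
  app (lift_map t U q q' t U' q0 q1 mu (%a. FM (lext t) (Idn (free_cat (TSrc t)) a, k, l))) b (lift_in t U q q' b a u e) =
  lift_in t U' q0 q1 b a (app mu a u) (X t (fid A a) k l b e)"
proof -
 note o = hom_objs[OF catQ k] hom_objs[OF catQ l]
 note i = QI[OF o(1)] QI[OF o(2)] QI[OF o(3)] QI[OF o(4)]
 have nat: "X t (fid A a') k l b (X t al (Idn Q q) (Idn Q q') b e) = X t al (Idn Q q0) (Idn Q q1) b (X t (fid A a) k l b e)"
  if al: "al:fhom A a a'" and e: "e:E t a q q' b" for al a a' b e
  using X_cmp[OF e al i(2,3) FAI[OF hom_obj2[OF catFA al]] k l] X_cmp[OF e FAI[OF hom_obj1[OF catFA al]] k l al i(1,4)] al k l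
  by (simp add: cmps)
 note L = lift_map[OF tdx tdx refl refl o(2,3,1,4) mu, where ph = "%a. FM (lext t) (Idn (free_cat (TSrc t)) a, k, l)", folded X_def]
 have m: "X t (fid A a) k l b e:E t a q0 q1 b" if "e:E t a q q' b" for a b e
  by (rule X_mem[OF that FAI[OF E_D(1)[OF that]] k l])
 have c: "X t (fid A a) k l b' (Act t a q q' be e) = Act t a q0 q1 be (X t (fid A a) k l b e)"
  if "e:E t a q q' b" "be:fhom B b' b" for a b b' be e
  by (rule X_Act[OF that(1) FAI[OF E_D(1)[OF that(1)]] k l that(2)])
 show "PROP ?Ga"
  by (rule L(1)) (erule m | erule (1) c | erule (1) nat)+
 show "app (lift_map t U q q' t U' q0 q1 mu (%a. FM (lext t) (Idn (free_cat (TSrc t)) a, k, l))) b (lift_in t U q q' b a u e) =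
  lift_in t U' q0 q1 b a (app mu a u) (X t (fid A a) k l b e)" if "u:sel A U a" "e:E t a q q' b"
  by (rule L(2)) (erule m | erule (1) c | erule (1) nat | rule that)+
qed

lemma lift_FO: "psh A U ==> q:Obj Q ==> q':Obj Q ==> FO (lift t) (U, q, q') = lift_ob t U q q'"
 by (simp add: lift_def)

lemma lift_FM_eq:
 assumes mu: "mu:phom A U U'" and k: "k:hom Q q0 q" and l: "l:hom Q q' q1"
 shows "FM (lift t) (mu, k, l) = lift_map t U q q' t U' q0 q1 mu (%a. FM (lext t) (Idn (free_cat (TSrc t)) a, k, l))"
 using hom_Mor[OF mu] hom_Mor[OF k] hom_Mor[OF l]
 by (simp add: lift_def phom_Src[OF mu] phom_Tgt[OF mu] hom_Src[OF k] hom_Tgt[OF k] hom_Src[OF l] hom_Tgt[OF l])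

lemma lift_FM:
 assumes mu: "mu:phom A U U'" and k: "k:hom Q q0 q" and l: "l:hom Q q' q1"
  and "u:sel A U a" "e:E t a q q' b"
 shows "app (FM (lift t) (mu, k, l)) b (lift_in t U q q' b a u e) = lift_in t U' q0 q1 b a (app mu a u) (X t (fid A a) k l b e)"
 unfolding lift_FM_eq[OF assms(1-3)] by (rule lift_FM0(2)[OF assms])

text \<open>\<open>lift t\<close> is already extensional, hence equal to the \<open>mk_func\<close>
  of its own arrow map; in that form the criterion \<open>functor_pshI\<close> can be applied to
  it.\<close>

lemma lift_functor: "is_functor (DP t) (psh_cat B) (lift t)"
proof -
 have "is_functor (DP t) (psh_cat B) 
  (mk_func (DP t) (%(U, q, q'). lift_ob t U q q') (FM (lift t)))"
 proof (rule functor_pshI[OF catB catPL])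
  fix x assume "x:Obj (DP t)"
  then show "psh B (case x of (U, q, q') => lift_ob t U q q')"
  by (cases x) (auto intro: psh_lift)
 next
  fix x y f assume "f:hom (DP t) x y"
  then obtain U q q' U' q0 q1 mu k l where *: "x = (U, q, q')" "y = (U', q0, q1)" "f = (mu, k, l)"
  "mu:phom A U U'" "k:hom Q q0 q" "l:hom Q q' q1"
  by (cases x; cases y; cases f) simp
  then show "FM (lift t) f:phom B (case x of (U, q, q') => lift_ob t U q q') (case y of (U, q, q') => lift_ob t U q q')"
  using lift_FM0(1)[OF *(4-6)] lift_FM_eq[OF *(4-6)] by simp
 next
  fix x b e assume x: "x:Obj (DP t)" and e: "e:sel B (case x of (U, q, q') => lift_ob t U q q') b"
  then obtain U q q' where *: "x = (U, q, q')" "psh A U" "q:Obj Q" "q':Obj Q" by (cases x) auto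
  have e0: "e:sel B (lift_ob t U q q') b" using e * by simp
  obtain a u e' where **: "u:sel A U a" "e':E t a q q' b" "e = lift_in t U q q' b a u e'"
  by (rule lift_E[OF *(3,4) e0])
  show "app (FM (lift t) (Idn (DP t) x)) b e = e"
  using lift_FM[OF phom_id[OF catA *(2)] QI[OF *(3)] QI[OF *(4)] **(1,2)] app_id[OF **(1)] X_id[OF **(2)]
  by (simp add: * **(3))
 next
  fix x y z f g b e assume f: "f:hom (DP t) x y" and g: "g:hom (DP t) y z"
  and e: "e:sel B (case x of (U, q, q') => lift_ob t U q q') b"
  obtain U q q' U' q0 q1 mu k l where *: "x = (U, q, q')" "y = (U', q0, q1)" "f = (mu, k, l)"
  "mu:phom A U U'" "k:hom Q q0 q" "l:hom Q q' q1"
  using f by (cases x; cases y; cases f) simp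
  obtain U'' q00 q11 mu' k' l' where **: "z = (U'', q00, q11)" "g = (mu', k', l')"
  "mu':phom A U' U''" "k':hom Q q00 q0" "l':hom Q q1 q11"
  using g * by (cases z; cases g) simp
  have e0: "e:sel B (lift_ob t U q q') b" using e * by simp
  obtain a u e' where ***: "u:sel A U a" "e':E t a q q' b" "e = lift_in t U q q' b a u e'"
  by (rule lift_E[OF hom_obj2[OF catQ *(5)] hom_obj1[OF catQ *(6)] e0])
  note ia = FAI[OF E_D(1)[OF ***(2)]]
  show "app (FM (lift t) (Cmp (DP t) g f)) b e = app (FM (lift t) g) b (app (FM (lift t) f) b e)"
  unfolding *(3) **(2) prod_simps op_simps ***(3) lift_FM[OF *(4-6) ***(1,2)]
  lift_FM[OF **(3-5) app_mem[OF catA *(4) ***(1)] X_mem[OF ***(2) ia *(5,6)]]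
  lift_FM[OF phom_cmp[OF catA *(4) **(3)] Cmp_hom[OF catQ **(4) *(5)] Cmp_hom[OF catQ *(6) **(5)] ***(1,2)]
  app_cmp[OF catA *(4) **(3) ***(1)] X_cmp[OF ***(2) ia *(5,6) ia **(4,5)] Cmp_idl[OF catFA ia] ..
 qed
 moreover have "mk_func (DP t) (%(U, q, q'). lift_ob t U q q') (FM (lift t)) = lift t"
  by (simp add: lift_def mk_func_def)
 ultimately show ?thesis by simp
qed

end


section \<open>Composition of 2-transducers\<close>

lemma code_cat_simps [simp]:
 assumes "inj (enc :: 'a => 'u::universe)"
 shows "(enc (x :: 'a) :: 'u):Obj (code_cat C) \<longleftrightarrow> x:Obj C"
  "Idn (code_cat C) (enc (x :: 'a) :: 'u) = enc (Idn C x)"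
 using assms by (auto simp: code_cat_def dec_enc inj_image_mem_iff)

lemma code_cat_mor:
 assumes "inj (enc :: 'b => 'u::universe)"
 shows "(enc (f :: 'b) :: 'u):Mor (code_cat C) \<longleftrightarrow> f:Mor C"
  "Src (code_cat C) (enc (f :: 'b) :: 'u) = enc (Src C f)"
  "Tgt (code_cat C) (enc (f :: 'b) :: 'u) = enc (Tgt C f)"
  "Cmp (code_cat C) (enc (g :: 'b) :: 'u) (enc f) = enc (Cmp C g f)"
 using assms by (auto simp: code_cat_def dec_enc inj_image_mem_iff)

lemma code_cat_hom:
 fixes C :: "('a, 'b) cat"
 assumes "inj (enc :: 'a => 'u::universe)" "inj (enc :: 'b => 'u::universe)"
 shows "(enc f :: 'u):hom (code_cat C) (enc x) (enc y) \<longleftrightarrow> f:hom C x y"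
  and "m:hom (code_cat C) z z' \<longleftrightarrow> (EX f x y. (m :: 'u) = enc f & (z :: 'u) = enc x & (z' :: 'u) = enc y & f:hom C x y)" (is "PROP ?Gb")
proof -
 show 1: "(enc f :: 'u):hom (code_cat C) (enc x) (enc y) \<longleftrightarrow> f:hom C x y" for f x y
  using assms by (simp add: hom_def code_cat_mor inj_eq)
 show "PROP ?Gb"
 proof
  assume m: "m:hom (code_cat C) z z'"
  then obtain f where f: "m = enc f" "f:Mor C" by (auto simp: hom_def code_cat_def)
  then have "z = enc (Src C f)" "z' = enc (Tgt C f)" using m assms by (auto simp: hom_def code_cat_mor)
  then show "EX f x y. (m :: 'u) = enc f & (z :: 'u) = enc x & (z' :: 'u) = enc y & f:hom C x y"
  using f Mor_hom by metis
 qed (use 1 in auto)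
qed

lemma category_code:
 fixes C :: "('a, 'b) cat"
 assumes inj: "inj (enc :: 'a => 'u::universe)" "inj (enc :: 'b => 'u::universe)" and C: "category C"
 shows "category (code_cat C :: ('u, 'u) cat)"
proof (rule categoryI)
 fix f assume "f:Mor (code_cat C :: ('u, 'u) cat)"
 then have "EX g. f = enc g & g:Mor C" by (auto simp: code_cat_def)
 then show "Src (code_cat C) f:Obj (code_cat C :: ('u, 'u) cat) & Tgt (code_cat C) f:Obj (code_cat C :: ('u, 'u) cat)"
  using C inj by (auto simp: code_cat_mor category_def)
next
 fix x assume "x:Obj (code_cat C :: ('u, 'u) cat)"
 then have "EX y. x = enc y & y:Obj C" by (auto simp: code_cat_def)
 then show "Idn (code_cat C) x:hom (code_cat C :: ('u, 'u) cat) x x"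
  using Idn_hom[OF C] inj by (auto simp: code_cat_hom(1)[OF inj])
next
 fix x y z :: 'u and f g assume "f:hom (code_cat C) x y" "g:hom (code_cat C) y z"
 then show "Cmp (code_cat C) g f:hom (code_cat C) x z"
  using inj_eq[OF inj(1)] Cmp_hom[OF C] unfolding code_cat_hom(2)[OF inj] by (auto simp: code_cat_mor[OF inj(2)])
next
 fix x y :: 'u and f assume "f:hom (code_cat C) x y"
 then show "Cmp (code_cat C) f (Idn (code_cat C) x) = f" "Cmp (code_cat C) (Idn (code_cat C) y) f = f"
  unfolding code_cat_hom(2)[OF inj] by (auto simp: code_cat_mor[OF inj(2)] inj Cmp_idl[OF C] Cmp_idr[OF C])
next
 fix x y z w :: 'u and f g h assume "f:hom (code_cat C) x y" "g:hom (code_cat C) y z" "h:hom (code_cat C) z w"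
 then show "Cmp (code_cat C) h (Cmp (code_cat C) g f) = Cmp (code_cat C) (Cmp (code_cat C) h g) f"
  using inj_eq[OF inj(1)] Cmp_assoc[OF C] unfolding code_cat_hom(2)[OF inj] by (auto simp: code_cat_mor[OF inj(2)])
qed

lemma small_code:
 fixes C :: "('a, 'b) cat"
 assumes "inj (enc :: 'a => 'u::universe)" "inj (enc :: 'b => 'u::universe)" and "category C"
  "covered TYPE('u) (Obj C)" "covered TYPE('u) (Mor C)"
 shows "small_category (code_cat C :: ('u, 'u) cat)"
 using category_code[OF assms(1-3)] covered_image[OF assms(4), where g = "enc :: _ => 'u"] covered_image[OF assms(5), where g = "enc :: _ => 'u"]
 by (simp add: small_category_def) (simp add: code_cat_def)

lemma small_states_prod:
 assumes "small_category (Q :: ('u::universe, 'u) cat)" "small_category P"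
 shows "small_category (states_prod Q P)"
 unfolding states_prod_def using assms
 by (intro small_code inj_enc category_prod) (auto simp: small_category_def intro!: covered_Sigma)

lemma small_terminal: "small_category (terminal_cat :: ('u::universe, 'u) cat)"
proof -
 have "covered TYPE('u) {()}"
  using covered_image[OF covered_nat, where g = "%_. ()"] by (rule covered_subset) auto
 then show ?thesis
  unfolding terminal_cat_def by (intro small_code inj_enc) (auto intro!: categoryI simp: hom_def)
qed

lemma states_prod_simps [simp]:
 fixes Q P :: "('u::universe, 'u) cat" and q p k l :: 'u
 shows "enc (q, p):Obj (states_prod Q P) \<longleftrightarrow> q:Obj Q & p:Obj P"
  "Idn (states_prod Q P) (enc (q, p)) = enc (Idn Q q, Idn P p)"
  "enc (k, l):hom (states_prod Q P) (enc (q, p)) (enc (q', p')) \<longleftrightarrow> k:hom Q q q' & l:hom P p p'"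
  "Cmp (states_prod Q P) (enc (k', l')) (enc (k, l)) = enc (Cmp Q k' k, Cmp P l' l)"
  "enc (k, l):Mor (states_prod Q P) \<longleftrightarrow> k:Mor Q & l:Mor P"
 unfolding states_prod_def by (simp_all add: inj_enc code_cat_hom(1) code_cat_mor)

lemma states_objE:
 fixes Q P :: "('u::universe, 'u) cat"
 assumes "z:Obj (states_prod Q P)"
 obtains q p :: 'u where "z = enc (q, p)" "q:Obj Q" "p:Obj P"
 using assms by (auto simp: states_prod_def code_cat_def)

lemma states_homE:
 fixes Q P :: "('u::universe, 'u) cat"
 assumes "m:hom (states_prod Q P) z z'"
 obtains k l q p q' p' :: 'u where "m = enc (k, l)" "z = enc (q, p)" "z' = enc (q', p')" "k:hom Q q q'" "l:hom P p p'"
 using assms unfolding states_prod_def code_cat_hom(2)[OF inj_enc(2) inj_enc(2)] by auto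

lemma terminal_simps [simp]:
 "z:Obj terminal_cat \<longleftrightarrow> z = pt" "m:hom terminal_cat z z' \<longleftrightarrow> m = pt & z = pt & z' = pt"
 "Idn terminal_cat pt = pt" "Cmp terminal_cat pt pt = pt" "m:Mor terminal_cat \<longleftrightarrow> m = pt"
 by (auto simp: terminal_cat_def code_cat_def pt_def hom_def)

text \<open>The pair is listed in the order of application: \<open>t\<close> comes first, and
  \<open>ut\<close> stands for \<open>u\<close> after \<open>t\<close>.\<close>

locale tdx2 = t: tdx t + u: tdx u for t :: "'u::universe tdx" and u :: "'u tdx" +
 assumes src_u: "TSrc u = TTgt t"
begin

abbreviation "ut == tdx_comp u t"

lemma comp_simps [simp]: "TSrc ut = TSrc t" "TTgt ut = TTgt u" "St ut = states_prod (St t) (St u)"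
 by (simp_all add: tdx_comp_def)

lemma comp_FO:
 assumes "b:Obj (TSrc t)" "p:Obj (St t)" "p':Obj (St t)" "r:Obj (St u)" "r':Obj (St u)"
 shows "FO (Tf ut) (b, enc (p, r), enc (p', r')) = lift_ob u (FO (Tf t) (b, p, p')) r r'"
proof -
 have "psh (TSrc u) (FO (Tf t) (b, p, p'))"
  using FO_psh[OF t.catB t.catT t.Tf, of "(b, p, p')"] assms src_u by simp
 then show ?thesis
  using assms by (simp add: tdx_comp_def u.lift_FO)
qed

lemma comp_FM:
 assumes "be:Mor (TSrc t)" "k:Mor (St t)" "k':Mor (St t)" "l:Mor (St u)" "l':Mor (St u)"
 shows "FM (Tf ut) (be, enc (k, l), enc (k', l')) = FM (lift u) (FM (Tf t) (be, k, k'), l, l')"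
 using assms by (simp add: tdx_comp_def)

lemma comp_tdx: "is_tdx ut"
proof -
 let ?S = "states_prod (St t) (St u)"
 let ?D = "TSrc t \<times>\<^sub>c op_cat ?S \<times>\<^sub>c ?S"
 have cS: "category ?S" by (intro sl small_states_prod t.smallQ u.smallQ)
 have "is_functor ?D (psh_cat (TTgt u)) (mk_func ?D (FO (Tf ut)) (FM (Tf ut)))"
 proof (rule functorI)
  show "category ?D" by (intro category_prod category_op cS t.catA)
 next
  fix x assume "x:Obj ?D"
  then obtain b z z' where x: "x = (b, z, z')" "b:Obj (TSrc t)" "z:Obj ?S" "z':Obj ?S" by (cases x) auto
  obtain p r where z: "z = enc (p, r)" "p:Obj (St t)" "r:Obj (St u)" by (rule states_objE[OF x(3)])
  obtain p' r' where z': "z' = enc (p', r')" "p':Obj (St t)" "r':Obj (St u)" by (rule states_objE[OF x(4)])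
  have "psh (TSrc u) (FO (Tf t) (b, p, p'))"
  using FO_psh[OF t.catB t.catT t.Tf, of "(b, p, p')"] x z z' src_u by simp
  then show "psh (TTgt u) (FO (Tf ut) x)"
  using x z z' by (simp add: comp_FO u.psh_lift)
  have i: "(Idn (TSrc t) b, Idn (St t) p, Idn (St t) p'):hom (D3 t) (b, p, p') (b, p, p')"
  using x z z' by (auto intro: Idn_hom t.catA t.catQ)
  show "FM (Tf ut) (Idn ?D x) = Idn (psh_cat (TTgt u)) (FO (Tf ut) x)"
  using functor_Idn[OF t.Tf, of "(b, p, p')"] functor_Idn[OF u.lift_functor, of "(FO (Tf t) (b, p, p'), r, r')"]
  x z z' \<open>psh (TSrc u) (FO (Tf t) (b, p, p'))\<close> hom_Mor[OF i]
  by (simp add: comp_FO comp_FM Idn_Mor u.catQ u.lift_FO src_u)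
 next
  fix x y f assume "f:hom ?D x y"
  then obtain b z z' b2 z2 z2' be m m' where x: "x = (b, z, z')" "y = (b2, z2, z2')" "f = (be, m, m')" and be: "be:hom (TSrc t) b b2"
  and m: "m:hom ?S z2 z" and m': "m':hom ?S z' z2'" by (cases x; cases y; cases f) auto
  obtain k l p2 r2 p r where z: "m = enc (k, l)" "z2 = enc (p2, r2)" "z = enc (p, r)" "k:hom (St t) p2 p" "l:hom (St u) r2 r"
  by (rule states_homE[OF m])
  obtain k' l' p' r' p2' r2' where z': "m' = enc (k', l')" "z' = enc (p', r')" "z2' = enc (p2', r2')" "k':hom (St t) p' p2'" "l':hom (St u) r' r2'"
  by (rule states_homE[OF m'])
  have T: "FM (Tf t) (be, k, k'):phom (TSrc u) (FO (Tf t) (b, p, p')) (FO (Tf t) (b2, p2, p2'))"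
  using functor_hom[OF t.Tf, of "(be, k, k')" "(b, p, p')" "(b2, p2, p2')"] be z z' src_u by simp
  note o = hom_objs[OF t.catA be] hom_objs[OF t.catQ z(4)] hom_objs[OF u.catQ z(5)]
  hom_objs[OF t.catQ z'(4)] hom_objs[OF u.catQ z'(5)]
  show "FM (Tf ut) f:phom (TTgt u) (FO (Tf ut) x) (FO (Tf ut) y)"
  using u.lift_FM0(1)[OF T z(5) z'(5)] u.lift_FM_eq[OF T z(5) z'(5)] o
  hom_Mor[OF be] hom_Mor[OF z(4)] hom_Mor[OF z(5)] hom_Mor[OF z'(4)] hom_Mor[OF z'(5)]
  by (simp add: x z z' comp_FO comp_FM)
 next
  fix x y w f g assume f: "f:hom ?D x y" and g: "g:hom ?D y w"
  obtain b z z' b2 z2 z2' be m m' where x: "x = (b, z, z')" "y = (b2, z2, z2')" "f = (be, m, m')" and be: "be:hom (TSrc t) b b2"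
  and m: "m:hom ?S z2 z" and m': "m':hom ?S z' z2'" using f by (cases x; cases y; cases f) auto
  obtain k l p2 r2 p r where z: "m = enc (k, l)" "z2 = enc (p2, r2)" "z = enc (p, r)" "k:hom (St t) p2 p" "l:hom (St u) r2 r"
  by (rule states_homE[OF m])
  obtain k' l' p' r' p2' r2' where z': "m' = enc (k', l')" "z' = enc (p', r')" "z2' = enc (p2', r2')" "k':hom (St t) p' p2'" "l':hom (St u) r' r2'"
  by (rule states_homE[OF m'])
  obtain b3 z3 z3' ga n n' where y: "w = (b3, z3, z3')" "g = (ga, n, n')" and ga: "ga:hom (TSrc t) b2 b3"
  and n: "n:hom ?S z3 z2" and n': "n':hom ?S z2' z3'" using g x by (cases w; cases g) auto
  obtain k2 l2 p3 r3 where n2: "n = enc (k2, l2)" "z3 = enc (p3, r3)" "k2:hom (St t) p3 p2" "l2:hom (St u) r3 r2"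
  by (rule states_homE[OF n]) (use z in auto)
  obtain k2' l2' p3' r3' where n2': "n' = enc (k2', l2')" "z3' = enc (p3', r3')" "k2':hom (St t) p2' p3'" "l2':hom (St u) r2' r3'"
  by (rule states_homE[OF n']) (use z' in auto)
  have T: "FM (Tf t) (be, k, k'):phom (TSrc u) (FO (Tf t) (b, p, p')) (FO (Tf t) (b2, p2, p2'))"
  using functor_hom[OF t.Tf, of "(be, k, k')" "(b, p, p')" "(b2, p2, p2')"] be z z' src_u by simp
  have T2: "FM (Tf t) (ga, k2, k2'):phom (TSrc u) (FO (Tf t) (b2, p2, p2')) (FO (Tf t) (b3, p3, p3'))"
  using functor_hom[OF t.Tf, of "(ga, k2, k2')" "(b2, p2, p2')" "(b3, p3, p3')"] ga n2 n2' src_u by simp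
  have C: "FM (Tf t) (Cmp (TSrc t) ga be, Cmp (St t) k k2, Cmp (St t) k2' k') = Cmp (psh_cat (TSrc u)) (FM (Tf t) (ga, k2, k2')) (FM (Tf t) (be, k, k'))"
  using functor_Cmp[OF t.Tf, of "(be, k, k')" "(b, p, p')" "(b2, p2, p2')" "(ga, k2, k2')" "(b3, p3, p3')"] be ga z z' n2 n2' src_u by simp
  note cm = Cmp_hom[OF t.catA be ga] Cmp_hom[OF t.catQ n2(3) z(4)] Cmp_hom[OF t.catQ z'(4) n2'(3)] Cmp_hom[OF u.catQ n2(4) z(5)] Cmp_hom[OF u.catQ z'(5) n2'(4)]
  show "FM (Tf ut) (Cmp ?D g f) = Cmp (psh_cat (TTgt u)) (FM (Tf ut) g) (FM (Tf ut) f)"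
  using functor_Cmp[OF u.lift_functor, of "(FM (Tf t) (be, k, k'), l, l')" "(FO (Tf t) (b, p, p'), r, r')" "(FO (Tf t) (b2, p2, p2'), r2, r2')"
  "(FM (Tf t) (ga, k2, k2'), l2, l2')" "(FO (Tf t) (b3, p3, p3'), r3, r3')"] T T2 C z z' n2 n2' cm[THEN hom_Mor]
  hom_Mor[OF be] hom_Mor[OF ga] z(4,5)[THEN hom_Mor] z'(4,5)[THEN hom_Mor] n2(3,4)[THEN hom_Mor] n2'(3,4)[THEN hom_Mor]
  by (simp add: x y comp_FM)
 qed
 moreover have "mk_func ?D (FO (Tf ut)) (FM (Tf ut)) = Tf ut"
  by (simp add: tdx_comp_def mk_func_def)
 ultimately show ?thesis
  by (simp add: is_tdx_def t.smallA u.smallB small_states_prod t.smallQ u.smallQ)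
qed

end

sublocale tdx2 \<subseteq> ut: tdx "tdx_comp u t"
 by unfold_locales (rule comp_tdx)

section \<open>Lists of letters of a composite\<close>

text \<open>
 \<open>LS bs p p' r r' d\<close> is \<open>U(t(bs; p, p'), r, r')[d]\<close>, with generators \<open>LL\<close>, action \<open>LX\<close> of arrows in
 \<open>(bs, p, p', r, r')\<close> and action \<open>LA\<close> of arrows in \<open>d\<close>; \<open>Mh\<close> is the multiplication
 \<open>U(t(bs1)) \<otimes> U(t(bs2)) \<rightarrow> U(t(bs1 @ bs2))\<close>.
\<close>

context tdx2
begin

abbreviation "P == St t"
abbreviation "R == St u"
abbreviation "cB == TSrc t"
abbreviation "cC == TTgt t"
abbreviation "cD == TTgt u"
abbreviation "Eu bs p r p' r' d == E ut bs (enc (p, r)) (enc (p', r')) d"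
abbreviation "Au bs p r p' r' de e == Act ut bs (enc (p, r)) (enc (p', r')) de e"

text \<open>The facts about \<open>u\<close> are restated with its source rewritten to the target of
  \<open>t\<close>, so that lists in the middle category have one name.\<close>

lemmas uX_mem = u.X_mem[unfolded src_u] and uX_id = u.X_id[unfolded src_u] and uX_cmp = u.X_cmp[unfolded src_u]
 and uX_Act = u.X_Act[unfolded src_u] and utcat_X = u.tcat_X[unfolded src_u] and utcat_slide = u.tcat_slide[unfolded src_u]
 and utcat_Nil_right = u.tcat_Nil_right[unfolded src_u] and utcat_Nil = u.tcat_Nil[unfolded src_u] and utcat_univ = u.tcat_univ[unfolded src_u]
 and uE_D = u.E_D[unfolded src_u] and ulift_slide = u.lift_slide[unfolded src_u] and ulift_desc_in = u.lift_desc_in[unfolded src_u]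
 and ulift_E = u.lift_E[unfolded src_u] and ulift_mem = u.lift_mem[unfolded src_u] and ulift_act = u.lift_act[unfolded src_u]
 and ulift_FM = u.lift_FM[unfolded src_u] and ulift_functor = u.lift_functor[unfolded src_u]

definition LL where "LL bs p p' r r' d c v e = lift_in u (FO (lext t) (bs, p, p')) r r' d c v e"

definition LS where
 "LS bs p p' r r' d = {z. bs:fob cB & p:Obj P & p':Obj P & r:Obj R & r':Obj R &
  z:sel cD (lift_ob u (FO (lext t) (bs, p, p')) r r') d}"

definition LX where "LX be k k' l l' d z = app (FM (lift u) (FM (lext t) (be, k, k'), l, l')) d z"

definition LA where "LA bs p p' r r' de z = act (lift_ob u (FO (lext t) (bs, p, p')) r r') de z"

lemma t_sel: "e:E t bs p p' c ==> e:sel cC (FO (lext t) (bs, p, p')) c"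
 by (simp add: E_def pel_def)

lemma t_psh: "bs:fob cB ==> p:Obj P ==> p':Obj P ==> psh cC (FO (lext t) (bs, p, p'))"
 using FO_psh[OF t.catB t.catL t.lext_functor, of "(bs, p, p')"] by simp

lemma t_phom: "be:fhom cB bs bs' ==> k:hom P p0 p ==> k':hom P p' p1 ==>
  FM (lext t) (be, k, k'):phom cC (FO (lext t) (bs, p, p')) (FO (lext t) (bs', p0, p1))"
 using functor_hom[OF t.lext_functor, of "(be, k, k')" "(bs, p, p')" "(bs', p0, p1)"] by simp

lemma LL_mem: "v:E t bs p p' c ==> e:E u c r r' d ==> LL bs p p' r r' d c v e:LS bs p p' r r' d"
 using ulift_mem[OF t_sel] t.E_D[of v bs p p' c] uE_D[of e c r r' d] by (simp add: LS_def LL_def)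

lemma LS_D: "z:LS bs p p' r r' d ==> bs:fob cB & p:Obj P & p':Obj P & r:Obj R & r':Obj R & d:fob cD"
 by (simp add: LS_def sel_def)

lemma LS_E:
 assumes z: "z:LS bs p p' r r' d"
 obtains c v e where "v:E t bs p p' c" "e:E u c r r' d" "z = LL bs p p' r r' d c v e"
proof -
 have *: "r:Obj R" "r':Obj R" "z:sel cD (lift_ob u (FO (lext t) (bs, p, p')) r r') d" using z by (auto simp: LS_def)
 show ?thesis
  by (rule ulift_E[OF *]) (rule that, use z in \<open>auto simp: LS_def t.sel_lext LL_def\<close>)
qed

lemma LL_slide:
 assumes al: "al:fhom cC c' c" and v: "v:E t bs p p' c" and e: "e:E u c' r r' d"
 shows "LL bs p p' r r' d c' (Act t bs p p' al v) e = LL bs p p' r r' d c v (X u al (Idn R r) (Idn R r') d e)"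
 unfolding LL_def by (rule ulift_slide[OF t_psh[OF t.E_D(1-3)[OF v]] al t_sel[OF v] e])

lemma LL_desc:
 assumes F: "!!c c' al v e. al:fhom cC c' c ==> v:E t bs p p' c ==> e:E u c' r r' d ==>
  F c' (Act t bs p p' al v) e = F c v (X u al (Idn R r) (Idn R r') d e)"
  and v: "v:E t bs p p' c" and e: "e:E u c r r' d"
 shows "lift_desc u (FO (lext t) (bs, p, p')) r r' d F (LL bs p p' r r' d c v e) = F c v e"
 unfolding LL_def
 by (rule ulift_desc_in[OF t_psh[OF t.E_D(1-3)[OF v]] _ t_sel[OF v] e]) (rule F, simp_all add: t.sel_lext t.E_D(1-3)[OF v])

lemma LX_LL:
 assumes v: "v:E t bs p p' c" and e: "e:E u c r r' d" and h: "be:fhom cB bs bs'" "k:hom P p0 p" "k':hom P p' p1" "l:hom R r0 r" "l':hom R r' r1"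
 shows "LX be k k' l l' d (LL bs p p' r r' d c v e) = LL bs' p0 p1 r0 r1 d c (X t be k k' c v) (X u (fid cC c) l l' d e)"
 unfolding LX_def LL_def X_def[of t] by (rule ulift_FM[OF t_phom[OF h(1-3)] h(4,5) t_sel[OF v] e])

lemma LA_LL:
 assumes v: "v:E t bs p p' c" and e: "e:E u c r r' d" and de: "de:fhom cD d' d"
 shows "LA bs p p' r r' de (LL bs p p' r r' d c v e) = LL bs p p' r r' d' c v (Act u c r r' de e)"
 unfolding LA_def LL_def by (rule ulift_act[OF t_psh[OF t.E_D(1-3)[OF v]] t_sel[OF v] e de])

lemma LX_mem:
 assumes z: "z:LS bs p p' r r' d" and h: "be:fhom cB bs bs'" "k:hom P p0 p" "k':hom P p' p1" "l:hom R r0 r" "l':hom R r' r1"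
 shows "LX be k k' l l' d z:LS bs' p0 p1 r0 r1 d"
proof -
 obtain c v e where *: "v:E t bs p p' c" "e:E u c r r' d" "z = LL bs p p' r r' d c v e" by (rule LS_E[OF z])
 have ic: "fid cC c:fhom cC c c" by (rule t.FBI[OF t.E_D(4)[OF *(1)]])
 show ?thesis
  unfolding *(3) LX_LL[OF *(1,2) h] by (rule LL_mem[OF t.X_mem[OF *(1) h(1-3)] uX_mem[OF *(2) ic h(4,5)]])
qed

text \<open>On one letter the composite is by definition the lift along \<open>u\<close> of the
  value of \<open>t\<close>. Elements of the composite and elements of the regrouped form thus
  coincide there, which anchors the inductions on regrouping.\<close>

lemma letter_FO:
 assumes "b:Obj cB" "p:Obj P" "p':Obj P" "r:Obj R" "r':Obj R"
 shows "FO (lext ut) ([b], enc (p, r), enc (p', r')) = lift_ob u (FO (lext t) ([b], p, p')) r r'"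
 using assms by (simp add: ut.lext_FO[simplified] ut.tlet_simps t.lext_FO t.tlet_simps comp_FO)

lemma E_letter: "e:Eu [b] p r p' r' d \<longleftrightarrow> e:LS [b] p p' r r' d"
 by (auto simp: E_def pel_def LS_def letter_FO)

lemma Act_letter:
 "e:LS [b] p p' r r' d ==> Au [b] p r p' r' de e = LA [b] p p' r r' de e"
 using LS_D[of e "[b]"] by (simp add: LA_def letter_FO)

lemma X_letter:
 assumes "[be]:fhom cB [b] [b']" "k:hom P p0 p" "k':hom P p' p1" "l:hom R r0 r" "l':hom R r' r1"
 shows "X ut [be] (enc (k, l)) (enc (k', l')) d e = LX [be] k k' l l' d e"
proof -
 have be: "be:hom cB b b'" using assms(1) by simp
 show ?thesis
  using ut.lext_letter[of be b b' "enc (k, l)" "enc (p0, r0)" "enc (p, r)" "enc (k', l')" "enc (p', r')" "enc (p1, r1)"]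
  t.lext_letter[OF be assms(2,3)] be assms(2-5) hom_Mor[OF be] assms(2-5)[THEN hom_Mor]
  by (simp add: X_def LX_def comp_FM)
qed

text \<open>The multiplication \<open>U(t(bs1; p, x), r, w) \<otimes> U(t(bs2; x, p'), w, r') \<rightarrow> U(t(bs1 @ bs2; p, p'), r, r')\<close>, precomposed with \<open>h\<close>.\<close>

definition Mh where
 "Mh bs1 bs2 p x p' r w r' d d1 d2 z1 z2 h = lift_desc u (FO (lext t) (bs1, p, x)) r w d1 (%c1 v1 w1.
  lift_desc u (FO (lext t) (bs2, x, p')) w r' d2 (%c2 v2 w2.
  LL (bs1 @ bs2) p p' r r' d (c1 @ c2) (tcat t bs1 bs2 p x p' c1 c2 v1 v2)
  (Act u (c1 @ c2) r r' h (tcat u c1 c2 r w r' d1 d2 w1 w2))) z2) z1"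

text \<open>\<open>Mh\<close> leaves two coends, one after the other, and has to respect the
  relation of each. Both requirements are instances of a single computation in which the two middle
  lists move at once.\<close>

lemma Mh_LL:
 assumes v1: "v1:E t bs1 p x c1" and w1: "w1:E u c1 r w d1" and v2: "v2:E t bs2 x p' c2" and w2: "w2:E u c2 w r' d2"
  and h: "h:fhom cD d (d1 @ d2)"
 shows "Mh bs1 bs2 p x p' r w r' d d1 d2 (LL bs1 p x r w d1 c1 v1 w1) (LL bs2 x p' w r' d2 c2 v2 w2) h =
  LL (bs1 @ bs2) p p' r r' d (c1 @ c2) (tcat t bs1 bs2 p x p' c1 c2 v1 v2) (Act u (c1 @ c2) r r' h (tcat u c1 c2 r w r' d1 d2 w1 w2))"
proof -
 note iR = u.QI[OF u.E_D(2)[OF w1]] u.QI[OF u.E_D(3)[OF w1]] u.QI[OF u.E_D(3)[OF w2]]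
 \<comment> \<open>Arrows \<open>al1\<close>, \<open>al2\<close> of the middle lists slide together:
   concatenation for \<open>t\<close> is natural under their contravariant action, concatenation for
   \<open>u\<close> under the covariant one, and the coend relation at \<open>al1 @ al2\<close>
   joins the two. The cases needed below have an identity as one of the arrows.\<close>
 have gen: "LL (bs1 @ bs2) p p' r r' d (c1' @ c2') (tcat t bs1 bs2 p x p' c1' c2' (Act t bs1 p x al1 v1) (Act t bs2 x p' al2 v2))
  (Act u (c1' @ c2') r r' h (tcat u c1' c2' r w r' d1 d2 w1 w2)) =
  LL (bs1 @ bs2) p p' r r' d (c1 @ c2) (tcat t bs1 bs2 p x p' c1 c2 v1 v2)
  (Act u (c1 @ c2) r r' h (tcat u c1 c2 r w r' d1 d2 (X u al1 (Idn R r) (Idn R w) d1 w1) (X u al2 (Idn R w) (Idn R r') d2 w2)))"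
  if v1: "v1:E t bs1 p x c1" and v2: "v2:E t bs2 x p' c2" and w1: "w1:E u c1' r w d1" and w2: "w2:E u c2' w r' d2"
  and al: "al1:fhom cC c1' c1" "al2:fhom cC c2' c2" for c1 c1' c2 c2' v1 v2 w1 w2 al1 al2
 proof -
  note T = t.tcat_mem[OF v1 v2] and T' = u.tcat_mem[OF w1 w2]
  show ?thesis
  unfolding t.tcat_Act[OF v1 v2 al, symmetric] LL_slide[OF fhom_append[OF al] T u.Act_mem[OF T' h]]
  uX_Act[OF T' fhom_append[OF al] iR(1,3) h] utcat_X[OF w1 w2 al iR(1,3)] ..
 qed
 have inner: "lift_desc u (FO (lext t) (bs2, x, p')) w r' d2 (%c2 v2 w2.
  LL (bs1 @ bs2) p p' r r' d (c1 @ c2) (tcat t bs1 bs2 p x p' c1 c2 v1 v2)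
  (Act u (c1 @ c2) r r' h (tcat u c1 c2 r w r' d1 d2 w1 w2))) (LL bs2 x p' w r' d2 c2 v2 w2) =
  LL (bs1 @ bs2) p p' r r' d (c1 @ c2) (tcat t bs1 bs2 p x p' c1 c2 v1 v2) (Act u (c1 @ c2) r r' h (tcat u c1 c2 r w r' d1 d2 w1 w2))"
  if v1: "v1:E t bs1 p x c1" and w1: "w1:E u c1 r w d1" for c1 v1 w1
 proof (rule LL_desc[OF _ v2 w2])
  fix c c' al v e assume *: "al:fhom cC c' c" "v:E t bs2 x p' c" "e:E u c' w r' d2"
  note i1 = t.FBI[OF t.E_D(4)[OF v1]]
  show "LL (bs1 @ bs2) p p' r r' d (c1 @ c') (tcat t bs1 bs2 p x p' c1 c' v1 (Act t bs2 x p' al v)) (Act u (c1 @ c') r r' h (tcat u c1 c' r w r' d1 d2 w1 e)) =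
  LL (bs1 @ bs2) p p' r r' d (c1 @ c) (tcat t bs1 bs2 p x p' c1 c v1 v) (Act u (c1 @ c) r r' h (tcat u c1 c r w r' d1 d2 w1 (X u al (Idn R w) (Idn R r') d2 e)))"
  using gen[OF v1 *(2) w1 *(3) i1 *(1)] t.Act_id[OF v1] uX_id[OF w1] by simp
 qed
 show ?thesis
  unfolding Mh_def
 proof (subst LL_desc[OF _ v1 w1])
  fix c c' al v e assume *: "al:fhom cC c' c" "v:E t bs1 p x c" "e:E u c' r w d1"
  note i2 = t.FBI[OF t.E_D(4)[OF v2]]
  show "lift_desc u (FO (lext t) (bs2, x, p')) w r' d2 (%c2 v2 w2.
  LL (bs1 @ bs2) p p' r r' d (c' @ c2) (tcat t bs1 bs2 p x p' c' c2 (Act t bs1 p x al v) v2)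
  (Act u (c' @ c2) r r' h (tcat u c' c2 r w r' d1 d2 e w2))) (LL bs2 x p' w r' d2 c2 v2 w2) =
  lift_desc u (FO (lext t) (bs2, x, p')) w r' d2 (%c2 v2 w2.
  LL (bs1 @ bs2) p p' r r' d (c @ c2) (tcat t bs1 bs2 p x p' c c2 v v2)
  (Act u (c @ c2) r r' h (tcat u c c2 r w r' d1 d2 (X u al (Idn R r) (Idn R w) d1 e) w2))) (LL bs2 x p' w r' d2 c2 v2 w2)"
  unfolding inner[OF t.Act_mem[OF *(2,1)] *(3)] inner[OF *(2) uX_mem[OF *(3,1) iR(1,2)]]
  using gen[OF *(2) v2 *(3) w2 *(1) i2] t.Act_id[OF v2] uX_id[OF w2] by simp
 qed (rule inner[OF v1 w1])
qed

context
 fixes bs1 bs2 p x p' r w r' d d1 d2 z1 z2 h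
 assumes z1: "z1:LS bs1 p x r w d1" and z2: "z2:LS bs2 x p' w r' d2" and h: "h:fhom cD d (d1 @ d2)"
begin

lemma Mh_mem: "Mh bs1 bs2 p x p' r w r' d d1 d2 z1 z2 h:LS (bs1 @ bs2) p p' r r' d"
proof -
 obtain c1 v1 w1 where 1: "v1:E t bs1 p x c1" "w1:E u c1 r w d1" "z1 = LL bs1 p x r w d1 c1 v1 w1" by (rule LS_E[OF z1])
 obtain c2 v2 w2 where 2: "v2:E t bs2 x p' c2" "w2:E u c2 w r' d2" "z2 = LL bs2 x p' w r' d2 c2 v2 w2" by (rule LS_E[OF z2])
 show ?thesis
  unfolding 1(3) 2(3) Mh_LL[OF 1(1,2) 2(1,2) h]
  by (rule LL_mem[OF t.tcat_mem[OF 1(1) 2(1)] u.Act_mem[OF u.tcat_mem[OF 1(2) 2(2)] h]])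
qed

lemma LA_Mh:
 assumes de: "de:fhom cD d' d"
 shows "LA (bs1 @ bs2) p p' r r' de (Mh bs1 bs2 p x p' r w r' d d1 d2 z1 z2 h) = Mh bs1 bs2 p x p' r w r' d' d1 d2 z1 z2 (fcmp cD h de)"
proof -
 obtain c1 v1 w1 where 1: "v1:E t bs1 p x c1" "w1:E u c1 r w d1" "z1 = LL bs1 p x r w d1 c1 v1 w1" by (rule LS_E[OF z1])
 obtain c2 v2 w2 where 2: "v2:E t bs2 x p' c2" "w2:E u c2 w r' d2" "z2 = LL bs2 x p' w r' d2 c2 v2 w2" by (rule LS_E[OF z2])
 note T = u.tcat_mem[OF 1(2) 2(2)]
 show ?thesis
  unfolding 1(3) 2(3) Mh_LL[OF 1(1,2) 2(1,2) h] Mh_LL[OF 1(1,2) 2(1,2) Cmp_hom[OF u.catFB de h]]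
  LA_LL[OF t.tcat_mem[OF 1(1) 2(1)] u.Act_mem[OF T h] de] u.Act_cmp[OF T h de] ..
qed

lemma Mh_LX:
 assumes be: "be1:fhom cB bs1 bs1'" "be2:fhom cB bs2 bs2'" and kl: "k:hom P p0 p" "k':hom P p' p1" "l:hom R r0 r" "l':hom R r' r1"
 shows "LX (be1 @ be2) k k' l l' d (Mh bs1 bs2 p x p' r w r' d d1 d2 z1 z2 h) =
  Mh bs1' bs2' p0 x p1 r0 w r1 d d1 d2 (LX be1 k (Idn P x) l (Idn R w) d1 z1) (LX be2 (Idn P x) k' (Idn R w) l' d2 z2) h"
proof -
 obtain c1 v1 w1 where 1: "v1:E t bs1 p x c1" "w1:E u c1 r w d1" "z1 = LL bs1 p x r w d1 c1 v1 w1" by (rule LS_E[OF z1])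
 obtain c2 v2 w2 where 2: "v2:E t bs2 x p' c2" "w2:E u c2 w r' d2" "z2 = LL bs2 x p' w r' d2 c2 v2 w2" by (rule LS_E[OF z2])
 note i = t.QI[OF t.E_D(3)[OF 1(1)]] u.QI[OF u.E_D(3)[OF 1(2)]] t.FBI[OF t.E_D(4)[OF 1(1)]] t.FBI[OF t.E_D(4)[OF 2(1)]]
 note i12 = fhom_append[OF i(3,4)]
 note T = u.tcat_mem[OF 1(2) 2(2)]
 show ?thesis
  unfolding 1(3) 2(3) Mh_LL[OF 1(1,2) 2(1,2) h] LX_LL[OF 1(1,2) be(1) kl(1) i(1) kl(3) i(2)] LX_LL[OF 2(1,2) be(2) i(1) kl(2) i(2) kl(4)]
  Mh_LL[OF t.X_mem[OF 1(1) be(1) kl(1) i(1)] uX_mem[OF 1(2) i(3) kl(3) i(2)] t.X_mem[OF 2(1) be(2) i(1) kl(2)] uX_mem[OF 2(2) i(4) i(2) kl(4)] h]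
  LX_LL[OF t.tcat_mem[OF 1(1) 2(1)] u.Act_mem[OF T h] fhom_append[OF be] kl] t.tcat_X[OF 1(1) 2(1) be kl(1,2)]
  using uX_Act[OF T i12 kl(3,4) h] utcat_X[OF 1(2) 2(2) i(3,4) kl(3,4)] by simp
qed

end

lemma Mh_LA:
 assumes z1: "z1:LS bs1 p x r w d1" and z2: "z2:LS bs2 x p' w r' d2" and h: "h:fhom cD d (d1' @ d2')"
  and k: "k1:fhom cD d1' d1" "k2:fhom cD d2' d2"
 shows "Mh bs1 bs2 p x p' r w r' d d1' d2' (LA bs1 p x r w k1 z1) (LA bs2 x p' w r' k2 z2) h =
  Mh bs1 bs2 p x p' r w r' d d1 d2 z1 z2 (fcmp cD (k1 @ k2) h)"
proof -
 obtain c1 v1 w1 where 1: "v1:E t bs1 p x c1" "w1:E u c1 r w d1" "z1 = LL bs1 p x r w d1 c1 v1 w1" by (rule LS_E[OF z1])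
 obtain c2 v2 w2 where 2: "v2:E t bs2 x p' c2" "w2:E u c2 w r' d2" "z2 = LL bs2 x p' w r' d2 c2 v2 w2" by (rule LS_E[OF z2])
 show ?thesis
  unfolding 1(3) 2(3) LA_LL[OF 1(1,2) k(1)] LA_LL[OF 2(1,2) k(2)] Mh_LL[OF 1(1) u.Act_mem[OF 1(2) k(1)] 2(1) u.Act_mem[OF 2(2) k(2)] h]
  Mh_LL[OF 1(1,2) 2(1,2) Cmp_hom[OF u.catFB h fhom_append[OF k]]] u.tcat_Act[OF 1(2) 2(2) k, symmetric]
  u.Act_cmp[OF u.tcat_mem[OF 1(2) 2(2)] fhom_append[OF k] h] ..
qed

lemma Mh_slide:
 assumes z1: "z1:LS bs1 p x r w d1" and z2: "z2:LS bs2 x' p' w' r' d2" and h: "h:fhom cD d (d1 @ d2)"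
  and k: "k:hom P x x'" and l: "l:hom R w w'"
 shows "Mh bs1 bs2 p x' p' r w' r' d d1 d2 (LX (fid cB bs1) (Idn P p) k (Idn R r) l d1 z1) z2 h =
  Mh bs1 bs2 p x p' r w r' d d1 d2 z1 (LX (fid cB bs2) k (Idn P p') l (Idn R r') d2 z2) h"
proof -
 obtain c1 v1 w1 where 1: "v1:E t bs1 p x c1" "w1:E u c1 r w d1" "z1 = LL bs1 p x r w d1 c1 v1 w1" by (rule LS_E[OF z1])
 obtain c2 v2 w2 where 2: "v2:E t bs2 x' p' c2" "w2:E u c2 w' r' d2" "z2 = LL bs2 x' p' w' r' d2 c2 v2 w2" by (rule LS_E[OF z2])
 note i = t.FAI[OF t.E_D(1)[OF 1(1)]] t.FAI[OF t.E_D(1)[OF 2(1)]] t.QI[OF t.E_D(2)[OF 1(1)]] t.QI[OF t.E_D(3)[OF 2(1)]]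
  u.QI[OF u.E_D(2)[OF 1(2)]] u.QI[OF u.E_D(3)[OF 2(2)]] t.FBI[OF t.E_D(4)[OF 1(1)]] t.FBI[OF t.E_D(4)[OF 2(1)]]
 show ?thesis
  unfolding 1(3) 2(3) LX_LL[OF 1(1,2) i(1,3) k i(5) l] LX_LL[OF 2(1,2) i(2) k i(4) l i(6)]
  Mh_LL[OF t.X_mem[OF 1(1) i(1,3) k] uX_mem[OF 1(2) i(7,5) l] 2(1,2) h] Mh_LL[OF 1(1,2) t.X_mem[OF 2(1) i(2) k i(4)] uX_mem[OF 2(2) i(8) l i(6)] h]
  t.tcat_slide[OF 1(1) 2(1) k] utcat_slide[OF 1(2) 2(2) l] ..
qed

text \<open>On generators both sides are concatenations in each of the two layers, so associativity
  of \<open>tcat\<close> for \<open>t\<close> and for \<open>u\<close> settles the matter once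
  naturality has moved \<open>h1\<close> outside.\<close>

lemma Mh_assoc:
 assumes z1: "z1:LS bs1 p x r w d1" and z2: "z2:LS bs2 x x' w w' d2" and z3: "z3:LS bs3 x' p' w' r' d3"
  and h1: "h1:fhom cD d0 (d1 @ d2)" and h: "h:fhom cD d (d0 @ d3)"
 shows "Mh (bs1 @ bs2) bs3 p x' p' r w' r' d d0 d3 (Mh bs1 bs2 p x x' r w w' d0 d1 d2 z1 z2 h1) z3 h =
  Mh bs1 (bs2 @ bs3) p x p' r w r' d d1 (d2 @ d3) z1 (Mh bs2 bs3 x x' p' w w' r' (d2 @ d3) d2 d3 z2 z3 (fid cD (d2 @ d3)))
  (fcmp cD (h1 @ fid cD d3) h)"
proof -
 obtain c1 v1 w1 where 1: "v1:E t bs1 p x c1" "w1:E u c1 r w d1" "z1 = LL bs1 p x r w d1 c1 v1 w1" by (rule LS_E[OF z1])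
 obtain c2 v2 w2 where 2: "v2:E t bs2 x x' c2" "w2:E u c2 w w' d2" "z2 = LL bs2 x x' w w' d2 c2 v2 w2" by (rule LS_E[OF z2])
 obtain c3 v3 w3 where 3: "v3:E t bs3 x' p' c3" "w3:E u c3 w' r' d3" "z3 = LL bs3 x' p' w' r' d3 c3 v3 w3" by (rule LS_E[OF z3])
 note T12 = t.tcat_mem[OF 1(1) 2(1)] and T23 = t.tcat_mem[OF 2(1) 3(1)] and U12 = u.tcat_mem[OF 1(2) 2(2)] and U23 = u.tcat_mem[OF 2(2) 3(2)]
 have i: "fid cD d3:fhom cD d3 d3" "fid cD (d2 @ d3):fhom cD (d2 @ d3) (d2 @ d3)"
  using u.FBI[OF u.E_D(4)[OF 3(2)]] u.FBI[OF u.E_D(4)[OF U23]] by auto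
 have h13: "h1 @ fid cD d3:fhom cD (d0 @ d3) (d1 @ d2 @ d3)" using fhom_append[OF h1 i(1)] by simp
 note hh = Cmp_hom[OF u.catFB h h13]
 have "Act u (c1 @ c2 @ c3) r r' h (tcat u (c1 @ c2) c3 r w' r' d0 d3 (Act u (c1 @ c2) r w' h1 (tcat u c1 c2 r w w' d1 d2 w1 w2)) w3) =
  Act u (c1 @ c2 @ c3) r r' (fcmp cD (h1 @ fid cD d3) h) (tcat u c1 (c2 @ c3) r w r' d1 (d2 @ d3) w1 (tcat u c2 c3 w w' r' d2 d3 w2 w3))"
  using u.tcat_Act[OF U12 3(2) h1 i(1)] u.Act_id[OF 3(2)] u.tcat_assoc[OF 1(2) 2(2) 3(2)] u.Act_cmp[OF u.tcat_mem[OF 1(2) U23] h13 h] by simp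
 then show ?thesis
  unfolding 1(3) 2(3) 3(3) Mh_LL[OF 1(1,2) 2(1,2) h1] Mh_LL[OF 2(1,2) 3(1,2) i(2)] Mh_LL[OF T12 u.Act_mem[OF U12 h1] 3(1,2) h]
  u.Act_id[OF U23] Mh_LL[OF 1(1,2) T23 U23 hh] t.tcat_assoc[OF 1(1) 2(1) 3(1)] by simp
qed

section \<open>The regrouping map of a composite\<close>

abbreviation "Rg == comp_regroup u t"

text \<open>This is to \<open>Rg\<close> what \<open>TP\<close> is to \<open>tcat\<close>.
  Naturality of \<open>Rg\<close> at the tail, in the target list and in the states, makes the
  recursive clause a cowedge at the next letter.\<close>

definition RP where
 "RP bs \<longleftrightarrow> (ALL p r p' r' d e. e:Eu bs p r p' r' d -->
  Rg bs p r p' r' d e:LS bs p p' r r' d &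
  (ALL de d'. de:fhom cD d' d --> Rg bs p r p' r' d' (Au bs p r p' r' de e) = LA bs p p' r r' de (Rg bs p r p' r' d e)) &
  (ALL be bs' k k' l l' p0 p1 r0 r1. be:fhom cB bs bs' --> k:hom P p0 p --> k':hom P p' p1 --> l:hom R r0 r --> l':hom R r' r1 -->
  Rg bs' p0 r0 p1 r1 d (X ut be (enc (k, l)) (enc (k', l')) d e) = LX be k k' l l' d (Rg bs p r p' r' d e)))"

lemma RP_D:
 assumes "RP bs" "e:Eu bs p r p' r' d"
 shows "Rg bs p r p' r' d e:LS bs p p' r r' d"
  and "de:fhom cD d' d ==> Rg bs p r p' r' d' (Au bs p r p' r' de e) = LA bs p p' r r' de (Rg bs p r p' r' d e)"
  and "be:fhom cB bs bs' ==> k:hom P p0 p ==> k':hom P p' p1 ==> l:hom R r0 r ==> l':hom R r' r1 ==>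
  Rg bs' p0 r0 p1 r1 d (X ut be (enc (k, l)) (enc (k', l')) d e) = LX be k k' l l' d (Rg bs p r p' r' d e)"
 using assms unfolding RP_def by blast+

lemma Rg_Nil:
 assumes "k:hom P p p'" "l:hom R r r'"
 shows "Rg [] p r p' r' [] (en (enc (k, l))) = LL [] p p' r r' [] [] (en k) (en l)"
 using hom_objs[OF t.catQ assms(1)] by (simp add: LL_def t.lext_FO)

lemma E_ut_Nil:
 assumes "e:E ut [] (enc (p, r)) (enc (p', r')) d"
 obtains k l where "d = []" "e = en (enc (k, l))" "k:hom P p p'" "l:hom R r r'"
proof -
 obtain m where m: "d = []" "e = en m" "m:hom (states_prod P R) (enc (p, r)) (enc (p', r'))"
  using assms by (auto simp: ut.E_Nil)
 show ?thesis
  by (rule states_homE[OF m(3)]) (use m that in auto)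
qed

lemma E_ut_NilI: "k:hom P p p' ==> l:hom R r r' ==> en (enc (k, l)):E ut [] (enc (p, r)) (enc (p', r')) []"
 by (simp add: ut.E_Nil)

lemma ut_cons_surj:
 fixes p r p' r' :: 'u
 assumes "e:Eu (b # bs) p r p' r' d"
 obtains x w :: 'u and d1 d2 e1 e2 h where "e1:Eu [b] p r x w d1" "e2:Eu bs x w p' r' d2"
  "h:fhom cD d (d1 @ d2)" "e = Au (b # bs) p r p' r' h (tcat ut [b] bs (enc (p, r)) (enc (x, w)) (enc (p', r')) d1 d2 e1 e2)"
proof -
 obtain z d1 d2 e1 e2 h where *: "e1:E ut [b] (enc (p, r)) z d1" "e2:E ut bs z (enc (p', r')) d2"
  "h:fhom cD d (d1 @ d2)" "e = Au (b # bs) p r p' r' h (tcat ut [b] bs (enc (p, r)) z (enc (p', r')) d1 d2 e1 e2)"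
  by (rule ut.cons_surj[OF assms, simplified])
 obtain x w :: 'u where "z = enc (x, w)" by (rule states_objE[OF ut.E_D(3)[OF *(1), simplified]])
 then show ?thesis using * that by auto
qed

text \<open>The recursive clause is \<open>Mh\<close> written out: with a single first letter,
  \<open>tcat\<close> for \<open>t\<close> is the generator of the tensor product that appears in
  the clause. For an empty tail \<open>Rg\<close> is the identity, and the equation is the right
  unit law of \<open>Mh\<close>.\<close>

lemma Rg_Cons:
 assumes RP: "RP bs" and e1: "e1:Eu [b] p r x w d1" and e2: "e2:Eu bs x w p' r' d2"
  and h: "h:fhom cD d (d1 @ d2)"
 shows "Rg (b # bs) p r p' r' d (Au (b # bs) p r p' r' h (tcat ut [b] bs (enc (p, r)) (enc (x, w)) (enc (p', r')) d1 d2 e1 e2)) =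
  Mh [b] bs p x p' r w r' d d1 d2 e1 (Rg bs x w p' r' d2 e2) h"
proof -
 have e1': "e1:LS [b] p x r w d1" using e1 by (simp add: E_letter)
 have opr: "p:Obj P" "r:Obj R" "p':Obj P" "r':Obj R" "b:Obj cB" "bs:fob cB"
  using ut.E_D[OF e1] ut.E_D[OF e2] by auto
 show ?thesis
 proof (cases "bs = []")
  case True
  obtain k l where m: "d2 = []" "e2 = en (enc (k, l))" "k:hom P x p'" "l:hom R w r'"
  by (rule E_ut_Nil) (use e2 True in auto)
  have h': "h:fhom cD d d1" using h m by simp
  obtain c1 v1 w1 where 1: "v1:E t [b] p x c1" "w1:E u c1 r w d1" "e1 = LL [b] p x r w d1 c1 v1 w1" by (rule LS_E[OF e1'])
  note i = t.QI[OF opr(1)] u.QI[OF opr(2)]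
  have ib: "fid cB [b]:fhom cB [b] [b]" by (rule t.FAI[OF t.E_D(1)[OF 1(1)]])
  have ib': "[Idn cB b]:fhom cB [b] [b]" using ib by simp
  note ic = t.FBI[OF t.E_D(4)[OF 1(1)]]
  have T: "tcat ut [b] [] (enc (p, r)) (enc (x, w)) (enc (p', r')) d1 [] e1 (en (enc (k, l))) = LX (fid cB [b]) (Idn P p) k (Idn R r) l d1 e1"
  using ut.tcat_Nil_right[OF e1, of "enc (k, l)" "enc (p', r')"] m X_letter[OF ib' i(1) m(3) i(2) m(4)] by simp
  note Lm = LX_mem[OF e1' ib i(1) m(3) i(2) m(4)]
  have "Rg [b] p r p' r' d (Au [b] p r p' r' h (LX (fid cB [b]) (Idn P p) k (Idn R r) l d1 e1)) =
  LA [b] p p' r r' h (LX (fid cB [b]) (Idn P p) k (Idn R r) l d1 e1)"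
  using Act_letter[OF Lm] by simp
  also have "... = LL [b] p p' r r' d c1 (X t (fid cB [b]) (Idn P p) k c1 v1) (Act u c1 r r' h (X u (fid cC c1) (Idn R r) l d1 w1))"
  unfolding 1(3) LX_LL[OF 1(1,2) ib i(1) m(3) i(2) m(4)]
  by (rule LA_LL[OF t.X_mem[OF 1(1) ib i(1) m(3)] uX_mem[OF 1(2) ic i(2) m(4)] h'])
  also have "... = Mh [b] [] p x p' r w r' d d1 [] e1 (Rg [] x w p' r' [] (en (enc (k, l)))) h"
  unfolding Rg_Nil[OF m(3,4)] 1(3) Mh_LL[OF 1(1,2) t.E_NilI[OF m(3)] u.E_NilI[OF m(4)] h[unfolded m]]
  using t.tcat_Nil_right[OF 1(1) m(3)] utcat_Nil_right[OF 1(2) m(4)] by simp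
  finally show ?thesis by (simp add: True m T del: free_simps comp_regroup.simps)
 next
  case False
  then obtain b' br where r: "bs = b' # br" by (cases bs) auto
  let ?F = "%(z :: 'u) d1 d2 e1 e2 h. let (x, w) = dec z in
  lift_desc u (FO (Tf t) (b, p, x)) r w d1
  (%c1 v1 w1.
  lift_desc u (FO (tlist t (b' # br)) (x, p')) w r' d2
  (%c2 v2 w2.
  lift_in u (FO (tlist t (b # b' # br)) (p, p')) r r' d (c1 @ c2)
  (tens_in (St t) (TTgt t) (tlet t b) (tlist t (b' # br)) p p' (c1 @ c2)
  x c1 c2 v1 v2 (Idn (free_cat (TTgt t)) (c1 @ c2)))
  (act (FO (lext u) (c1 @ c2, r, r')) h (tcat u c1 c2 r w r' d1 d2 w1 w2)))
  (comp_regroup u t (b' # br) x w p' r' d2 e2))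
  e1"
  have F: "?F (enc (x, w)) d1 d2 e1 e2 h = Mh [b] bs p x p' r w r' d d1 d2 e1 (Rg bs x w p' r' d2 e2) h"
  if "x:Obj P" for x w d1 d2 e1 e2 h
  using that opr by (simp add: Mh_def LL_def r t.lext_FO t.tlet_simps t.tcat_letter del: comp_regroup.simps)
  have "cowedge ut [b] bs (enc (p, r)) (enc (p', r')) d ?F"
  proof (rule cowedgeI)
  fix z z' m d1 d2 e1 e2 h
  assume m: "m:hom (St ut) z z'" and e1: "e1:E ut [b] (enc (p, r)) z d1" and e2: "e2:E ut bs z' (enc (p', r')) d2" and h: "h:fhom (TTgt ut) d (d1 @ d2)"
  obtain k l x w x' w' where *: "m = enc (k, l)" "z = enc (x, w)" "z' = enc (x', w')" "k:hom P x x'" "l:hom R w w'"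
  by (rule states_homE[OF m[simplified]])
  note o = hom_objs[OF t.catQ *(4)]
  note i = t.QI[OF opr(1)] u.QI[OF opr(2)] t.QI[OF opr(3)] u.QI[OF opr(4)] t.FAI[OF opr(6)]
  have ib: "[Idn cB b]:fhom cB [b] [b]" using Idn_hom[OF t.catA opr(5)] by simp
  have e1': "e1:LS [b] p x r w d1" using e1 * by (simp add: E_letter)
  have e2': "e2:Eu bs x' w' p' r' d2" using e2 * by simp
  have 1: "X ut (fid cB [b]) (enc (Idn P p, Idn R r)) (enc (k, l)) d1 e1 = LX [Idn cB b] (Idn P p) k (Idn R r) l d1 e1"
  using X_letter[OF ib i(1) *(4) i(2) *(5)] by simp
  have 2: "Rg bs x w p' r' d2 (X ut (fid cB bs) (enc (k, l)) (enc (Idn P p', Idn R r')) d2 e2) = LX (fid cB bs) k (Idn P p') l (Idn R r') d2 (Rg bs x' w' p' r' d2 e2)"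
  by (rule RP_D(3)[OF RP e2' i(5) *(4) i(3) *(5) i(4)])
  show "?F z' d1 d2 (X ut (fid (TSrc ut) [b]) (Idn (St ut) (enc (p, r))) m d1 e1) e2 h =
  ?F z d1 d2 e1 (X ut (fid (TSrc ut) bs) m (Idn (St ut) (enc (p', r'))) d2 e2) h"
  unfolding *(1-3) F[OF o(1)] F[OF o(2)] comp_simps states_prod_simps 1 2
  using Mh_slide[OF e1' RP_D(1)[OF RP e2'] h[simplified] *(4,5)] by simp
  next
  fix z d1 d1' d2 d2' k1 k2 e1 e2 h
  assume k: "k1:fhom (TTgt ut) d1' d1" "k2:fhom (TTgt ut) d2' d2" and e1: "e1:E ut [b] (enc (p, r)) z d1" and e2: "e2:E ut bs z (enc (p', r')) d2" and h: "h:fhom (TTgt ut) d (d1' @ d2')"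
  obtain x w where z: "z = enc (x, w)" "x:Obj P" "w:Obj R" by (rule states_objE[OF ut.E_D(3)[OF e1, simplified]])
  have e1': "e1:LS [b] p x r w d1" using e1 z by (simp add: E_letter)
  have e2': "e2:Eu bs x w p' r' d2" using e2 z by simp
  show "?F z d1' d2' (Act ut [b] (enc (p, r)) z k1 e1) (Act ut bs z (enc (p', r')) k2 e2) h = ?F z d1 d2 e1 e2 (fcmp (TTgt ut) (k1 @ k2) h)"
  unfolding z(1) F[OF z(2)] comp_simps Act_letter[OF e1'] RP_D(2)[OF RP e2' k(2)[simplified]]
  by (rule Mh_LA[OF e1' RP_D(1)[OF RP e2'] h[simplified] k[simplified]])
  qed
  from ut.letter_desc[OF False this e1 e2 h[folded comp_simps]]
  have "tens_desc (states_prod P R) cD (tlet ut b) (tlist ut bs) (enc (p, r)) (enc (p', r')) d ?F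
  (Au (b # bs) p r p' r' h (tcat ut [b] bs (enc (p, r)) (enc (x, w)) (enc (p', r')) d1 d2 e1 e2)) = ?F (enc (x, w)) d1 d2 e1 e2 h"
  by (simp only: comp_simps)
  moreover have "x:Obj P" using LS_D[OF e1'] by simp
  ultimately show ?thesis
  unfolding F[OF \<open>x \<in> Obj P\<close>] unfolding r comp_regroup.simps by (simp only:)
 qed
qed

lemma RP_Nil: "RP []"
 unfolding RP_def
proof (intro allI impI)
 fix p r p' r' :: 'u and d e assume "e:E ut [] (enc (p, r)) (enc (p', r')) d"
 then obtain k l where m: "d = []" "e = en (enc (k, l))" "k:hom P p p'" "l:hom R r r'" by (rule E_ut_Nil)
 note LM = LL_mem[OF t.E_NilI[OF m(3)] u.E_NilI[OF m(4)]]
 have A: "Act ut [] (enc (p, r)) (enc (p', r')) [] e = e"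
  using ut.Act_Nil[of "enc (k, l)" "enc (p, r)" "enc (p', r')"] m by simp
 show "Rg [] p r p' r' d e:LS [] p p' r r' d &
  (ALL de d'. de:fhom cD d' d --> Rg [] p r p' r' d' (Act ut [] (enc (p, r)) (enc (p', r')) de e) = LA [] p p' r r' de (Rg [] p r p' r' d e)) &
  (ALL be bs' k k' l l' p0 p1 r0 r1. be:fhom cB [] bs' --> k:hom P p0 p --> k':hom P p' p1 --> l:hom R r0 r --> l':hom R r' r1 -->
  Rg bs' p0 r0 p1 r1 d (X ut be (enc (k, l)) (enc (k', l')) d e) = LX be k k' l l' d (Rg [] p r p' r' d e))"
 proof (intro conjI allI impI)
  show "Rg [] p r p' r' d e:LS [] p p' r r' d"
  unfolding m Rg_Nil[OF m(3,4)] by (rule LM)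
 next
  fix de d' assume de: "de:fhom cD d' d"
  then have "de = []" "d' = []" using m by auto
  then show "Rg [] p r p' r' d' (Act ut [] (enc (p, r)) (enc (p', r')) de e) = LA [] p p' r r' de (Rg [] p r p' r' d e)"
  using A LA_LL[OF t.E_NilI[OF m(3)] u.E_NilI[OF m(4)], of "[]" "[]"] u.Act_Nil[OF m(4)]
  by (simp add: m(1,2) Rg_Nil[OF m(3,4)] del: comp_regroup.simps)
 next
  fix be bs' k2 k' l2 l' p0 p1 r0 r1
  assume *: "be:fhom cB [] bs'" "k2:hom P p0 p" "k':hom P p' p1" "l2:hom R r0 r" "l':hom R r' r1"
  have [simp]: "be = []" "bs' = []" using *(1) by auto
  have c: "Cmp P k' (Cmp P k k2):hom P p0 p1" "Cmp R l' (Cmp R l l2):hom R r0 r1"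
  using * m by (auto intro!: Cmp_hom[OF t.catQ] Cmp_hom[OF u.catQ])
  have "X ut [] (enc (k2, l2)) (enc (k', l')) [] e = enc (enc (Cmp P k' (Cmp P k k2), Cmp R l' (Cmp R l l2)) :: 'u, [] :: 'u list)"
  using ut.X_Nil[of "enc (k, l)" "enc (p, r)" "enc (p', r')" "enc (k2, l2)" "enc (p0, r0)" "enc (k', l')" "enc (p1, r1)"] * m by simp
  then show "Rg bs' p0 r0 p1 r1 d (X ut be (enc (k2, l2)) (enc (k', l')) d e) = LX be k2 k' l2 l' d (Rg [] p r p' r' d e)"
  using LX_LL[OF t.E_NilI[OF m(3)] u.E_NilI[OF m(4)] *] t.X_Nil[OF m(3) *(2,3)] u.X_Nil[OF m(4) *(4,5)]
  by (simp add: m(1,2) Rg_Nil[OF m(3,4)] Rg_Nil[OF c] del: comp_regroup.simps)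
 qed
qed

text \<open>As with concatenation, an arrow of letters leads to another tail of equal length, at
  which the invariant must be available.\<close>

lemma RP_Cons:
 assumes RPs: "!!bs'. length bs' = length bs ==> RP bs'"
 shows "RP (b # bs)"
 unfolding RP_def
proof (intro allI impI)
 note RP = RPs[OF refl]
 fix p r p' r' :: 'u and d e assume e: "e:Eu (b # bs) p r p' r' d"
 obtain x w :: 'u and d1 d2 e1 e2 h where e1: "e1:Eu [b] p r x w d1" and e2: "e2:Eu bs x w p' r' d2"
  and h: "h:fhom cD d (d1 @ d2)" and eq: "e = Au (b # bs) p r p' r' h (tcat ut [b] bs (enc (p, r)) (enc (x, w)) (enc (p', r')) d1 d2 e1 e2)"
  by (rule ut_cons_surj[OF e])
 have e1': "e1:LS [b] p x r w d1" using e1 by (simp add: E_letter)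
 note R2 = RP_D[OF RP e2]
 note T = ut.tcat_mem[OF e1 e2, simplified]
 note Q = Rg_Cons[OF RP e1 e2]
 show "Rg (b # bs) p r p' r' d e:LS (b # bs) p p' r r' d &
  (ALL de d'. de:fhom cD d' d --> Rg (b # bs) p r p' r' d' (Au (b # bs) p r p' r' de e) = LA (b # bs) p p' r r' de (Rg (b # bs) p r p' r' d e)) &
  (ALL be bs' k k' l l' p0 p1 r0 r1. be:fhom cB (b # bs) bs' --> k:hom P p0 p --> k':hom P p' p1 --> l:hom R r0 r --> l':hom R r' r1 -->
  Rg bs' p0 r0 p1 r1 d (X ut be (enc (k, l)) (enc (k', l')) d e) = LX be k k' l l' d (Rg (b # bs) p r p' r' d e))"
 proof (intro conjI allI impI)
  show "Rg (b # bs) p r p' r' d e:LS (b # bs) p p' r r' d"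
  unfolding eq Q[OF h] using Mh_mem[OF e1' R2(1) h] by simp
 next
  fix de d' assume de: "de:fhom cD d' d"
  show "Rg (b # bs) p r p' r' d' (Au (b # bs) p r p' r' de e) = LA (b # bs) p p' r r' de (Rg (b # bs) p r p' r' d e)"
  using ut.Act_cmp[OF T] h de Q[OF h] Q[OF Cmp_hom[OF u.catFB de h]] LA_Mh[OF e1' R2(1) h de] by (simp add: eq del: comp_regroup.simps)
 next
  fix bes bs' k k' l l' p0 p1 r0 r1
  assume *: "bes:fhom cB (b # bs) bs'" "k:hom P p0 p" "k':hom P p' p1" "l:hom R r0 r" "l':hom R r' r1"
  obtain be ber b' br where be: "bes = be # ber" "bs' = b' # br" "be:hom cB b b'" "ber:fhom cB bs br"
  using fhom_Cons_left[OF *(1)] by auto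
  have be': "[be]:fhom cB [b] [b']" using be by simp
  have RP': "RP br" using fhom_length[OF be(4)] by (intro RPs) simp
  have xw: "x:Obj P" "w:Obj R" using LS_D[OF e1'] by auto
  note i = t.QI[OF xw(1)] u.QI[OF xw(2)]
  have m: "enc (k, l):hom (states_prod P R) (enc (p0, r0)) (enc (p, r))" "enc (k', l'):hom (states_prod P R) (enc (p', r')) (enc (p1, r1))"
  "enc (Idn P x, Idn R w):hom (states_prod P R) (enc (x, w)) (enc (x, w))"
  using * i by simp_all
  have X1: "X ut [be] (enc (k, l)) (enc (Idn P x, Idn R w)) d1 e1:E ut [b'] (enc (p0, r0)) (enc (x, w)) d1"
  and X2: "X ut ber (enc (Idn P x, Idn R w)) (enc (k', l')) d2 e2:Eu br x w p1 r1 d2"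
  using ut.X_mem[OF e1] ut.X_mem[OF e2] be' be(4) m by (simp_all)
  have "X ut bes (enc (k, l)) (enc (k', l')) d e = Au bs' p0 r0 p1 r1 h 
  (tcat ut [b'] br (enc (p0, r0)) (enc (x, w)) (enc (p1, r1)) d1 d2 (X ut [be] (enc (k, l)) (enc (Idn P x, Idn R w)) d1 e1) (X ut ber (enc (Idn P x, Idn R w)) (enc (k', l')) d2 e2))"
  using ut.X_Act[OF T, of bes bs' "enc (k, l)" "enc (p0, r0)" "enc (k', l')" "enc (p1, r1)" h d] h * m
  ut.tcat_X[OF e1 e2, of "[be]" "[b']" ber br "enc (k, l)" "enc (p0, r0)" "enc (k', l')" "enc (p1, r1)"] be be'
  by (simp add: eq)
  then show "Rg bs' p0 r0 p1 r1 d (X ut bes (enc (k, l)) (enc (k', l')) d e) = LX bes k k' l l' d (Rg (b # bs) p r p' r' d e)"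
  using Rg_Cons[OF RP' X1 X2 h] Q[OF h] Mh_LX[OF e1' R2(1) h be' be(4) *(2-5)] X_letter[OF be' *(2) i(1) *(4) i(2)]
  R2(3)[OF be(4) i(1) *(3) i(2) *(5)] by (simp add: eq be del: comp_regroup.simps)
 qed
qed

lemma RP: "RP bs"
proof (induction "length bs" arbitrary: bs)
 case 0
 then show ?case using RP_Nil by simp
next
 case (Suc n)
 then obtain b br where "bs = b # br" "n = length br" by (cases bs) auto
 then show ?case using RP_Cons[of br b] Suc.hyps(1) by auto
qed

declare comp_regroup.simps [simp del]

lemmas Rg_mem = RP_D(1)[OF RP] and Rg_Act = RP_D(2)[OF RP] and Rg_X = RP_D(3)[OF RP] and Rg_rec = Rg_Cons[OF RP]

lemma Rg_letter: "Rg [b] p r p' r' d e = e"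
 by (simp add: comp_regroup.simps)

text \<open>Induction on the first list: the step is associativity of \<open>Mh\<close>, the base
  case its left unit law. This multiplicativity later allows the unit and the counit to be computed
  letter by letter.\<close>

lemma Rg_tcat:
 "e1:Eu bs1 p r x w d1 ==> e2:Eu bs2 x w p' r' d2 ==>
  Rg (bs1 @ bs2) p r p' r' (d1 @ d2) (tcat ut bs1 bs2 (enc (p, r)) (enc (x, w)) (enc (p', r')) d1 d2 e1 e2) =
  Mh bs1 bs2 p x p' r w r' (d1 @ d2) d1 d2 (Rg bs1 p r x w d1 e1) (Rg bs2 x w p' r' d2 e2) (fid cD (d1 @ d2))"
proof (induction bs1 arbitrary: p r d1 e1)
 case Nil
 note e2 = Nil.prems(2)
 obtain k l where m: "d1 = []" "e1 = en (enc (k, l))" "k:hom P p x" "l:hom R r w"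
  by (rule E_ut_Nil[OF Nil.prems(1)])
 have o: "bs2:fob cB" "p':Obj P" "r':Obj R" using ut.E_D[OF e2] by auto
 note i = t.FAI[OF o(1)] t.QI[OF o(2)] u.QI[OF o(3)]
 have id2: "fid cD d2:fhom cD d2 d2" using u.FBI ut.E_D(4)[OF e2] by simp
 have "tcat ut [] bs2 (enc (p, r)) (enc (x, w)) (enc (p', r')) [] d2 e1 e2 = X ut (fid cB bs2) (enc (k, l)) (enc (Idn P p', Idn R r')) d2 e2"
  using ut.tcat_Nil[of "enc (k, l)" "enc (p, r)" "enc (x, w)", OF _ e2] m by simp
 then have 1: "Rg bs2 p r p' r' d2 (tcat ut [] bs2 (enc (p, r)) (enc (x, w)) (enc (p', r')) [] d2 e1 e2) = LX (fid cB bs2) k (Idn P p') l (Idn R r') d2 (Rg bs2 x w p' r' d2 e2)"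
  using Rg_X[OF e2 i(1) m(3) i(2) m(4) i(3)] by simp
 obtain c2 v2 w2 where 2: "v2:E t bs2 x p' c2" "w2:E u c2 w r' d2" "Rg bs2 x w p' r' d2 e2 = LL bs2 x p' w r' d2 c2 v2 w2"
  by (rule LS_E[OF Rg_mem[OF e2]])
 have id2': "fid cD d2:fhom cD d2 ([] @ d2)" using id2 by simp
 have U: "X u (fid cC c2) l (Idn R r') d2 w2:E u c2 r r' d2"
  by (rule uX_mem[OF 2(2) t.FBI[OF t.E_D(4)[OF 2(1)]] m(4) i(3)])
 have "Mh [] bs2 p x p' r w r' d2 [] d2 (Rg [] p r x w [] e1) (Rg bs2 x w p' r' d2 e2) (fid cD d2) = LX (fid cB bs2) k (Idn P p') l (Idn R r') d2 (Rg bs2 x w p' r' d2 e2)"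
  unfolding m(2) Rg_Nil[OF m(3,4)] 2(3) Mh_LL[OF t.E_NilI[OF m(3)] u.E_NilI[OF m(4)] 2(1,2) id2'] LX_LL[OF 2(1,2) i(1) m(3) i(2) m(4) i(3)]
  using t.tcat_Nil[OF m(3) 2(1)] utcat_Nil[OF m(4) 2(2)] u.Act_id[OF U] by simp
 then show ?case using 1 by (simp add: m(1))
next
 case (Cons b bs)
 note e2 = Cons.prems(2)
 obtain y v :: 'u and b1 b2 f1 f2 h where f1: "f1:Eu [b] p r y v b1" and f2: "f2:Eu bs y v x w b2"
  and h: "h:fhom cD d1 (b1 @ b2)" and eq: "e1 = Au (b # bs) p r x w h (tcat ut [b] bs (enc (p, r)) (enc (y, v)) (enc (x, w)) b1 b2 f1 f2)"
  by (rule ut_cons_surj[OF Cons.prems(1)])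
 have f1': "f1:LS [b] p y r v b1" using f1 by (simp add: E_letter)
 have i2: "fid cD d2:fhom cD d2 d2" using u.FBI ut.E_D(4)[OF e2] by simp
 have h2: "h @ fid cD d2:fhom cD (d1 @ d2) (b1 @ b2 @ d2)" using fhom_append[OF h i2] by simp
 have id: "fid cD (d1 @ d2):fhom cD (d1 @ d2) (d1 @ d2)" by (rule u.FBI[OF hom_obj1[OF u.catFB h2]])
 have h2': "fcmp cD (h @ fid cD d2) (fid cD (d1 @ d2)) = h @ fid cD d2" by (rule Cmp_idr[OF u.catFB h2])
 have "Rg (b # bs @ bs2) p r p' r' (d1 @ d2) (tcat ut (b # bs) bs2 (enc (p, r)) (enc (x, w)) (enc (p', r')) d1 d2 e1 e2) =
  Mh [b] (bs @ bs2) p y p' r v r' (d1 @ d2) b1 (b2 @ d2) f1 (Rg (bs @ bs2) y v p' r' (b2 @ d2) (tcat ut bs bs2 (enc (y, v)) (enc (x, w)) (enc (p', r')) b2 d2 f2 e2)) (h @ fid cD d2)"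
  unfolding eq using ut.tcat_rec[OF f1 f2 _ e2, of h d1] h Rg_rec[OF f1 ut.tcat_mem[OF f2 e2] h2] by simp
 also have "... = Mh [b] (bs @ bs2) p y p' r v r' (d1 @ d2) b1 (b2 @ d2) f1 
  (Mh bs bs2 y x p' v w r' (b2 @ d2) b2 d2 (Rg bs y v x w b2 f2) (Rg bs2 x w p' r' d2 e2) (fid cD (b2 @ d2))) (h @ fid cD d2)"
  using Cons.IH[OF f2 e2] by simp
 also have "... = Mh (b # bs) bs2 p x p' r w r' (d1 @ d2) d1 d2 (Mh [b] bs p y x r v w d1 b1 b2 f1 (Rg bs y v x w b2 f2) h) (Rg bs2 x w p' r' d2 e2) (fid cD (d1 @ d2))"
  using Mh_assoc[OF f1' Rg_mem[OF f2] Rg_mem[OF e2] h id] h2' by simp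
 also have "Mh [b] bs p y x r v w d1 b1 b2 f1 (Rg bs y v x w b2 f2) h = Rg (b # bs) p r x w d1 e1"
  unfolding eq by (rule Rg_rec[OF f1 f2 h, symmetric])
 finally show ?case by simp
qed

text \<open>The first layer of a generator is split at the first letter. The arrow \<open>h\<close>
  left over slides to the second layer, which is then split along the same two lists. The first
  piece is its own regrouping, and the second is a regrouping by induction.\<close>

lemma Rg_surj: "z:LS bs p p' r r' d ==> EX e:Eu bs p r p' r' d. Rg bs p r p' r' d e = z"
proof (induction bs arbitrary: p r d z)
 case Nil
 obtain c v e where *: "v:E t [] p p' c" "e:E u c r r' d" "z = LL [] p p' r r' d c v e" by (rule LS_E[OF Nil])
 obtain k where k: "c = []" "v = en k" "k:hom P p p'" using *(1) by (auto simp: t.E_Nil)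
 obtain l where l: "d = []" "e = en l" "l:hom R r r'" using *(2) k by (auto simp: u.E_Nil)
 show ?case
  using E_ut_NilI[OF k(3) l(3)] Rg_Nil[OF k(3) l(3)] * k l by auto
next
 case (Cons b bs)
 obtain c v e where *: "v:E t (b # bs) p p' c" "e:E u c r r' d" "z = LL (b # bs) p p' r r' d c v e" by (rule LS_E[OF Cons.prems])
 obtain x c1 c2 v1 v2 h where v1: "v1:E t [b] p x c1" and v2: "v2:E t bs x p' c2" and h: "h:fhom cC c (c1 @ c2)"
  and v: "v = Act t (b # bs) p p' h (tcat t [b] bs p x p' c1 c2 v1 v2)" by (rule t.cons_surj[OF *(1)])
 note i = u.QI[OF u.E_D(2)[OF *(2)]] u.QI[OF u.E_D(3)[OF *(2)]]
 obtain w d1 d2 w1 w2 h' where w1: "w1:E u c1 r w d1" and w2: "w2:E u c2 w r' d2" and h': "h':fhom cD d (d1 @ d2)"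
  and e: "X u h (Idn R r) (Idn R r') d e = Act u (c1 @ c2) r r' h' (tcat u c1 c2 r w r' d1 d2 w1 w2)"
  by (rule u.tcat_surj[OF uX_mem[OF *(2) h i]])
 have e1: "LL [b] p x r w d1 c1 v1 w1:Eu [b] p r x w d1"
  unfolding E_letter by (rule LL_mem[OF v1 w1])
 obtain e2 where e2: "e2:Eu bs x w p' r' d2" "Rg bs x w p' r' d2 e2 = LL bs x p' w r' d2 c2 v2 w2"
  using Cons.IH[OF LL_mem[OF v2 w2]] by auto
 have "z = Rg (b # bs) p r p' r' d (Au (b # bs) p r p' r' h' (tcat ut [b] bs (enc (p, r)) (enc (x, w)) (enc (p', r')) d1 d2 (LL [b] p x r w d1 c1 v1 w1) e2))"
  unfolding Rg_rec[OF e1 e2(1) h'] e2(2) Mh_LL[OF v1 w1 v2 w2 h'] *(3) v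
  using LL_slide[OF h t.tcat_mem[OF v1 v2] *(2)] e by simp
 moreover have "Au (b # bs) p r p' r' h' (tcat ut [b] bs (enc (p, r)) (enc (x, w)) (enc (p', r')) d1 d2 (LL [b] p x r w d1 c1 v1 w1) e2):Eu (b # bs) p r p' r' d"
  using ut.Act_mem[OF ut.tcat_mem[OF e1 e2(1)]] h' by simp
 ultimately show ?case by blast
qed

lemma Rg_retract_Nil: "EX G. ALL e:E ut [] (enc (p, r)) (enc (p', r')) d. G (Rg [] p r p' r' d e) = e"
proof -
 \<comment> \<open>The two layers are decoded back into a pair of state arrows. Over the empty list
   \<open>t\<close> has elements only at the empty list, so the value \<open>undefined\<close> is
   never reached.\<close>
 define F where "F c v w = (if c = [] then enc (enc (fst (dec v :: 'u \<times> 'u list), fst (dec w :: 'u \<times> 'u list)) :: 'u, [] :: 'u list) else (undefined :: 'u))" for c :: "'u list" and v w :: 'u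
 have "lift_desc u (FO (lext t) ([], p, p')) r r' d F (Rg [] p r p' r' d e) = e" if e: "e:E ut [] (enc (p, r)) (enc (p', r')) d" for e
 proof -
  obtain k l where m: "d = []" "e = en (enc (k, l))" "k:hom P p p'" "l:hom R r r'" by (rule E_ut_Nil[OF e])
  have "lift_desc u (FO (lext t) ([], p, p')) r r' [] F (LL [] p p' r r' [] [] (en k) (en l)) = F [] (en k) (en l)"
  proof (rule LL_desc[OF _ t.E_NilI[OF m(3)] u.E_NilI[OF m(4)]])
  fix c c' al v e assume *: "al:fhom cC c' c" "v:E t [] p p' c" "e:E u c' r r' []"
  obtain k where k: "c = []" "v = en k" "k:hom P p p'" using *(2) by (auto simp: t.E_Nil)
  have [simp]: "al = []" "c' = []" using * k by auto
  show "F c' (Act t [] p p' al v) e = F c v (X u al (Idn R r) (Idn R r') [] e)"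
  using t.Act_Nil[OF k(3)] uX_id[OF *(3)] k by simp
  qed
  then show ?thesis
  using m by (simp add: Rg_Nil F_def)
 qed
 then show ?thesis by blast
qed

text \<open>The retraction of \<open>Rg\<close> on \<open>b # bs\<close> is built by splitting both layers of an element into a first letter and a tail.\<close>

lemma Rg_retract_Cons:
 assumes IH: "!!p r d. EX G. ALL e:Eu bs p r p' r' d. G (Rg bs p r p' r' d e) = e"
  and o: "b:Obj cB" "bs:fob cB" "p:Obj P" "p':Obj P" "r:Obj R" "r':Obj R"
 shows "EX G. ALL e:Eu (b # bs) p r p' r' d. G (Rg (b # bs) p r p' r' d e) = e"
proof -
 let ?Z = "enc (p, r)" and ?Z' = "enc (p', r')"
 have ob: "b # bs:fob cB" using o by simp
 \<comment> \<open>The retraction on the tail. As regrouping is also surjective there,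
   \<open>S\<close> is a two-sided inverse and inherits naturality from \<open>Rg\<close>.\<close>
 define S where "S x w d2 = (SOME G. ALL e:E ut bs (enc (x, w)) ?Z' d2. G (Rg bs x w p' r' d2 e) = e)" for x w d2
 have S: "S x w d2 (Rg bs x w p' r' d2 e) = e" if "e:E ut bs (enc (x, w)) ?Z' d2" for x w d2 e
  using someI_ex[OF IH[of x w d2]] that unfolding S_def by blast
 note i = t.QI[OF o(3)] t.QI[OF o(4)] u.QI[OF o(5)] u.QI[OF o(6)] t.FAI[OF o(2)]
 have ib: "[Idn cB b]:fhom cB [b] [b]" using Idn_hom[OF t.catA o(1)] by simp
 have S_mem: "S x w d2 z:E ut bs (enc (x, w)) ?Z' d2" and S_Act: "de:fhom cD d' d2 ==> S x w d' (LA bs x p' w r' de z) = Act ut bs (enc (x, w)) ?Z' de (S x w d2 z)"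
  and S_X: "k:hom P x0 x ==> l:hom R w0 w ==> S x0 w0 d2 (LX (fid cB bs) k (Idn P p') l (Idn R r') d2 z) = X ut (fid cB bs) (enc (k, l)) (enc (Idn P p', Idn R r')) d2 (S x w d2 z)"
  if z: "z:LS bs x p' w r' d2" for x w d2 z de d' k l x0 w0
 proof -
  obtain e where e: "e:E ut bs (enc (x, w)) ?Z' d2" "Rg bs x w p' r' d2 e = z" using Rg_surj[OF z] by auto
  show "S x w d2 z:E ut bs (enc (x, w)) ?Z' d2" using S[OF e(1)] e by simp
  show "S x w d' (LA bs x p' w r' de z) = Act ut bs (enc (x, w)) ?Z' de (S x w d2 z)" if "de:fhom cD d' d2"
  using S[OF e(1)] S[OF ut.Act_mem[OF e(1)], of de d'] Rg_Act[OF e(1) that] that e(2) by simp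
  show "S x0 w0 d2 (LX (fid cB bs) k (Idn P p') l (Idn R r') d2 z) = X ut (fid cB bs) (enc (k, l)) (enc (Idn P p', Idn R r')) d2 (S x w d2 z)"
  if kl: "k:hom P x0 x" "l:hom R w0 w"
  proof -
  have "X ut (fid cB bs) (enc (k, l)) (enc (Idn P p', Idn R r')) d2 e:E ut bs (enc (x0, w0)) ?Z' d2"
  using ut.X_mem[OF e(1), of "fid cB bs" bs "enc (k, l)" "enc (x0, w0)" "enc (Idn P p', Idn R r')" ?Z'] kl i by simp
  from S[OF this] show ?thesis
  using S[OF e(1)] Rg_X[OF e(1) i(5) kl(1) i(2) kl(2) i(4)] e(2) by simp
  qed
 qed
 \<comment> \<open>The element rebuilt from fully split layers: on the first letter regrouping is
   the identity, on the tail it is undone by \<open>S\<close>, and the results are concatenated in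
   the composite.\<close>
 define Fu where "Fu x c1 c2 v1 v2 w d1 d2 w1 w2 h' = Act ut (b # bs) ?Z ?Z' h'
  (tcat ut [b] bs ?Z (enc (x, w)) ?Z' d1 d2 (LL [b] p x r w d1 c1 v1 w1) (S x w d2 (LL bs x p' w r' d2 c2 v2 w2)))"
  for x c1 c2 v1 v2 w d1 d2 w1 w2 h'
 \<comment> \<open>\<open>Gu\<close> will undo the splitting of the second layer for a first layer
   that is already split, and \<open>Gt\<close> that of the first layer. Both exist by universal
   properties and are selected by choice.\<close>
 define Q where "Q x c1 c2 v1 v2 G \<longleftrightarrow> (ALL w d1 d2 w1 w2 h'. w1:E u c1 r w d1 --> w2:E u c2 w r' d2 --> h':fhom cD d (d1 @ d2) -->
  G (Act u (c1 @ c2) r r' h' (tcat u c1 c2 r w r' d1 d2 w1 w2)) = Fu x c1 c2 v1 v2 w d1 d2 w1 w2 h')" for x c1 c2 v1 v2 and G :: "'u => 'u"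
 define Gu where "Gu x c1 c2 v1 v2 = (SOME G. Q x c1 c2 v1 v2 G)" for x c1 c2 v1 v2
 have LE: "LL [b] p x r w d1 c1 v1 w1:E ut [b] ?Z (enc (x, w)) d1" if "v1:E t [b] p x c1" "w1:E u c1 r w d1" for x w d1 c1 v1 w1
  unfolding E_letter by (rule LL_mem[OF that])
 have LXE: "X ut [Idn cB b] (enc (Idn P p, Idn R r)) (enc (k, l)) d1 (LL [b] p x r w d1 c1 v1 w1) =
  LL [b] p x' r w' d1 c1 (X t [Idn cB b] (Idn P p) k c1 v1) (X u (fid cC c1) (Idn R r) l d1 w1)"
  if "v1:E t [b] p x c1" "w1:E u c1 r w d1" "k:hom P x x'" "l:hom R w w'" for x w d1 c1 v1 w1 k l x' w'
  unfolding X_letter[OF ib i(1) that(3) i(3) that(4)] by (rule LX_LL[OF that(1,2) ib i(1) that(3) i(3) that(4)])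
 have tslide: "tcat ut [b] bs ?Z (enc (x', w')) ?Z' d1 d2 (X ut [Idn cB b] (enc (Idn P p, Idn R r)) (enc (k, l)) d1 e1) e2 =
  tcat ut [b] bs ?Z (enc (x, w)) ?Z' d1 d2 e1 (X ut (fid cB bs) (enc (k, l)) (enc (Idn P p', Idn R r')) d2 e2)"
  if "e1:E ut [b] ?Z (enc (x, w)) d1" "e2:E ut bs (enc (x', w')) ?Z' d2" "k:hom P x x'" "l:hom R w w'" for x w x' w' d1 d2 e1 e2 k l
  using ut.tcat_slide[OF that(1,2), of "enc (k, l)"] that(3,4) by simp
 have "Q x c1 c2 v1 v2 (Gu x c1 c2 v1 v2)" if v1: "v1:E t [b] p x c1" and v2: "v2:E t bs x p' c2" for x c1 c2 v1 v2
 proof -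
  have ix: "Idn P x:hom P x x" by (rule t.QI[OF t.E_D(3)[OF v1]])
  have "cowedge u c1 c2 r r' d (Fu x c1 c2 v1 v2)"
  proof (rule cowedgeI[of u, unfolded src_u])
  fix w w' l d1 d2 w1 w2 h
  assume l: "l:hom R w w'" and w1: "w1:E u c1 r w d1" and w2: "w2:E u c2 w' r' d2" and h: "h:fhom cD d (d1 @ d2)"
  show "Fu x c1 c2 v1 v2 w' d1 d2 (X u (fid cC c1) (Idn R r) l d1 w1) w2 h = Fu x c1 c2 v1 v2 w d1 d2 w1 (X u (fid cC c2) l (Idn R r') d2 w2) h"
  using LXE[OF v1 w1 ix l] t.X_id[OF v1] tslide[OF LE[OF v1 w1] S_mem[OF LL_mem[OF v2 w2]] ix l]
  S_X[OF LL_mem[OF v2 w2] ix l] LX_LL[OF v2 w2 i(5) ix i(2) l i(4)] t.X_id[OF v2] unfolding Fu_def by simp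
  next
  fix w d1 d1' d2 d2' k1 k2 w1 w2 h
  assume k: "k1:fhom cD d1' d1" "k2:fhom cD d2' d2" and w1: "w1:E u c1 r w d1" and w2: "w2:E u c2 w r' d2" and h: "h:fhom cD d (d1' @ d2')"
  note e1 = LE[OF v1 w1] and e2 = S_mem[OF LL_mem[OF v2 w2]]
  show "Fu x c1 c2 v1 v2 w d1' d2' (Act u c1 r w k1 w1) (Act u c2 w r' k2 w2) h = Fu x c1 c2 v1 v2 w d1 d2 w1 w2 (fcmp cD (k1 @ k2) h)"
  using ut.tcat_Act[OF e1 e2, of k1 d1' k2 d2'] k h ut.Act_cmp[OF ut.tcat_mem[OF e1 e2], of "k1 @ k2" "d1' @ d2'" h d] fhom_append[OF k]
  Act_letter[OF LL_mem[OF v1 w1], of k1] LA_LL[OF v1 w1 k(1)] S_Act[OF LL_mem[OF v2 w2] k(2)] LA_LL[OF v2 w2 k(2)]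
  unfolding Fu_def by simp
  qed
  from utcat_univ[OF t.E_D(4)[OF v1] t.E_D(4)[OF v2] this] have "EX G. Q x c1 c2 v1 v2 G" unfolding Q_def .
  then show ?thesis unfolding Gu_def by (rule someI_ex)
 qed
 then have Gu: "Gu x c1 c2 v1 v2 (Act u (c1 @ c2) r r' h' (tcat u c1 c2 r w r' d1 d2 w1 w2)) = Fu x c1 c2 v1 v2 w d1 d2 w1 w2 h'"
  if "v1:E t [b] p x c1" "v2:E t bs x p' c2" "w1:E u c1 r w d1" "w2:E u c2 w r' d2" "h':fhom cD d (d1 @ d2)"
  for x c1 c2 v1 v2 w d1 d2 w1 w2 h'
  using that unfolding Q_def by blast
 define Q2 where "Q2 c e G \<longleftrightarrow> (ALL x c1 c2 v1 v2 h. v1:E t [b] p x c1 --> v2:E t bs x p' c2 --> h:fhom cC c (c1 @ c2) -->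
  G (Act t (b # bs) p p' h (tcat t [b] bs p x p' c1 c2 v1 v2)) = Gu x c1 c2 v1 v2 (X u h (Idn R r) (Idn R r') d e))" for c e and G :: "'u => 'u"
 define Gt where "Gt c e = (SOME G. Q2 c e G)" for c e
 have "Q2 c e (Gt c e)" if e: "e:E u c r r' d" for c e
 proof -
  \<comment> \<open>The second layer is transported along \<open>h\<close> and then split along
    \<open>c1 @ c2\<close>; the state condition becomes a slide in the composite, and the list
    condition becomes the coend relation for \<open>LL\<close> on each part.\<close>
  have "cowedge t [b] bs p p' c (%x c1 c2 v1 v2 h. Gu x c1 c2 v1 v2 (X u h (Idn R r) (Idn R r') d e))"
  proof (rule cowedgeI)
  fix x x' k c1 c2 v1 v2 h
  assume k: "k:hom P x x'" and v1: "v1:E t [b] p x c1" and v2: "v2:E t bs x' p' c2" and h: "h:fhom cC c (c1 @ c2)"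
  obtain w d1 d2 w1 w2 h' where w1: "w1:E u c1 r w d1" and w2: "w2:E u c2 w r' d2" and h': "h':fhom cD d (d1 @ d2)"
  and e': "X u h (Idn R r) (Idn R r') d e = Act u (c1 @ c2) r r' h' (tcat u c1 c2 r w r' d1 d2 w1 w2)"
  by (rule u.tcat_surj[OF uX_mem[OF e h i(3,4)]])
  have iw: "Idn R w:hom R w w" by (rule u.QI[OF u.E_D(3)[OF w1]])
  have ib': "fid cB [b]:fhom cB [b] [b]" using ib by simp
  show "Gu x' c1 c2 (X t (fid cB [b]) (Idn P p) k c1 v1) v2 (X u h (Idn R r) (Idn R r') d e) =
  Gu x c1 c2 v1 (X t (fid cB bs) k (Idn P p') c2 v2) (X u h (Idn R r) (Idn R r') d e)"
  unfolding e' Gu[OF t.X_mem[OF v1 ib' i(1) k] v2 w1 w2 h'] Gu[OF v1 t.X_mem[OF v2 i(5) k i(2)] w1 w2 h'] Fu_def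
  using LXE[OF v1 w1 k iw] uX_id[OF w1] tslide[OF LE[OF v1 w1] S_mem[OF LL_mem[OF v2 w2]] k iw]
  S_X[OF LL_mem[OF v2 w2] k iw] LX_LL[OF v2 w2 i(5) k i(2) iw i(4)] uX_id[OF w2] by simp
  next
  fix x c1 c1' c2 c2' k1 k2 v1 v2 h
  assume k: "k1:fhom cC c1' c1" "k2:fhom cC c2' c2" and v1: "v1:E t [b] p x c1" and v2: "v2:E t bs x p' c2" and h: "h:fhom cC c (c1' @ c2')"
  obtain w d1 d2 w1 w2 h' where w1: "w1:E u c1' r w d1" and w2: "w2:E u c2' w r' d2" and h': "h':fhom cD d (d1 @ d2)"
  and e': "X u h (Idn R r) (Idn R r') d e = Act u (c1' @ c2') r r' h' (tcat u c1' c2' r w r' d1 d2 w1 w2)"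
  by (rule u.tcat_surj[OF uX_mem[OF e h i(3,4)]])
  have iw: "Idn R w:hom R w w" by (rule u.QI[OF u.E_D(3)[OF w1]])
  note kk = fhom_append[OF k]
  note X1 = uX_mem[OF w1 k(1) i(3) iw] and X2 = uX_mem[OF w2 k(2) iw i(4)]
  have "X u (fcmp cC (k1 @ k2) h) (Idn R r) (Idn R r') d e = X u (k1 @ k2) (Idn R r) (Idn R r') d (X u h (Idn R r) (Idn R r') d e)"
  using uX_cmp[OF e h i(3,4) kk i(3,4)] Cmp_idl[OF u.catQ i(3)] Cmp_idl[OF u.catQ i(4)] by simp
  also have "... = Act u (c1 @ c2) r r' h' (tcat u c1 c2 r w r' d1 d2 (X u k1 (Idn R r) (Idn R w) d1 w1) (X u k2 (Idn R w) (Idn R r') d2 w2))"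
  unfolding e' using uX_Act[OF u.tcat_mem[OF w1 w2] kk i(3,4) h'] utcat_X[OF w1 w2 k i(3,4)] by simp
  finally have e'': "X u (fcmp cC (k1 @ k2) h) (Idn R r) (Idn R r') d e = Act u (c1 @ c2) r r' h' (tcat u c1 c2 r w r' d1 d2 (X u k1 (Idn R r) (Idn R w) d1 w1) (X u k2 (Idn R w) (Idn R r') d2 w2))" .
  show "Gu x c1' c2' (Act t [b] p x k1 v1) (Act t bs x p' k2 v2) (X u h (Idn R r) (Idn R r') d e) =
  Gu x c1 c2 v1 v2 (X u (fcmp cC (k1 @ k2) h) (Idn R r) (Idn R r') d e)"
  unfolding e'' unfolding e' Gu[OF t.Act_mem[OF v1 k(1)] t.Act_mem[OF v2 k(2)] w1 w2 h'] Gu[OF v1 v2 X1 X2 h'] Fu_def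
  LL_slide[OF k(1) v1 w1] LL_slide[OF k(2) v2 w2] ..
  qed
  from t.letter_univ[OF this o(1,2)] have "EX G. Q2 c e G" unfolding Q2_def .
  then show ?thesis unfolding Gt_def by (rule someI_ex)
 qed
 then have Gt: "Gt c e (Act t (b # bs) p p' h (tcat t [b] bs p x p' c1 c2 v1 v2)) = Gu x c1 c2 v1 v2 (X u h (Idn R r) (Idn R r') d e)"
  if "e:E u c r r' d" "v1:E t [b] p x c1" "v2:E t bs x p' c2" "h:fhom cC c (c1 @ c2)" for c e x c1 c2 v1 v2 h
  using that unfolding Q2_def by blast
 have "lift_desc u (FO (lext t) (b # bs, p, p')) r r' d (%c v e. Gt c e v) (Rg (b # bs) p r p' r' d e) = e" if e: "e:E ut (b # bs) ?Z ?Z' d" for e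
 proof -
  obtain x w :: 'u and d1 d2 e1 e2 h where e1: "e1:E ut [b] ?Z (enc (x, w)) d1" and e2: "e2:E ut bs (enc (x, w)) ?Z' d2"
  and h: "h:fhom cD d (d1 @ d2)" and eq: "e = Act ut (b # bs) ?Z ?Z' h (tcat ut [b] bs ?Z (enc (x, w)) ?Z' d1 d2 e1 e2)"
  by (rule ut_cons_surj[OF e])
  have e1': "e1:LS [b] p x r w d1" using e1 by (simp add: E_letter)
  obtain c1 v1 w1 where 1: "v1:E t [b] p x c1" "w1:E u c1 r w d1" "e1 = LL [b] p x r w d1 c1 v1 w1" by (rule LS_E[OF e1'])
  obtain c2 v2 w2 where 2: "v2:E t bs x p' c2" "w2:E u c2 w r' d2" "Rg bs x w p' r' d2 e2 = LL bs x p' w r' d2 c2 v2 w2" by (rule LS_E[OF Rg_mem[OF e2]])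
  note T = t.tcat_mem[OF 1(1) 2(1), simplified] and U = u.Act_mem[OF u.tcat_mem[OF 1(2) 2(2)] h]
  have ic: "fid cC (c1 @ c2):fhom cC (c1 @ c2) (c1 @ c2)" by (rule t.FBI[OF t.E_D(4)[OF T]])
  have "Rg (b # bs) p r p' r' d e = LL (b # bs) p p' r r' d (c1 @ c2) (tcat t [b] bs p x p' c1 c2 v1 v2) (Act u (c1 @ c2) r r' h (tcat u c1 c2 r w r' d1 d2 w1 w2))"
  using Rg_rec[OF e1 e2 h] Mh_LL[OF 1(1,2) 2(1,2) h] by (simp add: eq 2(3) 1(3))
  also have "lift_desc u (FO (lext t) (b # bs, p, p')) r r' d (%c v e. Gt c e v) ... = 
  Gt (c1 @ c2) (Act u (c1 @ c2) r r' h (tcat u c1 c2 r w r' d1 d2 w1 w2)) (tcat t [b] bs p x p' c1 c2 v1 v2)"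
  proof (rule LL_desc[OF _ T U])
  fix c c' al v e assume *: "al:fhom cC c' c" "v:E t (b # bs) p p' c" "e:E u c' r r' d"
  obtain x c1 c2 v1 v2 h where v1: "v1:E t [b] p x c1" and v2: "v2:E t bs x p' c2" and h: "h:fhom cC c (c1 @ c2)"
  and v: "v = Act t (b # bs) p p' h (tcat t [b] bs p x p' c1 c2 v1 v2)" by (rule t.cons_surj[OF *(2)])
  note T = t.tcat_mem[OF v1 v2, simplified] and X1 = uX_mem[OF *(3,1) i(3,4)]
  show "Gt c' e (Act t (b # bs) p p' al v) = Gt c (X u al (Idn R r) (Idn R r') d e) v"
  unfolding v t.Act_cmp[OF T h *(1)] Gt[OF X1 v1 v2 h] Gt[OF *(3) v1 v2 Cmp_hom[OF t.catFB *(1) h]]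
  using uX_cmp[OF *(3,1) i(3,4) h i(3,4)] Cmp_idl[OF u.catQ i(3)] Cmp_idl[OF u.catQ i(4)] by simp
  qed
  also have "... = Fu x c1 c2 v1 v2 w d1 d2 w1 w2 h"
  using Gt[OF U 1(1) 2(1) ic] t.Act_id[OF T] uX_id[OF U] Gu[OF 1(1) 2(1) 1(2) 2(2) h] by simp
  also have "... = e"
  unfolding Fu_def 2(3)[symmetric] S[OF e2] 1(3)[symmetric] eq ..
  finally show ?thesis .
 qed
 then show ?thesis by blast
qed

lemma Rg_retract:
 "bs:fob cB ==> p:Obj P ==> p':Obj P ==> r:Obj R ==> r':Obj R ==>
  EX G. ALL e:Eu bs p r p' r' d. G (Rg bs p r p' r' d e) = e"
proof (induction bs arbitrary: p r d)
 case Nil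
 show ?case by (rule Rg_retract_Nil)
next
 case (Cons b bs)
 show ?case
 proof (rule Rg_retract_Cons)
  fix p r d
  show "EX G. ALL e:Eu bs p r p' r' d. G (Rg bs p r p' r' d e) = e"
  \<comment> \<open>A pair that is no state has no elements, so a retraction exists vacuously, and
    the hypothesis is available at all intermediate pairs.\<close>
  proof (cases "p:Obj P & r:Obj R")
  case True
  then show ?thesis using Cons by simp
  next
  case False
  have "Eu bs p r p' r' d = {}"
  using False ut.E_D(2)[of _ bs "enc (p, r)" "enc (p', r')" d] by auto
  then show ?thesis by simp
  qed
 qed (use Cons.prems in auto)
qed

lemma Rg_inj:
 assumes e: "e:Eu bs p r p' r' d" "e':Eu bs p r p' r' d"
  and eq: "Rg bs p r p' r' d e = Rg bs p r p' r' d e'"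
 shows "e = e'"
proof -
 have "bs:fob cB" "p:Obj P" "p':Obj P" "r:Obj R" "r':Obj R"
  using ut.E_D[OF e(1)] by auto
 from Rg_retract[OF this] e eq show ?thesis by metis
qed

end

section \<open>The extension of a composite\<close>

context tdx2
begin

context
 fixes V p p' r r'
 assumes V: "psh cB V" and o: "p:Obj P" "p':Obj P" "r:Obj R" "r':Obj R"
begin

abbreviation (input) "TV == lift_ob t V p p'"
abbreviation (input) "UTV == lift_ob u (lift_ob t V p p') r r'"
abbreviation (input) "Z == enc (p, r) :: 'u"
abbreviation (input) "Z' == enc (p', r') :: 'u"

private lemma TV: "psh cC TV" by (rule t.psh_lift[OF V o(1,2)])
private lemma UTV: "psh cD UTV" using u.psh_lift[of TV r r'] TV o src_u by simp
private lemma oZ: "Z:Obj (St ut)" "Z':Obj (St ut)" using o by auto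
private lemma iR: "Idn R r:hom R r r" "Idn R r':hom R r' r'" using o by (auto intro: u.QI)
private lemma iP: "Idn P p:hom P p p" "Idn P p':hom P p' p'" using o by (auto intro: t.QI)

text \<open>The inner half of \<open>lift_comp_map\<close>, for a fixed element \<open>v\<close> of
  the presheaf: it leaves the coend of the regrouped form and can be evaluated on its
  generators.\<close>

definition lcm_reg where
 "lcm_reg d b v z = lift_desc u (FO (lext t) (b, p, p')) r r' d (%c w e'. lift_in u TV r r' d c (lift_in t V p p' c b v w) e') z"

private lemma lcm_reg_LL:
 assumes v: "v:sel cB V b" and w: "w:E t b p p' c" and e: "e:E u c r r' d"
 shows "lcm_reg d b v (LL b p p' r r' d c w e) = lift_in u TV r r' d c (lift_in t V p p' c b v w) e"
 unfolding lcm_reg_def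
proof (rule LL_desc[OF _ w e])
 fix c c' al w e assume *: "al:fhom cC c' c" "w:E t b p p' c" "e:E u c' r r' d"
 show "lift_in u TV r r' d c' (lift_in t V p p' c' b v (Act t b p p' al w)) e = lift_in u TV r r' d c (lift_in t V p p' c b v w) (X u al (Idn R r) (Idn R r') d e)"
  using ulift_slide[OF TV *(1) t.lift_mem[OF v *(2)] *(3)] t.lift_act[OF V v *(2,1)] by simp
qed

abbreviation "LC == lift_comp_map u t V p r p' r'"
abbreviation "LR d == lift_desc ut V Z Z' d (%b v e. lcm_reg d b v (Rg b p r p' r' d e))"

text \<open>The cowedge condition is naturality of regrouping in the letters followed by the coend
  relation of the lift along \<open>t\<close>.\<close>

private lemma lcm_desc:
 assumes v: "v:sel cB V b" and e: "e:E ut b Z Z' d"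
 shows "LR d (lift_in ut V Z Z' d b v e) = lcm_reg d b v (Rg b p r p' r' d e)"
proof (rule ut.lift_desc_in[OF _ _ v[folded comp_simps(1)] e])
 show "psh (TSrc ut) V" using V by simp
 fix b b' be v e assume *: "be:fhom (TSrc ut) b' b" "v:sel (TSrc ut) V b" "e:E ut b' Z Z' d"
 note st = *(1,2)[unfolded comp_simps]
 obtain c w e' where 1: "w:E t b' p p' c" "e':E u c r r' d" "Rg b' p r p' r' d e = LL b' p p' r r' d c w e'" by (rule LS_E[OF Rg_mem[OF *(3)]])
 show "lcm_reg d b' (act V be v) (Rg b' p r p' r' d e) = lcm_reg d b v (Rg b p r p' r' d (X ut be (Idn (St ut) Z) (Idn (St ut) Z') d e))"
  unfolding comp_simps states_prod_simps Rg_X[OF *(3) st(1) iP iR] 1(3) LX_LL[OF 1(1,2) st(1) iP iR] uX_id[OF 1(2)]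
  lcm_reg_LL[OF act_mem[OF t.catA V st(2,1)] 1(1,2)] lcm_reg_LL[OF st(2) t.X_mem[OF 1(1) st(1) iP] 1(2)]
  t.lift_slide[OF V st(1,2) 1(1)] ..
qed

private lemma lcm_eq: "LC = mk_pmap cD (lift_ob ut V Z Z') UTV
 LR"
 by (simp add: lift_comp_map_def lcm_reg_def)

private lemma lcm_gen:
 assumes v: "v:sel cB V b" and e: "e:E ut b Z Z' d" and eq: "Rg b p r p' r' d e = LL b p p' r r' d c w e'" "w:E t b p p' c" "e':E u c r r' d"
 shows "LR d (lift_in ut V Z Z' d b v e) =
  lift_in u TV r r' d c (lift_in t V p p' c b v w) e'"
 unfolding lcm_desc[OF v e] eq(1) by (rule lcm_reg_LL[OF v eq(2,3)])

private lemma ut_lift_E: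
 assumes z: "z:sel cD (lift_ob ut V Z Z') d"
 obtains b v e c w e' where "v:sel cB V b" "e:E ut b Z Z' d" "w:E t b p p' c" "e':E u c r r' d"
  "Rg b p r p' r' d e = LL b p p' r r' d c w e'" "z = lift_in ut V Z Z' d b v e"
proof -
 obtain b v e where *: "v:sel cB V b" "e:E ut b Z Z' d" "z = lift_in ut V Z Z' d b v e"
  by (rule ut.lift_E[OF oZ, simplified, OF z])
 obtain c w e' where 1: "w:E t b p p' c" "e':E u c r r' d" "Rg b p r p' r' d e = LL b p p' r r' d c w e'" by (rule LS_E[OF Rg_mem[OF *(2)]])
 show ?thesis by (rule that[OF *(1,2) 1 *(3)])
qed

lemma lcm_phom: "LC:phom cD (lift_ob ut V Z Z') UTV"
 unfolding lcm_eq
proof (rule mk_pmap_hom[OF u.catB _ UTV])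
 show "psh cD (lift_ob ut V Z Z')" using ut.psh_lift[OF _ oZ, of V] V by simp
 fix d z assume z: "z:sel cD (lift_ob ut V Z Z') d"
 obtain b v e c w e' where *: "v:sel cB V b" "e:E ut b Z Z' d" "w:E t b p p' c" "e':E u c r r' d"
  "Rg b p r p' r' d e = LL b p p' r r' d c w e'" "z = lift_in ut V Z Z' d b v e" by (rule ut_lift_E[OF z])
 show "LR d z:sel cD UTV d"
  unfolding *(6) lcm_gen[OF *(1,2,5,3,4)] by (rule ulift_mem[OF t.lift_mem[OF *(1,3)] *(4)])
 fix d' de assume de: "de:fhom cD d' d"
 have 1: "Rg b p r p' r' d' (Act ut b Z Z' de e) = LL b p p' r r' d' c w (Act u c r r' de e')"
  unfolding Rg_Act[OF *(2) de] *(5) LA_LL[OF *(3,4) de] ..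
 have 2: "Act ut b Z Z' de e:E ut b Z Z' d'" using ut.Act_mem[OF *(2)] de by simp
 have 3: "act (lift_ob ut V Z Z') de z = lift_in ut V Z Z' d' b v (Act ut b Z Z' de e)"
  using ut.lift_act[of V v b e Z Z' d de d'] V * de by simp
 show "LR d' (act (lift_ob ut V Z Z') de z) =
  act UTV de (LR d z)"
  unfolding 3 unfolding *(6) lcm_gen[OF *(1,2,5,3,4)] lcm_gen[OF *(1) 2 1 *(3) u.Act_mem[OF *(4) de]]
  using ulift_act[OF TV t.lift_mem[OF *(1,3)] *(4) de] by simp
qed

lemma lcm_app:
 assumes v: "v:sel cB V b" and e: "e:E ut b Z Z' d" and eq: "Rg b p r p' r' d e = LL b p p' r r' d c w e'" "w:E t b p p' c" "e':E u c r r' d"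
 shows "app LC d (lift_in ut V Z Z' d b v e) = lift_in u TV r r' d c (lift_in t V p p' c b v w) e'"
proof -
 have "lift_in ut V Z Z' d b v e:sel cD (lift_ob ut V Z Z') d"
  using ut.lift_mem[OF _ e, of v V] v by simp
 then show ?thesis
  unfolding lcm_eq by (simp add: app_mk_pmap lcm_gen[OF assms])
qed

lemma lcm_surj:
 assumes z: "z:sel cD UTV d"
 shows "EX y:sel cD (lift_ob ut V Z Z') d. app LC d y = z"
proof -
 obtain c y e' where 1: "y:sel cC TV c" "e':E u c r r' d" "z = lift_in u TV r r' d c y e'" by (rule ulift_E[OF o(3,4) z])
 obtain b v w where 2: "v:sel cB V b" "w:E t b p p' c" "y = lift_in t V p p' c b v w" by (rule t.lift_E[OF o(1,2) 1(1)])
 obtain e where e: "e:E ut b Z Z' d" "Rg b p r p' r' d e = LL b p p' r r' d c w e'"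
  using Rg_surj[OF LL_mem[OF 2(2) 1(2)]] by auto
 have "lift_in ut V Z Z' d b v e:sel cD (lift_ob ut V Z Z') d"
  using ut.lift_mem[OF _ e(1), of v V] 2 by simp
 then show ?thesis
  using lcm_app[OF 2(1) e 2(2) 1(2)] 1(3) 2(3) by auto
qed

text \<open>A left inverse is assembled coend by coend: \<open>S\<close> inverts regrouping at each
  list, \<open>K\<close> descends it along the coend for \<open>t\<close>, and a last description
  map descends it along the coend for \<open>u\<close>.\<close>

lemma lcm_inj:
 assumes y: "y:sel cD (lift_ob ut V Z Z') d" "y':sel cD (lift_ob ut V Z Z') d"
  and eq: "app LC d y = app LC d y'"
 shows "y = y'"
proof -
 define S where "S b z = (SOME e. e:E ut b Z Z' d & Rg b p r p' r' d e = z)" for b z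
 have S: "S b z:E ut b Z Z' d & Rg b p r p' r' d (S b z) = z" if "z:LS b p p' r r' d" for b z
  unfolding S_def by (rule someI_ex) (use Rg_surj[OF that] in blast)
 have S_Rg: "S b (Rg b p r p' r' d e) = e" if "e:E ut b Z Z' d" for b e
  using S[OF Rg_mem[OF that]] Rg_inj[OF _ that] by blast
 define K where "K c e' = lift_desc t V p p' c (%b v w. lift_in ut V Z Z' d b v (S b (LL b p p' r r' d c w e')))" for c e'
 have K: "K c e' (lift_in t V p p' c b v w) = lift_in ut V Z Z' d b v (S b (LL b p p' r r' d c w e'))"
  if e': "e':E u c r r' d" and v: "v:sel cB V b" and w: "w:E t b p p' c" for c e' b v w
  unfolding K_def
 proof (rule t.lift_desc_in[OF V _ v w])
  fix b b' be v w assume *: "be:fhom cB b' b" "v:sel cB V b" "w:E t b' p p' c"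
  note s = S[OF LL_mem[OF *(3) e'], THEN conjunct1] S[OF LL_mem[OF *(3) e'], THEN conjunct2]
  have 1: "X ut be (Idn (St ut) Z) (Idn (St ut) Z') d (S b' (LL b' p p' r r' d c w e')):E ut b Z Z' d"
  using ut.X_mem[OF s(1), of be b "Idn (St ut) Z" Z "Idn (St ut) Z'" Z'] *(1) iP iR by simp
  have "S b (LL b p p' r r' d c (X t be (Idn P p) (Idn P p') c w) e') = X ut be (Idn (St ut) Z) (Idn (St ut) Z') d (S b' (LL b' p p' r r' d c w e'))"
  using S_Rg[OF 1] Rg_X[OF s(1) *(1) iP iR] LX_LL[OF *(3) e' *(1) iP iR] uX_id[OF e'] by (simp add: s(2))
  then show "lift_in ut V Z Z' d b' (act V be v) (S b' (LL b' p p' r r' d c w e')) =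
  lift_in ut V Z Z' d b v (S b (LL b p p' r r' d c (X t be (Idn P p) (Idn P p') c w) e'))"
  using ut.lift_slide[of V be b' b v _ Z Z' d] V * s(1) by simp
 qed
 have "lift_desc u TV r r' d (%c y e'. K c e' y) (app LC d y) = y"
  if y: "y:sel cD (lift_ob ut V Z Z') d" for y
 proof -
  obtain b v e c w e' where *: "v:sel cB V b" "e:E ut b Z Z' d" "w:E t b p p' c" "e':E u c r r' d"
  "Rg b p r p' r' d e = LL b p p' r r' d c w e'" "y = lift_in ut V Z Z' d b v e" by (rule ut_lift_E[OF y])
  have "lift_desc u TV r r' d (%c y e'. K c e' y) (lift_in u TV r r' d c (lift_in t V p p' c b v w) e') = K c e' (lift_in t V p p' c b v w)"
  proof (rule ulift_desc_in[OF TV _ t.lift_mem[OF *(1,3)] *(4)])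
  fix c c' al y e' assume **: "al:fhom cC c' c" "y:sel cC TV c" "e':E u c' r r' d"
  obtain b v w where 2: "v:sel cB V b" "w:E t b p p' c" "y = lift_in t V p p' c b v w" by (rule t.lift_E[OF o(1,2) **(2)])
  show "K c' e' (act TV al y) = K c (X u al (Idn R r) (Idn R r') d e') y"
  unfolding 2(3) t.lift_act[OF V 2(1,2) **(1)] K[OF **(3) 2(1) t.Act_mem[OF 2(2) **(1)]] K[OF uX_mem[OF **(3,1) iR] 2(1,2)]
  LL_slide[OF **(1) 2(2) **(3)] ..
  qed
  then show ?thesis
  using lcm_app[OF *(1,2,5,3,4)] K[OF *(4,1,3)] S_Rg[OF *(2)] *(5,6) by simp
 qed
 from this[OF y(1)] this[OF y(2)] show ?thesis unfolding eq by (rule trans[OF sym])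
qed

lemma lcm_inverse:
 shows "inverse_mor (psh_cat cD) LC:phom cD UTV (lift_ob ut V Z Z')" (is "PROP ?Ga")
  and "y:sel cD (lift_ob ut V Z Z') d ==>
  app (inverse_mor (psh_cat cD) LC) d (app LC d y) = y" (is "PROP ?Gb")
  and "z:sel cD UTV d ==>
  app LC d (app (inverse_mor (psh_cat cD) LC) d z) = z" (is "PROP ?Gc")
proof -
 note I = inverse_mor_bij[OF u.catB lcm_phom]
 show "PROP ?Ga"
  by (rule I(1)) (assumption | erule lcm_surj | erule (2) lcm_inj)+
 show "PROP ?Gb"
  by (rule I(2)) (assumption | erule lcm_surj | erule (2) lcm_inj)+
 show "PROP ?Gc"
  by (rule I(3)) (assumption | erule lcm_surj | erule (2) lcm_inj)+
qed

end

text \<open>Both sides move \<open>v\<close> by \<open>mu\<close> and each layer by its own state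
  arrows; by \<open>Rg_X\<close>, regrouping carries the action of paired state arrows to these
  separate actions.\<close>

lemma lcm_nat:
 assumes mu: "mu:phom cB V V'" and kl: "k:hom P p0 p" "k':hom P p' p1" "l:hom R r0 r" "l':hom R r' r1"
  and y: "y:sel cD (lift_ob ut V (enc (p, r)) (enc (p', r'))) d"
 shows "app (lift_comp_map u t V' p0 r0 p1 r1) d (app (FM (lift ut) (mu, enc (k, l), enc (k', l'))) d y) =
  app (FM (lift u) (FM (lift t) (mu, k, k'), l, l')) d (app (lift_comp_map u t V p r p' r') d y)"
proof -
 note V = phom_psh[OF t.catA mu]
 note op = hom_obj2[OF t.catQ kl(1)] hom_obj1[OF t.catQ kl(2)] hom_obj2[OF u.catQ kl(3)] hom_obj1[OF u.catQ kl(4)]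
 note op0 = hom_obj1[OF t.catQ kl(1)] hom_obj2[OF t.catQ kl(2)] hom_obj1[OF u.catQ kl(3)] hom_obj2[OF u.catQ kl(4)]
 have oZ: "enc (p, r):Obj (St ut)" "enc (p', r'):Obj (St ut)" using op by auto
 obtain b v e where *: "v:sel cB V b" "e:Eu b p r p' r' d" "y = lift_in ut V (enc (p, r)) (enc (p', r')) d b v e"
  by (rule ut.lift_E[OF oZ, simplified, OF y])
 obtain c w e' where 1: "w:E t b p p' c" "e':E u c r r' d" "Rg b p r p' r' d e = LL b p p' r r' d c w e'" by (rule LS_E[OF Rg_mem[OF *(2)]])
 note i = t.FAI[OF t.E_D(1)[OF 1(1)]] t.FBI[OF t.E_D(4)[OF 1(1)]]
 note muv = app_mem[OF t.catA mu *(1)]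
 have kl': "enc (k, l):hom (St ut) (enc (p0, r0)) (enc (p, r))" "enc (k', l'):hom (St ut) (enc (p', r')) (enc (p1, r1))" using kl by auto
 have e2: "X ut (fid cB b) (enc (k, l)) (enc (k', l')) d e:Eu b p0 r0 p1 r1 d"
  using ut.X_mem[OF *(2) _ kl', of "fid cB b" b] i by simp
 have R2: "Rg b p0 r0 p1 r1 d (X ut (fid cB b) (enc (k, l)) (enc (k', l')) d e) = LL b p0 p1 r0 r1 d c (X t (fid cB b) k k' c w) (X u (fid cC c) l l' d e')"
  unfolding Rg_X[OF *(2) i(1) kl] 1(3) by (rule LX_LL[OF 1(1,2) i(1) kl])
 have L: "app (FM (lift ut) (mu, enc (k, l), enc (k', l'))) d y = lift_in ut V' (enc (p0, r0)) (enc (p1, r1)) d b (app mu b v) (X ut (fid cB b) (enc (k, l)) (enc (k', l')) d e)"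
  using ut.lift_FM[of mu V V' "enc (k, l)" "enc (p0, r0)" "enc (p, r)" "enc (k', l')" "enc (p', r')" "enc (p1, r1)" v b e d] mu kl' * by simp
 have T: "FM (lift t) (mu, k, k'):phom cC (lift_ob t V p p') (lift_ob t V' p0 p1)"
  unfolding t.lift_FM_eq[OF mu kl(1,2)] by (rule t.lift_FM0(1)[OF mu kl(1,2)])
 show ?thesis
  unfolding L lcm_app[OF V(2) op0 muv e2 R2 t.X_mem[OF 1(1) i(1) kl(1,2)] uX_mem[OF 1(2) i(2) kl(3,4)]]
  unfolding *(3) lcm_app[OF V(1) op *(1,2) 1(3,1,2)] ulift_FM[OF T kl(3,4) t.lift_mem[OF *(1) 1(1)] 1(2)]
  t.lift_FM[OF mu kl(1,2) *(1) 1(1)] ..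
qed

end

section \<open>2-cells\<close>

lemma catT3: "is_tdx s ==> category (D3 s)"
 by (intro category_prod category_op) (auto simp: is_tdx_def sl)

lemma pull_functor:
 assumes s: "is_tdx s" and t: "is_tdx t" and eq: "TSrc t = TSrc s" and K: "is_functor (St s) (St t) K"
 shows "is_functor (D3 s) (psh_cat (TTgt t)) (pull s t K)"
proof -
 interpret t: tdx t by unfold_locales (rule t)
 have Tf: "is_functor (TSrc s \<times>\<^sub>c op_cat (St t) \<times>\<^sub>c St t) (psh_cat (TTgt t)) (Tf t)"
  using t.Tf eq by simp
 show ?thesis
  unfolding pull_def
 proof (rule functorI[OF catT3[OF s]])
  fix x assume "x:Obj (D3 s)"
  then obtain a p p' where x: "x = (a, p, p')" "a:Obj (TSrc s)" "p:Obj (St s)" "p':Obj (St s)" by (cases x) auto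
  then have x': "(a, FO K p, FO K p'):Obj (TSrc s \<times>\<^sub>c op_cat (St t) \<times>\<^sub>c St t)" using functor_obj[OF K] by auto
  show "psh (TTgt t) (case x of (a, p, p') => FO (Tf t) (a, FO K p, FO K p'))"
  using functor_obj[OF Tf x'] x by simp
  show "(case Idn (D3 s) x of (al, k, k') => FM (Tf t) (al, FM K k, FM K k')) =
  Idn (psh_cat (TTgt t)) (case x of (a, p, p') => FO (Tf t) (a, FO K p, FO K p'))"
  using functor_Idn[OF Tf x'] x functor_Idn[OF K] by simp
 next
  fix x y f assume "f:hom (D3 s) x y"
  then obtain a p p' a' p0 p1 al k l where *: "x = (a, p, p')" "y = (a', p0, p1)" "f = (al, k, l)" "al:hom (TSrc s) a a'" "k:hom (St s) p0 p" "l:hom (St s) p' p1"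
  by (cases x; cases y; cases f) auto
  show "(case f of (al, k, k') => FM (Tf t) (al, FM K k, FM K k')):phom (TTgt t) (case x of (a, p, p') => FO (Tf t) (a, FO K p, FO K p')) (case y of (a, p, p') => FO (Tf t) (a, FO K p, FO K p'))"
  using functor_hom[OF Tf, of "(al, FM K k, FM K l)" "(a, FO K p, FO K p')" "(a', FO K p0, FO K p1)"] * functor_hom[OF K] by simp
 next
  fix x y z f g assume f: "f:hom (D3 s) x y" and g: "g:hom (D3 s) y z"
  obtain a p p' a' p0 p1 al k l where *: "x = (a, p, p')" "y = (a', p0, p1)" "f = (al, k, l)" "al:hom (TSrc s) a a'" "k:hom (St s) p0 p" "l:hom (St s) p' p1"
  using f by (cases x; cases y; cases f) auto
  obtain a'' p00 p11 al' k' l' where **: "z = (a'', p00, p11)" "g = (al', k', l')" "al':hom (TSrc s) a' a''" "k':hom (St s) p00 p0" "l':hom (St s) p1 p11"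
  using g * by (cases z; cases g) auto
  show "(case Cmp (D3 s) g f of (al, k, k') => FM (Tf t) (al, FM K k, FM K k')) =
  Cmp (psh_cat (TTgt t)) (case g of (al, k, k') => FM (Tf t) (al, FM K k, FM K k')) (case f of (al, k, k') => FM (Tf t) (al, FM K k, FM K k'))"
  using functor_Cmp[OF Tf, of "(al, FM K k, FM K l)" "(a, FO K p, FO K p')" "(a', FO K p0, FO K p1)" "(al', FM K k', FM K l')" "(a'', FO K p00, FO K p11)"]
  functor_hom[OF K *(5)] functor_hom[OF K *(6)] functor_hom[OF K **(4)] functor_hom[OF K **(5)] * **
  functor_Cmp[OF K **(4) *(5)] functor_Cmp[OF K *(6) **(5)] by simp
 qed
qed

lemma mk_cell_simps [simp]:
 "CSrc (mk_cell s t oK mK th) = s" "CTgt (mk_cell s t oK mK th) = t" "CK (mk_cell s t oK mK th) = mk_func (St s) oK mK"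
 "NSrc (CTh (mk_cell s t oK mK th)) = Tf s" "NTgt (CTh (mk_cell s t oK mK th)) = pull s t (mk_func (St s) oK mK)"
 "a:Obj (TSrc s) ==> p:Obj (St s) ==> p':Obj (St s) ==> Nc (CTh (mk_cell s t oK mK th)) (a, p, p') = th a p p'"
 by (auto simp: mk_cell_def Let_def)

lemma mk_cellI:
 fixes s t :: "'u::universe tdx"
 assumes s: "is_tdx s" and t: "is_tdx t" and eq: "TSrc t = TSrc s" "TTgt t = TTgt s"
  and K: "is_functor (St s) (St t) (mk_func (St s) oK mK)"
  and th: "!!a p p'. a:Obj (TSrc s) ==> p:Obj (St s) ==> p':Obj (St s) ==>
  th a p p':phom (TTgt s) (FO (Tf s) (a, p, p')) (FO (Tf t) (a, oK p, oK p'))"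
  and nat: "!!a a' p p' p0 p1 al k l b e. al:hom (TSrc s) a a' ==> k:hom (St s) p0 p ==> l:hom (St s) p' p1 ==>
  e:sel (TTgt s) (FO (Tf s) (a, p, p')) b ==>
  app (th a' p0 p1) b (app (FM (Tf s) (al, k, l)) b e) = app (FM (Tf t) (al, mK k, mK l)) b (app (th a p p') b e)"
 shows "is_cell s t (mk_cell s t oK mK th)"
proof -
 interpret s: tdx s by unfold_locales (rule s)
 interpret t: tdx t by unfold_locales (rule t)
 let ?K = "mk_func (St s) oK mK"
 have PF: "is_functor (D3 s) (psh_cat (TTgt s)) (pull s t ?K)"
  using pull_functor[OF s t eq(1) K] eq by simp
 have "is_ntrans (D3 s) (psh_cat (TTgt s)) (CTh (mk_cell s t oK mK th))"
 proof (rule ntransI)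
  show "Nc (CTh (mk_cell s t oK mK th)):extensional (Obj (D3 s))"
  by (simp add: mk_cell_def Let_def)
 next
  fix x assume "x:Obj (D3 s)"
  then obtain a p p' where x: "x = (a, p, p')" "a:Obj (TSrc s)" "p:Obj (St s)" "p':Obj (St s)" by (cases x) auto
  show "Nc (CTh (mk_cell s t oK mK th)) x:phom (TTgt s) (FO (NSrc (CTh (mk_cell s t oK mK th))) x) (FO (NTgt (CTh (mk_cell s t oK mK th))) x)"
  using th[OF x(2-4)] x by (simp add: pull_def)
 next
  fix f x y assume f: "f:hom (D3 s) x y"
  obtain a p p' a' p0 p1 al k l where *: "x = (a, p, p')" "y = (a', p0, p1)" "f = (al, k, l)" "al:hom (TSrc s) a a'" "k:hom (St s) p0 p" "l:hom (St s) p' p1"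
  using f by (cases x; cases y; cases f) auto
  note ox = hom_obj1[OF s.catA *(4)] hom_obj2[OF s.catQ *(5)] hom_obj1[OF s.catQ *(6)]
  note oy = hom_obj2[OF s.catA *(4)] hom_obj1[OF s.catQ *(5)] hom_obj2[OF s.catQ *(6)]
  have F1: "FM (Tf s) (al, k, l):phom (TTgt s) (FO (Tf s) (a, p, p')) (FO (Tf s) (a', p0, p1))"
  using functor_hom[OF s.Tf f] * by simp
  have F2: "FM (Tf t) (al, mK k, mK l):phom (TTgt s) (FO (Tf t) (a, oK p, oK p')) (FO (Tf t) (a', oK p0, oK p1))"
  using functor_hom[OF PF f] * ox oy hom_Mor[OF *(4)] hom_Mor[OF *(5)] hom_Mor[OF *(6)] by (simp add: pull_def)
  have "Cmp (psh_cat (TTgt s)) (FM (Tf t) (al, mK k, mK l)) (th a p p') = Cmp (psh_cat (TTgt s)) (th a' p0 p1) (FM (Tf s) (al, k, l))"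
  by (rule phom_eqI[OF s.catB phom_cmp[OF s.catB th[OF ox] F2] phom_cmp[OF s.catB F1 th[OF oy]]])
  (simp add: app_cmp[OF s.catB th[OF ox] F2] app_cmp[OF s.catB F1 th[OF oy]] nat[OF *(4-6)])
  then show "Cmp (psh_cat (TTgt s)) (FM (NTgt (CTh (mk_cell s t oK mK th))) f) (Nc (CTh (mk_cell s t oK mK th)) x) =
  Cmp (psh_cat (TTgt s)) (Nc (CTh (mk_cell s t oK mK th)) y) (FM (NSrc (CTh (mk_cell s t oK mK th))) f)"
  using * ox oy hom_Mor[OF *(4)] hom_Mor[OF *(5)] hom_Mor[OF *(6)] by (simp add: pull_def)
 qed (use s.Tf PF in simp_all)
 then show ?thesis
  unfolding is_cell_def using K eq by simp
qed

section \<open>Extension of a 2-cell to lists\<close>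

locale cell = s: tdx s + t: tdx t for s :: "'u::universe tdx" and t :: "'u tdx" +
 fixes ph :: "'u cell"
 assumes cell: "is_cell s t ph"
begin

lemma cell_simps [simp]: "CSrc ph = s" "CTgt ph = t" "TSrc t = TSrc s" "TTgt t = TTgt s"
 using cell by (auto simp: is_cell_def)

abbreviation "oK == FO (CK ph)"
abbreviation "mK == FM (CK ph)"

lemma K: "is_functor (St s) (St t) (CK ph)"
 using cell by (auto simp: is_cell_def)

lemmas oK_obj = functor_obj[OF K] and mK_hom = functor_hom[OF K] and mK_id = functor_Idn[OF K] and mK_cmp = functor_Cmp[OF K]

lemma Nc_phom:
 assumes "a:Obj (TSrc s)" "p:Obj (St s)" "p':Obj (St s)"
 shows "Nc (CTh ph) (a, p, p'):phom (TTgt s) (FO (Tf s) (a, p, p')) (FO (Tf t) (a, oK p, oK p'))"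
proof -
 have N: "is_ntrans (D3 s) (psh_cat (TTgt s)) (CTh ph)" "NSrc (CTh ph) = Tf s" "NTgt (CTh ph) = pull s t (CK ph)"
  using cell by (auto simp: is_cell_def)
 show ?thesis
  using ntransD(3)[OF N(1), of "(a, p, p')"] N(2,3) assms by (simp add: pull_def)
qed

lemma Nc_nat:
 assumes al: "al:hom (TSrc s) a a'" and kl: "k:hom (St s) p0 p" "l:hom (St s) p' p1" and e: "e:E s [a] p p' b"
 shows "app (Nc (CTh ph) (a', p0, p1)) b (X s [al] k l b e) = X t [al] (mK k) (mK l) b (app (Nc (CTh ph) (a, p, p')) b e)"
proof -
 have N: "is_ntrans (D3 s) (psh_cat (TTgt s)) (CTh ph)" "NSrc (CTh ph) = Tf s" "NTgt (CTh ph) = pull s t (CK ph)"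
  using cell by (auto simp: is_cell_def)
 note ox = hom_obj1[OF s.catA al] hom_obj2[OF s.catQ kl(1)] hom_obj1[OF s.catQ kl(2)]
 note oy = hom_obj2[OF s.catA al] hom_obj1[OF s.catQ kl(1)] hom_obj2[OF s.catQ kl(2)]
 have F1: "FM (Tf s) (al, k, l):phom (TTgt s) (FO (Tf s) (a, p, p')) (FO (Tf s) (a', p0, p1))"
  using functor_hom[OF s.Tf, of "(al, k, l)" "(a, p, p')" "(a', p0, p1)"] al kl by simp
 have F2: "FM (Tf t) (al, mK k, mK l):phom (TTgt s) (FO (Tf t) (a, oK p, oK p')) (FO (Tf t) (a', oK p0, oK p1))"
  using functor_hom[OF t.Tf, of "(al, mK k, mK l)" "(a, oK p, oK p')" "(a', oK p0, oK p1)"] al mK_hom[OF kl(1)] mK_hom[OF kl(2)] by simp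
 have e': "e:sel (TTgt s) (FO (Tf s) (a, p, p')) b"
  using e ox by (simp add: s.E_iff pel_def s.tlet_simps)
 have "Cmp (psh_cat (TTgt s)) (FM (Tf t) (al, mK k, mK l)) (Nc (CTh ph) (a, p, p')) = Cmp (psh_cat (TTgt s)) (Nc (CTh ph) (a', p0, p1)) (FM (Tf s) (al, k, l))"
  using ntransD(4)[OF N(1), of "(al, k, l)" "(a, p, p')" "(a', p0, p1)"] N(2,3) al kl hom_Mor[OF al] hom_Mor[OF kl(1)] hom_Mor[OF kl(2)] by (simp add: pull_def)
 then have "app (FM (Tf t) (al, mK k, mK l)) b (app (Nc (CTh ph) (a, p, p')) b e) = app (Nc (CTh ph) (a', p0, p1)) b (app (FM (Tf s) (al, k, l)) b e)"
  using app_cmp[OF s.catB Nc_phom[OF ox] F2 e'] app_cmp[OF s.catB F1 Nc_phom[OF oy] e'] by simp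
 then show ?thesis
  using s.lext_letter[OF al kl] t.lext_letter[of al a a' "mK k" "oK p0" "oK p" "mK l" "oK p'" "oK p1"] al mK_hom[OF kl(1)] mK_hom[OF kl(2)]
  by (simp add: X_def)
qed

text \<open>Typing and naturality of the letterwise extension, kept together because naturality of
  the tail in its states makes the map at the next letter well defined.\<close>

definition CP where
 "CP as \<longleftrightarrow> (ALL p:Obj (St s). ALL p':Obj (St s). cext ph as p p':phom (TTgt s) (FO (lext s) (as, p, p')) (FO (lext t) (as, oK p, oK p'))) &
  (ALL al as' k l p p' p0 p1 b e. al:fhom (TSrc s) as as' --> k:hom (St s) p0 p --> l:hom (St s) p' p1 --> e:E s as p p' b -->
  app (cext ph as' p0 p1) b (X s al k l b e) = X t al (mK k) (mK l) b (app (cext ph as p p') b e))"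

lemma CP_D:
 assumes "CP as"
 shows "p:Obj (St s) ==> p':Obj (St s) ==> cext ph as p p':phom (TTgt s) (FO (lext s) (as, p, p')) (FO (lext t) (as, oK p, oK p'))"
  and "al:fhom (TSrc s) as as' ==> k:hom (St s) p0 p ==> l:hom (St s) p' p1 ==> e:E s as p p' b ==>
  app (cext ph as' p0 p1) b (X s al k l b e) = X t al (mK k) (mK l) b (app (cext ph as p p') b e)"
 using assms unfolding CP_def by blast+

lemma CP_mem:
 assumes CP: "CP as" and e: "e:E s as p p' b"
 shows "app (cext ph as p p') b e:E t as (oK p) (oK p') b" (is "PROP ?Ga")
  and "be:fhom (TTgt s) b' b ==> app (cext ph as p p') b' (Act s as p p' be e) = Act t as (oK p) (oK p') be (app (cext ph as p p') b e)" (is "PROP ?Gb")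
proof -
 note o = s.E_D[OF e]
 have e': "e:sel (TTgt s) (FO (lext s) (as, p, p')) b" using e o by (simp add: s.sel_lext)
 show "PROP ?Ga"
  using app_mem[OF s.catB CP_D(1)[OF CP o(2,3)] e'] t.sel_lext[OF oK_obj[OF o(2)] oK_obj[OF o(3)], of as] o(1) by simp
 show "PROP ?Gb"
  by (rule app_act[OF s.catB CP_D(1)[OF CP o(2,3)] e'])
qed

lemma cext_Nil:
 assumes m: "m:hom (St s) p p'"
 shows "app (cext ph [] p p') [] (en m) = en (mK m)"
 using peD(4)[OF s.E_D(5)[OF s.E_NilI[OF m]]] by (simp add: app_mk_pmap)

lemma CP_Nil: "CP []"
 unfolding CP_def
proof (intro conjI ballI allI impI)
 fix p p' assume p: "p:Obj (St s)" "p':Obj (St s)"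
 note l = s.lext_FO[of "[]" p p'] t.lext_FO[of "[]" "oK p" "oK p'"]
 have "mk_pmap (TTgt s) (FO (lext s) ([], p, p')) (FO (lext t) ([], oK p, oK p'))
  (%_ x. let (m :: 'u, h :: 'u list) = dec x in enc (mK m, h)):phom (TTgt s) (FO (lext s) ([], p, p')) (FO (lext t) ([], oK p, oK p'))"
 proof (rule mk_pmap_hom[OF s.catB])
  show "psh (TTgt s) (FO (lext s) ([], p, p'))" using FO_psh[OF s.catB s.catL s.lext_functor, of "([], p, p')"] p by simp
  show "psh (TTgt s) (FO (lext t) ([], oK p, oK p'))" using FO_psh[OF t.catB t.catL t.lext_functor, of "([], oK p, oK p')"] p oK_obj by simp
  have E: "e:sel (TTgt s) (FO (lext s) ([], p, p')) b \<longleftrightarrow> e:E s [] p p' b" "e:sel (TTgt s) (FO (lext t) ([], oK p, oK p')) b \<longleftrightarrow> e:E t [] (oK p) (oK p') b" for e b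
  using s.sel_lext[OF p] t.sel_lext[OF oK_obj[OF p(1)] oK_obj[OF p(2)]] by simp_all
  show "(let (m :: 'u, h :: 'u list) = dec e in enc (mK m, h)):sel (TTgt s) (FO (lext t) ([], oK p, oK p')) b"
  if "e:sel (TTgt s) (FO (lext s) ([], p, p')) b" for b e
  using that mK_hom unfolding E by (auto simp: s.E_Nil t.E_Nil)
  show "(let (m :: 'u, h :: 'u list) = dec (act (FO (lext s) ([], p, p')) be e) in enc (mK m, h)) =
  act (FO (lext t) ([], oK p, oK p')) be (let (m :: 'u, h :: 'u list) = dec e in enc (mK m, h))"
  if "e:sel (TTgt s) (FO (lext s) ([], p, p')) b" "be:fhom (TTgt s) b' b" for b b' be e
  using that mK_hom unfolding E by (auto simp: s.E_Nil t.E_Nil s.Act_Nil t.Act_Nil)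
 qed
 then show "cext ph [] p p':phom (TTgt s) (FO (lext s) ([], p, p')) (FO (lext t) ([], oK p, oK p'))"
  using l p oK_obj by simp
next
 fix al as' k l p p' p0 p1 b e
 assume *: "al:fhom (TSrc s) [] as'" "k:hom (St s) p0 p" "l:hom (St s) p' p1" "e:E s [] p p' b"
 obtain m where m: "b = []" "e = en m" "m:hom (St s) p p'" using *(4) by (auto simp: s.E_Nil)
 have [simp]: "al = []" "as' = []" using *(1) by auto
 note c = Cmp_hom[OF s.catQ *(2) m(3)]
 show "app (cext ph as' p0 p1) b (X s al k l b e) = X t al (mK k) (mK l) b (app (cext ph [] p p') b e)"
  using cext_Nil[OF m(3)] cext_Nil[OF Cmp_hom[OF s.catQ c *(3)]] mK_cmp[OF *(2) m(3)] mK_cmp[OF c *(3)]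
  by (simp add: m s.X_Nil[OF m(3) *(2,3)] t.X_Nil[OF mK_hom[OF m(3)] mK_hom[OF *(2)] mK_hom[OF *(3)]] del: cext.simps)
qed

lemma CP_letter: "a:Obj (TSrc s) ==> CP [a]"
 unfolding CP_def
proof (intro conjI ballI allI impI)
 fix p p' assume *: "a:Obj (TSrc s)" "p:Obj (St s)" "p':Obj (St s)"
 show "cext ph [a] p p':phom (TTgt s) (FO (lext s) ([a], p, p')) (FO (lext t) ([a], oK p, oK p'))"
  using Nc_phom[OF *] * oK_obj by (simp add: s.lext_FO s.tlet_simps t.lext_FO t.tlet_simps)
next
 fix al as' k l p p' p0 p1 b e
 assume *: "al:fhom (TSrc s) [a] as'" "k:hom (St s) p0 p" "l:hom (St s) p' p1" "e:E s [a] p p' b"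
 obtain al' a' where "al = [al']" "as' = [a']" "al':hom (TSrc s) a a'" using fhom_Cons_left[OF *(1)] by auto
 then show "app (cext ph as' p0 p1) b (X s al k l b e) = X t al (mK k) (mK l) b (app (cext ph [a] p p') b e)"
  using Nc_nat[OF _ *(2,3,4)] by simp
qed

text \<open>The recursion for \<open>cext\<close> on generators. It is phrased with
  \<open>tcat\<close> so as to include an empty tail, where \<open>cext\<close> is not given by a
  \<open>tens_map\<close>.\<close>

abbreviation "cext_eq a as p p' x b1 b2 e1 e2 h b ==
 app (cext ph (a # as) p p') b (Act s (a # as) p p' h (tcat s [a] as p x p' b1 b2 e1 e2)) = Act t (a # as) (oK p) (oK p') h (tcat t [a] as (oK p) (oK x) (oK p') b1 b2 (app (cext ph [a] p x) b1 e1) (app (cext ph as x p') b2 e2))"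

text \<open>For a nonempty tail \<open>tens_map\<close> applies with the state functor as
  \<open>ka\<close>, and its dinaturality is naturality of the letter and of the tail in the middle
  state. For an empty tail the second element is a state arrow, which naturality of the letter
  component absorbs.\<close>

lemma cext_Cons0:
 assumes a: "a:Obj (TSrc s)" and as: "as:fob (TSrc s)" and CP: "CP as"
 shows "p:Obj (St s) ==> p':Obj (St s) ==> cext ph (a # as) p p':phom (TTgt s) (FO (lext s) (a # as, p, p')) (FO (lext t) (a # as, oK p, oK p'))" (is "PROP ?Ga")
  and "e1:E s [a] p x b1 ==> e2:E s as x p' b2 ==> h:fhom (TTgt s) b (b1 @ b2) ==>
  cext_eq a as p p' x b1 b2 e1 e2 h b"
proof -
 note CL = CP_letter[OF a]
 have "(ALL p:Obj (St s). ALL p':Obj (St s). cext ph (a # as) p p':phom (TTgt s) (FO (lext s) (a # as, p, p')) (FO (lext t) (a # as, oK p, oK p'))) &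
  (ALL p p' x b1 b2 e1 e2 h b. e1:E s [a] p x b1 --> e2:E s as x p' b2 --> h:fhom (TTgt s) b (b1 @ b2) -->
  cext_eq a as p p' x b1 b2 e1 e2 h b)"
 proof (cases "as = []")
  case True
  have "app (cext ph [a] p p') b (Act s [a] p p' h (tcat s [a] [] p x p' b1 b2 e1 e2)) =
  Act t [a] (oK p) (oK p') h (tcat t [a] [] (oK p) (oK x) (oK p') b1 b2 (app (cext ph [a] p x) b1 e1) (app (cext ph [] x p') b2 e2))"
  if e1: "e1:E s [a] p x b1" and e2: "e2:E s [] x p' b2" and h: "h:fhom (TTgt s) b (b1 @ b2)" for p p' x b1 b2 e1 e2 h b
  proof -
  obtain m where m: "b2 = []" "e2 = en m" "m:hom (St s) x p'" using e2 by (auto simp: s.E_Nil)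
  have ia: "[Idn (TSrc s) a]:fhom (TSrc s) [a] [a]" using Idn_hom[OF s.catA a] by simp
  note ip = s.QI[OF s.E_D(2)[OF e1]]
  have h': "h:fhom (TTgt s) b b1" using h m by simp
  show ?thesis
  using CP_mem(2)[OF CL s.X_mem[OF e1 ia ip m(3)] h'] CP_D(2)[OF CL ia ip m(3) e1] mK_id[OF s.E_D(2)[OF e1]]
  t.tcat_letter_Nil[OF CP_mem(1)[OF CL e1] mK_hom[OF m(3)]] cext_Nil[OF m(3)]
  by (simp add: m s.tcat_letter_Nil[OF e1 m(3)] del: cext.simps)
  qed
  then show ?thesis using CP_D(1)[OF CL] True by auto
 next
  case False
  then obtain a' ar where r: "as = a' # ar" by (cases as) auto
  have lF: "FO (lext s) (a # as, p, p') = psh_coend (St s) (TTgt s) (tensD (St s) (TTgt s) (tlet s a) (tlist s as) p p')"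
  if "p:Obj (St s)" "p':Obj (St s)" for p p'
  using that a as by (simp add: s.lext_FO r tens_FO[OF s.smallQ s.smallB s.tlet_prof s.tlist_prof])
  have lT: "FO (lext t) (a # as, p, p') = psh_coend (St t) (TTgt s) (tensD (St t) (TTgt s) (tlet t a) (tlist t as) p p')"
  if "p:Obj (St t)" "p':Obj (St t)" for p p'
  using that a as tens_FO[OF t.smallQ t.smallB t.tlet_prof t.tlist_prof, of a as p p'] by (simp add: t.lext_FO r)
  have P: "prof (St s) (TTgt s) (tlet s a)" "prof (St s) (TTgt s) (tlist s as)" "prof (St t) (TTgt s) (tlet t a)" "prof (St t) (TTgt s) (tlist t as)"
  using s.tlet_prof[OF a] s.tlist_prof[OF as] t.tlet_prof[of a] t.tlist_prof[of as] a as by auto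
  have eq: "cext ph (a # as) p p' = tens_map (TTgt s) (St s) (tlet s a) (tlist s as) p p' (St t) (tlet t a) (tlist t as) (oK p) (oK p') oK
  (%x. Nc (CTh ph) (a, p, x)) (%x. cext ph as x p')" for p p'
  by (simp add: r)
  have E1: "u:pe (St s) (TTgt s) (tlet s a) p x c \<longleftrightarrow> u:E s [a] p x c" for u p x c using a by (simp add: s.E_iff)
  have E2: "u:pe (St s) (TTgt s) (tlist s as) p x c \<longleftrightarrow> u:E s as p x c" for u p x c using as by (simp add: s.E_iff)
  have dinat: "tens_in (St t) (TTgt s) (tlet t a) (tlist t as) (oK p) (oK p') b (oK y) c1 c2 (app (Nc (CTh ph) (a, p, y)) c1 (app (FM (tlet s a) (Idn (St s) p, l)) c1 u)) (app (cext ph as y p') c2 v) h =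
  tens_in (St t) (TTgt s) (tlet t a) (tlist t as) (oK p) (oK p') b (oK x) c1 c2 (app (Nc (CTh ph) (a, p, x)) c1 u) (app (cext ph as x p') c2 (app (FM (tlist s as) (l, Idn (St s) p')) c2 v)) h"
  if l: "l:hom (St s) x y" and u: "u:pe (St s) (TTgt s) (tlet s a) p x c1" and v: "v:pe (St s) (TTgt s) (tlist s as) y p' c2" and h: "h:fhom (TTgt s) b (c1 @ c2)"
  for p p' x y l c1 c2 u v h b
  proof -
  have u': "u:E s [a] p x c1" and v': "v:E s as y p' c2" using u v E1 E2 by auto
  note i = s.QI[OF s.E_D(2)[OF u']] s.QI[OF s.E_D(3)[OF v']] s.FAI[OF as]
  have ia: "fid (TSrc s) [a]:fhom (TSrc s) [a] [a]" using Idn_hom[OF s.catA a] by simp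
  note Cu = CP_mem(1)[OF CL u'] and Cv = CP_mem(1)[OF CP v']
  have it: "Idn (St t) (oK p):hom (St t) (oK p) (oK p)" "Idn (St t) (oK p'):hom (St t) (oK p') (oK p')"
  using mK_hom[OF i(1)] mK_hom[OF i(2)] mK_id[OF s.E_D(2)[OF u']] mK_id[OF s.E_D(3)[OF v']] by auto
  have 1: "app (Nc (CTh ph) (a, p, y)) c1 (app (FM (tlet s a) (Idn (St s) p, l)) c1 u) = app (FM (tlet t a) (Idn (St t) (oK p), mK l)) c1 (app (Nc (CTh ph) (a, p, x)) c1 u)"
  using CP_D(2)[OF CL ia i(1) l u'] s.X_state[OF u' i(1) l] t.X_state[OF Cu it(1) mK_hom[OF l]] mK_id[OF s.E_D(2)[OF u']] by simp
  have 2: "app (cext ph as x p') c2 (app (FM (tlist s as) (l, Idn (St s) p')) c2 v) = app (FM (tlist t as) (mK l, Idn (St t) (oK p'))) c2 (app (cext ph as y p') c2 v)"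
  using CP_D(2)[OF CP i(3) l i(2) v'] s.X_state[OF v' l i(2)] t.X_state[OF Cv mK_hom[OF l] it(2)] mK_id[OF s.E_D(3)[OF v']] by simp
  show ?thesis
  unfolding 1 2 using tens_slide_state[OF t.smallQ s.smallB P(3,4) mK_hom[OF l] _ t.E_D(5)[OF Cv, unfolded cell_simps] h] t.E_D(5)[OF Cu] by simp
  qed
  have si: "Nc (CTh ph) (a, p, x):phom (TTgt s) (FO (tlet s a) (p, x)) (FO (tlet t a) (oK p, oK x))" if "p:Obj (St s)" "x:Obj (St s)" for p x
  using Nc_phom[OF a that] a that oK_obj by (simp add: s.tlet_simps t.tlet_simps)
  have rh: "cext ph as x p':phom (TTgt s) (FO (tlist s as) (x, p')) (FO (tlist t as) (oK x, oK p'))" if "x:Obj (St s)" "p':Obj (St s)" for x p'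
  using CP_D(1)[OF CP that] that as oK_obj by (simp add: s.lext_FO t.lext_FO)
  note T = tens_map[where ka = oK and si = "%x. Nc (CTh ph) (a, p, x)" and rh = "%x. cext ph as x p'" and q = p and q' = p' and r = "oK p" and r' = "oK p'" for p p',
  OF s.smallB s.smallQ t.smallQ P _ _ oK_obj oK_obj oK_obj si rh dinat, folded eq]
  show ?thesis
  proof (intro conjI ballI allI impI)
  fix p p' assume p: "p:Obj (St s)" "p':Obj (St s)"
  show "cext ph (a # as) p p':phom (TTgt s) (FO (lext s) (a # as, p, p')) (FO (lext t) (a # as, oK p, oK p'))"
  unfolding lF[OF p] lT[OF oK_obj[OF p(1)] oK_obj[OF p(2)]] by (rule T(1)) (assumption | rule p)+
  next
  fix p p' x b1 b2 e1 e2 h b assume e1: "e1:E s [a] p x b1" and e2: "e2:E s as x p' b2" and h: "h:fhom (TTgt s) b (b1 @ b2)"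
  have id: "fid (TTgt s) (b1 @ b2):fhom (TTgt s) (b1 @ b2) (b1 @ b2)" by (rule s.FBI[OF hom_obj2[OF s.catFB h]])
  note p = s.E_D(2)[OF e1] s.E_D(3)[OF e2]
  note C1 = CP_mem(1)[OF CL e1] and C2 = CP_mem(1)[OF CP e2]
  have S: "Act s (a # as) p p' h (tcat s [a] as p x p' b1 b2 e1 e2) = tens_in (St s) (TTgt s) (tlet s a) (tlist s as) p p' b x b1 b2 e1 e2 h"
  using s.Act_tens[OF False e1 e2 id h] Cmp_idl[OF s.catFB h] by (simp add: s.tcat_letter[OF False] del: free_simps)
  have T': "Act t (a # as) (oK p) (oK p') h (tcat t [a] as (oK p) (oK x) (oK p') b1 b2 (app (cext ph [a] p x) b1 e1) (app (cext ph as x p') b2 e2)) =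
  tens_in (St t) (TTgt s) (tlet t a) (tlist t as) (oK p) (oK p') b (oK x) b1 b2 (app (cext ph [a] p x) b1 e1) (app (cext ph as x p') b2 e2) h"
  using t.Act_tens[OF False C1 C2, of "fid (TTgt s) (b1 @ b2)" "b1 @ b2" h b] id h Cmp_idl[OF s.catFB h] by (simp add: t.tcat_letter[OF False] del: free_simps)
  have "app (cext ph (a # as) p p') b (tens_in (St s) (TTgt s) (tlet s a) (tlist s as) p p' b x b1 b2 e1 e2 h) =
  tens_in (St t) (TTgt s) (tlet t a) (tlist t as) (oK p) (oK p') b (oK x) b1 b2 (app (Nc (CTh ph) (a, p, x)) b1 e1) (app (cext ph as x p') b2 e2) h"
  by (rule T(2)) (assumption | rule p h e1[folded E1] e2[folded E2])+
  then show "cext_eq a as p p' x b1 b2 e1 e2 h b"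
  unfolding S T' by simp
  qed
 qed
 then show "PROP ?Ga"
  and "e1:E s [a] p x b1 ==> e2:E s as x p' b2 ==> h:fhom (TTgt s) b (b1 @ b2) ==>
  cext_eq a as p p' x b1 b2 e1 e2 h b"
  by blast+
qed

declare cext.simps [simp del]

text \<open>Naturality in the letters involves the target of the arrow as well, another list of the
  same length; hence the induction on length.\<close>

lemma CP: "as:fob (TSrc s) ==> CP as"
proof (induction "length as" arbitrary: as)
 case 0
 then show ?case using CP_Nil by simp
next
 case (Suc n)
 then obtain a ar where r: "as = a # ar" "n = length ar" by (cases as) auto
 have o: "a:Obj (TSrc s)" "ar:fob (TSrc s)" using Suc.prems r by auto
 note CPa = Suc.hyps(1)[OF r(2) o(2)]
 show ?case
  unfolding CP_def r
 proof (intro conjI ballI allI impI)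
  fix p p' assume "p:Obj (St s)" "p':Obj (St s)"
  then show "cext ph (a # ar) p p':phom (TTgt s) (FO (lext s) (a # ar, p, p')) (FO (lext t) (a # ar, oK p, oK p'))"
  by (rule cext_Cons0(1)[OF o CPa])
 next
  fix als as' k l p p' p0 p1 b e
  assume *: "als:fhom (TSrc s) (a # ar) as'" "k:hom (St s) p0 p" "l:hom (St s) p' p1" "e:E s (a # ar) p p' b"
  obtain al alr a' ar' where al: "als = al # alr" "as' = a' # ar'" "al:hom (TSrc s) a a'" "alr:fhom (TSrc s) ar ar'"
  using fhom_Cons_left[OF *(1)] by auto
  have al': "[al]:fhom (TSrc s) [a] [a']" using al by simp
  have o': "a':Obj (TSrc s)" "ar':fob (TSrc s)" using hom_obj2[OF s.catA al(3)] hom_obj2[OF s.catFA al(4)] by auto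
  have CPa': "CP ar'" using fhom_length[OF al(4)] r(2) by (intro Suc.hyps(1) o') simp
  obtain x b1 b2 e1 e2 h where e1: "e1:E s [a] p x b1" and e2: "e2:E s ar x p' b2" and h: "h:fhom (TTgt s) b (b1 @ b2)"
  and eq: "e = Act s (a # ar) p p' h (tcat s [a] ar p x p' b1 b2 e1 e2)" by (rule s.cons_surj[OF *(4)])
  note ix = s.QI[OF s.E_D(3)[OF e1]]
  note C1 = CP_mem(1)[OF CP_letter[OF o(1)] e1] and C2 = CP_mem(1)[OF CPa e2]
  have 1: "X s als k l b e = Act s as' p0 p1 h (tcat s [a'] ar' p0 x p1 b1 b2 (X s [al] k (Idn (St s) x) b1 e1) (X s alr (Idn (St s) x) l b2 e2))"
  using s.X_Act[OF s.tcat_mem[OF e1 e2] _ *(2,3) h, of als as'] s.tcat_X[OF e1 e2 al' al(4) *(2,3)] *(1) by (simp add: eq al)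
  have T: "tcat t [a] ar (oK p) (oK x) (oK p') b1 b2 (app (cext ph [a] p x) b1 e1) (app (cext ph ar x p') b2 e2):E t (a # ar) (oK p) (oK p') (b1 @ b2)"
  using t.tcat_mem[OF C1 C2] by simp
  have 2: "X t als (mK k) (mK l) b (app (cext ph (a # ar) p p') b e) =
  Act t as' (oK p0) (oK p1) h (tcat t [a'] ar' (oK p0) (oK x) (oK p1) b1 b2 (X t [al] (mK k) (Idn (St t) (oK x)) b1 (app (cext ph [a] p x) b1 e1)) (X t alr (Idn (St t) (oK x)) (mK l) b2 (app (cext ph ar x p') b2 e2)))"
  using t.X_Act[OF T, of als as' "mK k" "oK p0" "mK l" "oK p1" h b] *(1) h mK_hom[OF *(2)] mK_hom[OF *(3)]
  t.tcat_X[OF C1 C2, of "[al]" "[a']" alr ar' "mK k" "oK p0" "mK l" "oK p1"] al' al(4) cext_Cons0(2)[OF o CPa e1 e2 h]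
  by (simp add: eq al)
  show "app (cext ph as' p0 p1) b (X s als k l b e) = X t als (mK k) (mK l) b (app (cext ph (a # ar) p p') b e)"
  unfolding 1 2 unfolding al(2) cext_Cons0(2)[OF o' CPa' s.X_mem[OF e1 al' *(2) ix] s.X_mem[OF e2 al(4) ix *(3)] h]
  using CP_D(2)[OF CP_letter[OF o(1)] al' *(2) ix e1] CP_D(2)[OF CPa al(4) ix *(3) e2] mK_id[OF s.E_D(3)[OF e1]] by simp
 qed
qed

lemma cext_mem: "e:E s as p p' b ==> app (cext ph as p p') b e:E t as (oK p) (oK p') b"
 using CP_mem(1)[OF CP[OF s.E_D(1)]] .

lemma cext_Act: "e:E s as p p' b ==> be:fhom (TTgt s) b' b ==>
  app (cext ph as p p') b' (Act s as p p' be e) = Act t as (oK p) (oK p') be (app (cext ph as p p') b e)"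
 using CP_mem(2)[OF CP[OF s.E_D(1)]] .

lemma cext_X: "al:fhom (TSrc s) as as' ==> k:hom (St s) p0 p ==> l:hom (St s) p' p1 ==> e:E s as p p' b ==>
  app (cext ph as' p0 p1) b (X s al k l b e) = X t al (mK k) (mK l) b (app (cext ph as p p') b e)"
 using CP_D(2)[OF CP[OF s.E_D(1)]] .

lemma cext_Cons: "e1:E s [a] p x b1 ==> e2:E s as x p' b2 ==> h:fhom (TTgt s) b (b1 @ b2) ==>
  cext_eq a as p p' x b1 b2 e1 e2 h b"
 using cext_Cons0(2)[OF _ _ CP] s.E_D(1)[of e1 "[a]" p x b1] s.E_D(1)[of e2 as x p' b2] by simp

text \<open>\<open>tcat_rec\<close> peels off a first letter in the source and in the target, and
  the empty case is naturality in the state. Multiplicativity of the unit and the counit over lists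
  rests on this.\<close>

lemma cext_tcat:
 "e1:E s as1 p x b1 ==> e2:E s as2 x p' b2 ==>
  app (cext ph (as1 @ as2) p p') (b1 @ b2) (tcat s as1 as2 p x p' b1 b2 e1 e2) =
  tcat t as1 as2 (oK p) (oK x) (oK p') b1 b2 (app (cext ph as1 p x) b1 e1) (app (cext ph as2 x p') b2 e2)"
proof (induction as1 arbitrary: p b1 e1)
 case Nil
 note e2 = Nil.prems(2)
 obtain m where m: "b1 = []" "e1 = en m" "m:hom (St s) p x" using Nil by (auto simp: s.E_Nil)
 note i = s.FAI[OF s.E_D(1)[OF e2]] s.QI[OF s.E_D(3)[OF e2]]
 show ?case
  using cext_X[OF i(1) m(3) i(2) e2] t.tcat_Nil[OF mK_hom[OF m(3)] cext_mem[OF e2]] mK_id[OF s.E_D(3)[OF e2]]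
  by (simp add: m s.tcat_Nil[OF m(3) e2] cext_Nil[OF m(3)])
next
 case (Cons a as)
 note e2 = Cons.prems(2)
 obtain y c1 c2 f1 f2 h where f1: "f1:E s [a] p y c1" and f2: "f2:E s as y x c2" and h: "h:fhom (TTgt s) b1 (c1 @ c2)"
  and eq: "e1 = Act s (a # as) p x h (tcat s [a] as p y x c1 c2 f1 f2)" by (rule s.cons_surj[OF Cons.prems(1)])
 have i2: "fid (TTgt s) b2:fhom (TTgt s) b2 b2" by (rule s.FBI[OF s.E_D(4)[OF e2]])
 have h2: "h @ fid (TTgt s) b2:fhom (TTgt s) (b1 @ b2) (c1 @ c2 @ b2)" using fhom_append[OF h i2] by simp
 show ?case
  using s.tcat_rec[OF f1 f2 h e2] cext_Cons[OF f1 s.tcat_mem[OF f2 e2] h2] Cons.IH[OF f2 e2] cext_Cons[OF f1 f2 h]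
  t.tcat_rec[OF cext_mem[OF f1] cext_mem[OF f2] _ cext_mem[OF e2], of h b1] h by (simp add: eq)
qed

end

section \<open>One-letter elements; vertical composition and inverses of 2-cells\<close>

context tdx
begin

lemma E_Tf: "a:Obj A ==> p:Obj Q ==> p':Obj Q ==> e:sel B (FO (Tf t) (a, p, p')) b \<longleftrightarrow> e:E t [a] p p' b"
 by (auto simp: E_iff pel_def tlet_simps)

lemma X_Tf: "al:hom A a a' ==> k:hom Q q0 q ==> l:hom Q q' q1 ==> app (FM (Tf t) (al, k, l)) b e = X t [al] k l b e"
 by (simp add: X_def lext_letter)

lemma Tf_psh: "a:Obj A ==> p:Obj Q ==> p':Obj Q ==> psh B (FO (Tf t) (a, p, p'))"
 using functor_obj[OF Tf, of "(a, p, p')"] by simp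

lemma Tf_phom: "al:hom A a a' ==> k:hom Q q0 q ==> l:hom Q q' q1 ==>
  FM (Tf t) (al, k, l):phom B (FO (Tf t) (a, q, q')) (FO (Tf t) (a', q0, q1))"
 using functor_hom[OF Tf, of "(al, k, l)" "(a, q, q')" "(a', q0, q1)"] by simp

end

text \<open>Triangles of 2-cells are evaluated on elements; naturality plays no role in this, so the
 components and the action on states are all that \<open>wcell\<close> retains.\<close>

definition wcell :: "'u::universe tdx => 'u tdx => 'u cell => bool" where
 "wcell s t ph \<longleftrightarrow> is_tdx s & is_tdx t & CSrc ph = s & CTgt ph = t & TSrc t = TSrc s & TTgt t = TTgt s &
  (ALL p:Obj (St s). FO (CK ph) p:Obj (St t)) &
  (ALL a:Obj (TSrc s). ALL p:Obj (St s). ALL p':Obj (St s).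
  Nc (CTh ph) (a, p, p'):phom (TTgt s) (FO (Tf s) (a, p, p')) (FO (Tf t) (a, FO (CK ph) p, FO (CK ph) p')))"

lemma wcellD:
 assumes "wcell s t ph"
 shows "is_tdx s" "is_tdx t" "CSrc ph = s" "CTgt ph = t" "TSrc t = TSrc s" "TTgt t = TTgt s"
  "p:Obj (St s) ==> FO (CK ph) p:Obj (St t)"
  "a:Obj (TSrc s) ==> p:Obj (St s) ==> p':Obj (St s) ==>
  Nc (CTh ph) (a, p, p'):phom (TTgt s) (FO (Tf s) (a, p, p')) (FO (Tf t) (a, FO (CK ph) p, FO (CK ph) p'))"
 using assms unfolding wcell_def by blast+

lemma wcell_app:
 assumes "wcell s t ph" "e:E s [a] p p' b"
 shows "app (Nc (CTh ph) (a, p, p')) b e:E t [a] (FO (CK ph) p) (FO (CK ph) p') b"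
proof -
 note w = wcellD[OF assms(1)]
 interpret s: tdx s by unfold_locales (rule w)
 interpret t: tdx t by unfold_locales (rule w)
 note o = s.E_D[OF assms(2)]
 have a: "a:Obj (TSrc s)" using o by simp
 show ?thesis
  using app_mem[OF s.catB w(8)[OF a o(2,3)], of e b] s.E_Tf[OF a o(2,3)] assms(2) t.E_Tf[OF _ w(7)[OF o(2)] w(7)[OF o(3)]] a w(5,6) by simp
qed

lemma (in cell) wcell: "wcell s t ph"
 unfolding wcell_def using s.tdx t.tdx oK_obj Nc_phom by simp

lemma wcell_mk:
 assumes "is_tdx s" "is_tdx t" "TSrc t = TSrc s" "TTgt t = TTgt s" "!!p. p:Obj (St s) ==> oK p:Obj (St t)"
  "!!a p p'. a:Obj (TSrc s) ==> p:Obj (St s) ==> p':Obj (St s) ==>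
  th a p p':phom (TTgt s) (FO (Tf s) (a, p, p')) (FO (Tf t) (a, oK p, oK p'))"
 shows "wcell s t (mk_cell s t oK mK th)"
 unfolding wcell_def using assms by simp

lemma vcomp_states:
 "CSrc ph = s ==> p:Obj (St s) ==> FO (CK (cell_vcomp ps ph)) p = FO (CK ps) (FO (CK ph) p)"
 "CSrc ph = s ==> k:Mor (St s) ==> FM (CK (cell_vcomp ps ph)) k = FM (CK ps) (FM (CK ph) k)"
 by (simp_all add: cell_vcomp_def)

lemma vcomp:
 assumes ph: "wcell s t ph" and ps: "wcell t u ps"
 shows "wcell s u (cell_vcomp ps ph)" (is "PROP ?Ga")
  and "e:E s [a] p p' b ==> app (Nc (CTh (cell_vcomp ps ph)) (a, p, p')) b e =
  app (Nc (CTh ps) (a, FO (CK ph) p, FO (CK ph) p')) b (app (Nc (CTh ph) (a, p, p')) b e)"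
proof -
 note w = wcellD[OF ph] and w' = wcellD[OF ps]
 interpret s: tdx s by unfold_locales (rule w)
 have eq: "CTgt ps = u" by (rule w')
 have P: "Nc (CTh ps) (a, FO (CK ph) p, FO (CK ph) p'):phom (TTgt s) (FO (Tf t) (a, FO (CK ph) p, FO (CK ph) p')) (FO (Tf u) (a, FO (CK ps) (FO (CK ph) p), FO (CK ps) (FO (CK ph) p')))"
  if "a:Obj (TSrc s)" "p:Obj (St s)" "p':Obj (St s)" for a p p'
  using w'(8)[of a "FO (CK ph) p" "FO (CK ph) p'"] that w(5-7) by simp
 show "PROP ?Ga"
  unfolding cell_vcomp_def w(3) eq
  by (rule wcell_mk) (use w w' phom_cmp[OF s.catB w(8) P] in simp_all)
 assume e: "e:E s [a] p p' b"
 note o = s.E_D[OF e]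
 have a: "a:Obj (TSrc s)" using o by simp
 have e': "e:sel (TTgt s) (FO (Tf s) (a, p, p')) b" using s.E_Tf[OF a o(2,3)] e by simp
 show "app (Nc (CTh (cell_vcomp ps ph)) (a, p, p')) b e =
  app (Nc (CTh ps) (a, FO (CK ph) p, FO (CK ph) p')) b (app (Nc (CTh ph) (a, p, p')) b e)"
  using app_cmp[OF s.catB w(8)[OF a o(2,3)] P[OF a o(2,3)] e'] a o w(3) by (simp add: cell_vcomp_def)
qed

lemma cellI: "is_cell s t ph ==> is_tdx s ==> is_tdx t ==> cell s t ph"
 by unfold_locales

text \<open>Naturality of composites serves the inversion of the associator, where composites must
  be compared with identity 2-cells as records.\<close>

lemma vcomp_cell:
 assumes "cell s t ph" "cell t u ps"
 shows "is_cell s u (cell_vcomp ps ph)"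
proof -
 interpret ph: cell s t ph by (rule assms)
 interpret ps: cell t u ps by (rule assms)
 note w = wcellD(7,8)[OF vcomp(1)[OF ph.wcell ps.wcell]]
 show ?thesis
  unfolding cell_vcomp_def ph.cell_simps(1) ps.cell_simps(2)
 proof (rule mk_cellI)
  show "is_functor (St s) (St u) (mk_func (St s) (%p. ps.oK (ph.oK p)) (%k. ps.mK (ph.mK k)))"
  by (rule functorI) (auto simp: ph.s.catQ ph.oK_obj ps.oK_obj ph.mK_hom ps.mK_hom ph.mK_id ps.mK_id ph.mK_cmp intro: ps.mK_cmp[OF ph.mK_hom ph.mK_hom])
 next
  fix a p p' assume "a:Obj (TSrc s)" "p:Obj (St s)" "p':Obj (St s)"
  then show "Cmp (psh_cat (TTgt s)) (Nc (CTh ps) (a, ph.oK p, ph.oK p')) (Nc (CTh ph) (a, p, p')):phom (TTgt s) (FO (Tf s) (a, p, p')) (FO (Tf u) (a, ps.oK (ph.oK p), ps.oK (ph.oK p')))"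
  using w(2)[of a p p'] vcomp_states(1)[of ph s p ps] vcomp_states(1)[of ph s p' ps] by (simp add: cell_vcomp_def)
 next
  fix a a' p p' p0 p1 al k l b e
  assume al: "al:hom (TSrc s) a a'" and kl: "k:hom (St s) p0 p" "l:hom (St s) p' p1"
  and e0: "e:sel (TTgt s) (FO (Tf s) (a, p, p')) b"
  note o = hom_obj1[OF ph.s.catA al] hom_obj2[OF ph.s.catQ kl(1)] hom_obj1[OF ph.s.catQ kl(2)]
  note o' = hom_obj2[OF ph.s.catA al] hom_obj1[OF ph.s.catQ kl(1)] hom_obj2[OF ph.s.catQ kl(2)]
  have e: "e:E s [a] p p' b" using ph.s.E_Tf[OF o] e0 by simp
  have al': "[al]:fhom (TSrc s) [a] [a']" using al by simp
  have 1: "app (Cmp (psh_cat (TTgt s)) (Nc (CTh ps) (a, ph.oK p, ph.oK p')) (Nc (CTh ph) (a, p, p'))) b e =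
  app (Nc (CTh ps) (a, ph.oK p, ph.oK p')) b (app (Nc (CTh ph) (a, p, p')) b e)" if "e:E s [a] p p' b" for a p p' e
  using vcomp(2)[OF ph.wcell ps.wcell that] ph.s.E_D(1-3)[OF that] by (simp add: cell_vcomp_def)
  note X = ph.s.X_mem[OF e al' kl]
  note m = wcell_app[OF ph.wcell e]
  show "app (Cmp (psh_cat (TTgt s)) (Nc (CTh ps) (a', ph.oK p0, ph.oK p1)) (Nc (CTh ph) (a', p0, p1))) b (app (FM (Tf s) (al, k, l)) b e) =
  app (FM (Tf u) (al, ps.mK (ph.mK k), ps.mK (ph.mK l))) b (app (Cmp (psh_cat (TTgt s)) (Nc (CTh ps) (a, ph.oK p, ph.oK p')) (Nc (CTh ph) (a, p, p'))) b e)"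
  unfolding 1[OF e] ph.s.X_Tf[OF al kl] 1[OF X] ph.Nc_nat[OF al kl e]
  using ps.Nc_nat[OF _ ph.mK_hom[OF kl(1)] ph.mK_hom[OF kl(2)] m] ps.t.X_Tf[OF _ ps.mK_hom[OF ph.mK_hom[OF kl(1)]] ps.mK_hom[OF ph.mK_hom[OF kl(2)]]] al
  by simp
 qed (simp_all add: ph.s.tdx ps.t.tdx)
qed

lemma cell_eqI:
 assumes "cell s t ph" "cell s t ps"
  and "!!p. p:Obj (St s) ==> FO (CK ph) p = FO (CK ps) p" "!!k. k:Mor (St s) ==> FM (CK ph) k = FM (CK ps) k"
  and eq: "!!a p p' b e. e:E s [a] p p' b ==> app (Nc (CTh ph) (a, p, p')) b e = app (Nc (CTh ps) (a, p, p')) b e"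
 shows "ph = ps"
proof -
 interpret ph: cell s t ph by (rule assms)
 interpret ps: cell s t ps by (rule assms)
 have K: "CK ph = CK ps" by (rule functor_eqI[OF ph.K ps.K]) (simp_all add: assms(3,4))
 have N: "is_ntrans (D3 s) (psh_cat (TTgt s)) (CTh ph)" "NSrc (CTh ph) = Tf s" "NTgt (CTh ph) = pull s t (CK ph)"
  "is_ntrans (D3 s) (psh_cat (TTgt s)) (CTh ps)" "NSrc (CTh ps) = Tf s" "NTgt (CTh ps) = pull s t (CK ps)"
  using ph.cell ps.cell by (auto simp: is_cell_def)
 have "CTh ph = CTh ps"
 proof (rule ntrans_eqI[OF N(1,4)])
  fix x assume "x:Obj (D3 s)"
  then obtain a p p' where x: "x = (a, p, p')" "a:Obj (TSrc s)" "p:Obj (St s)" "p':Obj (St s)" by (cases x) auto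
  show "Nc (CTh ph) x = Nc (CTh ps) x"
  unfolding x(1) by (rule phom_eqI[OF ph.s.catB ph.Nc_phom[OF x(2-4)] ps.Nc_phom[OF x(2-4), folded K]])
  (use eq ph.s.E_Tf[OF x(2-4)] in blast)
 qed (simp_all add: N K)
 then show ?thesis
  by (intro cell.equality) (simp_all add: K)
qed

lemma cell_id:
 assumes t: "is_tdx t"
 shows "is_cell t t (cell_id t)"
  and "e:E t [a] p p' b ==> app (Nc (CTh (cell_id t)) (a, p, p')) b e = e" (is "PROP ?Gb")
  and "p:Obj (St t) ==> FO (CK (cell_id t)) p = p"
  and "k:Mor (St t) ==> FM (CK (cell_id t)) k = k"
proof -
 interpret t: tdx t by unfold_locales (rule t)
 show "is_cell t t (cell_id t)"
  unfolding cell_id_def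
 proof (rule mk_cellI[OF t t refl refl])
  show "is_functor (St t) (St t) (mk_func (St t) (%q. q) (%k. k))" by (rule functorI) (auto simp: t.catQ)
 next
  fix a a' p p' p0 p1 al k l b e
  assume *: "al:hom (TSrc t) a a'" "k:hom (St t) p0 p" "l:hom (St t) p' p1" "e:sel (TTgt t) (FO (Tf t) (a, p, p')) b"
  show "app (Idn (psh_cat (TTgt t)) (FO (Tf t) (a', p0, p1))) b (app (FM (Tf t) (al, k, l)) b e) =
  app (FM (Tf t) (al, k, l)) b (app (Idn (psh_cat (TTgt t)) (FO (Tf t) (a, p, p'))) b e)"
  using app_id[OF *(4)] app_id[OF app_mem[OF t.catB t.Tf_phom[OF *(1-3)] *(4)]] by simp
 qed (simp add: phom_id[OF t.catB] t.Tf_psh)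
 show "PROP ?Gb"
  using app_id[of e "TTgt t" "FO (Tf t) (a, p, p')" b] t.E_Tf[of a p p' e b] t.E_D[of e "[a]" p p' b] by (simp add: cell_id_def)
qed (simp_all add: cell_id_def)

lemma cext_cell_id:
 assumes t: "is_tdx t" and "e:E t as p p' b"
 shows "app (cext (cell_id t) as p p') b e = e"
proof -
 interpret i: cell t t "cell_id t" by (rule cellI[OF cell_id(1)[OF t] t t])
 show ?thesis
  using assms(2)
 proof (induction as arbitrary: p b e)
  case Nil
  then obtain m where "b = []" "e = en m" "m:hom (St t) p p'" by (auto simp: i.s.E_Nil)
  then show ?case using i.cext_Nil[of m p p'] cell_id(4)[OF t hom_Mor] by simp
 next
  case (Cons a as)
  obtain x b1 b2 e1 e2 h where e1: "e1:E t [a] p x b1" and e2: "e2:E t as x p' b2" and h: "h:fhom (TTgt t) b (b1 @ b2)"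
  and eq: "e = Act t (a # as) p p' h (tcat t [a] as p x p' b1 b2 e1 e2)" by (rule i.s.cons_surj[OF Cons.prems])
  show ?case
  using i.cext_Cons[OF e1 e2 h] Cons.IH[OF e2] cell_id(2)[OF t e1] cell_id(3)[OF t] i.s.E_D(2,3)[OF e1] i.s.E_D(3)[OF e2] by (simp add: eq cext.simps(2))
 qed
qed

text \<open>\<open>inverse_2cell\<close> is a definite description, so uniqueness among genuine
  2-cells has to be shown. A left inverse of \<open>al\<close> agrees with \<open>be\<close>, since
  every state, state arrow and element on the side of \<open>t\<close> is the image under
  \<open>al\<close> of its image under \<open>be\<close>.\<close>

lemma inverse_2cell_eqI:
 assumes "cell s t al" "cell t s be"
  and K: "!!p. p:Obj (St s) ==> FO (CK be) (FO (CK al) p) = p" "!!k. k:Mor (St s) ==> FM (CK be) (FM (CK al) k) = k"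
  "!!p. p:Obj (St t) ==> FO (CK al) (FO (CK be) p) = p" "!!k. k:Mor (St t) ==> FM (CK al) (FM (CK be) k) = k"
  and l: "!!a p p' b e. e:E s [a] p p' b ==>
  app (Nc (CTh be) (a, FO (CK al) p, FO (CK al) p')) b (app (Nc (CTh al) (a, p, p')) b e) = e"
  and r: "!!a p p' b e. e:E t [a] p p' b ==>
  app (Nc (CTh al) (a, FO (CK be) p, FO (CK be) p')) b (app (Nc (CTh be) (a, p, p')) b e) = e"
 shows "inverse_2cell TDX s t al = be"
proof -
 interpret al: cell s t al by (rule assms)
 interpret be: cell t s be by (rule assms)
 have id: "cell s s (cell_id s)" "cell t t (cell_id t)" by (auto intro!: cellI cell_id al.s.tdx al.t.tdx)
 have vc: "cell s s (cell_vcomp be al)" "cell t t (cell_vcomp al be)"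
  by (intro cellI vcomp_cell[OF assms(1,2)] vcomp_cell[OF assms(2,1)] al.s.tdx al.t.tdx)+
 note v = vcomp(2)[OF al.wcell be.wcell] vcomp(2)[OF be.wcell al.wcell]
 note vs = vcomp_states[of al s] vcomp_states[of be t]
 have 1: "cell_vcomp be al = cell_id s"
  by (rule cell_eqI[OF vc(1) id(1)]) (simp_all add: vs K v l cell_id[OF al.s.tdx])
 have 2: "cell_vcomp al be = cell_id t"
  by (rule cell_eqI[OF vc(2) id(2)]) (simp_all add: vs K v r cell_id[OF al.t.tdx])
 have "ps = be" if ps0: "is_cell t s ps" and eq: "cell_vcomp ps al = cell_id s" for ps
 proof -
  interpret ps: cell t s ps by (rule cellI[OF ps0 al.t.tdx al.s.tdx])
  have o: "FO (CK ps) (FO (CK al) p) = p" if "p:Obj (St s)" for p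
  using vs(1)[OF al.cell_simps(1) that, of ps] cell_id(3)[OF al.s.tdx that] eq by simp
  have m: "FM (CK ps) (FM (CK al) k) = k" if "k:Mor (St s)" for k
  using vs(2)[OF al.cell_simps(1) that, of ps] cell_id(4)[OF al.s.tdx that] eq by simp
  have o': "FO (CK ps) p = FO (CK be) p" if "p:Obj (St t)" for p
  using o[OF be.oK_obj[OF that]] K(3)[OF that] by simp
  show ?thesis
  proof (rule cell_eqI[OF ps.cell_axioms be.cell_axioms])
  fix k assume k: "k:Mor (St t)"
  show "FM (CK ps) k = FM (CK be) k"
  using m[OF hom_Mor(1)[OF be.mK_hom[OF Mor_hom[OF k]]]] K(4)[OF k] by simp
  next
  fix a p p' b e assume e: "e:E t [a] p p' b"
  note o = al.t.E_D[OF e]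
  note m = wcell_app[OF be.wcell e]
  have "app (Nc (CTh ps) (a, p, p')) b (app (Nc (CTh al) (a, FO (CK be) p, FO (CK be) p')) b (app (Nc (CTh be) (a, p, p')) b e)) = app (Nc (CTh be) (a, p, p')) b e"
  using vcomp(2)[OF al.wcell ps.wcell m] cell_id(2)[OF al.s.tdx m] K(3)[OF o(2)] K(3)[OF o(3)] eq by simp
  then show "app (Nc (CTh ps) (a, p, p')) b e = app (Nc (CTh be) (a, p, p')) b e"
  unfolding r[OF e] .
  qed (rule o')
 qed
 then show ?thesis
  unfolding inverse_2cell_def TDX_def bicat.simps mem_Collect_eq using 1 2 be.cell by (intro the_equality) blast+
qed

section \<open>Horizontal composition of 2-cells\<close>

lemma hcomp_states:
 assumes "CSrc ps = u" "CSrc ph = (s :: 'u::universe tdx)"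
 shows "q:Obj (St s) ==> p:Obj (St u) ==> FO (CK (cell_hcomp ps ph)) (enc (q, p)) = enc (FO (CK ph) q, FO (CK ps) p)"
  and "k:Mor (St s) ==> l:Mor (St u) ==> FM (CK (cell_hcomp ps ph)) (enc (k, l)) = enc (FM (CK ph) k, FM (CK ps) l)"
 using assms by (simp_all add: cell_hcomp_def tdx_comp_def)

text \<open>The first factor \<open>ph\<close> enters through its components alone. The second
  factor \<open>ps\<close> acts through its extension to lists, whose naturality makes the map on
  coends well defined; therefore it is a full 2-cell while \<open>ph\<close> is a
  \<open>wcell\<close>.\<close>

lemma hcomp:
 assumes "tdx2 s u" "tdx2 s' u'" and ph: "wcell s s' ph" and ps: "cell u u' ps"
 shows "wcell (tdx_comp u s) (tdx_comp u' s') (cell_hcomp ps ph)" (is "PROP ?Ga")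
  and "v:E s [a] q q' c ==> e:E u c p p' d ==>
  app (Nc (CTh (cell_hcomp ps ph)) (a, enc (q, p), enc (q', p'))) d (lift_in u (FO (Tf s) (a, q, q')) p p' d c v e) =
  lift_in u' (FO (Tf s') (a, FO (CK ph) q, FO (CK ph) q')) (FO (CK ps) p) (FO (CK ps) p') d c
  (app (Nc (CTh ph) (a, q, q')) c v) (app (cext ps c p p') d e)"
proof -
 interpret s: tdx2 s u by (rule assms)
 interpret s': tdx2 s' u' by (rule assms)
 interpret ps: cell u u' ps by (rule ps)
 note w = wcellD[OF ph]
 let ?L = "%a q p q' p'. lift_map u (FO (Tf s) (a, q, q')) p p' u' (FO (Tf s') (a, FO (CK ph) q, FO (CK ph) q')) (ps.oK p) (ps.oK p') (Nc (CTh ph) (a, q, q')) (%b. cext ps b p p')"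
 have L: "?L a q p q' p':phom (TTgt u) (lift_ob u (FO (Tf s) (a, q, q')) p p') (lift_ob u' (FO (Tf s') (a, FO (CK ph) q, FO (CK ph) q')) (ps.oK p) (ps.oK p')) &
  (ALL v e c d. v:sel (TTgt s) (FO (Tf s) (a, q, q')) c --> e:E u c p p' d -->
  app (?L a q p q' p') d (lift_in u (FO (Tf s) (a, q, q')) p p' d c v e) = lift_in u' (FO (Tf s') (a, FO (CK ph) q, FO (CK ph) q')) (ps.oK p) (ps.oK p') d c
  (app (Nc (CTh ph) (a, q, q')) c v) (app (cext ps c p p') d e))"
  if o: "a:Obj (TSrc s)" "q:Obj (St s)" "q':Obj (St s)" "p:Obj (St u)" "p':Obj (St u)" for a q q' p p'
 proof -
  have mu: "Nc (CTh ph) (a, q, q'):phom (TSrc u) (FO (Tf s) (a, q, q')) (FO (Tf s') (a, FO (CK ph) q, FO (CK ph) q'))"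
  using w(8)[OF o(1-3)] s.src_u by simp
  note nat = ps.cext_X[OF _ s.u.QI[OF o(4)] s.u.QI[OF o(5)], unfolded ps.mK_id[OF o(4)] ps.mK_id[OF o(5)]]
  note L = lift_map[where t = u and t' = u' and ph = "%b. cext ps b p p'", OF s.u.tdx s'.u.tdx ps.cell_simps(3,4) o(4,5) ps.oK_obj[OF o(4)] ps.oK_obj[OF o(5)]
  mu ps.cext_mem ps.cext_Act nat]
  show ?thesis by (intro conjI allI impI L(1) L(2)) (simp_all add: s.src_u)
 qed
 have def: "cell_hcomp ps ph = mk_cell (tdx_comp u s) (tdx_comp u' s')
  (%z. let (q :: 'a, p :: 'a) = dec z in enc (FO (CK ph) q, ps.oK p))
  (%m. let (k :: 'a, l :: 'a) = dec m in enc (FM (CK ph) k, ps.mK l))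
  (%a z z'. let (q, p) = dec z; (q', p') = dec z' in
  ?L a q p q' p')"
  by (simp add: cell_hcomp_def w(3,4))
 show "PROP ?Ga"
  unfolding def
 proof (rule wcell_mk[OF s.comp_tdx s'.comp_tdx])
  fix p assume "p:Obj (St (tdx_comp u s))"
  then show "(let (q :: 'a, p :: 'a) = dec p in enc (FO (CK ph) q, ps.oK p)):Obj (St (tdx_comp u' s'))"
  using w(7) ps.oK_obj by (auto elim!: states_objE)
 next
  fix a z z' assume a: "a:Obj (TSrc (tdx_comp u s))" "z:Obj (St (tdx_comp u s))" "z':Obj (St (tdx_comp u s))"
  obtain q p q' p' where z: "z = enc (q, p)" "z' = enc (q', p')" "q:Obj (St s)" "p:Obj (St u)" "q':Obj (St s)" "p':Obj (St u)"
  using a by (auto elim!: states_objE)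
  have a': "a:Obj (TSrc s)" using a by simp
  show "(let (q, p) = dec z; (q', p') = dec z' in
  ?L a q p q' p'):phom (TTgt (tdx_comp u s)) (FO (Tf (tdx_comp u s)) (a, z, z'))
  (FO (Tf (tdx_comp u' s')) (a, let (q :: 'a, p :: 'a) = dec z in enc (FO (CK ph) q, ps.oK p), let (q :: 'a, p :: 'a) = dec z' in enc (FO (CK ph) q, ps.oK p)))"
  using L[OF a' z(3,5,4,6)] s.comp_FO[OF a' z(3,5,4,6)] s'.comp_FO[OF _ w(7)[OF z(3)] w(7)[OF z(5)] ps.oK_obj[OF z(4)] ps.oK_obj[OF z(6)], of a] a' w(5) z
  by simp
 qed (simp_all add: w)
 assume v: "v:E s [a] q q' c" and e: "e:E u c p p' d"
 note o = s.t.E_D[OF v] s.u.E_D[OF e]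
 have a: "a:Obj (TSrc s)" using o by simp
 show "app (Nc (CTh (cell_hcomp ps ph)) (a, enc (q, p), enc (q', p'))) d (lift_in u (FO (Tf s) (a, q, q')) p p' d c v e) =
  lift_in u' (FO (Tf s') (a, FO (CK ph) q, FO (CK ph) q')) (ps.oK p) (ps.oK p') d c (app (Nc (CTh ph) (a, q, q')) c v) (app (cext ps c p p') d e)"
  using L[OF a o(2,3,7,8)] e s.t.E_Tf[OF a o(2,3)] v a o unfolding def by simp
qed

section \<open>The associator and its inverse\<close>

locale tdx3 = tdx2 t u + s: tdx s for s t u :: "'u::universe tdx" +
 assumes src_t: "TSrc t = TTgt s"
begin

sublocale st: tdx2 s t by unfold_locales (rule src_t)

lemma tdx2_left: "tdx2 s ut"
 by unfold_locales (simp add: src_t)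

lemma tdx2_right: "tdx2 (tdx_comp t s) u"
 by unfold_locales (simp add: src_u)

abbreviation "pD == psh_cat cD"
abbreviation "V a q q' == FO (Tf s) (a, q, q')"
abbreviation "eR q p r == enc (q, enc (p, r) :: 'u) :: 'u"
abbreviation "eL q p r == enc (enc (q, p) :: 'u, r) :: 'u"
abbreviation "uts1 == tdx_comp ut s"
abbreviation "uts2 == tdx_comp u (tdx_comp t s)"

lemma uts_simps [simp]:
 "TSrc uts1 = TSrc s" "TTgt uts1 = TTgt u" "St uts1 = states_prod (St s) (states_prod (St t) (St u))"
 "TSrc uts2 = TSrc s" "TTgt uts2 = TTgt u" "St uts2 = states_prod (states_prod (St s) (St t)) (St u)"
 by (simp_all add: tdx_comp_def)

abbreviation (input) "sL == (%z. let (q :: 'u, y :: 'u) = dec z; (p :: 'u, r :: 'u) = dec y in eL q p r :: 'u)"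
abbreviation (input) "sR == (%z. let (y :: 'u, r :: 'u) = dec z; (q :: 'u, p :: 'u) = dec y in eR q p r :: 'u)"

text \<open>Its components are inverses of those of the associator, available because
  \<open>lift_comp_map\<close> is bijective; on states the brackets are moved the other way.\<close>

definition assoc_inv :: "'u cell" where
 "assoc_inv = mk_cell uts2 uts1
  sR
  sR
  (%a z z'. let (y :: 'u, r :: 'u) = dec z; (q :: 'u, p :: 'u) = dec y; (y' :: 'u, r' :: 'u) = dec z'; (q' :: 'u, p' :: 'u) = dec y' in
  inverse_mor (psh_cat (TTgt u)) (lift_comp_map u t (V a q q') p r p' r'))"

lemma uts1_FO:
 assumes "a:Obj (TSrc s)" "q:Obj (St s)" "q':Obj (St s)" "p:Obj P" "p':Obj P" "r:Obj R" "r':Obj R"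
 shows "FO (Tf uts1) (a, eR q p r, eR q' p' r') = lift_ob ut (V a q q') (enc (p, r)) (enc (p', r'))"
 by (rule tdx2.comp_FO[OF tdx2_left]) (use assms in simp_all)

lemma uts2_FO:
 assumes "a:Obj (TSrc s)" "q:Obj (St s)" "q':Obj (St s)" "p:Obj P" "p':Obj P" "r:Obj R" "r':Obj R"
 shows "FO (Tf uts2) (a, eL q p r, eL q' p' r') = lift_ob u (lift_ob t (V a q q') p p') r r'"
 using tdx2.comp_FO[OF tdx2_right, of a "enc (q, p)" "enc (q', p')" r r'] st.comp_FO[of a q q' p p'] assms by simp

lemma uts1_FM:
 assumes "al:hom (TSrc s) a a'" "k:hom (St s) q0 q" "k':hom (St s) q' q1" "l:hom P p0 p" "l':hom P p' p1" "j:hom R r0 r" "j':hom R r' r1"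
 shows "FM (Tf uts1) (al, eR k l j, eR k' l' j') = FM (lift ut) (FM (Tf s) (al, k, k'), enc (l, j), enc (l', j'))"
 by (rule tdx2.comp_FM[OF tdx2_left]) (use assms[THEN hom_Mor(1)] in simp_all)

lemma uts2_FM:
 assumes "al:hom (TSrc s) a a'" "k:hom (St s) q0 q" "k':hom (St s) q' q1" "l:hom P p0 p" "l':hom P p' p1" "j:hom R r0 r" "j':hom R r' r1"
 shows "FM (Tf uts2) (al, eL k l j, eL k' l' j') = FM (lift u) (FM (lift t) (FM (Tf s) (al, k, k'), l, l'), j, j')"
 using tdx2.comp_FM[OF tdx2_right, of al "enc (k, l)" "enc (k', l')" j j'] st.comp_FM[of al k k' l l'] assms[THEN hom_Mor(1)] by simp

lemma Tf_src:
 "a:Obj (TSrc s) ==> q:Obj (St s) ==> q':Obj (St s) ==> psh cB (V a q q')"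
 using s.Tf_psh src_t by simp

lemma uts1_obj_E:
 assumes "z:Obj (St uts1)"
 obtains q p r where "z = eR q p r" "q:Obj (St s)" "p:Obj P" "r:Obj R"
 using assms by (auto elim!: states_objE)

lemma uts2_obj_E:
 assumes "z:Obj (St uts2)"
 obtains q p r where "z = eL q p r" "q:Obj (St s)" "p:Obj P" "r:Obj R"
 using assms by (auto elim!: states_objE)

lemma uts1_hom_E:
 assumes "m:hom (St uts1) z z'"
 obtains k l j q p r q' p' r' where "m = eR k l j" "z = eR q p r" "z' = eR q' p' r'"
  "k:hom (St s) q q'" "l:hom P p p'" "j:hom R r r'"
 using assms by (auto elim!: states_homE)

lemma uts2_hom_E:
 assumes "m:hom (St uts2) z z'"
 obtains k l j q p r q' p' r' where "m = eL k l j" "z = eL q p r" "z' = eL q' p' r'"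
  "k:hom (St s) q q'" "l:hom P p p'" "j:hom R r r'"
 using assms by (auto elim!: states_homE)

lemma uts1_tdx: "is_tdx uts1" and uts2_tdx: "is_tdx uts2"
 by (rule tdx2.comp_tdx[OF tdx2_left]) (rule tdx2.comp_tdx[OF tdx2_right])

lemma uts_cat: "category (St uts1)" "category (St uts2)"
 using uts1_tdx uts2_tdx by (auto simp: is_tdx_def sl)

lemma assoc_nat:
 assumes al: "al:hom (TSrc s) a a'" and kl: "k:hom (St s) q0 q" "k':hom (St s) q' q1" "l:hom P p0 p" "l':hom P p' p1" "j:hom R r0 r" "j':hom R r' r1"
  and e: "e:sel cD (lift_ob ut (V a q q') (enc (p, r)) (enc (p', r'))) d"
 shows "app (lift_comp_map u t (V a' q0 q1) p0 r0 p1 r1) d (app (FM (Tf uts1) (al, eR k l j, eR k' l' j')) d e) =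
  app (FM (Tf uts2) (al, eL k l j, eL k' l' j')) d (app (lift_comp_map u t (V a q q') p r p' r') d e)"
 unfolding uts1_FM[OF al kl] uts2_FM[OF al kl]
 by (rule lcm_nat[OF s.Tf_phom[OF al kl(1,2), folded src_t] kl(3-6) e])

lemma assoc_cell: "is_cell uts1 uts2 (associator u t s)"
 unfolding associator_def
proof (rule mk_cellI[OF uts1_tdx uts2_tdx])
 show "is_functor (St uts1) (St uts2) (mk_func (St uts1)
  sL
  sL)"
  by (rule functorI[OF uts_cat(1)]) (auto elim!: states_objE states_homE)
next
 fix a z z' assume a: "a:Obj (TSrc uts1)" and z: "z:Obj (St uts1)" "z':Obj (St uts1)"
 obtain q p r where 1: "z = eR q p r" "q:Obj (St s)" "p:Obj P" "r:Obj R" by (rule uts1_obj_E[OF z(1)])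
 obtain q' p' r' where 2: "z' = eR q' p' r'" "q':Obj (St s)" "p':Obj P" "r':Obj R" by (rule uts1_obj_E[OF z(2)])
 have a': "a:Obj (TSrc s)" using a by simp
 show "(let (q :: 'u, y :: 'u) = dec z; (p, r) = dec y; (q' :: 'u, y' :: 'u) = dec z'; (p', r') = dec y' in
  lift_comp_map u t (V a q q') p r p' r'):phom (TTgt uts1) (FO (Tf uts1) (a, z, z')) (FO (Tf uts2) (a,
  sL z,
  sL z'))"
  using lcm_phom[OF Tf_src[OF a' 1(2) 2(2)] 1(3) 2(3) 1(4) 2(4)] uts1_FO[OF a' 1(2) 2(2) 1(3) 2(3) 1(4) 2(4)] uts2_FO[OF a' 1(2) 2(2) 1(3) 2(3) 1(4) 2(4)]
  by (simp add: 1(1) 2(1))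
next
 fix a a' z z' z0 z1 al m m' d e
 assume al: "al:hom (TSrc uts1) a a'" and m: "m:hom (St uts1) z0 z" "m':hom (St uts1) z' z1" and e: "e:sel (TTgt uts1) (FO (Tf uts1) (a, z, z')) d"
 obtain k l j q0 p0 r0 q p r where 1: "m = eR k l j" "z0 = eR q0 p0 r0" "z = eR q p r"
  "k:hom (St s) q0 q" "l:hom P p0 p" "j:hom R r0 r" by (rule uts1_hom_E[OF m(1)])
 obtain k' l' j' q' p' r' q1 p1 r1 where 2: "m' = eR k' l' j'" "z' = eR q' p' r'" "z1 = eR q1 p1 r1"
  "k':hom (St s) q' q1" "l':hom P p' p1" "j':hom R r' r1" by (rule uts1_hom_E[OF m(2)])
 have al': "al:hom (TSrc s) a a'" using al by simp
 note o = hom_obj1[OF s.catA al'] hom_obj2[OF s.catQ 1(4)] hom_obj1[OF s.catQ 2(4)] hom_obj2[OF t.catQ 1(5)] hom_obj1[OF t.catQ 2(5)] hom_obj2[OF u.catQ 1(6)] hom_obj1[OF u.catQ 2(6)]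
 have e': "e:sel cD (lift_ob ut (V a q q') (enc (p, r)) (enc (p', r'))) d"
  using e uts1_FO[OF o] by (simp add: 1(3) 2(2))
 show "app (let (q :: 'u, y :: 'u) = dec z0; (p, r) = dec y; (q' :: 'u, y' :: 'u) = dec z1; (p', r') = dec y' in
  lift_comp_map u t (FO (Tf s) (a', q, q')) p r p' r') d (app (FM (Tf uts1) (al, m, m')) d e) =
  app (FM (Tf uts2) (al, sL m,
  sL m')) d
  (app (let (q :: 'u, y :: 'u) = dec z; (p, r) = dec y; (q' :: 'u, y' :: 'u) = dec z'; (p', r') = dec y' in
  lift_comp_map u t (V a q q') p r p' r') d e)"
  using assoc_nat[OF al' 1(4) 2(4) 1(5) 2(5) 1(6) 2(6) e'] by (simp add: 1(1-3) 2(1-3))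
qed simp_all

text \<open>Naturality of an inverse: the element is written as an image under the associator,
  naturality of the associator carries the arrow across, and the inverse cancels.\<close>

lemma assoc_inv_cell: "is_cell uts2 uts1 assoc_inv"
 unfolding assoc_inv_def
proof (rule mk_cellI[OF uts2_tdx uts1_tdx])
 show "is_functor (St uts2) (St uts1) (mk_func (St uts2)
  sR
  sR)"
  by (rule functorI[OF uts_cat(2)]) (auto elim!: states_objE states_homE)
next
 fix a z z' assume a: "a:Obj (TSrc uts2)" and z: "z:Obj (St uts2)" "z':Obj (St uts2)"
 obtain q p r where 1: "z = eL q p r" "q:Obj (St s)" "p:Obj P" "r:Obj R" by (rule uts2_obj_E[OF z(1)])
 obtain q' p' r' where 2: "z' = eL q' p' r'" "q':Obj (St s)" "p':Obj P" "r':Obj R" by (rule uts2_obj_E[OF z(2)])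
 have a': "a:Obj (TSrc s)" using a by simp
 show "(let (y :: 'u, r :: 'u) = dec z; (q :: 'u, p :: 'u) = dec y; (y' :: 'u, r' :: 'u) = dec z'; (q' :: 'u, p' :: 'u) = dec y' in
  inverse_mor (psh_cat (TTgt u)) (lift_comp_map u t (V a q q') p r p' r')):phom (TTgt uts2) (FO (Tf uts2) (a, z, z')) (FO (Tf uts1) (a,
  sR z,
  sR z'))"
  using lcm_inverse(1)[OF Tf_src[OF a' 1(2) 2(2)] 1(3) 2(3) 1(4) 2(4)] uts1_FO[OF a' 1(2) 2(2) 1(3) 2(3) 1(4) 2(4)] uts2_FO[OF a' 1(2) 2(2) 1(3) 2(3) 1(4) 2(4)]
  by (simp add: 1(1) 2(1))
next
 fix a a' z z' z0 z1 al m m' d e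
 assume al: "al:hom (TSrc uts2) a a'" and m: "m:hom (St uts2) z0 z" "m':hom (St uts2) z' z1" and e: "e:sel (TTgt uts2) (FO (Tf uts2) (a, z, z')) d"
 obtain k l j q0 p0 r0 q p r where 1: "m = eL k l j" "z0 = eL q0 p0 r0" "z = eL q p r"
  "k:hom (St s) q0 q" "l:hom P p0 p" "j:hom R r0 r" by (rule uts2_hom_E[OF m(1)])
 obtain k' l' j' q' p' r' q1 p1 r1 where 2: "m' = eL k' l' j'" "z' = eL q' p' r'" "z1 = eL q1 p1 r1"
  "k':hom (St s) q' q1" "l':hom P p' p1" "j':hom R r' r1" by (rule uts2_hom_E[OF m(2)])
 have al': "al:hom (TSrc s) a a'" using al by simp
 note o = hom_obj1[OF s.catA al'] hom_obj2[OF s.catQ 1(4)] hom_obj1[OF s.catQ 2(4)] hom_obj2[OF t.catQ 1(5)] hom_obj1[OF t.catQ 2(5)] hom_obj2[OF u.catQ 1(6)] hom_obj1[OF u.catQ 2(6)]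
 note o0 = hom_obj2[OF s.catA al'] hom_obj1[OF s.catQ 1(4)] hom_obj2[OF s.catQ 2(4)] hom_obj1[OF t.catQ 1(5)] hom_obj2[OF t.catQ 2(5)] hom_obj1[OF u.catQ 1(6)] hom_obj2[OF u.catQ 2(6)]
 note I = lcm_inverse[OF Tf_src[OF o(1-3)] o(4-7)] and I0 = lcm_inverse[OF Tf_src[OF o0(1-3)] o0(4-7)]
 have e': "e:sel cD (lift_ob u (lift_ob t (V a q q') p p') r r') d"
  using e uts2_FO[OF o] by (simp add: 1(3) 2(2))
 let ?L = "lift_comp_map u t (V a q q') p r p' r'" and ?M = "lift_comp_map u t (V a' q0 q1) p0 r0 p1 r1"
 let ?F = "FM (Tf uts1) (al, eR k l j, eR k' l' j')"
 let ?y = "app (inverse_mor pD ?L) d e"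
 have y: "?y:sel cD (lift_ob ut (V a q q') (enc (p, r)) (enc (p', r'))) d"
  by (rule app_mem[OF u.catB I(1) e'])
 have F: "?F:phom cD (lift_ob ut (V a q q') (enc (p, r)) (enc (p', r'))) (lift_ob ut (V a' q0 q1) (enc (p0, r0)) (enc (p1, r1)))"
  using tdx.Tf_phom[of uts1 al a a' "eR k l j" "eR q0 p0 r0" "eR q p r" "eR k' l' j'" "eR q' p' r'" "eR q1 p1 r1"]
  uts1_FO[OF o] uts1_FO[OF o0] al' 1 2 tdx.intro[OF uts1_tdx] by simp
 have "app (inverse_mor pD ?M) d (app (FM (Tf uts2) (al, eL k l j, eL k' l' j')) d (app ?L d ?y)) = app ?F d ?y"
  unfolding assoc_nat[OF al' 1(4) 2(4) 1(5) 2(5) 1(6) 2(6) y, symmetric] by (rule I0(2)[OF app_mem[OF u.catB F y]])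
 then show "app (let (y :: 'u, r :: 'u) = dec z0; (q :: 'u, p :: 'u) = dec y; (y' :: 'u, r' :: 'u) = dec z1; (q' :: 'u, p' :: 'u) = dec y' in
  inverse_mor (psh_cat (TTgt u)) (lift_comp_map u t (FO (Tf s) (a', q, q')) p r p' r')) d (app (FM (Tf uts2) (al, m, m')) d e) =
  app (FM (Tf uts1) (al, sR m,
  sR m')) d
  (app (let (y :: 'u, r :: 'u) = dec z; (q :: 'u, p :: 'u) = dec y; (y' :: 'u, r' :: 'u) = dec z'; (q' :: 'u, p' :: 'u) = dec y' in
  inverse_mor (psh_cat (TTgt u)) (lift_comp_map u t (V a q q') p r p' r')) d e)"
  using I(3)[OF e'] by (simp add: 1(1-3) 2(1-3))
qed simp_all

lemma assoc_cells: "cell uts1 uts2 (associator u t s)" "cell uts2 uts1 assoc_inv"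
 by (intro cellI assoc_cell assoc_inv_cell uts1_tdx uts2_tdx)+

lemma assoc_states:
 "q:Obj (St s) ==> p:Obj P ==> r:Obj R ==> FO (CK (associator u t s)) (eR q p r) = eL q p r"
 "k:Mor (St s) ==> l:Mor P ==> j:Mor R ==> FM (CK (associator u t s)) (eR k l j) = eL k l j"
 "q:Obj (St s) ==> p:Obj P ==> r:Obj R ==> FO (CK assoc_inv) (eL q p r) = eR q p r"
 "k:Mor (St s) ==> l:Mor P ==> j:Mor R ==> FM (CK assoc_inv) (eL k l j) = eR k l j"
 by (simp_all add: associator_def assoc_inv_def)

lemma assoc_Nc:
 assumes "a:Obj (TSrc s)" "q:Obj (St s)" "q':Obj (St s)" "p:Obj P" "p':Obj P" "r:Obj R" "r':Obj R"
 shows "Nc (CTh (associator u t s)) (a, eR q p r, eR q' p' r') = lift_comp_map u t (V a q q') p r p' r'"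
  and "Nc (CTh assoc_inv) (a, eL q p r, eL q' p' r') = inverse_mor pD (lift_comp_map u t (V a q q') p r p' r')"
 using assms by (simp_all add: associator_def assoc_inv_def)

text \<open>Once the regrouping of \<open>e\<close> is known, both directions are explicit on the
  generator. The second triangle reads the associator forwards, with the regrouped unit as input;
  the first reads its inverse, with a preimage under regrouping as output.\<close>

lemma assoc_app:
 assumes v: "v:E s [a] q q' b" and e: "e:Eu b p r p' r' d"
  and eq: "Rg b p r p' r' d e = LL b p p' r r' d c w e'" "w:E t b p p' c" "e':E u c r r' d"
 shows "app (Nc (CTh (associator u t s)) (a, eR q p r, eR q' p' r')) d
  (lift_in ut (V a q q') (enc (p, r)) (enc (p', r')) d b v e) =
  lift_in u (lift_ob t (V a q q') p p') r r' d c (lift_in t (V a q q') p p' c b v w) e'" (is "PROP ?Ga")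
  and "app (Nc (CTh assoc_inv) (a, eL q p r, eL q' p' r')) d
  (lift_in u (lift_ob t (V a q q') p p') r r' d c (lift_in t (V a q q') p p' c b v w) e') =
  lift_in ut (V a q q') (enc (p, r)) (enc (p', r')) d b v e" (is "PROP ?Gb")
proof -
 note o = s.E_D[OF v] t.E_D(2,3)[OF eq(2)] u.E_D(2,3)[OF eq(3)]
 have a: "a:Obj (TSrc s)" using o by simp
 have v': "v:sel cB (V a q q') b" using v s.E_Tf[OF a o(2,3)] src_t by simp
 note N = assoc_Nc[OF a o(2,3,6-9)] and V = Tf_src[OF a o(2,3)]
 note l = lcm_app[OF V o(6-9) v' e eq]
 have m: "lift_in ut (V a q q') (enc (p, r)) (enc (p', r')) d b v e:sel cD (lift_ob ut (V a q q') (enc (p, r)) (enc (p', r'))) d"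
  using ut.lift_mem[OF _ e, of v] v' by simp
 show "PROP ?Ga"
  unfolding N(1) by (rule l)
 show "PROP ?Gb"
  unfolding N(2) using lcm_inverse(2)[OF V o(6-9) m] l by simp
qed

lemma inverse_assoc: "inverse_2cell TDX uts1 uts2 (associator u t s) = assoc_inv"
proof (rule inverse_2cell_eqI[OF assoc_cells])
 fix a z z' d e assume e0: "e:E uts1 [a] z z' d"
 interpret x: tdx uts1 by unfold_locales (rule uts1_tdx)
 note o0 = x.E_D[OF e0]
 obtain q p r where 1: "z = eR q p r" "q:Obj (St s)" "p:Obj P" "r:Obj R" by (rule uts1_obj_E[OF o0(2)])
 obtain q' p' r' where 2: "z' = eR q' p' r'" "q':Obj (St s)" "p':Obj P" "r':Obj R" by (rule uts1_obj_E[OF o0(3)])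
 have a: "a:Obj (TSrc s)" using o0(1) by simp
 note o = a 1(2) 2(2) 1(3) 2(3) 1(4) 2(4)
 have e: "e:sel cD (lift_ob ut (V a q q') (enc (p, r)) (enc (p', r'))) d"
  using e0 x.E_Tf[OF _ o0(2,3), of a e d] a uts1_FO[OF o] 1(1) 2(1) by simp
 show "app (Nc (CTh assoc_inv) (a, FO (CK (associator u t s)) z, FO (CK (associator u t s)) z')) d (app (Nc (CTh (associator u t s)) (a, z, z')) d e) = e"
  using lcm_inverse(2)[OF Tf_src[OF o(1-3)] o(4-7) e] assoc_Nc[OF o] assoc_states o by (simp add: 1(1) 2(1))
next
 fix a z z' d e assume e0: "e:E uts2 [a] z z' d"
 interpret x: tdx uts2 by unfold_locales (rule uts2_tdx)
 note o0 = x.E_D[OF e0]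
 obtain q p r where 1: "z = eL q p r" "q:Obj (St s)" "p:Obj P" "r:Obj R" by (rule uts2_obj_E[OF o0(2)])
 obtain q' p' r' where 2: "z' = eL q' p' r'" "q':Obj (St s)" "p':Obj P" "r':Obj R" by (rule uts2_obj_E[OF o0(3)])
 have a: "a:Obj (TSrc s)" using o0(1) by simp
 note o = a 1(2) 2(2) 1(3) 2(3) 1(4) 2(4)
 have e: "e:sel cD (lift_ob u (lift_ob t (V a q q') p p') r r') d"
  using e0 x.E_Tf[OF _ o0(2,3), of a e d] a uts2_FO[OF o] 1(1) 2(1) by simp
 show "app (Nc (CTh (associator u t s)) (a, FO (CK assoc_inv) z, FO (CK assoc_inv) z')) d (app (Nc (CTh assoc_inv) (a, z, z')) d e) = e"
  using lcm_inverse(3)[OF Tf_src[OF o(1-3)] o(4-7) e] assoc_Nc[OF o] assoc_states o by (simp add: 1(1) 2(1))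
next
 fix k assume k: "k:Mor (St uts1)"
 show "FM (CK assoc_inv) (FM (CK (associator u t s)) k) = k"
  by (rule uts1_hom_E[OF Mor_hom[OF k]]) (simp add: assoc_states hom_Mor(1))
next
 fix k assume k: "k:Mor (St uts2)"
 show "FM (CK (associator u t s)) (FM (CK assoc_inv) k) = k"
  by (rule uts2_hom_E[OF Mor_hom[OF k]]) (simp add: assoc_states hom_Mor(1))
qed (auto elim!: states_objE simp: assoc_states)

end

section \<open>The identity 2-transducer\<close>

locale tid =
 fixes B :: "('u::universe, 'u) cat"
 assumes smallB: "small_category B"
begin

lemmas catB = sl[OF smallB]
lemmas catFB = category_free[OF catB]

section \<open>Representable presheaves\<close>

lemma yon_psh: "b:fob B ==> psh B (yon B b)"
 unfolding yon_def
proof (rule mk_pshI[OF catB])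
 fix b' :: "'u list"
 show "small (enc ` fhom B b' b :: 'u set)"
  using covered_image[OF covered_free(2)[OF smallB], of "enc :: 'u list => 'u"] by (simp del: free_simps)
qed (auto simp: Cmp_idr[OF catFB] Cmp_assoc[OF catFB] intro: Cmp_hom[OF catFB] simp del: free_simps)

lemma yon_sel: "b:fob B ==> x:sel B (yon B b) b' \<longleftrightarrow> (EX h:fhom B b' b. x = enc h)"
 by (auto simp: sel_def yon_def mk_psh_simps hom_obj1[OF catFB] simp del: free_simps)

lemma yon_act: "h:fhom B b' b ==> be:fhom B b'' b' ==> act (yon B b) be (enc h) = enc (fcmp B h be)"
 unfolding yon_def by (subst mk_psh_simps(2)) auto

lemma yon_map_phom: "ga:fhom B b c ==> yon_map B ga:phom B (yon B b) (yon B c)"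
 unfolding yon_map_def hom_Src hom_Tgt
proof (rule mk_pmap_hom[OF catB yon_psh yon_psh])
 assume ga: "ga:fhom B b c"
 show o: "b:fob B" "c:fob B" by (rule hom_objs[OF catFB ga])+
 show "enc (fcmp B ga (dec e)):sel B (yon B c) b'" if "e:sel B (yon B b) b'" for b' e
  using that ga by (auto simp: yon_sel[OF o(1)] yon_sel[OF o(2)] intro: Cmp_hom[OF catFB] simp del: free_simps)
 show "enc (fcmp B ga (dec (act (yon B b) be e))) = act (yon B c) be (enc (fcmp B ga (dec e)))"
  if "e:sel B (yon B b) b'" "be:fhom B b'' b'" for b' b'' be e
  using that ga by (auto simp: yon_sel[OF o(1)] yon_act yon_act[OF Cmp_hom[OF catFB]] Cmp_assoc[OF catFB] simp del: free_simps)
qed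

lemma yon_map_app:
 assumes "ga:fhom B b c" "h:fhom B b' b"
 shows "app (yon_map B ga) b' (enc h) = enc (fcmp B ga h)"
proof -
 have "enc h:sel B (yon B b) b'" using assms by (auto simp: yon_sel hom_obj1[OF catFB assms(1)] simp del: free_simps)
 then show ?thesis
  using hom_Src[OF assms(1)] by (simp add: yon_map_def app_mk_pmap del: free_simps)
qed

lemma yon_func: "is_functor (free_cat B) (psh_cat B) (yon_func B)"
 unfolding yon_func_def
proof (rule functorI[OF catFB])
 fix b assume b: "b:fob B"
 note i = Idn_hom[OF catFB b]
 show "yon_map B (fid B b) = Idn (psh_cat B) (yon B b)"
  by (rule phom_eqI[OF catB yon_map_phom[OF i] phom_id[OF catB yon_psh[OF b]]])
  (auto simp: app_id yon_map_app[OF i] yon_sel[OF b] Cmp_idl[OF catFB] simp del: free_simps)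
next
 fix x y z f g assume f: "f:fhom B x y" and g: "g:fhom B y z"
 note c = Cmp_hom[OF catFB f g] and F = yon_map_phom[OF f] and G = yon_map_phom[OF g]
 show "yon_map B (fcmp B g f) = Cmp (psh_cat B) (yon_map B g) (yon_map B f)"
 proof (rule phom_eqI[OF catB yon_map_phom[OF c] phom_cmp[OF catB F G]])
  fix b e assume e: "e:sel B (yon B x) b"
  then obtain h where h: "h:fhom B b x" "e = enc h" by (auto simp: yon_sel[OF hom_obj1[OF catFB f]] simp del: free_simps)
  show "app (yon_map B (fcmp B g f)) b e = app (Cmp (psh_cat B) (yon_map B g) (yon_map B f)) b e"
  unfolding app_cmp[OF catB F G e] unfolding h(2) yon_map_app[OF c h(1)] yon_map_app[OF f h(1)] yon_map_app[OF g Cmp_hom[OF catFB h(1) f]]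
  Cmp_assoc[OF catFB h(1) f g] ..
 qed
qed (auto intro: yon_psh yon_map_phom)

lemma yon_func_simps:
 "b:fob B ==> FO (yon_func B) b = yon B b" "ga:fhom B b c ==> FM (yon_func B) ga = yon_map B ga"
 by (auto simp: yon_func_def dest: hom_Mor)

section \<open>Extension of the identity 2-transducer to lists\<close>

abbreviation "I == tdx_id B"

lemma id_simps [simp]: "TSrc I = B" "TTgt I = B" "St I = terminal_cat"
 by (simp_all add: tdx_id_def)

lemma id_FO: "a:Obj B ==> FO (Tf I) (a, pt, pt) = yon B [a]"
 and id_FM: "al:hom B a a' ==> FM (Tf I) (al, pt, pt) = yon_map B [al]"
 by (auto simp: tdx_id_def dest: hom_Mor)

lemma id_tdx: "is_tdx I"
proof -
 let ?D = "B \<times>\<^sub>c op_cat (terminal_cat :: ('u, 'u) cat) \<times>\<^sub>c (terminal_cat :: ('u, 'u) cat)"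
 have cT: "category (terminal_cat :: ('u, 'u) cat)" by (rule sl[OF small_terminal])
 have cc: "category ?D"
  by (intro category_prod category_op cT catB)
 have "is_functor ?D (psh_cat B) (Tf I)"
  unfolding tdx_id_def tdx.simps
 proof (rule functorI[OF cc])
  fix x y z f g assume *: "f:hom ?D x y" "g:hom ?D y z"
  obtain al a b where f: "f = (al, pt, pt)" "x = (a, pt, pt)" "y = (b, pt, pt)" "al:hom B a b" using *(1) by (cases f; cases x; cases y) auto
  obtain be c where g: "g = (be, pt, pt)" "z = (c, pt, pt)" "be:hom B b c" using *(2) f by (cases g; cases z) auto
  have "yon_map B [Cmp B be al] = Cmp (psh_cat B) (yon_map B [be]) (yon_map B [al])"
  using functor_Cmp[OF yon_func, of "[al]" "[a]" "[b]" "[be]" "[c]"] yon_func_simps(2)[of "[al]" "[a]" "[b]"] yon_func_simps(2)[of "[be]" "[b]" "[c]"]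
  yon_func_simps(2)[of "[Cmp B be al]" "[a]" "[c]"] Cmp_hom[OF catB f(4) g(3)] f g by simp
  then show "(case Cmp ?D g f of (al, _, _) => yon_map B [al]) =
  Cmp (psh_cat B) (case g of (al, _, _) => yon_map B [al]) (case f of (al, _, _) => yon_map B [al])"
  by (simp add: f g)
 next
  fix x assume *: "x:Obj ?D"
  then obtain a where x: "x = (a, pt, pt)" "a:Obj B" by (cases x) auto
  have "yon_map B [Idn B a] = Idn (psh_cat B) (yon B [a])"
  using functor_Idn[OF yon_func, of "[a]"] yon_func_simps(1)[of "[a]"] yon_func_simps(2)[of "[Idn B a]" "[a]" "[a]"] Idn_hom[OF catB x(2)] x by simp
  then show "(case Idn ?D x of (al, _, _) => yon_map B [al]) =
  Idn (psh_cat B) (case x of (a, _, _) => yon B [a])"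
  by (simp add: x)
 qed (auto intro!: yon_psh yon_map_phom)
 then show ?thesis unfolding is_tdx_def by (simp add: smallB small_terminal)
qed

sublocale i: tdx I by unfold_locales (rule id_tdx)

abbreviation "EI as b == E I as pt pt b"
abbreviation "AI as be e == Act I as pt pt be e"
abbreviation "TI as1 as2 b1 b2 e1 e2 == tcat I as1 as2 pt pt pt b1 b2 e1 e2"

lemma I_D: "e:EI as b ==> as:fob B" "e:EI as b ==> b:fob B"
 using i.E_D(1,4)[of e as pt pt b] by auto

lemma I_E: "e:E I as z z' b ==> z = pt & z' = pt & e:EI as b"
 using i.E_D(2,3)[of e as z z' b] by auto

lemma I_X_mem: "e:EI as b ==> al:fhom B as as' ==> X I al pt pt b e:EI as' b"
 and I_X_id: "e:EI as b ==> X I (fid B as) pt pt b e = e"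
 and I_X_Act: "e:EI as b ==> al:fhom B as as' ==> be:fhom B b' b ==> X I al pt pt b' (AI as be e) = AI as' be (X I al pt pt b e)"
 using i.X_mem[of e as pt pt b al as' pt pt pt pt] i.X_id[of e as pt pt b] i.X_Act[of e as pt pt b al as' pt pt pt pt be b'] by simp_all

lemma I_Act_mem: "e:EI as b ==> be:fhom B b' b ==> AI as be e:EI as b'"
 and I_Act_id: "e:EI as b ==> AI as (fid B b) e = e"
 and I_Act_cmp: "e:EI as b ==> be:fhom B b' b ==> be':fhom B b'' b' ==> AI as be' (AI as be e) = AI as (fcmp B be be') e"
 using i.Act_mem[of e as pt pt b be b'] i.Act_id[of e as pt pt b] i.Act_cmp[of e as pt pt b be b' be' b''] by simp_all

lemma I_tcat_mem: "e1:EI as1 b1 ==> e2:EI as2 b2 ==> TI as1 as2 b1 b2 e1 e2:EI (as1 @ as2) (b1 @ b2)"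
 and I_tcat_Act: "e1:EI as1 b1 ==> e2:EI as2 b2 ==> k1:fhom B b1' b1 ==> k2:fhom B b2' b2 ==>
  AI (as1 @ as2) (k1 @ k2) (TI as1 as2 b1 b2 e1 e2) = TI as1 as2 b1' b2' (AI as1 k1 e1) (AI as2 k2 e2)"
 and I_tcat_X: "e1:EI as1 b1 ==> e2:EI as2 b2 ==> al1:fhom B as1 as1' ==> al2:fhom B as2 as2' ==>
  X I (al1 @ al2) pt pt (b1 @ b2) (TI as1 as2 b1 b2 e1 e2) = TI as1' as2' b1 b2 (X I al1 pt pt b1 e1) (X I al2 pt pt b2 e2)"
 using i.tcat_mem[of e1 as1 pt pt b1 e2 as2 pt b2] i.tcat_Act[of e1 as1 pt pt b1 e2 as2 pt b2 k1 b1' k2 b2']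
  i.tcat_X[of e1 as1 pt pt b1 e2 as2 pt b2 al1 as1' al2 as2' pt pt pt pt] by simp_all

lemma I_cons_surj:
 assumes "e:EI (a # as) b"
 obtains b1 b2 e1 e2 h where "e1:EI [a] b1" "e2:EI as b2" "h:fhom B b (b1 @ b2)" "e = AI (a # as) h (TI [a] as b1 b2 e1 e2)"
proof -
 obtain w b1 b2 e1 e2 h where *: "e1:E I [a] pt w b1" "e2:E I as w pt b2" "h:fhom (TTgt I) b (b1 @ b2)"
  "e = Act I (a # as) pt pt h (tcat I [a] as pt w pt b1 b2 e1 e2)" by (rule i.cons_surj[OF assms])
 with I_E[OF *(1)] show ?thesis by (intro that[of e1 b1 e2 b2 h]) auto
qed

lemma I_Nil: "e:EI [] b \<longleftrightarrow> b = [] & e = en pt"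
 by (auto simp: i.E_Nil)

lemma I_letter: "e:EI [a] b \<longleftrightarrow> a:Obj B & (EX h:fhom B b [a]. e = enc h)"
proof (cases "a:Obj B")
 case True
 then show ?thesis using i.E_Tf[of a pt pt e b] by (simp add: id_FO yon_sel)
next
 case False
 then show ?thesis using I_D(1)[of e "[a]" b] by auto
qed

lemma I_letter_Act: "h:fhom B b [a] ==> be:fhom B b' b ==> AI [a] be (enc h) = enc (fcmp B h be)"
 using hom_obj2[OF catFB] by (force simp: i.lext_FO i.tlet_simps id_FO yon_act)

lemma I_letter_X: "al:hom B a a' ==> h:fhom B b [a] ==> X I [al] pt pt b (enc h) = enc (fcmp B [al] h)"
 using i.X_Tf[of al a a' pt pt pt pt pt pt b "enc h"] yon_map_app[of "[al]" "[a]" "[a']" h b] by (simp add: id_FM)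

abbreviation "ic == id_collapse B"

text \<open>From length two on, the collapse is a map out of a coend, so naturality at the tail has
  to accompany typing through the induction.\<close>

definition IP where
 "IP as \<longleftrightarrow> (ALL b e. e:EI as b --> ic as b e:fhom B b as &
  (ALL b' be. be:fhom B b' b --> ic as b' (AI as be e) = fcmp B (ic as b e) be))"

lemma IP_D: "IP as ==> e:EI as b ==> ic as b e:fhom B b as"
 "IP as ==> e:EI as b ==> be:fhom B b' b ==> ic as b' (AI as be e) = fcmp B (ic as b e) be"
 unfolding IP_def by blast+

lemma IP_Nil: "IP []"
 using i.Act_Nil[of pt pt pt] by (auto simp: IP_def I_Nil)

lemma IP_letter: "IP [a]"
 by (auto simp: IP_def I_letter I_letter_Act simp del: free_simps)

text \<open>The cowedge condition is associativity of composition cut in two by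
  \<open>fcmp_append\<close>. For an empty tail the second element is the only element of the
  unit.\<close>

lemma ic_Cons0:
 assumes IP: "IP as" and e1: "e1:EI [a] b1" and e2: "e2:EI as b2" and h: "h:fhom B b (b1 @ b2)"
 shows "ic (a # as) b (AI (a # as) h (TI [a] as b1 b2 e1 e2)) = fcmp B (ic [a] b1 e1 @ ic as b2 e2) h"
proof (cases "as = []")
 case True
 then have 2: "b2 = []" "e2 = en pt" using e2 I_Nil by auto
 have a: "a:Obj B" using I_D(1)[OF e1] by simp
 have t: "TI [a] [] b1 [] e1 (en pt) = e1"
  using i.tcat_letter_Nil[of e1 a pt pt b1 pt pt] e1 I_X_id[OF e1] by simp
 show ?thesis
  using IP_D(2)[OF IP_letter e1, of h b] h by (simp add: True 2 t del: id_collapse.simps(2))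
next
 case False
 then obtain a' ar where r: "as = a' # ar" by (cases as) auto
 let ?F = "%_ c1 c2 e1 e2 h. fcmp B (dec e1 @ ic as c2 e2) h"
 note L = IP_letter[of a]
 have "cowedge I [a] as pt pt b ?F"
 proof (rule cowedgeI)
  fix w w' l d1 d2 e1 e2 h assume "l:hom (St I) w w'" and e: "e1:E I [a] pt w d1" "e2:E I as w' pt d2"
  then have "l = pt" "w = pt" "w' = pt" by simp_all
  with e show "fcmp B (dec (X I (fid (TSrc I) [a]) (Idn (St I) pt) l d1 e1) @ ic as d2 e2) h = fcmp B (dec e1 @ ic as d2 (X I (fid (TSrc I) as) l (Idn (St I) pt) d2 e2)) h"
  using I_X_id[of e1 "[a]" d1] I_X_id[of e2 as d2] by simp
 next
  fix w d1 d1' d2 d2' k1 k2 e1 e2 h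
  assume k: "k1:fhom (TTgt I) d1' d1" "k2:fhom (TTgt I) d2' d2" and e: "e1:E I [a] pt w d1" "e2:E I as w pt d2" and h: "h:fhom (TTgt I) b (d1' @ d2')"
  have w: "w = pt" and e1: "e1:EI [a] d1" and e2: "e2:EI as d2" using e I_E by blast+
  have k1: "k1:fhom B d1' d1" and k2: "k2:fhom B d2' d2" and h: "h:fhom B b (d1' @ d2')" using k h by simp_all
  note d = IP_D(1)[OF L e1, unfolded id_collapse.simps] IP_D(1)[OF IP e2]
  have "dec (AI [a] k1 e1) = fcmp B (dec e1) k1" "ic as d2' (AI as k2 e2) = fcmp B (ic as d2 e2) k2"
  using IP_D(2)[OF L e1 k1] IP_D(2)[OF IP e2 k2] by simp_all
  then show "fcmp B (dec (Act I [a] pt w k1 e1) @ ic as d2' (Act I as w pt k2 e2)) h = fcmp B (dec e1 @ ic as d2 e2) (fcmp (TTgt I) (k1 @ k2) h)"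
  using fcmp_append[OF k1 d(1), of "ic as d2 e2" k2] Cmp_assoc[OF catFB h fhom_append[OF k1 k2] fhom_append[OF d]]
  by (simp add: w del: free_simps)
 qed
 from i.letter_desc[OF False this e1 e2] h show ?thesis
  by (simp add: r)
qed

lemma IP: "IP as"
proof (induction as)
 case (Cons a as)
 show ?case
  unfolding IP_def
 proof (intro allI impI conjI)
  fix b e assume e: "e:EI (a # as) b"
  obtain b1 b2 e1 e2 h where e1: "e1:EI [a] b1" and e2: "e2:EI as b2" and h: "h:fhom B b (b1 @ b2)"
  and eq: "e = AI (a # as) h (TI [a] as b1 b2 e1 e2)" by (rule I_cons_surj[OF e])
  have d: "ic [a] b1 e1 @ ic as b2 e2:fhom B (b1 @ b2) (a # as)"
  using fhom_append[OF IP_D(1)[OF IP_letter e1] IP_D(1)[OF Cons e2]] by simp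
  show "ic (a # as) b e:fhom B b (a # as)"
  unfolding eq ic_Cons0[OF Cons e1 e2 h] by (rule Cmp_hom[OF catFB h d])
  fix b' be assume be: "be:fhom B b' b"
  have "TI [a] as b1 b2 e1 e2:EI (a # as) (b1 @ b2)" using I_tcat_mem[OF e1 e2] by simp
  from I_Act_cmp[OF this h be] show "ic (a # as) b' (AI (a # as) be e) = fcmp B (ic (a # as) b e) be"
  unfolding eq using ic_Cons0[OF Cons e1 e2 h] ic_Cons0[OF Cons e1 e2 Cmp_hom[OF catFB be h]] Cmp_assoc[OF catFB be h d] by simp
 qed
qed (rule IP_Nil)

lemmas ic_mem = IP_D(1)[OF IP] and ic_Act = IP_D(2)[OF IP] and ic_Cons = ic_Cons0[OF IP]

text \<open>The element of \<open>\<iota>(as; pt, pt)[as]\<close> that corresponds to the identity of \<open>as\<close>; it generates \<open>\<iota>(as; pt, pt)\<close>.\<close>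

fun de :: "'u list => 'u" where
 "de [] = en pt"
| "de (a # as) = TI [a] as [a] as (enc [Idn B a]) (de as)"

declare de.simps(2) [simp del] id_collapse.simps(2,3) [simp del]

lemma de_letter: "a:Obj B ==> enc [Idn B a]:EI [a] [a]"
 using Idn_hom[OF catB, of a] by (simp add: I_letter)

lemma de_mem: "as:fob B ==> de as:EI as as"
proof (induction as)
 case (Cons a as)
 then show ?case using I_tcat_mem[OF de_letter[of a], of "de as" as as] by (simp add: de.simps(2))
qed (simp add: I_Nil)

lemma ic_de: "as:fob B ==> ic as as (de as) = fid B as"
proof (induction as)
 case (Cons a as)
 then have o: "a:Obj B" "as:fob B" by simp_all
 have i: "fid B (a # as):fhom B (a # as) ([a] @ as)" using Idn_hom[OF catFB Cons.prems] by simp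
 have m: "TI [a] as [a] as (enc [Idn B a]) (de as):EI (a # as) (a # as)" using I_tcat_mem[OF de_letter[OF o(1)] de_mem[OF o(2)]] by simp
 show ?case
  using ic_Cons[OF de_letter[OF o(1)] de_mem[OF o(2)] i] I_Act_id[OF m] Cons.IH[OF o(2)] Cmp_idl[OF catFB Idn_hom[OF catFB Cons.prems]]
  by (simp add: de.simps(2) id_collapse.simps(2))
qed simp

text \<open>A Yoneda argument: the collapse of \<open>e\<close>, acting on the universal element,
  gives back \<open>e\<close>. So the collapse is injective and is inverse to the action on
  \<open>de as\<close>.\<close>

lemma de_act: "e:EI as b ==> e = AI as (ic as b e) (de as)"
proof (induction as arbitrary: b e)
 case Nil
 then show ?case using i.Act_Nil[of pt pt pt] by (auto simp: I_Nil)
next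
 case (Cons a as)
 obtain b1 b2 e1 e2 h where e1: "e1:EI [a] b1" and e2: "e2:EI as b2" and h: "h:fhom B b (b1 @ b2)"
  and eq: "e = AI (a # as) h (TI [a] as b1 b2 e1 e2)" by (rule I_cons_surj[OF Cons.prems])
 have o: "a:Obj B" "as:fob B" using I_D(1)[OF e1] I_D(1)[OF e2] by simp_all
 note dea = de_letter[OF o(1)] and des = de_mem[OF o(2)]
 note d = ic_mem[OF e1] ic_mem[OF e2]
 obtain h1 where h1: "h1:fhom B b1 [a]" "e1 = enc h1" using e1 by (auto simp: I_letter simp del: free_simps)
 have 1: "e1 = AI [a] (ic [a] b1 e1) (enc [Idn B a])"
  using I_letter_Act[of "[Idn B a]" "[a]" a h1 b1] Idn_hom[OF catB o(1)] h1 Cmp_idl[OF catFB h1(1)] by (simp add: id_collapse.simps(2))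
 have "TI [a] as b1 b2 e1 e2 = AI (a # as) (ic [a] b1 e1 @ ic as b2 e2) (de (a # as))"
  using I_tcat_Act[OF dea des d] 1 Cons.IH[OF e2] by (simp add: de.simps(2))
 moreover have "de (a # as):EI (a # as) ([a] @ as)" using de_mem[of "a # as"] o by simp
 ultimately show ?case
  using I_Act_cmp[of "de (a # as)" "a # as" "[a] @ as" "ic [a] b1 e1 @ ic as b2 e2" "b1 @ b2" h b] fhom_append[OF d] h ic_Cons[OF e1 e2 h]
  by (simp add: eq)
qed

lemma ic_inj: "e:EI as b ==> e':EI as b ==> ic as b e = ic as b e' ==> e = e'"
 using de_act by metis

lemma Act_de: "h:fhom B b as ==> AI as h (de as):EI as b" "h:fhom B b as ==> ic as b (AI as h (de as)) = h"
 using de_mem hom_obj2[OF catFB] I_Act_mem ic_Act[OF de_mem] ic_de Cmp_idl[OF catFB] by (metis, metis)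

lemma ic_tcat:
 assumes "e1:EI as1 b1" "e2:EI as2 b2"
 shows "ic (as1 @ as2) (b1 @ b2) (TI as1 as2 b1 b2 e1 e2) = ic as1 b1 e1 @ ic as2 b2 e2"
 using assms(1)
proof (induction as1 arbitrary: b1 e1)
 case Nil
 then show ?case using i.tcat_Nil[of pt pt pt e2 as2 pt b2] assms(2) I_X_id[OF assms(2)] by (simp add: I_Nil)
next
 case (Cons a as)
 obtain c1 c2 f1 f2 h where f1: "f1:EI [a] c1" and f2: "f2:EI as c2" and h: "h:fhom B b1 (c1 @ c2)"
  and eq: "e1 = AI (a # as) h (TI [a] as c1 c2 f1 f2)" by (rule I_cons_surj[OF Cons.prems])
 have i: "fid B b2:fhom B b2 b2" by (rule Idn_hom[OF catFB I_D(2)[OF assms(2)]])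
 have h2: "h @ fid B b2:fhom B (b1 @ b2) (c1 @ c2 @ b2)" using fhom_append[OF h i] by simp
 have d: "ic [a] c1 f1 @ ic as c2 f2:fhom B (c1 @ c2) (a # as)" using fhom_append[OF ic_mem[OF f1] ic_mem[OF f2]] by simp
 show ?case
  using i.tcat_rec[OF f1 f2 _ assms(2), of h b1] ic_Cons[OF f1 I_tcat_mem[OF f2 assms(2)] h2] Cons.IH[OF f2] ic_Cons[OF f1 f2 h]
  fcmp_append[OF h d, of "ic as2 b2 e2" "fid B b2"] Cmp_idr[OF catFB ic_mem[OF assms(2)]] h
  by (simp add: eq)
qed

text \<open>Both elements collapse to the identity, and the collapse is injective. The unit at a
  concatenated list is thereby determined by its values at the parts.\<close>

lemma de_append:
 assumes "as1:fob B" "as2:fob B"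
 shows "TI as1 as2 as1 as2 (de as1) (de as2) = de (as1 @ as2)"
 using ic_inj[OF I_tcat_mem[OF de_mem[OF assms(1)] de_mem[OF assms(2)]] de_mem] ic_tcat[OF de_mem[OF assms(1)] de_mem[OF assms(2)]]
  ic_de[OF assms(1)] ic_de[OF assms(2)] ic_de[of "as1 @ as2"] assms by simp

lemma ic_X:
 assumes "e:EI as b" "al:fhom B as as'"
 shows "ic as' b (X I al pt pt b e) = fcmp B al (ic as b e)"
 using assms
proof (induction as arbitrary: as' al b e)
 case Nil
 then show ?case using i.X_Nil[of pt pt pt pt pt pt pt] by (auto simp: I_Nil)
next
 case (Cons a as)
 obtain al1 al2 a' ar where al: "al = al1 # al2" "as' = a' # ar" "al1:hom B a a'" "al2:fhom B as ar" using fhom_Cons_left[OF Cons.prems(2)] by auto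
 obtain b1 b2 e1 e2 h where e1: "e1:EI [a] b1" and e2: "e2:EI as b2" and h: "h:fhom B b (b1 @ b2)"
  and eq: "e = AI (a # as) h (TI [a] as b1 b2 e1 e2)" by (rule I_cons_surj[OF Cons.prems(1)])
 have al1: "[al1]:fhom B [a] [a']" using al by simp
 obtain h1 where h1: "h1:fhom B b1 [a]" "e1 = enc h1" using e1 by (auto simp: I_letter simp del: free_simps)
 have m: "TI [a] as b1 b2 e1 e2:EI (a # as) (b1 @ b2)" using I_tcat_mem[OF e1 e2] by simp
 have 1: "ic [a'] b1 (X I [al1] pt pt b1 e1) = fcmp B [al1] (ic [a] b1 e1)"
  using I_letter_X[OF al(3) h1(1)] by (simp add: h1 id_collapse.simps(2))
 have 2: "X I al pt pt b e = AI as' h (TI [a'] ar b1 b2 (X I [al1] pt pt b1 e1) (X I al2 pt pt b2 e2))"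
  using I_X_Act[OF m Cons.prems(2) h] I_tcat_X[OF e1 e2 al1 al(4)] by (simp add: eq al)
 note d = fhom_append[OF ic_mem[OF e1] ic_mem[OF e2]]
 have al': "al:fhom B ([a] @ as) as'" using Cons.prems(2) by simp
 show ?case
  unfolding 2 unfolding al(2) ic_Cons[OF I_X_mem[OF e1 al1] I_X_mem[OF e2 al(4)] h] 1 Cons.IH[OF e2 al(4)]
  using fcmp_append[OF ic_mem[OF e1] al1, of al2 "ic as b2 e2"] ic_Cons[OF e1 e2 h] Cmp_assoc[OF catFB h d al'] by (simp add: eq al del: free_simps)
qed

text \<open>The covariant action of \<open>al\<close> on one universal element and the contravariant
  action on the other have the same collapse, namely \<open>al\<close>.\<close>

lemma X_de:
 assumes "al:fhom B as as'"
 shows "X I al pt pt as (de as) = AI as' al (de as')"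
proof -
 have as: "as:fob B" by (rule hom_obj1[OF catFB assms])
 show ?thesis
  using ic_inj[OF I_X_mem[OF de_mem[OF as] assms] Act_de(1)[OF assms]] ic_X[OF de_mem[OF as] assms] Act_de(2)[OF assms] ic_de[OF as] Cmp_idr[OF catFB assms] by simp
qed

lemma collapse_phom:
 assumes as: "as:fob B"
 shows "id_collapse_map B as:phom B (FO (lext I) (as, pt, pt)) (yon B as)" (is "PROP ?Ga")
  and "e:EI as b ==> app (id_collapse_map B as) b e = enc (ic as b e)" (is "PROP ?Gb")
proof -
 have s: "e:sel B (FO (lext I) (as, pt, pt)) b \<longleftrightarrow> e:EI as b" for e b using i.sel_lext[of pt pt as e b] as by simp
 show "PROP ?Ga"
  unfolding id_collapse_map_def
 proof (rule mk_pmap_hom[OF catB])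
  show "psh B (FO (lext I) (as, pt, pt))" using FO_psh[OF i.catB i.catL i.lext_functor, of "(as, pt, pt)"] as by simp
  show "enc (ic as b e):sel B (yon B as) b" if "e:sel B (FO (lext I) (as, pt, pt)) b" for b e
  using that ic_mem unfolding s yon_sel[OF as] by blast
  show "enc (ic as b' (AI as be e)) = act (yon B as) be (enc (ic as b e))" if "e:sel B (FO (lext I) (as, pt, pt)) b" "be:fhom B b' b" for b b' be e
  using that ic_Act[of e as b be b'] yon_act[of "ic as b e" b as be b'] ic_mem[of e as b] unfolding s by simp
 qed (rule yon_psh[OF as])
 show "PROP ?Gb"
  unfolding id_collapse_map_def by (simp add: app_mk_pmap s)
qed

text \<open>An arrow is sent to its action on the universal element; with this formula the unit on
  lists can be computed.\<close>

lemma collapse_inverse: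
 assumes as: "as:fob B"
 shows "inverse_mor (psh_cat B) (id_collapse_map B as):phom B (yon B as) (FO (lext I) (as, pt, pt))" (is "PROP ?Ga")
  and "h:fhom B b as ==> app (inverse_mor (psh_cat B) (id_collapse_map B as)) b (enc h) = AI as h (de as)"
proof -
 have s: "e:sel B (FO (lext I) (as, pt, pt)) b \<longleftrightarrow> e:EI as b" for e b using i.sel_lext[of pt pt as e b] as by simp
 note c = collapse_phom[OF as]
 have inj: "e = e'" if "e:sel B (FO (lext I) (as, pt, pt)) b" "e':sel B (FO (lext I) (as, pt, pt)) b"
  "app (id_collapse_map B as) b e = app (id_collapse_map B as) b e'" for b e e'
 proof (rule ic_inj)
  show o: "e:EI as b" "e':EI as b" using that(1,2) unfolding s .
  show "ic as b e = ic as b e'" by (rule injD[OF inj_enc(3) that(3)[unfolded c(2)[OF o(1)] c(2)[OF o(2)]]])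
 qed
 have surj: "EX e':sel B (FO (lext I) (as, pt, pt)) b. app (id_collapse_map B as) b e' = e" if e: "e:sel B (yon B as) b" for b e
 proof -
  obtain h where h: "h:fhom B b as" "e = enc h" using e yon_sel[OF as] by blast
  show ?thesis
  by (rule bexI[of _ "AI as h (de as)"]) (simp_all add: h(2) s c(2) Act_de[OF h(1)])
 qed
 show "PROP ?Ga"
  by (rule inverse_mor_bij(1)[OF catB c(1)]) (erule surj | erule (2) inj)+
 assume h: "h:fhom B b as"
 have "app (inverse_mor (psh_cat B) (id_collapse_map B as)) b (app (id_collapse_map B as) b (AI as h (de as))) = AI as h (de as)"
  by (rule inverse_mor_bij(2)[OF catB c(1)]) (erule surj | erule (2) inj | simp add: s Act_de(1)[OF h])+
 then show "app (inverse_mor (psh_cat B) (id_collapse_map B as)) b (enc h) = AI as h (de as)"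
  using c(2)[OF Act_de(1)[OF h]] Act_de(2)[OF h] by simp
qed

context
 fixes U
 assumes U: "psh B U"
begin

text \<open>By \<open>de_act\<close> and \<open>X_de\<close>, \<open>e\<close> is the covariant
  image of \<open>de b\<close> under its collapse, and the coend relation moves that arrow over to
  \<open>u\<close>. Every class therefore has a representative at \<open>b\<close> itself, as in the
  co-Yoneda lemma.\<close>

lemma lift_id_in:
 assumes u: "u:sel B U a" and e: "e:EI a b"
 shows "lift_in I U pt pt b a u e = lift_in I U pt pt b b (act U (ic a b e) u) (de b)"
 using i.lift_slide[of U "ic a b e" b a u "de b" pt pt b] U u ic_mem[OF e] de_mem[OF I_D(2)[OF e]] X_de[OF ic_mem[OF e]] de_act[OF e] by simp

lemma lift_id_app:
 assumes u: "u:sel B U a" and e: "e:EI a b"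
 shows "app (lift_id_map B U) b (lift_in I U pt pt b a u e) = act U (ic a b e) u"
proof -
 have m: "lift_in I U pt pt b a u e:sel B (lift_ob I U pt pt) b" using i.lift_mem[of u U a e pt pt b] u e by simp
 have "lift_desc I U pt pt b (%a u e. act U (ic a b e) u) (lift_in I U pt pt b a u e) = act U (ic a b e) u"
 proof (rule i.lift_desc_in)
  fix a a' al u e assume *: "al:fhom (TSrc I) a' a" "u:sel (TSrc I) U a" "e:E I a' pt pt b"
  then have "act U (ic a' b e) (act U al u) = act U (fcmp B al (ic a' b e)) u"
  using act_cmp[OF catB U, of u a al a' "ic a' b e" b] ic_mem[OF *(3)] by simp
  then show "act U (ic a' b e) (act U al u) = act U (ic a b (X I al (Idn (St I) pt) (Idn (St I) pt) b e)) u"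
  using ic_X[OF *(3), of al a] * by simp
 qed (use U u e in simp_all)
 then show ?thesis unfolding lift_id_map_def by (simp add: app_mk_pmap m)
qed

lemma lift_id_E:
 assumes "z:sel B (lift_ob I U pt pt) b"
 obtains u where "u:sel B U b" "z = lift_in I U pt pt b b u (de b)"
proof -
 obtain a u e where *: "u:sel B U a" "e:EI a b" "z = lift_in I U pt pt b a u e"
  by (rule i.lift_E[of pt pt z U b]) (use assms in simp_all)
 show ?thesis
  using that[OF act_mem[OF catB U *(1) ic_mem[OF *(2)]]] *(3) lift_id_in[OF *(1,2)] by simp
qed

lemma lift_id_app_de:
 assumes "u:sel B U b"
 shows "app (lift_id_map B U) b (lift_in I U pt pt b b u (de b)) = u" "lift_in I U pt pt b b u (de b):sel B (lift_ob I U pt pt) b"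
 using lift_id_app[OF assms de_mem[OF selD(1)[OF assms]]] ic_de[OF selD(1)[OF assms]] act_id[OF catB U assms]
  i.lift_mem[of u U b "de b" pt pt b] de_mem[OF selD(1)[OF assms]] assms by simp_all

lemma lift_id_phom: "lift_id_map B U:phom B (lift_ob I U pt pt) U"
proof -
 \<comment> \<open>The description map is replaced by application of the map itself, so that the
   values computed on generators can be used in \<open>mk_pmap_hom\<close>.\<close>
 have L: "lift_id_map B U = mk_pmap B (lift_ob I U pt pt) U (%b z. app (lift_id_map B U) b z)"
  unfolding lift_id_map_def mk_pmap_def by (auto simp: app_def smap_def fun_eq_iff restrict_def)
 show ?thesis
 proof (subst L, rule mk_pmap_hom[OF catB _ U])
  show "psh B (lift_ob I U pt pt)" using i.psh_lift[of U pt pt] U by simp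
  show "app (lift_id_map B U) b z:sel B U b" if z: "z:sel B (lift_ob I U pt pt) b" for b z
  proof -
  obtain u where "u:sel B U b" "z = lift_in I U pt pt b b u (de b)" by (rule lift_id_E[OF z])
  then show ?thesis using lift_id_app_de by simp
  qed
  show "app (lift_id_map B U) b' (act (lift_ob I U pt pt) be z) = act U be (app (lift_id_map B U) b z)"
  if z: "z:sel B (lift_ob I U pt pt) b" and be: "be:fhom B b' b" for b b' be z
  proof -
  obtain u where u: "u:sel B U b" "z = lift_in I U pt pt b b u (de b)" by (rule lift_id_E[OF z])
  note d = de_mem[OF selD(1)[OF u(1)]]
  have "act (lift_ob I U pt pt) be z = lift_in I U pt pt b' b u (AI b be (de b))"
  using i.lift_act[of U u b "de b" pt pt b be b'] U u d be by simp
  then show ?thesis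
  using lift_id_app[OF u(1) Act_de(1)[OF be]] Act_de(2)[OF be] lift_id_app_de(1)[OF u(1)] u(2) by simp
  qed
 qed
qed

lemma lift_id_inverse:
 shows "inverse_mor (psh_cat B) (lift_id_map B U):phom B U (lift_ob I U pt pt)" (is "PROP ?Ga")
  and "u:sel B U b ==> app (inverse_mor (psh_cat B) (lift_id_map B U)) b u = lift_in I U pt pt b b u (de b)"
proof -
 have inj: "e = e'" if e: "e:sel B (lift_ob I U pt pt) b" "e':sel B (lift_ob I U pt pt) b"
  and eq: "app (lift_id_map B U) b e = app (lift_id_map B U) b e'" for b e e'
 proof -
  obtain u where u: "u:sel B U b" "e = lift_in I U pt pt b b u (de b)" by (rule lift_id_E[OF e(1)])
  obtain u' where u': "u':sel B U b" "e' = lift_in I U pt pt b b u' (de b)" by (rule lift_id_E[OF e(2)])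
  show ?thesis using eq lift_id_app_de(1)[OF u(1)] lift_id_app_de(1)[OF u'(1)] u(2) u'(2) by simp
 qed
 have surj: "EX e':sel B (lift_ob I U pt pt) b. app (lift_id_map B U) b e' = e" if "e:sel B U b" for b e
  using lift_id_app_de[OF that] by blast
 show "PROP ?Ga"
  by (rule inverse_mor_bij(1)[OF catB lift_id_phom]) (erule surj | erule (2) inj)+
 assume u: "u:sel B U b"
 have "app (inverse_mor (psh_cat B) (lift_id_map B U)) b (app (lift_id_map B U) b (lift_in I U pt pt b b u (de b))) = lift_in I U pt pt b b u (de b)"
  by (rule inverse_mor_bij(2)[OF catB lift_id_phom]) (erule surj | erule (2) inj | rule lift_id_app_de(2)[OF u])+
 then show "app (inverse_mor (psh_cat B) (lift_id_map B U)) b u = lift_in I U pt pt b b u (de b)"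
  unfolding lift_id_app_de(1)[OF u] .
qed

end

end

section \<open>Unitors\<close>

context tdx
begin

interpretation j: tid "TTgt t" by unfold_locales (rule smallB)
interpretation i: tid "TSrc t" by unfold_locales (rule smallA)

lemma tdx2_idl: "tdx2 t (tdx_id (TTgt t))" and tdx2_idr: "tdx2 (tdx_id (TSrc t)) t"
 by unfold_locales simp_all

text \<open>The component at a letter is the co-Yoneda map \<open>lift_id_map\<close> of the
  presheaf that \<open>t\<close> assigns to it, so the element of the identity 2-transducer acts
  through its collapse.\<close>

lemma left_unitor:
 shows "wcell (tdx_comp (tdx_id B) t) t (left_unitor t)" (is "PROP ?Ga")
  and "v:E t [a] x x' c ==> e:E (tdx_id B) c pt pt b ==>
  app (Nc (CTh (left_unitor t)) (a, enc (x, pt :: 'u), enc (x', pt :: 'u))) b (lift_in (tdx_id B) (FO (Tf t) (a, x, x')) pt pt b c v e) =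
  Act t [a] x x' (id_collapse B c b e) v"
  and "x:Obj Q ==> FO (CK (left_unitor t)) (enc (x, pt :: 'u)) = x"
  and "k:Mor Q ==> FM (CK (left_unitor t)) (enc (k, pt :: 'u)) = k"
proof -
 interpret c: tdx2 t "tdx_id B" by (rule tdx2_idl)
 show "PROP ?Ga"
  unfolding left_unitor_def
 proof (rule wcell_mk[OF c.comp_tdx tdx])
  fix a z z' assume a: "a:Obj (TSrc (tdx_comp (tdx_id B) t))" "z:Obj (St (tdx_comp (tdx_id B) t))" "z':Obj (St (tdx_comp (tdx_id B) t))"
  then obtain x x' where z: "z = enc (x, pt :: 'u)" "z' = enc (x', pt :: 'u)" "x:Obj Q" "x':Obj Q" by (auto elim!: states_objE)
  have a': "a:Obj A" using a by simp
  show "lift_id_map B (FO (Tf t) (a, fst (dec z :: 'u \<times> 'u), fst (dec z' :: 'u \<times> 'u))):phom (TTgt (tdx_comp (tdx_id B) t)) (FO (Tf (tdx_comp (tdx_id B) t)) (a, z, z')) (FO (Tf t) (a, fst (dec z :: 'u \<times> 'u), fst (dec z' :: 'u \<times> 'u)))"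
  using j.lift_id_phom[OF Tf_psh[OF a' z(3,4)]] c.comp_FO[OF a' z(3,4), of pt pt] z by simp
 qed (auto elim!: states_objE)
 assume v: "v:E t [a] x x' c" and e: "e:E (tdx_id B) c pt pt b"
 note o = E_D[OF v]
 have a: "a:Obj A" using o by simp
 show "app (Nc (CTh (left_unitor t)) (a, enc (x, pt :: 'u), enc (x', pt :: 'u))) b (lift_in (tdx_id B) (FO (Tf t) (a, x, x')) pt pt b c v e) =
  Act t [a] x x' (id_collapse B c b e) v"
  using j.lift_id_app[OF Tf_psh[OF a o(2,3)] _ e, of v] E_Tf[OF a o(2,3)] v a o by (simp add: left_unitor_def lext_FO tlet_simps)
qed (simp_all add: left_unitor_def tdx_comp_def)

text \<open>The presheaf being lifted is representable: a generator is an arrow \<open>h\<close>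
  into \<open>[a]\<close> with an element over the source of \<open>h\<close>, and the cowedge
  condition is functoriality of \<open>X\<close>.\<close>

lemma right_unitor:
 shows "wcell (tdx_comp t (tdx_id A)) t (right_unitor t)" (is "PROP ?Ga")
  and "h:fhom A a' [a] ==> e:E t a' x x' b ==>
  app (Nc (CTh (right_unitor t)) (a, enc (pt :: 'u, x), enc (pt :: 'u, x'))) b (lift_in t (yon A [a]) x x' b a' (enc h) e) =
  X t h (Idn Q x) (Idn Q x') b e"
  and "x:Obj Q ==> FO (CK (right_unitor t)) (enc (pt :: 'u, x)) = x"
  and "k:Mor Q ==> FM (CK (right_unitor t)) (enc (pt :: 'u, k)) = k"
proof -
 interpret c: tdx2 "tdx_id A" t by (rule tdx2_idr)
 let ?L = "%a x x' b. lift_desc t (yon A [a]) x x' b (%a' ph e. X t (dec ph) (Idn Q x) (Idn Q x') b e)"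
 have L: "?L a x x' b (lift_in t (yon A [a]) x x' b a' (enc h) e) = X t h (Idn Q x) (Idn Q x') b e"
  if h: "h:fhom A a' [a]" and e: "e:E t a' x x' b" for a a' x x' b h e
 proof -
  note o = E_D[OF e] and i = QI[OF E_D(2)[OF e]] QI[OF E_D(3)[OF e]]
  have a: "[a]:fob A" by (rule hom_obj2[OF catFA h])
  have "?L a x x' b (lift_in t (yon A [a]) x x' b a' (enc h) e) = X t (dec (enc h :: 'u)) (Idn Q x) (Idn Q x') b e"
  proof (rule lift_desc_in[OF i.yon_psh[OF a] _ _ e])
  show "enc h:sel A (yon A [a]) a'" using h i.yon_sel[OF a] by blast
  fix a1 a2 al v e assume *: "al:fhom A a2 a1" "v:sel A (yon A [a]) a1" "e:E t a2 x x' b"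
  obtain h where h: "h:fhom A a1 [a]" "v = enc h" using *(2) i.yon_sel[OF a] by blast
  show "X t (dec (act (yon A [a]) al v)) (Idn Q x) (Idn Q x') b e = X t (dec v) (Idn Q x) (Idn Q x') b (X t al (Idn Q x) (Idn Q x') b e)"
  unfolding h(2) i.yon_act[OF h(1) *(1)] X_cmp[OF *(3,1) i h(1) i] dec_enc_simps cmps(1)[OF i(1)] cmps(1)[OF i(2)] ..
  qed
  then show ?thesis by simp
 qed
 have P: "mk_pmap B (lift_ob t (yon A [a]) x x') (FO (Tf t) (a, x, x')) (?L a x x'):phom B (lift_ob t (yon A [a]) x x') (FO (Tf t) (a, x, x'))"
  if o: "a:Obj A" "x:Obj Q" "x':Obj Q" for a x x'
 proof -
  have a: "[a]:fob A" using o by simp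
  have E: "e:sel B (FO (Tf t) (a, x, x')) b \<longleftrightarrow> e:E t [a] x x' b" for e b by (rule E_Tf[OF o])
  have Ac: "act (FO (Tf t) (a, x, x')) be e = Act t [a] x x' be e" for be e using o by (simp add: lext_FO tlet_simps)
  show ?thesis
  proof (rule mk_pmap_hom[OF catB psh_lift[OF i.yon_psh[OF a] o(2,3)] Tf_psh[OF o]])
  fix b z assume z: "z:sel B (lift_ob t (yon A [a]) x x') b"
  obtain a' v e where *: "v:sel A (yon A [a]) a'" "e:E t a' x x' b" "z = lift_in t (yon A [a]) x x' b a' v e" by (rule lift_E[OF o(2,3) z])
  obtain h where h: "h:fhom A a' [a]" "v = enc h" using *(1) i.yon_sel[OF a] by blast
  show "?L a x x' b z:sel B (FO (Tf t) (a, x, x')) b"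
  unfolding E *(3) h(2) L[OF h(1) *(2)] by (rule X_mem[OF *(2) h(1) QI[OF o(2)] QI[OF o(3)]])
  fix b' be assume be: "be:fhom B b' b"
  show "?L a x x' b' (act (lift_ob t (yon A [a]) x x') be z) = act (FO (Tf t) (a, x, x')) be (?L a x x' b z)"
  unfolding *(3) lift_act[OF i.yon_psh[OF a] *(1,2) be] unfolding h(2) L[OF h(1) Act_mem[OF *(2) be]] L[OF h(1) *(2)] Ac
  by (rule X_Act[OF *(2) h(1) QI[OF o(2)] QI[OF o(3)] be])
  qed
 qed
 note Xd = X_def[symmetric]
 show "PROP ?Ga"
  unfolding right_unitor_def Xd
 proof (rule wcell_mk[OF c.comp_tdx tdx])
  fix a z z' assume a: "a:Obj (TSrc (tdx_comp t (tdx_id A)))" "z:Obj (St (tdx_comp t (tdx_id A)))" "z':Obj (St (tdx_comp t (tdx_id A)))"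
  then obtain x x' where z: "z = enc (pt :: 'u, x)" "z' = enc (pt :: 'u, x')" "x:Obj Q" "x':Obj Q" by (auto elim!: states_objE)
  have a': "a:Obj A" using a by simp
  have F: "FO (Tf (tdx_comp t (tdx_id A))) (a, z, z') = lift_ob t (yon A [a]) x x'"
  using c.comp_FO[of a pt pt x x'] a' z i.id_FO[OF a'] by simp
  show "(let x = snd (dec z :: 'u \<times> 'u); x' = snd (dec z' :: 'u \<times> 'u) in
  mk_pmap B (lift_ob t (yon A [a]) x x') (FO (Tf t) (a, x, x')) (?L a x x')):phom (TTgt (tdx_comp t (tdx_id A))) (FO (Tf (tdx_comp t (tdx_id A))) (a, z, z')) (FO (Tf t) (a, snd (dec z :: 'u \<times> 'u), snd (dec z' :: 'u \<times> 'u)))"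
  unfolding F using P[OF a' z(3,4)] by (simp add: z(1,2))
 qed (auto elim!: states_objE)
 assume h: "h:fhom A a' [a]" and e: "e:E t a' x x' b"
 note o = E_D[OF e]
 have a: "[a]:fob A" by (rule hom_obj2[OF catFA h])
 have "lift_in t (yon A [a]) x x' b a' (enc h) e:sel B (lift_ob t (yon A [a]) x x') b"
  by (rule lift_mem[OF _ e]) (use h i.yon_sel[OF a] in blast)
 then show "app (Nc (CTh (right_unitor t)) (a, enc (pt :: 'u, x), enc (pt :: 'u, x'))) b (lift_in t (yon A [a]) x x' b a' (enc h) e) =
  X t h (Idn Q x) (Idn Q x') b e"
  using L[OF h e] a o by (simp add: right_unitor_def Xd app_mk_pmap)
qed (simp_all add: right_unitor_def tdx_comp_def)

end


section \<open>Adjoint 2-transducers\<close>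

text \<open>The data of an adjunction with the object picked by the unit written as
  \<open>(x0, y0)\<close>. The triangles stay equations of 2-cells; they are evaluated on states and
  on elements separately.\<close>

locale adj = f: tdx f + g: tdx g for f g :: "'u::universe tdx" +
 fixes \<eta> \<epsilon> :: "'u cell" and x0 y0 :: 'u
 assumes gs: "TSrc g = TTgt f" "TTgt g = TSrc f"
  and \<eta>: "is_cell (tdx_id (TSrc f)) (tdx_comp g f) \<eta>"
  and \<epsilon>: "is_cell (tdx_comp f g) (tdx_id (TTgt f)) \<epsilon>"
  and K: "FO (CK \<eta>) pt = enc (x0, y0)"
  and x0: "x0:Obj (St f)" and y0: "y0:Obj (St g)"
  and tri1: "cell_vcomp (left_unitor f) (cell_vcomp (cell_hcomp \<epsilon> (cell_id f))
  (cell_vcomp (inverse_2cell TDX (tdx_comp (tdx_comp f g) f) (tdx_comp f (tdx_comp g f)) (associator f g f))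
  (cell_hcomp (cell_id f) \<eta>))) = right_unitor f"
  and tri2: "cell_vcomp (right_unitor g) (cell_vcomp (cell_hcomp (cell_id g) \<epsilon>)
  (cell_vcomp (associator g f g) (cell_hcomp \<eta> (cell_id g)))) = left_unitor g"
begin

abbreviation "A == TSrc f"
abbreviation "B == TTgt f"
abbreviation "GF == tdx_comp g f"
abbreviation "FG == tdx_comp f g"
abbreviation "Z == enc (x0, y0) :: 'u"
abbreviation "W == enc (y0, x0) :: 'u"

sublocale a: tid A by unfold_locales (rule f.smallA)
sublocale b: tid B by unfold_locales (rule f.smallB)
sublocale gf: tdx2 f g by unfold_locales (rule gs)
sublocale fg: tdx2 g f by unfold_locales (simp add: gs)
sublocale T1: tdx3 f g f by unfold_locales (rule gs)
sublocale T2: tdx3 g f g by unfold_locales (simp add: gs)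
sublocale \<eta>: cell "tdx_id A" GF \<eta> by (rule cellI[OF \<eta> a.id_tdx gf.comp_tdx])
sublocale \<epsilon>: cell FG "tdx_id B" \<epsilon> by (rule cellI[OF \<epsilon> fg.comp_tdx b.id_tdx])

lemma cid: "cell f f (cell_id f)" "cell g g (cell_id g)"
 by (intro cellI cell_id(1) f.tdx g.tdx)+

lemma tdx2s: "tdx2 (tdx_id A) f" "tdx2 f (tdx_id B)" "tdx2 g (tdx_id A)" "tdx2 (tdx_id B) g"
 using f.tdx2_idr f.tdx2_idl g.tdx2_idl g.tdx2_idr unfolding gs by auto

lemmas h1 = hcomp[OF tdx2s(1) T1.tdx2_right \<eta>.wcell cid(1)]
lemmas h2 = hcomp[OF T1.tdx2_left tdx2s(2) cell.wcell[OF cid(1)] \<epsilon>.cell_axioms]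
lemmas h3 = hcomp[OF tdx2s(3) T2.tdx2_left cell.wcell[OF cid(2)] \<eta>.cell_axioms]
lemmas h4 = hcomp[OF T2.tdx2_right tdx2s(4) \<epsilon>.wcell cid(2)]
lemmas lu1 = f.left_unitor and ru2 = g.right_unitor[unfolded gs]
lemmas as1 = cell.wcell[OF T1.assoc_cells(2)] and as2 = cell.wcell[OF T2.assoc_cells(1)]
text \<open>The described inverse in the first triangle is replaced by the explicit
  \<open>assoc_inv\<close>, whose values are known.\<close>

lemmas tri1' = tri1[unfolded T1.inverse_assoc]

section \<open>State categories of adjoint 2-transducers\<close>

lemma mor: "FM (CK \<eta>) pt = enc (Idn (St f) x0, Idn (St g) y0)"
 using \<eta>.mK_id[of pt] K x0 y0 by simp

lemma FO\<epsilon>: "z:Obj (St FG) ==> FO (CK \<epsilon>) z = pt" and FM\<epsilon>: "m:Mor (St FG) ==> FM (CK \<epsilon>) m = pt"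
 using \<epsilon>.oK_obj[of z] \<epsilon>.mK_hom[OF Mor_hom[of m]] by simp_all

lemma src_cells:
 "CSrc (cell_hcomp \<eta> (cell_id g)) = tdx_comp (tdx_id A) g" "CSrc (cell_hcomp (cell_id f) \<eta>) = tdx_comp f (tdx_id A)"
 by (rule wcellD(3)[OF h3(1)] wcellD(3)[OF h1(1)])+

lemma st_ids: "St (tdx_comp (tdx_id A) g) = states_prod (St g) terminal_cat" "St (tdx_comp f (tdx_id A)) = states_prod terminal_cat (St f)"
 by (simp_all add: tdx_comp_def)

text \<open>Along the second triangle \<open>y\<close> becomes \<open>(y, (x0, y0))\<close>, is
  rebracketed to \<open>((y, x0), y0)\<close>, and loses its first component because the counit ends
  in a single state. What remains is \<open>y0\<close>, while the left unitor returns
  \<open>y\<close>. Arrows behave alike.\<close>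

lemma states_g:
 "y:Obj (St g) ==> y = y0" "k:Mor (St g) ==> k = Idn (St g) y0"
proof -
 note c = vcomp(1)[OF h3(1) as2] and H = hcomp_states[of \<eta> "tdx_id A" "cell_id g" g] and H' = hcomp_states[of "cell_id g" g \<epsilon> FG]
 note C = wcellD(3)[OF c] wcellD(3)[OF vcomp(1)[OF c h4(1)]]
 have s: "CSrc (cell_id g) = g" by (simp add: cell_id_def)
 have iy: "Idn (St g) y0:Mor (St g)" "Idn (St f) x0:Mor (St f)" by (rule Idn_Mor[OF g.catQ y0] Idn_Mor[OF f.catQ x0])+
 show "y = y0" if y: "y:Obj (St g)"
 proof -
  have m: "enc (y, pt :: 'u):Obj (St (tdx_comp (tdx_id A) g))" "enc (enc (y, x0) :: 'u, y0):Obj (St (tdx_comp g FG))" "enc (y, x0):Obj (St FG)"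
  using y x0 y0 st_ids by simp_all
  show ?thesis
  using arg_cong[OF tri2, of "%c. FO (CK c) (enc (y, pt :: 'u))"] vcomp_states(1)[OF C(2) m(1), of "right_unitor g"] vcomp_states(1)[OF C(1) m(1), of "cell_hcomp (cell_id g) \<epsilon>"]
  vcomp_states(1)[OF src_cells(1) m(1), of "associator g f g"] H(1)[of y pt] H'(1)[OF _ _ m(3) y0] T2.assoc_states(1)[OF y x0 y0] FO\<epsilon>[OF m(3)]
  cell_id(3)[OF g.tdx] g.right_unitor(3)[OF y0] g.left_unitor(3)[OF y] y y0 K s by simp
 qed
 show "k = Idn (St g) y0" if k: "k:Mor (St g)"
 proof -
  have m: "enc (k, pt :: 'u):Mor (St (tdx_comp (tdx_id A) g))" "enc (k, Idn (St f) x0):Mor (St FG)"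
  using k iy st_ids by simp_all
  show ?thesis
  using arg_cong[OF tri2, of "%c. FM (CK c) (enc (k, pt :: 'u))"] vcomp_states(2)[OF C(2) m(1), of "right_unitor g"] vcomp_states(2)[OF C(1) m(1), of "cell_hcomp (cell_id g) \<epsilon>"]
  vcomp_states(2)[OF src_cells(1) m(1), of "associator g f g"] H(2)[of k pt] H'(2)[OF _ _ m(2) iy(1)] T2.assoc_states(2)[OF k iy(2,1)] FM\<epsilon>[OF m(2)]
  cell_id(4)[OF g.tdx] g.right_unitor(4)[OF iy(1)] g.left_unitor(4)[OF k] k iy mor s by simp
 qed
qed

text \<open>Along the first triangle \<open>x\<close> becomes \<open>((x0, y0), x)\<close> and then
  \<open>(x0, (y0, x))\<close>; the counit erases the second component and leaves \<open>x0\<close>,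
  while the right unitor returns \<open>x\<close>. Arrows behave alike.\<close>

lemma states_f:
 "x:Obj (St f) ==> x = x0" "k:Mor (St f) ==> k = Idn (St f) x0"
proof -
 note c = vcomp(1)[OF h1(1) as1] and H = hcomp_states[of "cell_id f" f \<eta> "tdx_id A"] and H' = hcomp_states[of \<epsilon> FG "cell_id f" f]
 note C = wcellD(3)[OF c] wcellD(3)[OF vcomp(1)[OF c h2(1)]]
 have s: "CSrc (cell_id f) = f" by (simp add: cell_id_def)
 have iy: "Idn (St g) y0:Mor (St g)" "Idn (St f) x0:Mor (St f)" by (rule Idn_Mor[OF g.catQ y0] Idn_Mor[OF f.catQ x0])+
 show "x = x0" if x: "x:Obj (St f)"
 proof -
  have m: "enc (pt :: 'u, x):Obj (St (tdx_comp f (tdx_id A)))" "enc (y0, x):Obj (St FG)"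
  using x x0 y0 st_ids by simp_all
  show ?thesis
  using arg_cong[OF tri1', of "%c. FO (CK c) (enc (pt :: 'u, x))"] vcomp_states(1)[OF C(2) m(1), of "left_unitor f"] vcomp_states(1)[OF C(1) m(1), of "cell_hcomp \<epsilon> (cell_id f)"]
  vcomp_states(1)[OF src_cells(2) m(1), of T1.assoc_inv] H(1)[of pt x] H'(1)[OF _ _ x0 m(2)] T1.assoc_states(3)[OF x0 y0 x] FO\<epsilon>[OF m(2)]
  cell_id(3)[OF f.tdx] f.left_unitor(3)[OF x0] f.right_unitor(3)[OF x] x x0 K s by simp
 qed
 show "k = Idn (St f) x0" if k: "k:Mor (St f)"
 proof -
  have m: "enc (pt :: 'u, k):Mor (St (tdx_comp f (tdx_id A)))" "enc (Idn (St g) y0, k):Mor (St FG)"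
  using k iy st_ids by simp_all
  show ?thesis
  using arg_cong[OF tri1', of "%c. FM (CK c) (enc (pt :: 'u, k))"] vcomp_states(2)[OF C(2) m(1), of "left_unitor f"] vcomp_states(2)[OF C(1) m(1), of "cell_hcomp \<epsilon> (cell_id f)"]
  vcomp_states(2)[OF src_cells(2) m(1), of T1.assoc_inv] H(2)[of pt k] H'(2)[OF _ _ iy(2) m(2)] T1.assoc_states(4)[OF iy(2,1) k] FM\<epsilon>[OF m(2)]
  cell_id(4)[OF f.tdx] f.left_unitor(4)[OF iy(2)] f.right_unitor(4)[OF k] k iy mor s by simp
 qed
qed

end

lemma (in tdx2) lift_in_letter:
 assumes "v:E t [b] p p' c"
 shows "LL [b] p p' r r' d c v e = lift_in u (FO (Tf t) (b, p, p')) r r' d c v e"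
  and "e:E u c r r' d ==> lift_in u (FO (Tf t) (b, p, p')) r r' d c v e:Eu [b] p r p' r' d" (is "PROP ?Gb")
proof -
 show *: "LL [b] p p' r r' d c v e = lift_in u (FO (Tf t) (b, p, p')) r r' d c v e" for e
  using t.E_D[OF assms] by (simp add: LL_def t.lext_FO t.tlet_simps)
 show "PROP ?Gb"
  unfolding E_letter using LL_mem[OF assms, of e r r' d] * by simp
qed

context adj
begin

section \<open>The unit and the counit on elements over lists\<close>

abbreviation "jx == Idn (St f) x0"
abbreviation "jy == Idn (St g) y0"
abbreviation "Ef a b == E f a x0 x0 b"
abbreviation "Eg c a == E g c y0 y0 a"
abbreviation "Xf al b e == X f al jx jx b e"
abbreviation "Xg ga a e == X g ga jy jy a e"
abbreviation "Af a be e == Act f a x0 x0 be e"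
abbreviation "Ag c al e == Act g c y0 y0 al e"
abbreviation "LFG c b a e' e == fg.LL c y0 y0 x0 x0 b a e' e"
abbreviation "LGF a a' c w e == gf.LL a x0 x0 y0 y0 a' c w e"

lemmas ix = f.QI[OF x0] and iy = g.QI[OF y0]
lemmas FX = f.X_mem[OF _ _ ix ix] and GA = g.Act_mem[unfolded gs] and GD = g.E_D[unfolded gs]

lemma GX_cmp: "e:Eg c a ==> ga:fhom B c c' ==> ga':fhom B c' c'' ==> Xg ga' a (Xg ga a e) = Xg (fcmp B ga' ga) a e"
 using g.X_cmp[OF _ _ iy iy _ iy iy, unfolded gs] g.cmps(1)[OF iy] by simp

text \<open>The counit is defined on the list extension of the composite \<open>FG\<close>, while
  the triangles provide elements in regrouped form; \<open>pre\<close> inverts the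
  regrouping.\<close>

definition pre where "pre c b z = (SOME e. e:E FG c W W b & fg.Rg c y0 x0 y0 x0 b e = z)"

text \<open>The counit on lists followed by the collapse. The value is an arrow of lists in
  \<open>B\<close>, which can act contravariantly on elements of \<open>f\<close> and covariantly on
  elements of \<open>g\<close>.\<close>

definition ep where "ep c b z = b.ic c b (app (cext \<epsilon> c W W) b (pre c b z))"

abbreviation "PE c b a e' e == pre c b (LFG c b a e' e)"
abbreviation "EE c b a e' e == ep c b (LFG c b a e' e)"

lemma ep_Rg: "e:E FG c W W b ==> ep c b (fg.Rg c y0 x0 y0 x0 b e) = b.ic c b (app (cext \<epsilon> c W W) b e)"
 unfolding ep_def pre_def by (rule arg_cong[where f = "%e. b.ic c b (app (cext \<epsilon> c W W) b e)"], rule some_equality) (auto intro: fg.Rg_inj)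

lemma EE:
 assumes "e':Eg c a" "e:Ef a b"
 shows "PE c b a e' e:E FG c W W b" (is "PROP ?Ga") "fg.Rg c y0 x0 y0 x0 b (PE c b a e' e) = LFG c b a e' e"
  "EE c b a e' e = b.ic c b (app (cext \<epsilon> c W W) b (PE c b a e' e))" (is "PROP ?Gc") "app (cext \<epsilon> c W W) b (PE c b a e' e):b.EI c b" (is "PROP ?Gd")
proof -
 have "EX z. z:E FG c W W b & fg.Rg c y0 x0 y0 x0 b z = LFG c b a e' e"
  using fg.Rg_surj[OF fg.LL_mem[OF assms(1), of e x0 x0 b]] assms(2) by auto
 from someI_ex[OF this] have z: "PE c b a e' e:E FG c W W b & fg.Rg c y0 x0 y0 x0 b (PE c b a e' e) = LFG c b a e' e"
  unfolding pre_def .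
 then show "PROP ?Ga" "fg.Rg c y0 x0 y0 x0 b (PE c b a e' e) = LFG c b a e' e" by blast+
 show "PROP ?Gc" by (rule ep_def)
 show "PROP ?Gd"
  using \<epsilon>.cext_mem[OF conjunct1[OF z]] FO\<epsilon>[of W] x0 y0 by simp
qed

lemma EE_mem: "e':Eg c a ==> e:Ef a b ==> EE c b a e' e:fhom B b c"
 using b.ic_mem[OF EE(4)] EE(3) by simp

lemma EE_slide:
 assumes "al:fhom A a' a" "e':Eg c a" "e:Ef a' b"
 shows "EE c b a' (Ag c al e') e = EE c b a e' (Xf al b e)"
 using fg.LL_slide[unfolded gs, OF assms] by simp

lemma EE_Act:
 assumes e: "e':Eg c a" "e:Ef a b" and be: "be:fhom B b' b"
 shows "EE c b' a e' (Af a be e) = fcmp B (EE c b a e' e) be"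
proof -
 note z = EE[OF e]
 have "fg.Rg c y0 x0 y0 x0 b' (Act FG c W W be (PE c b a e' e)) = LFG c b' a e' (Af a be e)"
  unfolding fg.Rg_Act[OF z(1) be] z(2) by (rule fg.LA_LL[OF e be])
 then show ?thesis
  using ep_Rg[OF fg.ut.Act_mem[OF z(1), of be b']] \<epsilon>.cext_Act[OF z(1), of be b'] b.ic_Act[OF z(4) be] z(3) be FO\<epsilon>[of W] x0 y0 by simp
qed

text \<open>Regrouping sends concatenation to \<open>Mh\<close>, the extension of a 2-cell preserves
  concatenation, and the collapse turns it into concatenation of arrows; the three facts
  compose.\<close>

lemma EE_tcat:
 assumes e: "e1':Eg c1 a1" "e1:Ef a1 b1" "e2':Eg c2 a2" "e2:Ef a2 b2"
 shows "EE (c1 @ c2) (b1 @ b2) (a1 @ a2) (tcat g c1 c2 y0 y0 y0 a1 a2 e1' e2') (tcat f a1 a2 x0 x0 x0 b1 b2 e1 e2) =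
  EE c1 b1 a1 e1' e1 @ EE c2 b2 a2 e2' e2"
proof -
 note z = EE[OF e(1,2)]
 note z' = EE[OF e(3,4)]
 have i: "fid B (b1 @ b2):fhom B (b1 @ b2) (b1 @ b2)" using f.FBI[of "b1 @ b2"] f.E_D(4)[OF e(2)] f.E_D(4)[OF e(4)] by (simp del: free_simps(6))
 have "fg.Rg (c1 @ c2) y0 x0 y0 x0 (b1 @ b2) (tcat FG c1 c2 W W W b1 b2 (PE c1 b1 a1 e1' e1) (PE c2 b2 a2 e2' e2)) =
  LFG (c1 @ c2) (b1 @ b2) (a1 @ a2) (tcat g c1 c2 y0 y0 y0 a1 a2 e1' e2') (tcat f a1 a2 x0 x0 x0 b1 b2 e1 e2)"
  unfolding fg.Rg_tcat[OF z(1) z'(1)] z(2) z'(2) fg.Mh_LL[OF e i] f.Act_id[OF f.tcat_mem[OF e(2,4)]] ..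
 then show ?thesis
  using ep_Rg[OF fg.ut.tcat_mem[OF z(1) z'(1)]] \<epsilon>.cext_tcat[OF z(1) z'(1)] b.ic_tcat[OF z(4) z'(4)] z(3) z'(3) FO\<epsilon>[of W] x0 y0 by simp
qed

text \<open>The unit at the universal element, in regrouped form. By Yoneda it determines the unit
  at the list \<open>a\<close>.\<close>

definition et where "et a = gf.Rg a x0 y0 x0 y0 a (app (cext \<eta> a pt pt) a (a.de a))"

lemma cext_\<eta>_mem: "e:a.EI a a' ==> app (cext \<eta> a pt pt) a' e:E GF a Z Z a'"
 using \<eta>.cext_mem[of e a pt pt a'] K by simp

lemmas eta_mem = cext_\<eta>_mem[OF a.de_mem]

lemma et_mem: "a:fob A ==> et a:gf.LS a x0 x0 y0 y0 a"
 unfolding et_def by (rule gf.Rg_mem[OF eta_mem])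

lemma et_E:
 assumes "a:fob A"
 obtains c w e' where "w:Ef a c" "e':Eg c a" "et a = LGF a a c w e'"
 by (rule gf.LS_E[OF et_mem[OF assms]])

text \<open>Naturality of the unit read at universal elements, on which the two actions of
  \<open>h\<close> agree by \<open>X_de\<close>. It relates the units at two different
  lists.\<close>

lemma et_LX:
 assumes h: "h:fhom A a a1"
 shows "gf.LX h jx jx jy jy a (et a) = gf.LA a1 x0 x0 y0 y0 h (et a1)"
proof -
 have o: "a:fob A" "a1:fob A" by (rule hom_objs[OF f.catFA h])+
 have h': "h:fhom (TTgt g) a a1" using h gs by simp
 show ?thesis
  unfolding et_def gf.Rg_X[OF eta_mem[OF o(1)] h ix ix iy iy, symmetric] gf.Rg_Act[OF eta_mem[OF o(2)] h', symmetric]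
  using \<eta>.cext_X[of h a a1 pt pt pt pt pt pt "a.de a" a] a.X_de[OF h] h a.de_mem[OF o(1)] a.de_mem[OF o(2)] \<eta>.cext_Act[of "a.de a1" a1 pt pt a1 h a] K mor
  by simp
qed

lemma et_append:
 assumes "a1:fob A" "a2:fob A"
 shows "et (a1 @ a2) = gf.Mh a1 a2 x0 x0 x0 y0 y0 y0 (a1 @ a2) a1 a2 (et a1) (et a2) (fid A (a1 @ a2))"
 using gf.Rg_tcat[OF eta_mem[OF assms(1)] eta_mem[OF assms(2)]] \<eta>.cext_tcat[of "a.de a1" a1 pt pt a1 "a.de a2" a2 pt a2]
  a.de_mem[OF assms(1)] a.de_mem[OF assms(2)] a.de_append[OF assms] K gs by (simp add: et_def)

lemma et_append_LL:
 assumes 1: "w1:Ef a1 c1" "e1:Eg c1 a1" "et a1 = LGF a1 a1 c1 w1 e1" and 2: "w2:Ef a2 c2" "e2:Eg c2 a2" "et a2 = LGF a2 a2 c2 w2 e2"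
 shows "et (a1 @ a2) = LGF (a1 @ a2) (a1 @ a2) (c1 @ c2) (tcat f a1 a2 x0 x0 x0 c1 c2 w1 w2) (tcat g c1 c2 y0 y0 y0 a1 a2 e1 e2)"
proof -
 note o = f.E_D(1)[OF 1(1)] f.E_D(1)[OF 2(1)]
 have i: "fid A (a1 @ a2):fhom (TTgt g) (a1 @ a2) (a1 @ a2)" using f.FAI[of "a1 @ a2"] o gs by (simp del: free_simps(6))
 show ?thesis
  unfolding et_append[OF o] 1(3) 2(3) gf.Mh_LL[OF 1(1,2) 2(1,2) i] using g.Act_id[OF g.tcat_mem[OF 1(2) 2(2)]] gs by simp
qed

section \<open>The triangle identities on letters and on lists\<close>

lemma de1: "a:Obj A ==> a.de [a] = enc [Idn A a]"
 using a.ic_de[of "[a]"] by (intro a.ic_inj[OF a.de_mem a.de_letter]) (simp_all add: id_collapse.simps(2))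

text \<open>The first triangle is applied to the generator formed by the identity of the letter and
  \<open>e\<close>. The unit replaces the identity by \<open>(w, e')\<close>, the inverse associator
  pairs \<open>e'\<close> with \<open>e\<close>, and the counit with the left unitor turns this pair
  into an arrow acting on \<open>w\<close>. The right unitor returns \<open>e\<close>.\<close>

lemma tri_f:
 assumes a: "a:Obj A" and e: "e:Ef [a] b" and w: "w:Ef [a] c" and e': "e':Eg c [a]" and eq: "et [a] = LGF [a] [a] c w e'"
 shows "Af [a] (EE c b [a] e' e) w = e"
proof -
 interpret c: tdx2 "tdx_id A" f by (rule tdx2s)
 let ?P = "enc (pt :: 'u, x0) :: 'u" and ?v = "enc [Idn A a] :: 'u"
 let ?H = "cell_hcomp (cell_id f) \<eta>" and ?K = "cell_hcomp \<epsilon> (cell_id f)"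
 note v = a.de_letter[OF a]
 have \<eta>v: "app (Nc (CTh \<eta>) (a, pt, pt)) [a] ?v = lift_in g (FO (Tf f) (a, x0, x0)) y0 y0 [a] c w e'"
  using eq de1[OF a] gf.lift_in_letter(1)[OF w] by (simp add: et_def gf.Rg_letter cext.simps(2))
 note z = EE[OF e' e]
 have y: "FO (Tf (tdx_id A)) (a, pt, pt) = yon A [a]" by (rule a.id_FO[OF a])
 note m = c.lift_in_letter(2)[OF v e, unfolded y]
 have oP: "?P:Obj (St (tdx_comp f (tdx_id A)))" using x0 by simp
 note c1 = vcomp(1)[OF h1(1) as1] and c2 = vcomp(1)[OF vcomp(1)[OF h1(1) as1] h2(1)]
 have s1: "FO (CK ?H) ?P = enc (Z, x0)" using hcomp_states(1)[of "cell_id f" f \<eta> "tdx_id A" pt x0] x0 K cell_id(3)[OF f.tdx x0] by (simp add: cell_id_def)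
 have s2: "FO (CK (cell_vcomp T1.assoc_inv ?H)) ?P = enc (x0, W)"
  using vcomp_states(1)[OF src_cells(2) oP, of T1.assoc_inv] s1 T1.assoc_states(3)[OF x0 y0 x0] by simp
 have s3: "FO (CK (cell_vcomp ?K (cell_vcomp T1.assoc_inv ?H))) ?P = enc (x0, pt :: 'u)"
  using vcomp_states(1)[OF wcellD(3)[OF c1] oP, of ?K] s2 hcomp_states(1)[of \<epsilon> FG "cell_id f" f x0 W] x0 y0 FO\<epsilon>[of W] cell_id(3)[OF f.tdx x0] by (simp add: cell_id_def)
 have G: "FO (Tf GF) (a, Z, Z) = lift_ob g (FO (Tf f) (a, x0, x0)) y0 y0" by (rule gf.comp_FO[OF a x0 x0 y0 y0])
 have 1: "app (Nc (CTh ?H) (a, ?P, ?P)) b (lift_in f (yon A [a]) x0 x0 b [a] ?v e) =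
  lift_in f (lift_ob g (FO (Tf f) (a, x0, x0)) y0 y0) x0 x0 b [a] (lift_in g (FO (Tf f) (a, x0, x0)) y0 y0 [a] c w e') e"
  using h1(2)[OF v e] \<eta>v K G cext_cell_id[OF f.tdx e] cell_id(3)[OF f.tdx x0] y by simp
 note 2 = T1.assoc_app(2)[OF w z(1,2) e' e]
 have 3: "app (Nc (CTh ?K) (a, enc (x0, W), enc (x0, W))) b (lift_in FG (FO (Tf f) (a, x0, x0)) W W b c w (PE c b [a] e' e)) =
  lift_in (tdx_id B) (FO (Tf f) (a, x0, x0)) pt pt b c w (app (cext \<epsilon> c W W) b (PE c b [a] e' e))"
  using h2(2)[OF w z(1)] cell_id(2)[OF f.tdx w] cell_id(3)[OF f.tdx x0] FO\<epsilon>[of W] x0 y0 by simp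
 have "app (Nc (CTh (right_unitor f)) (a, ?P, ?P)) b (lift_in f (yon A [a]) x0 x0 b [a] ?v e) = Af [a] (EE c b [a] e' e) w"
  unfolding tri1'[symmetric] vcomp(2)[OF c2 lu1(1) m] vcomp(2)[OF c1 h2(1) m] vcomp(2)[OF h1(1) as1 m] s1 s2 s3 1 2 3 lu1(2)[OF w z(4)] z(3) ..
 then show ?thesis
  using f.right_unitor(2)[of "[Idn A a]" "[a]" a e x0 x0 b] f.X_id[OF e] e Idn_hom[OF f.catA a] by simp
qed

text \<open>The second triangle is applied to \<open>e'\<close> with the universal element at
  \<open>a\<close>. The unit produces \<open>(w, e)\<close>, the associator pairs \<open>e'\<close>
  with \<open>w\<close>, the counit turns this pair into an arrow into \<open>[b]\<close>, and the
  right unitor lets it act on \<open>e\<close>. Only \<open>b\<close> is a letter here;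
  \<open>a\<close> is any list.\<close>

lemma tri_g:
 assumes b: "b:Obj B" and e': "e':Eg [b] a" and w: "w:Ef a c" and e: "e:Eg c a" and eq: "et a = LGF a a c w e"
 shows "Xg (EE [b] c a e' w) a e = e'"
proof -
 interpret c: tdx2 g "tdx_id A" by (rule tdx2s)
 let ?P = "enc (y0, pt :: 'u) :: 'u" and ?v = "lift_in (tdx_id A) (FO (Tf g) (b, y0, y0)) pt pt a a e' (a.de a)"
 let ?H = "cell_hcomp \<eta> (cell_id g)" and ?K = "cell_hcomp (cell_id g) \<epsilon>"
 have a: "a:fob A" using f.E_D(1)[OF w] .
 note d = a.de_mem[OF a]
 note m = c.lift_in_letter(2)[OF e' d]
 have oP: "?P:Obj (St (tdx_comp (tdx_id A) g))" using y0 by simp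
 note c1 = vcomp(1)[OF h3(1) as2] and c2 = vcomp(1)[OF vcomp(1)[OF h3(1) as2] h4(1)]
 have s1: "FO (CK ?H) ?P = enc (y0, Z)" using hcomp_states(1)[of \<eta> "tdx_id A" "cell_id g" g y0 pt] y0 K cell_id(3)[OF g.tdx y0] by (simp add: cell_id_def)
 have s2: "FO (CK (cell_vcomp (associator g f g) ?H)) ?P = enc (W, y0)"
  using vcomp_states(1)[OF src_cells(1) oP, of "associator g f g"] s1 T2.assoc_states(1)[OF y0 x0 y0] by simp
 have s3: "FO (CK (cell_vcomp ?K (cell_vcomp (associator g f g) ?H))) ?P = enc (pt :: 'u, y0)"
  using vcomp_states(1)[OF wcellD(3)[OF c1] oP, of ?K] s2 hcomp_states(1)[of "cell_id g" g \<epsilon> FG W y0] x0 y0 FO\<epsilon>[of W] cell_id(3)[OF g.tdx y0] by (simp add: cell_id_def)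
 have G: "FO (Tf FG) (b, W, W) = lift_ob f (FO (Tf g) (b, y0, y0)) x0 x0" using fg.comp_FO[of b y0 y0 x0 x0] b x0 y0 gs by simp
 have y: "FO (Tf (tdx_id B)) (b, pt, pt) = yon B [b]" by (rule b.id_FO[OF b])
 have 1: "app (Nc (CTh ?H) (b, ?P, ?P)) a ?v = lift_in GF (FO (Tf g) (b, y0, y0)) Z Z a a e' (app (cext \<eta> a pt pt) a (a.de a))"
  using h3(2)[OF e' d] K cell_id(2)[OF g.tdx e'] cell_id(3)[OF g.tdx y0] by simp
 note 2 = T2.assoc_app(1)[OF e' eta_mem[OF a] eq[unfolded et_def] w e]
 have l: "lift_in f (FO (Tf g) (b, y0, y0)) x0 x0 c a e' w = LFG [b] c a e' w" using fg.lift_in_letter(1)[OF e'] by simp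
 note z = EE[OF e' w]
 have z': "PE [b] c a e' w = LFG [b] c a e' w" using z(2) by (simp add: fg.Rg_letter)
 have ez: "app (Nc (CTh \<epsilon>) (b, W, W)) c (LFG [b] c a e' w) = enc (EE [b] c a e' w)"
  using z(3,4) unfolding z' b.I_letter by (auto simp: id_collapse.simps(2) cext.simps(2))
 have 3: "app (Nc (CTh ?K) (b, enc (W, y0), enc (W, y0))) a (lift_in g (lift_ob f (FO (Tf g) (b, y0, y0)) x0 x0) y0 y0 a c (LFG [b] c a e' w) e) =
  lift_in g (yon B [b]) y0 y0 a c (enc (EE [b] c a e' w)) e"
  using h4(2)[OF z(1)[unfolded z'] e] ez G y FO\<epsilon>[of W] x0 y0 cext_cell_id[OF g.tdx e] cell_id(3)[OF g.tdx y0] by simp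
 have "app (Nc (CTh (left_unitor g)) (b, ?P, ?P)) a ?v = Xg (EE [b] c a e' w) a e"
  unfolding tri2[symmetric] vcomp(2)[OF c2 ru2(1) m] vcomp(2)[OF c1 h4(1) m] vcomp(2)[OF h3(1) as2 m] s1 s2 s3 1 2 l 3 ru2(2)[OF EE_mem[OF e' w] e] ..
 then show ?thesis
  using g.left_unitor(2)[OF e', of "a.de a" a] d a.ic_de[OF a] g.Act_id[OF e'] gs by simp
qed

lemma et_Nil: "et [] = LGF [] [] [] (en jx) (en jy)"
 using \<eta>.cext_Nil[of pt pt pt] gf.Rg_Nil[OF ix iy] mor by (simp add: et_def)

text \<open>Representatives of the unit at the first letter and at the tail concatenate to one at
  the whole list, and \<open>EE\<close> splits along it; the intermediate state in a splitting of
  \<open>e\<close> is \<open>x0\<close> by \<open>states_f\<close>. One good representative is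
  enough, because the unit may be evaluated at any.\<close>

lemma tri_F:
 "a:fob A ==> EX c w e'. w:Ef a c & e':Eg c a & et a = LGF a a c w e' & (ALL b e. e:Ef a b --> Af a (EE c b a e' e) w = e)"
proof (induction a)
 case Nil
 note w = f.E_NilI[OF ix] and e' = g.E_NilI[OF iy]
 have "Af [] (EE [] b [] (en jy) e) (en jx) = e" if e: "e:Ef [] b" for b e
 proof -
  \<comment> \<open>Over the empty list \<open>e\<close> is a state arrow, and the equation holds
    because the identity of \<open>x0\<close> is the only one.\<close>
  obtain m where m: "b = []" "e = en m" "m:hom (St f) x0 x0" using e f.E_Nil by auto
  show ?thesis
  using EE_mem[OF e' e] f.Act_Nil[OF ix] states_f(2)[OF hom_Mor(1)[OF m(3)]] m(1,2) by simp
 qed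
 then show ?case using w e' et_Nil by blast
next
 case (Cons a as)
 then have a: "a:Obj A" by simp
 have a': "[a]:fob A" using a by simp
 obtain c1 w1 e1' where 1: "w1:Ef [a] c1" "e1':Eg c1 [a]" "et [a] = LGF [a] [a] c1 w1 e1'" by (rule et_E[OF a'])
 obtain c2 w2 e2' where 2: "w2:Ef as c2" "e2':Eg c2 as" "et as = LGF as as c2 w2 e2'"
  and IH: "!!b e. e:Ef as b ==> Af as (EE c2 b as e2' e) w2 = e" using Cons by auto
 let ?w = "tcat f [a] as x0 x0 x0 c1 c2 w1 w2" and ?e = "tcat g c1 c2 y0 y0 y0 [a] as e1' e2'"
 have we: "?w:Ef (a # as) (c1 @ c2)" "?e:Eg (c1 @ c2) (a # as)"
  using f.tcat_mem[OF 1(1) 2(1)] g.tcat_mem[OF 1(2) 2(2)] by simp_all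
 have "Af (a # as) (EE (c1 @ c2) b (a # as) ?e e) ?w = e" if e: "e:Ef (a # as) b" for b e
 proof -
  obtain x b1 b2 f1 f2 h where f0: "f1:E f [a] x0 x b1" "f2:E f as x x0 b2" and h: "h:fhom B b (b1 @ b2)"
  and eq: "e = Af (a # as) h (tcat f [a] as x0 x x0 b1 b2 f1 f2)" by (rule f.cons_surj[OF e])
  have x: "x = x0" by (rule states_f(1)[OF f.E_D(3)[OF f0(1)]])
  note f1 = f0[unfolded x]
  have m: "tcat f [a] as x0 x0 x0 b1 b2 f1 f2:Ef (a # as) (b1 @ b2)" using f.tcat_mem[OF f1] by simp
  note M = EE_mem[OF 1(2) f1(1)] EE_mem[OF 2(2) f1(2)]
  have "EE (c1 @ c2) b (a # as) ?e e = fcmp B (EE c1 b1 [a] e1' f1 @ EE c2 b2 as e2' f2) h"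
  using EE_Act[OF we(2) m h] EE_tcat[OF 1(2) f1(1) 2(2) f1(2)] by (simp add: eq x)
  then show ?thesis
  using f.Act_cmp[OF we(1) fhom_append[OF M] h] f.tcat_Act[OF 1(1) 2(1) M] tri_f[OF a f1(1) 1] IH[OF f1(2)] by (simp add: eq x)
 qed
 then show ?case using we et_append_LL[OF 1 2] by (auto intro!: exI conjI)
qed

text \<open>The left side of the second triangle as a function of a class and not of its
  representative, so that an equation of classes over different middle lists can be carried into the
  triangle.\<close>

definition TG where
 "TG c a e' a' z = lift_desc g (FO (lext f) (a, x0, x0)) y0 y0 a' (%c' w e. Xg (EE c c' a e' w) a' e) z"

lemma TG_LL:
 assumes e': "e':Eg c a" and w: "w:Ef a c'" and e: "e:Eg c' a'"
 shows "TG c a e' a' (LGF a a' c' w e) = Xg (EE c c' a e' w) a' e"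
 unfolding TG_def
proof (rule gf.LL_desc[OF _ w e])
 fix c1 c2 al w e assume *: "al:fhom B c2 c1" "w:Ef a c1" "e:Eg c2 a'"
 show "Xg (EE c c2 a e' (Af a al w)) a' e = Xg (EE c c1 a e' w) a' (Xg al a' e)"
  unfolding EE_Act[OF e' *(2,1)] GX_cmp[OF *(3,1) EE_mem[OF e' *(2)]] ..
qed

text \<open>Splitting \<open>e'\<close> along \<open>b # c\<close> splits its target list
  \<open>a\<close> only up to an arrow \<open>h\<close> into \<open>a1 @ a2\<close>. At
  \<open>a1 @ a2\<close> the unit is a concatenation and the parts are known; \<open>et_LX\<close>
  compares it with the unit at \<open>a\<close>, and \<open>TG\<close> carries the result
  over.\<close>

lemma tri_G0: "c:fob B ==> e':Eg c a ==> TG c a e' a (et a) = e'"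
proof (induction c arbitrary: a e')
 case Nil
 obtain m where m: "a = []" "e' = en m" "m:hom (St g) y0 y0" using Nil(2) g.E_Nil by auto
 have m': "m = jy" by (rule states_g(2)[OF hom_Mor(1)[OF m(3)]])
 note w = f.E_NilI[OF ix] and e = g.E_NilI[OF iy]
 have "TG [] [] (en jy) [] (et []) = Xg [] [] (en jy)"
  unfolding et_Nil TG_LL[OF e w e] using EE_mem[OF e w] by simp
 then show ?case
  using g.X_Nil[OF iy iy iy] g.cmps(1)[OF iy] by (simp add: m m')
next
 case (Cons b c)
 then have o: "b:Obj B" "c:fob B" by simp_all
 obtain y a1 a2 f1 f2 h where f0: "f1:E g [b] y0 y a1" "f2:E g c y y0 a2" and h0: "h:fhom (TTgt g) a (a1 @ a2)"
  and eq: "e' = Ag (b # c) h (tcat g [b] c y0 y y0 a1 a2 f1 f2)" by (rule g.cons_surj[OF Cons.prems(2)])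
 have y: "y = y0" by (rule states_g(1)[OF g.E_D(3)[OF f0(1)]])
 note f1 = f0[unfolded y] and h = h0[unfolded gs]
 note o' = GD(4)[OF f1(1)] GD(4)[OF f1(2)]
 let ?t = "tcat g [b] c y0 y0 y0 a1 a2 f1 f2"
 have t: "?t:Eg (b # c) (a1 @ a2)" using g.tcat_mem[OF f1] by simp
 obtain c1 w1 e1 where 1: "w1:Ef a1 c1" "e1:Eg c1 a1" "et a1 = LGF a1 a1 c1 w1 e1" by (rule et_E[OF o'(1)])
 obtain c2 w2 e2 where 2: "w2:Ef a2 c2" "e2:Eg c2 a2" "et a2 = LGF a2 a2 c2 w2 e2" by (rule et_E[OF o'(2)])
 let ?w = "tcat f a1 a2 x0 x0 x0 c1 c2 w1 w2" and ?e = "tcat g c1 c2 y0 y0 y0 a1 a2 e1 e2"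
 note w = f.tcat_mem[OF 1(1) 2(1)] and e = g.tcat_mem[OF 1(2) 2(2)]
 note L = et_append_LL[OF 1 2]
 note M = EE_mem[OF f1(1) 1(1)] EE_mem[OF f1(2) 2(1)]
 have T: "Xg (EE (b # c) (c1 @ c2) (a1 @ a2) ?t ?w) (a1 @ a2) ?e = ?t"
  using EE_tcat[OF f1(1) 1(1) f1(2) 2(1)] g.tcat_X[OF 1(2) 2(2) _ _ iy iy, unfolded gs, OF M] tri_g[OF o(1) f1(1) 1] Cons.IH[OF o(2) f1(2)] TG_LL[OF f1(2) 2(1,2)] 2(3) by simp
 obtain c3 w3 e3 where 3: "w3:Ef a c3" "e3:Eg c3 a" "et a = LGF a a c3 w3 e3" by (rule et_E[OF GD(4)[OF Cons.prems(2)]])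
 have X3: "Xf h c3 w3:Ef (a1 @ a2) c3" by (rule FX[OF 3(1) h])
 have "gf.LX h jx jx jy jy a (et a) = LGF (a1 @ a2) a c3 (Xf h c3 w3) e3"
  unfolding 3(3) using gf.LX_LL[OF 3(1,2) h ix ix iy iy] g.X_id[OF 3(2)] gs by simp
 moreover have "gf.LA (a1 @ a2) x0 x0 y0 y0 h (et (a1 @ a2)) = LGF (a1 @ a2) a (c1 @ c2) ?w (Ag (c1 @ c2) h ?e)"
  unfolding L by (rule gf.LA_LL[OF w e h0])
 \<comment> \<open>Two representatives of one class: the unit at \<open>a\<close> with its first
   layer moved along \<open>h\<close>, and the unit at \<open>a1 @ a2\<close> with its second layer
   restricted along \<open>h\<close>.\<close>
 ultimately have LL: "LGF (a1 @ a2) a c3 (Xf h c3 w3) e3 = LGF (a1 @ a2) a (c1 @ c2) ?w (Ag (c1 @ c2) h ?e)"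
  using et_LX[OF h] by simp
 have e'': "e':Eg (b # c) a" by (rule Cons.prems(2))
 have "TG (b # c) a e' a (et a) = Xg (EE (b # c) c3 a e' w3) a e3" unfolding 3(3) by (rule TG_LL[OF e'' 3(1,2)])
 also have "... = Xg (EE (b # c) c3 (a1 @ a2) ?t (Xf h c3 w3)) a e3"
  unfolding eq y EE_slide[OF h t 3(1)] ..
 also have "... = TG (b # c) (a1 @ a2) ?t a (LGF (a1 @ a2) a c3 (Xf h c3 w3) e3)" by (rule TG_LL[OF t X3 3(2), symmetric])
 also have "... = Xg (EE (b # c) (c1 @ c2) (a1 @ a2) ?t ?w) a (Ag (c1 @ c2) h ?e)"
  unfolding LL by (rule TG_LL[OF t w GA[OF e h]])
 also have "... = Ag (b # c) h (Xg (EE (b # c) (c1 @ c2) (a1 @ a2) ?t ?w) (a1 @ a2) ?e)"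
  by (rule g.X_Act[OF e _ iy iy h0, unfolded gs, OF EE_mem[OF t w]])
 also have "... = e'" unfolding T eq y ..
 finally show ?case .
qed

lemma tri_G:
 assumes "e':Eg c a" "w:Ef a c'" "e:Eg c' a" "et a = LGF a a c' w e"
 shows "Xg (EE c c' a e' w) a e = e'"
 using tri_G0[OF GD(1)[OF assms(1)] assms(1)] TG_LL[OF assms(1-3)] assms(4) by simp

end

section \<open>Functors and maps induced at chosen states\<close>

lemma (in tdx) lift_at:
 assumes q: "q:Obj Q"
 shows "is_functor (psh_cat A) (psh_cat B) (lift_at t q)"
  and "psh A U ==> FO (lift_at t q) U = lift_ob t U q q"
  and "mu:phom A U U' ==> FM (lift_at t q) mu:phom B (lift_ob t U q q) (lift_ob t U' q q)" (is "PROP ?Gc")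
  and "mu:phom A U U' ==> u:sel A U a ==> e:E t a q q b ==>
  app (FM (lift_at t q) mu) b (lift_in t U q q b a u e) = lift_in t U' q q b a (app mu a u) e" (is "PROP ?Gd")
proof -
 note i = QI[OF q]
 have M: "(mu, Idn Q q, Idn Q q):hom (DP t) (U, q, q) (U', q, q)" if "mu:phom A U U'" for mu U U'
  using that i by simp
 show F: "is_functor (psh_cat A) (psh_cat B) (lift_at t q)"
  unfolding lift_at_def
 proof (rule functorI[OF category_psh[OF catA]])
  fix U assume "psh A U"
  then have U: "(U, q, q):Obj (DP t)" using q by simp
  show "psh B (FO (lift t) (U, q, q))" by (rule functor_obj[OF lift_functor U])
  show "FM (lift t) (Idn (psh_cat A) U, Idn Q q, Idn Q q) = Idn (psh_cat B) (FO (lift t) (U, q, q))"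
  using functor_Idn[OF lift_functor U] by simp
 next
  fix U U' mu assume mu: "mu:phom A U U'"
  show "FM (lift t) (mu, Idn Q q, Idn Q q):phom B (FO (lift t) (U, q, q)) (FO (lift t) (U', q, q))"
  by (rule functor_hom[OF lift_functor M[OF mu]])
  fix U'' mu' assume mu': "mu':phom A U' U''"
  show "FM (lift t) (Cmp (psh_cat A) mu' mu, Idn Q q, Idn Q q) = Cmp (psh_cat B) (FM (lift t) (mu', Idn Q q, Idn Q q)) (FM (lift t) (mu, Idn Q q, Idn Q q))"
  using functor_Cmp[OF lift_functor M[OF mu] M[OF mu']] cmps(1)[OF i] by simp
 qed
 show FO: "psh A U ==> FO (lift_at t q) U = lift_ob t U q q" for U by (simp add: lift_at_def lift_FO q)
 show "PROP ?Gc"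
  using functor_hom[OF F, of mu U U'] FO phom_psh[OF catA] by metis
 show "PROP ?Gd"
  using lift_FM[OF _ i i, of mu U U' u a e b] X_id[of e a q q b] by (simp add: lift_at_def hom_Mor)
qed

lemma (in tdx) lext_at:
 assumes q: "q:Obj Q"
 shows "is_functor (free_cat A) (psh_cat B) (lext_at t q)" (is "PROP ?Ga")
  and "a:fob A ==> FO (lext_at t q) a = FO (lext t) (a, q, q)"
  and "al:fhom A a a' ==> FM (lext_at t q) al = FM (lext t) (al, Idn Q q, Idn Q q)"
proof -
 note i = QI[OF q]
 have M: "(al, Idn Q q, Idn Q q):hom (DL t) (a, q, q) (a', q, q)" if "al:fhom A a a'" for al a a'
  using that i by simp
 show "PROP ?Ga"
  unfolding lext_at_def
 proof (rule functorI[OF catFA])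
  fix a assume "a:fob A"
  then have a: "(a, q, q):Obj (DL t)" using q by simp
  show "psh B (FO (lext t) (a, q, q))" by (rule functor_obj[OF lext_functor a])
  show "FM (lext t) (fid A a, Idn Q q, Idn Q q) = Idn (psh_cat B) (FO (lext t) (a, q, q))"
  using functor_Idn[OF lext_functor a] by simp
 next
  fix a a' al assume al: "al:fhom A a a'"
  show "FM (lext t) (al, Idn Q q, Idn Q q):phom B (FO (lext t) (a, q, q)) (FO (lext t) (a', q, q))"
  by (rule functor_hom[OF lext_functor M[OF al]])
  fix a'' al' assume al': "al':fhom A a' a''"
  show "FM (lext t) (fcmp A al' al, Idn Q q, Idn Q q) = Cmp (psh_cat B) (FM (lext t) (al', Idn Q q, Idn Q q)) (FM (lext t) (al, Idn Q q, Idn Q q))"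
  using functor_Cmp[OF lext_functor M[OF al] M[OF al']] cmps(1)[OF i] by simp
 qed
qed (auto simp: lext_at_def dest: hom_Mor)

lemma (in cell) lift_cell:
 assumes U: "psh (TSrc s) U" and o: "p:Obj (St s)" "p':Obj (St s)"
 shows "lift_cell ph U p p':phom (TTgt s) (lift_ob s U p p') (lift_ob t U (oK p) (oK p'))" (is "PROP ?Ga")
  and "u:sel (TSrc s) U a ==> e:E s a p p' b ==>
  app (lift_cell ph U p p') b (lift_in s U p p' b a u e) = lift_in t U (oK p) (oK p') b a u (app (cext ph a p p') b e)" (is "PROP ?Gb")
proof -
 note nat = cext_X[OF _ s.QI[OF o(1)] s.QI[OF o(2)], unfolded mK_id[OF o(1)] mK_id[OF o(2)]]
 note L = lift_map[where ph = "%a. cext ph a p p'", OF s.tdx t.tdx cell_simps(3,4) o oK_obj[OF o(1)] oK_obj[OF o(2)] phom_id[OF s.catA U] cext_mem cext_Act nat]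
 show "PROP ?Ga"
  unfolding lift_cell_def cell_simps(1,2) by (rule L(1))
 show "PROP ?Gb"
  unfolding lift_cell_def cell_simps(1,2) using L(2)[of u a e b] app_id[of u "TSrc s" U a] by simp
qed

lemma (in tdx2) regroup_map:
 assumes o: "bs:fob cB" "p:Obj P" "p':Obj P" "r:Obj R" "r':Obj R"
 shows "comp_regroup_map u t bs p r p' r':phom cD (FO (lext ut) (bs, enc (p, r), enc (p', r'))) (lift_ob u (FO (lext t) (bs, p, p')) r r')" (is "PROP ?Ga")
  and "e:Eu bs p r p' r' d ==> app (comp_regroup_map u t bs p r p' r') d e = Rg bs p r p' r' d e" (is "PROP ?Gb")
proof -
 have s: "e:sel cD (FO (lext ut) (bs, enc (p, r), enc (p', r'))) d \<longleftrightarrow> e:Eu bs p r p' r' d" for e d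
  using ut.sel_lext[of "enc (p, r)" "enc (p', r')" bs e d] o by simp
 show "PROP ?Ga"
  unfolding comp_regroup_map_def
 proof (rule mk_pmap_hom[OF u.catB])
  show "psh cD (FO (lext ut) (bs, enc (p, r), enc (p', r')))"
  using FO_psh[OF ut.catB ut.catL ut.lext_functor, of "(bs, enc (p, r), enc (p', r'))"] o by simp
  show "psh cD (lift_ob u (FO (lext t) (bs, p, p')) r r')"
  using u.psh_lift[OF _ o(4,5)] t_psh[OF o(1-3)] src_u by simp
 qed (use Rg_mem Rg_Act in \<open>auto simp: s LS_def LA_def\<close>)
 show "PROP ?Gb"
  by (simp add: comp_regroup_map_def app_mk_pmap s)
qed

context adj
begin

lemmas lf = f.lift_at[OF x0] and lg = g.lift_at[OF y0, unfolded gs]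
lemmas Fp = f.psh_lift[OF _ x0 x0] and Gp = g.psh_lift[OF _ y0 y0, unfolded gs]
lemmas FL = f.lift_mem and GL = g.lift_mem[unfolded gs]
lemmas cK = category_psh[OF f.catA] category_psh[OF f.catB]

lemma FE:
 assumes "z:sel B (lift_ob f U x0 x0) b"
 obtains a u e where "u:sel A U a" "e:Ef a b" "z = lift_in f U x0 x0 b a u e"
 by (rule f.lift_E[OF x0 x0 assms])

lemma GE:
 assumes "z:sel A (lift_ob g V y0 y0) a"
 obtains c v e where "v:sel B V c" "e:Eg c a" "z = lift_in g V y0 y0 a c v e"
 by (rule g.lift_E[OF y0 y0, unfolded gs, OF assms])

section \<open>The induced unit and counit\<close>

abbreviation "un == induced_unit f g \<eta> x0 y0"
abbreviation "cu == induced_counit f g \<epsilon> x0 y0"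

lemma Cmp_functor_simps:
 "psh A U ==> FO (comp_func (psh_cat A) (lift_at g y0) (lift_at f x0)) U = lift_ob g (lift_ob f U x0 x0) y0 y0"
 "psh B V ==> FO (comp_func (psh_cat B) (lift_at f x0) (lift_at g y0)) V = lift_ob f (lift_ob g V y0 y0) x0 x0"
 "mu:phom A U U' ==> FM (comp_func (psh_cat A) (lift_at g y0) (lift_at f x0)) mu = FM (lift_at g y0) (FM (lift_at f x0) mu)"
 "nu:phom B V V' ==> FM (comp_func (psh_cat B) (lift_at f x0) (lift_at g y0)) nu = FM (lift_at f x0) (FM (lift_at g y0) nu)"
 by (simp_all add: comp_func_def lf(2) lg(2) Fp Gp hom_Mor)

text \<open>The inverse of \<open>lift_id_map\<close> places \<open>u\<close> over the universal
  element at \<open>a\<close>, the 2-cell acts on that element, and \<open>lift_comp_map\<close>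
  regroups the outcome. The result can be read off any representative of
  \<open>et a\<close>.\<close>

lemma unit_phom:
 assumes U: "psh A U"
 shows "Nc un U:phom A U (lift_ob g (lift_ob f U x0 x0) y0 y0)" (is "PROP ?Ga")
  and "u:sel A U a ==> w:Ef a c ==> e:Eg c a ==> et a = LGF a a c w e ==>
  app (Nc un U) a u = lift_in g (lift_ob f U x0 x0) y0 y0 a c (lift_in f U x0 x0 c a u w) e"
proof -
 note I = a.lift_id_inverse[OF U]
 have L: "lift_cell \<eta> U pt pt:phom A (lift_ob (tdx_id A) U pt pt) (lift_ob GF U Z Z)"
  using \<eta>.lift_cell(1)[of U pt pt] U K by simp
 have M: "lift_comp_map g f U x0 y0 x0 y0:phom A (lift_ob GF U Z Z) (lift_ob g (lift_ob f U x0 x0) y0 y0)"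
  using gf.lcm_phom[OF U x0 x0 y0 y0] gs by simp
 note c = phom_cmp[OF f.catA I(1) L]
 have N: "Nc un U = Cmp (psh_cat A) (lift_comp_map g f U x0 y0 x0 y0) (Cmp (psh_cat A) (lift_cell \<eta> U pt pt) (inverse_mor (psh_cat A) (lift_id_map A U)))"
  using U by (simp add: induced_unit_def Let_def)
 show "PROP ?Ga"
  unfolding N by (rule phom_cmp[OF f.catA c M])
 assume u: "u:sel A U a" and r: "w:Ef a c" "e:Eg c a" "et a = LGF a a c w e"
 note d = a.de_mem[OF selD(1)[OF u]]
 show "app (Nc un U) a u = lift_in g (lift_ob f U x0 x0) y0 y0 a c (lift_in f U x0 x0 c a u w) e"
  unfolding N app_cmp[OF f.catA c M u] app_cmp[OF f.catA I(1) L u] I(2)[OF u]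
  using \<eta>.lift_cell(2)[of U pt pt u a "a.de a" a] U u d K gf.lcm_app[OF U x0 x0 y0 y0 u eta_mem[OF selD(1)[OF u]] r(3)[unfolded et_def] r(1,2)] by simp
qed

text \<open>The inverse of \<open>lift_comp_map\<close> leads to the preimage chosen by
  \<open>pre\<close>; the counit 2-cell and the collapse turn it into the arrow \<open>EE\<close>,
  which acts on \<open>v\<close>.\<close>

lemma counit_phom:
 assumes V: "psh B V"
 shows "Nc cu V:phom B (lift_ob f (lift_ob g V y0 y0) x0 x0) V" (is "PROP ?Ga")
  and "v:sel B V c ==> e':Eg c a ==> e:Ef a b ==>
  app (Nc cu V) b (lift_in f (lift_ob g V y0 y0) x0 x0 b a (lift_in g V y0 y0 a c v e') e) = act V (EE c b a e' e) v"
proof -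
 have V': "psh (TSrc g) V" using V gs by simp
 note I = fg.lcm_inverse[OF V' y0 y0 x0 x0] and I' = b.lift_id_phom[OF V]
 have \<epsilon>W: "FO (CK \<epsilon>) W = pt" using FO\<epsilon>[of W] x0 y0 by simp
 have L: "lift_cell \<epsilon> V W W:phom B (lift_ob FG V W W) (lift_ob (tdx_id B) V pt pt)"
  using \<epsilon>.lift_cell(1)[of V W W] V' \<epsilon>W x0 y0 by simp
 note c = phom_cmp[OF f.catB I(1) L]
 have N: "Nc cu V = Cmp (psh_cat B) (lift_id_map B V) (Cmp (psh_cat B) (lift_cell \<epsilon> V W W) (inverse_mor (psh_cat B) (lift_comp_map f g V y0 x0 y0 x0)))"
  using V by (simp add: induced_counit_def Let_def)
 show "PROP ?Ga"
  unfolding N by (rule phom_cmp[OF f.catB c I'])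
 assume v: "v:sel B V c" and e': "e':Eg c a" and e: "e:Ef a b"
 note z = EE[OF e' e]
 have v': "v:sel (TSrc g) V c" using v gs by simp
 let ?y = "lift_in FG V W W b c v (PE c b a e' e)"
 have y: "?y:sel B (lift_ob FG V W W) b" using fg.ut.lift_mem[of v V c "PE c b a e' e" W W b] v' z(1) by simp
 have x: "lift_in f (lift_ob g V y0 y0) x0 x0 b a (lift_in g V y0 y0 a c v e') e:sel B (lift_ob f (lift_ob g V y0 y0) x0 x0) b"
  by (rule FL[OF GL[OF v e'] e])
 note l = fg.lcm_app[OF V' y0 y0 x0 x0 v' z(1,2) e' e]
 show "app (Nc cu V) b (lift_in f (lift_ob g V y0 y0) x0 x0 b a (lift_in g V y0 y0 a c v e') e) = act V (EE c b a e' e) v"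
  unfolding N app_cmp[OF f.catB c I' x] app_cmp[OF f.catB I(1) L x] unfolding l[symmetric] I(2)[OF y]
  using \<epsilon>.lift_cell(2)[of V W W v c "PE c b a e' e" b] V' v' x0 y0 z(1) \<epsilon>W b.lift_id_app[OF V v z(4)] z(3) by simp
qed

text \<open>\<open>et a\<close> does not involve the presheaf, so one representative serves for
  \<open>U\<close> and for \<open>U'\<close>.\<close>

lemma unit_ntrans: "is_ntrans (psh_cat A) (psh_cat A) un"
proof (rule ntransI)
 fix mu U U' assume mu: "mu:phom A U U'"
 note U = phom_psh[OF f.catA mu]
 note N = unit_phom[OF U(1)] unit_phom[OF U(2)]
 note F = lf(3)[OF mu] and GF = lg(3)[OF lf(3)[OF mu]]
 have "Cmp (psh_cat A) (FM (lift_at g y0) (FM (lift_at f x0) mu)) (Nc un U) = Cmp (psh_cat A) (Nc un U') mu"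
 proof (rule phom_eqI[OF f.catA phom_cmp[OF f.catA N(1) GF] phom_cmp[OF f.catA mu N(3)]])
  fix a u assume u: "u:sel A U a"
  obtain c w e where r: "w:Ef a c" "e:Eg c a" "et a = LGF a a c w e" by (rule et_E[OF selD(1)[OF u]])
  show "app (Cmp (psh_cat A) (FM (lift_at g y0) (FM (lift_at f x0) mu)) (Nc un U)) a u = app (Cmp (psh_cat A) (Nc un U') mu) a u"
  unfolding app_cmp[OF f.catA N(1) GF u] app_cmp[OF f.catA mu N(3) u] N(2)[OF u r] N(4)[OF app_mem[OF f.catA mu u] r]
  lg(4)[OF F FL[OF u r(1)] r(2)] lf(4)[OF mu u r(1)] ..
 qed
 then show "Cmp (psh_cat A) (FM (NTgt un) mu) (Nc un U) = Cmp (psh_cat A) (Nc un U') (FM (NSrc un) mu)"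
  using Cmp_functor_simps(3)[OF mu] by (simp add: induced_unit_def Let_def id_func_def hom_Mor[OF mu])
qed (use unit_phom(1) functor_comp[OF cK(1) lf(1) lg(1)] functor_id[OF cK(1)] in \<open>auto simp: induced_unit_def Let_def id_func_def Cmp_functor_simps\<close>)

text \<open>On generators the square is naturality of \<open>nu\<close> with respect to the arrow
  \<open>EE\<close>.\<close>

lemma counit_ntrans: "is_ntrans (psh_cat B) (psh_cat B) cu"
proof (rule ntransI)
 fix nu V V' assume nu: "nu:phom B V V'"
 note V = phom_psh[OF f.catB nu]
 note N = counit_phom[OF V(1)] counit_phom[OF V(2)]
 note G = lg(3)[OF nu] and FG = lf(3)[OF lg(3)[OF nu]]
 have "Cmp (psh_cat B) nu (Nc cu V) = Cmp (psh_cat B) (Nc cu V') (FM (lift_at f x0) (FM (lift_at g y0) nu))"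
 proof (rule phom_eqI[OF f.catB phom_cmp[OF f.catB N(1) nu] phom_cmp[OF f.catB FG N(3)]])
  fix b z assume z: "z:sel B (lift_ob f (lift_ob g V y0 y0) x0 x0) b"
  obtain a y e where 1: "y:sel A (lift_ob g V y0 y0) a" "e:Ef a b" "z = lift_in f (lift_ob g V y0 y0) x0 x0 b a y e" by (rule FE[OF z])
  obtain c v e' where 2: "v:sel B V c" "e':Eg c a" "y = lift_in g V y0 y0 a c v e'" by (rule GE[OF 1(1)])
  show "app (Cmp (psh_cat B) nu (Nc cu V)) b z = app (Cmp (psh_cat B) (Nc cu V') (FM (lift_at f x0) (FM (lift_at g y0) nu))) b z"
  unfolding app_cmp[OF f.catB N(1) nu z] app_cmp[OF f.catB FG N(3) z] unfolding 1(3) 2(3) N(2)[OF 2(1,2) 1(2)]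
  lf(4)[OF G GL[OF 2(1,2)] 1(2)] lg(4)[OF nu 2(1,2)] N(4)[OF app_mem[OF f.catB nu 2(1)] 2(2) 1(2)]
  by (rule app_act[OF f.catB nu 2(1) EE_mem[OF 2(2) 1(2)]])
 qed
 then show "Cmp (psh_cat B) (FM (NTgt cu) nu) (Nc cu V) = Cmp (psh_cat B) (Nc cu V') (FM (NSrc cu) nu)"
  using Cmp_functor_simps(4)[OF nu] by (simp add: induced_counit_def Let_def id_func_def hom_Mor[OF nu])
qed (use counit_phom(1) functor_comp[OF cK(2) lg(1) lf(1)] functor_id[OF cK(2)] in \<open>auto simp: induced_counit_def Let_def id_func_def Cmp_functor_simps\<close>)

text \<open>The arrow produced by the counit acts on the inner class through its component
  \<open>w\<close>, and \<open>tri_F\<close> turns the result into \<open>e\<close>.\<close>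

lemma triangle_F:
 assumes U: "psh A U"
 shows "Cmp (psh_cat B) (Nc cu (lift_ob f U x0 x0)) (FM (lift_at f x0) (Nc un U)) = Idn (psh_cat B) (lift_ob f U x0 x0)"
proof -
 note n = unit_phom[OF U] and c = counit_phom[OF Fp[OF U]]
 note F = lf(3)[OF n(1)]
 show ?thesis
 proof (rule phom_eqI[OF f.catB phom_cmp[OF f.catB F c(1)] phom_id[OF f.catB Fp[OF U]]])
  fix b z assume z: "z:sel B (lift_ob f U x0 x0) b"
  obtain a u e where 1: "u:sel A U a" "e:Ef a b" "z = lift_in f U x0 x0 b a u e" by (rule FE[OF z])
  obtain k w e' where r: "w:Ef a k" "e':Eg k a" "et a = LGF a a k w e'" and t: "ALL b e. e:Ef a b --> Af a (EE k b a e' e) w = e"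
  using tri_F[OF selD(1)[OF 1(1)]] by blast
  have t': "Af a (EE k b a e' e) w = e" using t 1(2) by blast
  show "app (Cmp (psh_cat B) (Nc cu (lift_ob f U x0 x0)) (FM (lift_at f x0) (Nc un U))) b z = app (Idn (psh_cat B) (lift_ob f U x0 x0)) b z"
  unfolding app_cmp[OF f.catB F c(1) z] app_id[OF z] unfolding 1(3) lf(4)[OF n(1) 1(1,2)] n(2)[OF 1(1) r] c(2)[OF FL[OF 1(1) r(1)] r(2) 1(2)]
  f.lift_act[OF U 1(1) r(1) EE_mem[OF r(2) 1(2)]] t' ..
 qed
qed

text \<open>The arrow produced by the counit acts on \<open>v\<close>; the coend relation moves it
  to \<open>e\<close>, where \<open>tri_G\<close> turns it into \<open>e'\<close>.\<close>

lemma triangle_G: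
 assumes V: "psh B V"
 shows "Cmp (psh_cat A) (FM (lift_at g y0) (Nc cu V)) (Nc un (lift_ob g V y0 y0)) = Idn (psh_cat A) (lift_ob g V y0 y0)"
proof -
 note n = unit_phom[OF Gp[OF V]] and c = counit_phom[OF V]
 note G = lg(3)[OF c(1)]
 show ?thesis
 proof (rule phom_eqI[OF f.catA phom_cmp[OF f.catA n(1) G] phom_id[OF f.catA Gp[OF V]]])
  fix a z assume z: "z:sel A (lift_ob g V y0 y0) a"
  obtain k v e' where 1: "v:sel B V k" "e':Eg k a" "z = lift_in g V y0 y0 a k v e'" by (rule GE[OF z])
  obtain k' w e where r: "w:Ef a k'" "e:Eg k' a" "et a = LGF a a k' w e" by (rule et_E[OF selD(1)[OF z]])
  note l = g.lift_slide[unfolded gs, OF V EE_mem[OF 1(2) r(1)] 1(1) r(2)]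
  show "app (Cmp (psh_cat A) (FM (lift_at g y0) (Nc cu V)) (Nc un (lift_ob g V y0 y0))) a z = app (Idn (psh_cat A) (lift_ob g V y0 y0)) a z"
  unfolding app_cmp[OF f.catA n(1) G z] app_id[OF z] n(2)[OF z r] lg(4)[OF c(1) FL[OF z r(1)] r(2)]
  unfolding 1(3) c(2)[OF 1(1,2) r(1)] l tri_G[OF 1(2) r] ..
 qed
qed

theorem adjunction: "adjunction (psh_cat A) (psh_cat B) (lift_at f x0) (lift_at g y0) un cu"
 unfolding adjunction_def
 using cK lf(1) lg(1) unit_ntrans counit_ntrans triangle_F triangle_G lf(2) lg(2)
 by (auto simp: induced_unit_def induced_counit_def Let_def)

section \<open>The unit on lists\<close>

abbreviation "UL == unit_on_lists f g \<eta> x0 y0"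

text \<open>At an arrow \<open>h\<close> the composite is the regrouped unit at the action of
  \<open>h\<close> on the universal element, so naturality in the list comes from that of
  \<open>cext\<close> and of \<open>Rg\<close> in the letters.\<close>

lemma unit_on_lists: "is_ntrans (free_cat A) (psh_cat A) UL"
proof (rule ntransI)
 let ?N = "%a. Cmp (psh_cat A) (comp_regroup_map g f a x0 y0 x0 y0) (Cmp (psh_cat A) (cext \<eta> a pt pt) (inverse_mor (psh_cat A) (id_collapse_map A a)))"
 let ?T = "%a. lift_ob g (FO (lext f) (a, x0, x0)) y0 y0"
 have P: "?N a:phom A (yon A a) (?T a)"
  and N: "!!a' h. h:fhom A a' a ==> app (?N a) a' (enc h) = gf.Rg a x0 y0 x0 y0 a' (app (cext \<eta> a pt pt) a' (a.AI a h (a.de a)))"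
  if a: "a:fob A" for a
 proof -
  note I = a.collapse_inverse[OF a]
  have C: "cext \<eta> a pt pt:phom A (FO (lext (tdx_id A)) (a, pt, pt)) (FO (lext GF) (a, Z, Z))"
  using \<eta>.CP_D(1)[OF \<eta>.CP, of a pt pt] a K by simp
  have R: "comp_regroup_map g f a x0 y0 x0 y0:phom A (FO (lext GF) (a, Z, Z)) (?T a)"
  using gf.regroup_map(1)[OF a x0 x0 y0 y0] gs by simp
  note c = phom_cmp[OF f.catA I(1) C]
  show "?N a:phom A (yon A a) (?T a)" by (rule phom_cmp[OF f.catA c R])
  fix a' h assume h: "h:fhom A a' a"
  have m: "enc h:sel A (yon A a) a'" using h a.yon_sel[OF a] by blast
  show "app (?N a) a' (enc h) = gf.Rg a x0 y0 x0 y0 a' (app (cext \<eta> a pt pt) a' (a.AI a h (a.de a)))"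
  unfolding app_cmp[OF f.catA c R m] app_cmp[OF f.catA I(1) C m] I(2)[OF h]
  by (rule gf.regroup_map(2)[OF a x0 x0 y0 y0 cext_\<eta>_mem[OF a.Act_de(1)[OF h]]])
 qed
 note le = f.lext_at[OF x0]
 have psh: "psh B (FO (lext f) (a, x0, x0))" if "a:fob A" for a using functor_obj[OF le(1) that] le(2)[OF that] by simp
 have FOc: "FO (comp_func (free_cat A) (lift_at g y0) (lext_at f x0)) a = ?T a" if "a:fob A" for a
  using that by (simp add: comp_func_def le(2) lg(2)[OF psh])
 show "is_functor (free_cat A) (psh_cat A) (NSrc UL)" "is_functor (free_cat A) (psh_cat A) (NTgt UL)"
  "Nc UL:extensional (fob A)"
  using a.yon_func functor_comp[OF f.catFA le(1) lg(1)] by (simp_all add: unit_on_lists_def Let_def)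
 show "Nc UL a:phom A (FO (NSrc UL) a) (FO (NTgt UL) a)" if a: "a:fob A" for a
  using P[OF a] FOc[OF a] a.yon_func_simps(1)[OF a] a by (simp add: unit_on_lists_def Let_def)
 fix ga a a1 assume ga: "ga:fhom A a a1"
 have o: "a:fob A" "a1:fob A" by (rule hom_objs[OF f.catFA ga])+
 let ?L = "FM (lift_at g y0) (FM (lext f) (ga, jx, jx))"
 have L0: "FM (lext f) (ga, jx, jx):phom B (FO (lext f) (a, x0, x0)) (FO (lext f) (a1, x0, x0))"
  using functor_hom[OF le(1) ga] le(2)[OF o(1)] le(2)[OF o(2)] le(3)[OF ga] by simp
 note L = lg(3)[OF L0] and y = a.yon_map_phom[OF ga]
 have "Cmp (psh_cat A) ?L (?N a) = Cmp (psh_cat A) (?N a1) (yon_map A ga)"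
 proof (rule phom_eqI[OF f.catA phom_cmp[OF f.catA P[OF o(1)] L] phom_cmp[OF f.catA y P[OF o(2)]]])
  fix a' z assume z: "z:sel A (yon A a) a'"
  obtain h where h: "h:fhom A a' a" "z = enc h" using z a.yon_sel[OF o(1)] by blast
  note m = a.Act_de(1)[OF h(1)] and c = Cmp_hom[OF f.catFA h(1) ga] and d = a.de_mem[OF o(1)] a.de_mem[OF o(2)]
  have "X (tdx_id A) ga pt pt a' (a.AI a h (a.de a)) = a.AI a1 (fcmp A ga h) (a.de a1)"
  unfolding a.I_X_Act[OF d(1) ga h(1)] a.X_de[OF ga] by (rule a.I_Act_cmp[OF d(2) ga h(1)])
  then have "gf.Rg a1 x0 y0 x0 y0 a' (app (cext \<eta> a1 pt pt) a' (a.AI a1 (fcmp A ga h) (a.de a1))) =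
  gf.LX ga jx jx jy jy a' (gf.Rg a x0 y0 x0 y0 a' (app (cext \<eta> a pt pt) a' (a.AI a h (a.de a))))"
  unfolding gf.Rg_X[OF cext_\<eta>_mem[OF m] ga ix ix iy iy, symmetric]
  using \<eta>.cext_X[of ga a a1 pt pt pt pt pt pt "a.AI a h (a.de a)" a'] ga m mor by simp
  moreover have "app ?L a' y = gf.LX ga jx jx jy jy a' y" for y
  using hom_Mor(1)[OF L0] gs by (simp add: lift_at_def gf.LX_def)
  ultimately show "app (Cmp (psh_cat A) ?L (?N a)) a' z = app (Cmp (psh_cat A) (?N a1) (yon_map A ga)) a' z"
  unfolding app_cmp[OF f.catA P[OF o(1)] L z] app_cmp[OF f.catA y P[OF o(2)] z] unfolding h(2) a.yon_map_app[OF ga h(1)] N[OF o(1) h(1)] N[OF o(2) c]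
  by simp
 qed
 then show "Cmp (psh_cat A) (FM (NTgt UL) ga) (Nc UL a) =
  Cmp (psh_cat A) (Nc UL a1) (FM (NSrc UL) ga)"
  using o a.yon_func_simps(2)[OF ga] le(3)[OF ga] hom_Mor(1)[OF ga] by (simp add: unit_on_lists_def Let_def comp_func_def)
qed

end

theorem corollary3p15:
  fixes A B :: "('u::universe, 'u) cat"
    and f g :: "'u tdx"
    and \<eta> \<epsilon> :: "'u cell"
  assumes "bicat_adjunction TDX A B f g \<eta> \<epsilon>"
  shows "is_functor terminal_cat (states_prod (St f) (St g)) (CK \<eta>) \<and>
    (\<exists>x0\<in>Obj (St f). \<exists>y0\<in>Obj (St g).
       FO (CK \<eta>) pt = enc (x0, y0) \<and>
       is_ntrans (free_cat A) (psh_cat A) (unit_on_lists f g \<eta> x0 y0) \<and>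
       adjunction (psh_cat A) (psh_cat B) (lift_at f x0) (lift_at g y0)
         (induced_unit f g \<eta> x0 y0) (induced_counit f g \<epsilon> x0 y0))"
proof -
 have f: "is_tdx f" "TSrc f = A" "TTgt f = B" and g: "is_tdx g" "TSrc g = B" "TTgt g = A"
  and \<eta>: "is_cell (tdx_id A) (tdx_comp g f) \<eta>" and \<epsilon>: "is_cell (tdx_comp f g) (tdx_id B) \<epsilon>"
  and tri: "cell_vcomp (left_unitor f) (cell_vcomp (cell_hcomp \<epsilon> (cell_id f))
  (cell_vcomp (inverse_2cell TDX (tdx_comp (tdx_comp f g) f) (tdx_comp f (tdx_comp g f)) (associator f g f))
  (cell_hcomp (cell_id f) \<eta>))) = right_unitor f"
  "cell_vcomp (right_unitor g) (cell_vcomp (cell_hcomp (cell_id g) \<epsilon>)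
  (cell_vcomp (associator g f g) (cell_hcomp \<eta> (cell_id g)))) = left_unitor g"
  using assms by (simp_all add: bicat_adjunction_def TDX_def)
 have KF: "is_functor terminal_cat (states_prod (St f) (St g)) (CK \<eta>)"
  using \<eta> by (simp add: is_cell_def tdx_id_def tdx_comp_def)
 \<comment> \<open>States of a composite are codes of pairs, so the image of the only state of the
   terminal category decodes to a pair.\<close>
 obtain x0 y0 :: 'u where xy: "FO (CK \<eta>) pt = enc (x0, y0)" "x0:Obj (St f)" "y0:Obj (St g)"
  by (rule states_objE[OF functor_obj[OF KF, of pt]]) simp
 interpret adj f g \<eta> \<epsilon> x0 y0
  using f g \<eta> \<epsilon> tri xy by unfold_locales simp_all
 show ?thesis
  using KF xy unit_on_lists[unfolded f] adjunction[unfolded f] by blast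
qed

end
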